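(* Let $k$ be a commutative ring and $H$ a $k$-flat Hopf algebra with bijective antipode. The group $\operatorname{Tor}(H)$ of isomorphism classes of quantum torsors $T$ equipped with specified Hopf algebra isomorphisms $H\cong H_l(T)$ and $H\cong H_r(T)$, which is a subgroup of the group $\operatorname{BiGal}(H)$ of isomorphism classes of (faithfully flat) $H$-$H$-bi-Galois objects, coincides with $\operatorname{BiGal}(H)$.
   Context: All tensor products are over the commutative base ring $k$; $T$ in a tensor product of maps denotes the identity of $T$; $\nabla$ denotes multiplication. Galois objects. A right $H$-comodule algebra $T$ is an algebra which is a right $H$-comodule such that the coaction $\rho\colon T\to T\otimes H$, $\rho(x)=x_{(0)}\otimes x_{(1)}$, is an algebra map. It is a right $H$-Galois object if $\{t\in T\mid \rho(t)=t\otimes 1\}=k$ and $T\otimes T\to T\otimes H$, $x\otimes y\mapsto xy_{(0)}\otimes y_{(1)}$, is bijective. Left Galois objects are defined by switching sides. An $L$-$H$-bi-Galois object is an $L$-$H$-bicomodule algebra which is both a left $L$-Galois object and a right $H$-Galois object. Faithfully flat means faithfully flat as a $k$-module. $\operatorname{BiGal}(H)=\operatorname{BiGal}(H,H)$ is the set of isomorphism classes (as bicomodule algebras) of faithfully flat $H$-$H$-bi-Galois objects; it is a group under the cotensor product $A\mathbin{\square}_H B=\{\sum a\otimes b\in A\otimes B\mid \sum \rho_A(a)\otimes b=\sum a\otimes\lambda_B(b)\}$, where $\rho_A$ is the right coaction of $A$ and $\lambda_B$ the left coaction of $B$. Quantum torsors. A quantum torsor $(T,\mu,\theta)$ consists of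 a faithfully flat $k$-algebra $T$, an algebra map $\mu\colon T\to T\otimes T^{\mathrm{op}}\otimes T$, and an algebra automorphism $\theta$ of $T$ such that for all $x\in T$: $(T\otimes\nabla)\mu(x)=x\otimes 1$; $(\nabla\otimes T)\mu(x)=1\otimes x$; $(T\otimes T^{\mathrm{op}}\otimes\mu)\mu=(\mu\otimes T^{\mathrm{op}}\otimes T)\mu$; $(T\otimes T^{\mathrm{op}}\otimes\theta\otimes T^{\mathrm{op}}\otimes T)(\mu\otimes T^{\mathrm{op}}\otimes T)\mu=(T\otimes\mu^{\mathrm{op}}\otimes T)\mu$; $(\theta\otimes\theta\otimes\theta)\mu=\mu\theta$. Here $\mu^{\mathrm{op}}=\tau_{(13)}\mu\colon T^{\mathrm{op}}\to T^{\mathrm{op}}\otimes T\otimes T^{\mathrm{op}}$, with $\tau_{(13)}$ exchanging the first and last tensor factors. Hopf algebras of a torsor (Grunspan). For a quantum torsor $(T,\mu,\theta)$, $$H_l(T)=\{\xi\in T\otimes T^{\mathrm{op}}\mid (T\otimes T^{\mathrm{op}}\otimes\theta\otimes T^{\mathrm{op}})(\mu\otimes T^{\mathrm{op}})(\xi)=(T\otimes\mu^{\mathrm{op}})(\xi)\},$$ $$H_r(T)=\{\xi\in T^{\mathrm{op}}\otimes T\mid (T^{\mathrm{op}}\otimes\theta\otimes T^{\mathrm{op}}\otimes T)(T^{\mathrm{op}}\otimes\mu)(\xi)=(\mu^{\mathrm{op}}\otimes T)(\xi)\}.$$ These are subalgebras of $T\otimes T^{\mathrm{op}}$ and $T^{\mathrm{op}}\otimes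 T$, and Hopf algebras with comultiplications induced by $\mu\otimes T^{\mathrm{op}}$ and $T^{\mathrm{op}}\otimes\mu$ respectively, and counits induced by $\nabla$. The map $\mu$, viewed as $T\to H_l(T)\otimes T$ and as $T\to T\otimes H_r(T)$, makes $T$ an $H_l(T)$-$H_r(T)$-bi-Galois object. Inclusion $\operatorname{Tor}(H)\subset\operatorname{BiGal}(H)$. A quantum torsor $T$ with specified isomorphisms $H\cong H_l(T)$ and $H\cong H_r(T)$ becomes an $H$-$H$-bi-Galois object by transporting the $H_l(T)$- and $H_r(T)$-coactions along these isomorphisms; isomorphisms of such data are algebra isomorphisms compatible with the torsor structures and the specified Hopf algebra isomorphisms. By Grunspan's observation this identifies $\operatorname{Tor}(H)$ with a subgroup of $\operatorname{BiGal}(H)$. The statement is that this subgroup is all of $\operatorname{BiGal}(H)$. *)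

theory Defs
  imports "HOL-Algebra.Module"
begin

section \<open>Linear maps and tensor products of modules\<close>

definition linear_map ::
  "'k ring \<Rightarrow> ('k, 'a, 'm) module_scheme \<Rightarrow> ('k, 'b, 'n) module_scheme \<Rightarrow> ('a \<Rightarrow> 'b) \<Rightarrow> bool" where
  "linear_map R M N f \<longleftrightarrow>
     f \<in> carrier M \<rightarrow> carrier N \<and>
     (\<forall>x\<in>carrier M. \<forall>y\<in>carrier M. f (x \<oplus>\<^bsub>M\<^esub> y) = f x \<oplus>\<^bsub>N\<^esub> f y) \<and>
     (\<forall>c\<in>carrier R. \<forall>x\<in>carrier M. f (c \<odot>\<^bsub>M\<^esub> x) = c \<odot>\<^bsub>N\<^esub> f x)"

text \<open>
  The tensor product of \<open>M\<close> and \<open>N\<close> over \<open>R\<close> is the quotient of the formal sums of pairs,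
  written as lists, by the congruence generated by the bilinearity relations. Only lists over
  \<open>carrier M \<times> carrier N\<close> are related, so the tensor product with a submodule is not
  identified with a subset of the tensor product with the whole module. The relation
  \<open>zero\<close> makes the quotient a group: the negative of the class of a pair \<open>(x, y)\<close>
  is the class of \<open>(\<ominus> x, y)\<close>.
\<close>

type_synonym ('a, 'b) tens = "('a \<times> 'b) list set"

inductive tensor_eq ::
  "'k ring \<Rightarrow> ('k, 'a, 'm) module_scheme \<Rightarrow> ('k, 'b, 'n) module_scheme \<Rightarrow>
   ('a \<times> 'b) list \<Rightarrow> ('a \<times> 'b) list \<Rightarrow> bool"
  for R (structure) and M (structure) and N (structure) where
  refl: "set u \<subseteq> carrier M \<times> carrier N \<Longrightarrow> tensor_eq R M N u u"
| sym: "tensor_eq R M N u v \<Longrightarrow> tensor_eq R M N v u"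
| trans: "tensor_eq R M N u v \<Longrightarrow> tensor_eq R M N v w \<Longrightarrow> tensor_eq R M N u w"
| append: "tensor_eq R M N u u' \<Longrightarrow> tensor_eq R M N v v' \<Longrightarrow> tensor_eq R M N (u @ v) (u' @ v')"
| commute: "set (u @ v) \<subseteq> carrier M \<times> carrier N \<Longrightarrow> tensor_eq R M N (u @ v) (v @ u)"
| add_left: "x \<in> carrier M \<Longrightarrow> x' \<in> carrier M \<Longrightarrow> y \<in> carrier N \<Longrightarrow>
    tensor_eq R M N [(x \<oplus>\<^bsub>M\<^esub> x', y)] [(x, y), (x', y)]"
| add_right: "x \<in> carrier M \<Longrightarrow> y \<in> carrier N \<Longrightarrow> y' \<in> carrier N \<Longrightarrow>
    tensor_eq R M N [(x, y \<oplus>\<^bsub>N\<^esub> y')] [(x, y), (x, y')]"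
| smult: "c \<in> carrier R \<Longrightarrow> x \<in> carrier M \<Longrightarrow> y \<in> carrier N \<Longrightarrow>
    tensor_eq R M N [(c \<odot>\<^bsub>M\<^esub> x, y)] [(x, c \<odot>\<^bsub>N\<^esub> y)]"
| zero: "y \<in> carrier N \<Longrightarrow> tensor_eq R M N [(\<zero>\<^bsub>M\<^esub>, y)] []"

definition tensor_class ::
  "'k ring \<Rightarrow> ('k, 'a, 'm) module_scheme \<Rightarrow> ('k, 'b, 'n) module_scheme \<Rightarrow>
   ('a \<times> 'b) list \<Rightarrow> ('a, 'b) tens" where
  "tensor_class R M N u = {v. tensor_eq R M N u v}"

definition tensor_rep :: "('a, 'b) tens \<Rightarrow> ('a \<times> 'b) list" where
  "tensor_rep X = (SOME u. u \<in> X)"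

text \<open>
  The tensor product carries the componentwise multiplication; its fields \<open>mult\<close> and
  \<open>one\<close> are meaningful when both factors are algebras.
\<close>

definition tensor ::
  "'k ring \<Rightarrow> ('k, 'a, 'm) module_scheme \<Rightarrow> ('k, 'b, 'n) module_scheme \<Rightarrow>
   ('k, ('a, 'b) tens) module"  (\<open>(_ \<boxtimes>\<index>/ _)\<close> [76, 75] 75) where
  "tensor R M N =
    \<lparr>carrier = {tensor_class R M N u | u. set u \<subseteq> carrier M \<times> carrier N},
     monoid.mult = (\<lambda>X Y. tensor_class R M N
       [(x \<otimes>\<^bsub>M\<^esub> x', y \<otimes>\<^bsub>N\<^esub> y'). (x, y) \<leftarrow> tensor_rep X, (x', y') \<leftarrow> tensor_rep Y]),
     one = tensor_class R M N [(\<one>\<^bsub>M\<^esub>, \<one>\<^bsub>N\<^esub>)],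
     zero = tensor_class R M N [],
     add = (\<lambda>X Y. tensor_class R M N (tensor_rep X @ tensor_rep Y)),
     smult = (\<lambda>c X. tensor_class R M N [(c \<odot>\<^bsub>M\<^esub> x, y). (x, y) \<leftarrow> tensor_rep X])\<rparr>"

definition pure_tensor ::
  "'k ring \<Rightarrow> ('k, 'a, 'm) module_scheme \<Rightarrow> ('k, 'b, 'n) module_scheme \<Rightarrow>
   'a \<Rightarrow> 'b \<Rightarrow> ('a, 'b) tens" where
  "pure_tensor R M N x y = tensor_class R M N [(x, y)]"

text \<open>
  The linear map on a tensor product with values in \<open>P\<close> induced by a bilinear map \<open>f\<close>.
\<close>

definition tensor_lift ::
  "('k, 'c, 'p) module_scheme \<Rightarrow> ('a \<Rightarrow> 'b \<Rightarrow> 'c) \<Rightarrow> ('a, 'b) tens \<Rightarrow> 'c" where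
  "tensor_lift P f X = foldr (\<lambda>(x, y) s. f x y \<oplus>\<^bsub>P\<^esub> s) (tensor_rep X) \<zero>\<^bsub>P\<^esub>"

text \<open>
  In \<open>tensor_map R M N f g\<close> the modules \<open>M\<close> and \<open>N\<close> are the targets of \<open>f\<close>
  and \<open>g\<close>. In particular, for submodules of \<open>M\<close> and \<open>N\<close>, the map
  \<open>tensor_map R M N id id\<close> is induced by the inclusions; it need not be injective.
\<close>

definition tensor_map ::
  "'k ring \<Rightarrow> ('k, 'c, 'm) module_scheme \<Rightarrow> ('k, 'd, 'n) module_scheme \<Rightarrow>
   ('a \<Rightarrow> 'c) \<Rightarrow> ('b \<Rightarrow> 'd) \<Rightarrow> ('a, 'b) tens \<Rightarrow> ('c, 'd) tens" where
  "tensor_map R M N f g =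
     tensor_lift (M \<boxtimes>\<^bsub>R\<^esub> N) (\<lambda>x y. pure_tensor R M N (f x) (g y))"

text \<open>Iterated tensor products are nested to the right, with explicit associativity maps.\<close>

definition assoc ::
  "'k ring \<Rightarrow> ('k, 'a, 'm) module_scheme \<Rightarrow> ('k, 'b, 'n) module_scheme \<Rightarrow>
   ('k, 'c, 'p) module_scheme \<Rightarrow> (('a, 'b) tens, 'c) tens \<Rightarrow> ('a, ('b, 'c) tens) tens" where
  "assoc R M N P =
     tensor_lift (M \<boxtimes>\<^bsub>R\<^esub> N \<boxtimes>\<^bsub>R\<^esub> P) (\<lambda>u z.
       tensor_lift (M \<boxtimes>\<^bsub>R\<^esub> N \<boxtimes>\<^bsub>R\<^esub> P) (\<lambda>x y.
         pure_tensor R M (N \<boxtimes>\<^bsub>R\<^esub> P) x (pure_tensor R N P y z)) u)"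

definition assoc_inv ::
  "'k ring \<Rightarrow> ('k, 'a, 'm) module_scheme \<Rightarrow> ('k, 'b, 'n) module_scheme \<Rightarrow>
   ('k, 'c, 'p) module_scheme \<Rightarrow> ('a, ('b, 'c) tens) tens \<Rightarrow> (('a, 'b) tens, 'c) tens" where
  "assoc_inv R M N P =
     tensor_lift ((M \<boxtimes>\<^bsub>R\<^esub> N) \<boxtimes>\<^bsub>R\<^esub> P) (\<lambda>x v.
       tensor_lift ((M \<boxtimes>\<^bsub>R\<^esub> N) \<boxtimes>\<^bsub>R\<^esub> P) (\<lambda>y z.
         pure_tensor R (M \<boxtimes>\<^bsub>R\<^esub> N) P (pure_tensor R M N x y) z) v)"

text \<open>\<open>assoc3 R M N P Q\<close> maps \<open>(M \<otimes> N \<otimes> P) \<otimes> Q\<close> to \<open>M \<otimes> N \<otimes> P \<otimes> Q\<close>.\<close>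

definition assoc3 ::
  "'k ring \<Rightarrow> ('k, 'a, 'm) module_scheme \<Rightarrow> ('k, 'b, 'n) module_scheme \<Rightarrow>
   ('k, 'c, 'p) module_scheme \<Rightarrow> ('k, 'd, 'q) module_scheme \<Rightarrow>
   (('a, ('b, 'c) tens) tens, 'd) tens \<Rightarrow> ('a, ('b, ('c, 'd) tens) tens) tens" where
  "assoc3 R M N P Q X =
     tensor_map R M (N \<boxtimes>\<^bsub>R\<^esub> P \<boxtimes>\<^bsub>R\<^esub> Q) id (assoc R N P Q)
       (assoc R M (N \<boxtimes>\<^bsub>R\<^esub> P) Q X)"

text \<open>\<open>flip13 R M N P\<close> maps \<open>M \<otimes> N \<otimes> P\<close> to \<open>P \<otimes> N \<otimes> M\<close>.\<close>

definition flip13 ::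
  "'k ring \<Rightarrow> ('k, 'a, 'm) module_scheme \<Rightarrow> ('k, 'b, 'n) module_scheme \<Rightarrow>
   ('k, 'c, 'p) module_scheme \<Rightarrow> ('a, ('b, 'c) tens) tens \<Rightarrow> ('c, ('b, 'a) tens) tens" where
  "flip13 R M N P =
     tensor_lift (P \<boxtimes>\<^bsub>R\<^esub> N \<boxtimes>\<^bsub>R\<^esub> M) (\<lambda>x v.
       tensor_lift (P \<boxtimes>\<^bsub>R\<^esub> N \<boxtimes>\<^bsub>R\<^esub> M) (\<lambda>y z.
         pure_tensor R P (N \<boxtimes>\<^bsub>R\<^esub> M) z (pure_tensor R N M y x)) v)"


section \<open>Flatness\<close>

definition exact_at ::
  "'a set \<Rightarrow> ('k, 'b, 'm) module_scheme \<Rightarrow> ('k, 'c, 'n) module_scheme \<Rightarrow>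
   ('a \<Rightarrow> 'b) \<Rightarrow> ('b \<Rightarrow> 'c) \<Rightarrow> bool" where
  "exact_at A M N f g \<longleftrightarrow> f ` A = {x \<in> carrier M. g x = \<zero>\<^bsub>N\<^esub>}"

text \<open>
  A formula cannot quantify over modules on all types. The test modules below have carriers
  in the type of sets of sequences in \<open>R\<close>, which contains an isomorphic copy of every
  countably generated \<open>R\<close>-module (as a quotient of a free module of countable rank).
  Flatness and faithful flatness are already determined by finitely generated test modules,
  so the notions agree with the unrestricted ones.
\<close>

type_synonym 'k test_module = "('k, (nat \<Rightarrow> 'k) set) module"

definition flat :: "'k ring \<Rightarrow> ('k, 'a, 'm) module_scheme \<Rightarrow> bool" where
  "flat R T \<longleftrightarrow> module R T \<and>
     (\<forall>(M' :: 'k test_module) (M :: 'k test_module) (M'' :: 'k test_module) f g.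
        module R M' \<and> module R M \<and> module R M'' \<and> linear_map R M' M f \<and> linear_map R M M'' g \<and>
        exact_at (carrier M') M M'' f g \<longrightarrow>
        exact_at (carrier (T \<boxtimes>\<^bsub>R\<^esub> M')) (T \<boxtimes>\<^bsub>R\<^esub> M) (T \<boxtimes>\<^bsub>R\<^esub> M'')
          (tensor_map R T M id f) (tensor_map R T M'' id g))"

definition faithfully_flat :: "'k ring \<Rightarrow> ('k, 'a, 'm) module_scheme \<Rightarrow> bool" where
  "faithfully_flat R T \<longleftrightarrow> module R T \<and>
     (\<forall>(M' :: 'k test_module) (M :: 'k test_module) (M'' :: 'k test_module) f g.
        module R M' \<and> module R M \<and> module R M'' \<and> linear_map R M' M f \<and> linear_map R M M'' g \<longrightarrow>
        (exact_at (carrier M') M M'' f g \<longleftrightarrow>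
         exact_at (carrier (T \<boxtimes>\<^bsub>R\<^esub> M')) (T \<boxtimes>\<^bsub>R\<^esub> M) (T \<boxtimes>\<^bsub>R\<^esub> M'')
           (tensor_map R T M id f) (tensor_map R T M'' id g)))"


section \<open>Algebras\<close>

text \<open>The locale \<open>algebra\<close> of the library is restricted to commutative algebras.\<close>

locale assoc_algebra = module R A + A?: ring A for R (structure) and A (structure) +
  assumes smult_mult_left: "\<lbrakk>c \<in> carrier R; x \<in> carrier A; y \<in> carrier A\<rbrakk> \<Longrightarrow>
      (c \<odot>\<^bsub>A\<^esub> x) \<otimes>\<^bsub>A\<^esub> y = c \<odot>\<^bsub>A\<^esub> (x \<otimes>\<^bsub>A\<^esub> y)"
    and smult_mult_right: "\<lbrakk>c \<in> carrier R; x \<in> carrier A; y \<in> carrier A\<rbrakk> \<Longrightarrow>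
      x \<otimes>\<^bsub>A\<^esub> (c \<odot>\<^bsub>A\<^esub> y) = c \<odot>\<^bsub>A\<^esub> (x \<otimes>\<^bsub>A\<^esub> y)"

definition opp :: "('k, 'a, 'm) module_scheme \<Rightarrow> ('k, 'a, 'm) module_scheme" where
  "opp A = A\<lparr>monoid.mult := (\<lambda>x y. y \<otimes>\<^bsub>A\<^esub> x)\<rparr>"

definition algebra_hom ::
  "'k ring \<Rightarrow> ('k, 'a, 'm) module_scheme \<Rightarrow> ('k, 'b, 'n) module_scheme \<Rightarrow> ('a \<Rightarrow> 'b) \<Rightarrow> bool" where
  "algebra_hom R A B f \<longleftrightarrow> f \<in> ring_hom A B \<and> linear_map R A B f"

definition algebra_iso ::
  "'k ring \<Rightarrow> ('k, 'a, 'm) module_scheme \<Rightarrow> ('k, 'b, 'n) module_scheme \<Rightarrow> ('a \<Rightarrow> 'b) \<Rightarrow> bool" where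
  "algebra_iso R A B f \<longleftrightarrow> algebra_hom R A B f \<and> bij_betw f (carrier A) (carrier B)"

definition nabla :: "('k, 'a, 'm) module_scheme \<Rightarrow> ('a, 'a) tens \<Rightarrow> 'a" where
  "nabla A = tensor_lift A (\<lambda>x y. x \<otimes>\<^bsub>A\<^esub> y)"


section \<open>Hopf algebras\<close>

record ('k, 'h) bialgebra = "('k, 'h) module" +
  comult :: "'h \<Rightarrow> ('h, 'h) tens"
  counit :: "'h \<Rightarrow> 'k"

locale bialgebra = assoc_algebra R H
  for R :: "'k ring" (structure) and H :: "('k, 'h) bialgebra" (structure) +
  assumes comult_hom: "algebra_hom R H (H \<boxtimes>\<^bsub>R\<^esub> H) (comult H)"
    and counit_hom: "counit H \<in> ring_hom H R"
    and counit_smult: "\<lbrakk>c \<in> carrier R; h \<in> carrier H\<rbrakk> \<Longrightarrow>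
      counit H (c \<odot>\<^bsub>H\<^esub> h) = c \<otimes>\<^bsub>R\<^esub> counit H h"
    and coassoc: "h \<in> carrier H \<Longrightarrow>
      assoc R H H H (tensor_map R (H \<boxtimes>\<^bsub>R\<^esub> H) H (comult H) id (comult H h)) =
      tensor_map R H (H \<boxtimes>\<^bsub>R\<^esub> H) id (comult H) (comult H h)"
    and counit_left: "h \<in> carrier H \<Longrightarrow>
      tensor_lift H (\<lambda>x y. counit H x \<odot>\<^bsub>H\<^esub> y) (comult H h) = h"
    and counit_right: "h \<in> carrier H \<Longrightarrow>
      tensor_lift H (\<lambda>x y. counit H y \<odot>\<^bsub>H\<^esub> x) (comult H h) = h"

locale hopf_algebra = bialgebra R H
  for R :: "'k ring" (structure) and H :: "('k, 'h) bialgebra" (structure) +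
  fixes S :: "'h \<Rightarrow> 'h"
  assumes antipode_linear: "linear_map R H H S"
    and antipode_left: "h \<in> carrier H \<Longrightarrow>
      tensor_lift H (\<lambda>x y. S x \<otimes>\<^bsub>H\<^esub> y) (comult H h) = counit H h \<odot>\<^bsub>H\<^esub> \<one>\<^bsub>H\<^esub>"
    and antipode_right: "h \<in> carrier H \<Longrightarrow>
      tensor_lift H (\<lambda>x y. x \<otimes>\<^bsub>H\<^esub> S y) (comult H h) = counit H h \<odot>\<^bsub>H\<^esub> \<one>\<^bsub>H\<^esub>"

text \<open>Between Hopf algebras, bialgebra maps preserve the antipodes automatically.\<close>

definition hopf_iso ::
  "'k ring \<Rightarrow> ('k, 'a) bialgebra \<Rightarrow> ('k, 'b) bialgebra \<Rightarrow> ('a \<Rightarrow> 'b) \<Rightarrow> bool" where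
  "hopf_iso R H K f \<longleftrightarrow> algebra_iso R H K f \<and>
     (\<forall>h\<in>carrier H. comult K (f h) = tensor_map R K K f f (comult H h) \<and>
                    counit K (f h) = counit H h)"


section \<open>Bi-Galois objects\<close>

locale right_comodule_algebra = H?: bialgebra R H + T?: assoc_algebra R T
  for R :: "'k ring" (structure) and H :: "('k, 'h) bialgebra" (structure)
    and T :: "('k, 'a, 'm) module_scheme" (structure) +
  fixes rho :: "'a \<Rightarrow> ('a, 'h) tens"
  assumes right_coaction_hom: "algebra_hom R T (T \<boxtimes>\<^bsub>R\<^esub> H) rho"
    and right_coassoc: "x \<in> carrier T \<Longrightarrow>
      assoc R T H H (tensor_map R (T \<boxtimes>\<^bsub>R\<^esub> H) H rho id (rho x)) =
      tensor_map R T (H \<boxtimes>\<^bsub>R\<^esub> H) id (comult H) (rho x)"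
    and right_counit: "x \<in> carrier T \<Longrightarrow>
      tensor_lift T (\<lambda>y h. counit H h \<odot>\<^bsub>T\<^esub> y) (rho x) = x"

locale left_comodule_algebra = L?: bialgebra R L + T?: assoc_algebra R T
  for R :: "'k ring" (structure) and L :: "('k, 'l) bialgebra" (structure)
    and T :: "('k, 'a, 'm) module_scheme" (structure) +
  fixes lam :: "'a \<Rightarrow> ('l, 'a) tens"
  assumes left_coaction_hom: "algebra_hom R T (L \<boxtimes>\<^bsub>R\<^esub> T) lam"
    and left_coassoc: "x \<in> carrier T \<Longrightarrow>
      assoc R L L T (tensor_map R (L \<boxtimes>\<^bsub>R\<^esub> L) T (comult L) id (lam x)) =
      tensor_map R L (L \<boxtimes>\<^bsub>R\<^esub> T) id lam (lam x)"
    and left_counit: "x \<in> carrier T \<Longrightarrow>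
      tensor_lift T (\<lambda>h y. counit L h \<odot>\<^bsub>T\<^esub> y) (lam x) = x"

text \<open>
  That the coinvariants are \<open>k\<close> means that \<open>c \<mapsto> c 1\<close> is a bijection from \<open>k\<close>
  onto them. The Galois maps are \<open>x \<otimes> y \<mapsto> x y\<^sub>(\<^sub>0\<^sub>) \<otimes> y\<^sub>(\<^sub>1\<^sub>)\<close>
  and \<open>x \<otimes> y \<mapsto> x\<^sub>(\<^sub>-\<^sub>1\<^sub>) \<otimes> x\<^sub>(\<^sub>0\<^sub>) y\<close>.
\<close>

locale right_galois = right_comodule_algebra +
  assumes right_coinvariants:
      "bij_betw (\<lambda>c. c \<odot>\<^bsub>T\<^esub> \<one>\<^bsub>T\<^esub>) (carrier R)
         {t \<in> carrier T. rho t = pure_tensor R T H t \<one>\<^bsub>H\<^esub>}"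
    and right_galois_bij:
      "bij_betw (tensor_lift (T \<boxtimes>\<^bsub>R\<^esub> H)
                  (\<lambda>x y. tensor_map R T H (\<lambda>y0. x \<otimes>\<^bsub>T\<^esub> y0) id (rho y)))
         (carrier (T \<boxtimes>\<^bsub>R\<^esub> T)) (carrier (T \<boxtimes>\<^bsub>R\<^esub> H))"

locale left_galois = left_comodule_algebra +
  assumes left_coinvariants:
      "bij_betw (\<lambda>c. c \<odot>\<^bsub>T\<^esub> \<one>\<^bsub>T\<^esub>) (carrier R)
         {t \<in> carrier T. lam t = pure_tensor R L T \<one>\<^bsub>L\<^esub> t}"
    and left_galois_bij:
      "bij_betw (tensor_lift (L \<boxtimes>\<^bsub>R\<^esub> T)
                  (\<lambda>x y. tensor_map R L T id (\<lambda>x0. x0 \<otimes>\<^bsub>T\<^esub> y) (lam x)))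
         (carrier (T \<boxtimes>\<^bsub>R\<^esub> T)) (carrier (L \<boxtimes>\<^bsub>R\<^esub> T))"

record ('k, 'l, 'h, 'a) bicomodule_algebra = "('k, 'a) module" +
  lcoact :: "'a \<Rightarrow> ('l, 'a) tens"
  rcoact :: "'a \<Rightarrow> ('a, 'h) tens"

locale bicomodule_algebra =
  left_comodule_algebra R L T "lcoact T" + right_comodule_algebra R H T "rcoact T"
  for R :: "'k ring" and L :: "('k, 'l) bialgebra" and H :: "('k, 'h) bialgebra"
    and T :: "('k, 'l, 'h, 'a) bicomodule_algebra" +
  assumes coactions_commute: "x \<in> carrier T \<Longrightarrow>
      assoc R L T H (tensor_map R (L \<boxtimes>\<^bsub>R\<^esub> T) H (lcoact T) id (rcoact T x)) =
      tensor_map R L (T \<boxtimes>\<^bsub>R\<^esub> H) id (rcoact T) (lcoact T x)"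

locale bi_galois = bicomodule_algebra R L H T +
  left_galois R L T "lcoact T" + right_galois R H T "rcoact T"
  for R :: "'k ring" and L :: "('k, 'l) bialgebra" and H :: "('k, 'h) bialgebra"
    and T :: "('k, 'l, 'h, 'a) bicomodule_algebra"

definition bicomodule_algebra_iso ::
  "'k ring \<Rightarrow> ('k, 'l) bialgebra \<Rightarrow> ('k, 'h) bialgebra \<Rightarrow>
   ('k, 'l, 'h, 'a) bicomodule_algebra \<Rightarrow> ('k, 'l, 'h, 'b) bicomodule_algebra \<Rightarrow> bool" where
  "bicomodule_algebra_iso R L H A B \<longleftrightarrow>
     (\<exists>f. algebra_iso R A B f \<and>
        (\<forall>x\<in>carrier A. lcoact B (f x) = tensor_map R L B id f (lcoact A x) \<and>
                       rcoact B (f x) = tensor_map R B H f id (rcoact A x)))"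

definition with_coactions ::
  "('k, 'a, 'm) module_scheme \<Rightarrow> ('a \<Rightarrow> ('l, 'a) tens) \<Rightarrow> ('a \<Rightarrow> ('a, 'h) tens) \<Rightarrow>
   ('k, 'l, 'h, 'a) bicomodule_algebra" where
  "with_coactions A lam rho =
     \<lparr>carrier = carrier A, monoid.mult = monoid.mult A, one = \<one>\<^bsub>A\<^esub>, zero = \<zero>\<^bsub>A\<^esub>,
      add = add A, smult = smult A, lcoact = lam, rcoact = rho\<rparr>"


section \<open>The group of bi-Galois objects\<close>

definition cotensor_algebra ::
  "'k ring \<Rightarrow> ('k, 'h) bialgebra \<Rightarrow> ('k, 'h, 'h, 'a) bicomodule_algebra \<Rightarrow>
   ('k, 'h, 'h, 'b) bicomodule_algebra \<Rightarrow> ('k, ('a, 'b) tens) module" where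
  "cotensor_algebra R H A B = (A \<boxtimes>\<^bsub>R\<^esub> B)\<lparr>carrier :=
     {z \<in> carrier (A \<boxtimes>\<^bsub>R\<^esub> B).
        assoc R A H B (tensor_map R (A \<boxtimes>\<^bsub>R\<^esub> H) B (rcoact A) id z) =
        tensor_map R A (H \<boxtimes>\<^bsub>R\<^esub> B) id (lcoact B) z}\<rparr>"

text \<open>
  The coactions of the cotensor product are induced by the left coaction of \<open>A\<close> and the
  right coaction of \<open>B\<close>: they are determined by their composites with the maps induced by
  the inclusion into \<open>A \<otimes> B\<close>, which are injective for flat \<open>H\<close>.
\<close>

definition cotensor ::
  "'k ring \<Rightarrow> ('k, 'h) bialgebra \<Rightarrow> ('k, 'h, 'h, 'a) bicomodule_algebra \<Rightarrow>
   ('k, 'h, 'h, 'b) bicomodule_algebra \<Rightarrow> ('k, 'h, 'h, ('a, 'b) tens) bicomodule_algebra" where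
  "cotensor R H A B =
     (let C = cotensor_algebra R H A B in
      with_coactions C
        (\<lambda>z. THE w. w \<in> carrier (H \<boxtimes>\<^bsub>R\<^esub> C) \<and>
           tensor_map R H (A \<boxtimes>\<^bsub>R\<^esub> B) id id w =
           assoc R H A B (tensor_map R (H \<boxtimes>\<^bsub>R\<^esub> A) B (lcoact A) id z))
        (\<lambda>z. THE w. w \<in> carrier (C \<boxtimes>\<^bsub>R\<^esub> H) \<and>
           assoc R A B H (tensor_map R (A \<boxtimes>\<^bsub>R\<^esub> B) H id id w) =
           tensor_map R A (B \<boxtimes>\<^bsub>R\<^esub> H) id (rcoact B) z))"

text \<open>
  Isomorphism classes are formed among the objects whose carrier is contained in a type
  \<open>'u\<close>, which plays the role of a universe and is left arbitrary. A faithfully flat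
  bi-Galois object over \<open>H\<close> has at most as many elements as the larger of \<open>R\<close>,
  \<open>H\<close> and the natural numbers; hence, up to isomorphism, no object is missed if \<open>'u\<close>
  is infinite and at least as large as \<open>R\<close> and \<open>H\<close>. Since the cotensor product of two
  objects on \<open>'u\<close> lives on another type, the product of two classes consists of the objects
  on \<open>'u\<close> that are isomorphic to a cotensor product of representatives; likewise the unit
  consists of the objects isomorphic to \<open>H\<close>.
\<close>

definition bigal_objects ::
  "'k ring \<Rightarrow> ('k, 'h) bialgebra \<Rightarrow> ('k, 'h, 'h, 'u) bicomodule_algebra set" where
  "bigal_objects R H = {A. bi_galois R H H A \<and> faithfully_flat R A}"

definition bigal_rel ::
  "'k ring \<Rightarrow> ('k, 'h) bialgebra \<Rightarrow> ('k, 'h, 'h, 'u) bicomodule_algebra rel" where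
  "bigal_rel R H = {(A, B). A \<in> bigal_objects R H \<and> B \<in> bigal_objects R H \<and>
                            bicomodule_algebra_iso R H H A B}"

definition BiGal ::
  "'k ring \<Rightarrow> ('k, 'h) bialgebra \<Rightarrow> ('k, 'h, 'h, 'u) bicomodule_algebra set monoid" where
  "BiGal R H =
     \<lparr>carrier = bigal_objects R H // bigal_rel R H,
      monoid.mult = (\<lambda>X Y. {C \<in> bigal_objects R H.
         \<exists>A\<in>X. \<exists>B\<in>Y. bicomodule_algebra_iso R H H C (cotensor R H A B)}),
      one = {C \<in> bigal_objects R H.
         bicomodule_algebra_iso R H H C (with_coactions H (comult H) (comult H))}\<rparr>"


section \<open>Quantum torsors\<close>

record ('k, 'a) torsor = "('k, 'a) module" +
  tmu :: "'a \<Rightarrow> ('a, ('a, 'a) tens) tens"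
  theta :: "'a \<Rightarrow> 'a"

definition tmu_op ::
  "'k ring \<Rightarrow> ('k, 'a, 'm) torsor_scheme \<Rightarrow> 'a \<Rightarrow> ('a, ('a, 'a) tens) tens" where
  "tmu_op R T x = flip13 R (opp T) T (opp T) (tmu T x)"

locale quantum_torsor = T?: assoc_algebra R T
  for R :: "'k ring" (structure) and T :: "('k, 'a, 'm) torsor_scheme" (structure) +
  assumes torsor_faithfully_flat: "faithfully_flat R T"
    and tmu_hom: "algebra_hom R T (T \<boxtimes>\<^bsub>R\<^esub> opp T \<boxtimes>\<^bsub>R\<^esub> T) (tmu T)"
    and theta_aut: "algebra_iso R T T (theta T)"
    and tmu_nabla_right: "x \<in> carrier T \<Longrightarrow>
      tensor_map R T T id (nabla T) (tmu T x) = pure_tensor R T T x \<one>\<^bsub>T\<^esub>"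
    and tmu_nabla_left: "x \<in> carrier T \<Longrightarrow>
      tensor_map R T T (nabla T) id (assoc_inv R T (opp T) T (tmu T x)) =
      pure_tensor R T T \<one>\<^bsub>T\<^esub> x"
    and tmu_assoc: "x \<in> carrier T \<Longrightarrow>
      tensor_map R T (opp T \<boxtimes>\<^bsub>R\<^esub> T \<boxtimes>\<^bsub>R\<^esub> opp T \<boxtimes>\<^bsub>R\<^esub> T) id
        (tensor_map R (opp T) (T \<boxtimes>\<^bsub>R\<^esub> opp T \<boxtimes>\<^bsub>R\<^esub> T) id (tmu T)) (tmu T x) =
      assoc3 R T (opp T) T (opp T \<boxtimes>\<^bsub>R\<^esub> T)
        (tensor_map R (T \<boxtimes>\<^bsub>R\<^esub> opp T \<boxtimes>\<^bsub>R\<^esub> T) (opp T \<boxtimes>\<^bsub>R\<^esub> T) (tmu T) id (tmu T x))"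
    and tmu_theta: "x \<in> carrier T \<Longrightarrow>
      tensor_map R T (opp T \<boxtimes>\<^bsub>R\<^esub> T \<boxtimes>\<^bsub>R\<^esub> opp T \<boxtimes>\<^bsub>R\<^esub> T) id
        (tensor_map R (opp T) (T \<boxtimes>\<^bsub>R\<^esub> opp T \<boxtimes>\<^bsub>R\<^esub> T) id
          (tensor_map R T (opp T \<boxtimes>\<^bsub>R\<^esub> T) (theta T) id))
        (assoc3 R T (opp T) T (opp T \<boxtimes>\<^bsub>R\<^esub> T)
          (tensor_map R (T \<boxtimes>\<^bsub>R\<^esub> opp T \<boxtimes>\<^bsub>R\<^esub> T) (opp T \<boxtimes>\<^bsub>R\<^esub> T) (tmu T) id (tmu T x))) =
      tensor_map R T (opp T \<boxtimes>\<^bsub>R\<^esub> T \<boxtimes>\<^bsub>R\<^esub> opp T \<boxtimes>\<^bsub>R\<^esub> T) id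
        (assoc3 R (opp T) T (opp T) T)
        (tensor_map R T ((opp T \<boxtimes>\<^bsub>R\<^esub> T \<boxtimes>\<^bsub>R\<^esub> opp T) \<boxtimes>\<^bsub>R\<^esub> T) id
          (tensor_map R (opp T \<boxtimes>\<^bsub>R\<^esub> T \<boxtimes>\<^bsub>R\<^esub> opp T) T (tmu_op R T) id) (tmu T x))"
    and theta_tmu: "x \<in> carrier T \<Longrightarrow>
      tensor_map R T (opp T \<boxtimes>\<^bsub>R\<^esub> T) (theta T)
        (tensor_map R (opp T) T (theta T) (theta T)) (tmu T x) = tmu T (theta T x)"


section \<open>The Hopf algebras of a quantum torsor\<close>

definition left_algebra ::
  "'k ring \<Rightarrow> ('k, 'a, 'm) torsor_scheme \<Rightarrow> ('k, ('a, 'a) tens) module" where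
  "left_algebra R T = (T \<boxtimes>\<^bsub>R\<^esub> opp T)\<lparr>carrier :=
     {z \<in> carrier (T \<boxtimes>\<^bsub>R\<^esub> opp T).
        tensor_map R T (opp T \<boxtimes>\<^bsub>R\<^esub> T \<boxtimes>\<^bsub>R\<^esub> opp T) id
          (tensor_map R (opp T) (T \<boxtimes>\<^bsub>R\<^esub> opp T) id (tensor_map R T (opp T) (theta T) id))
          (assoc3 R T (opp T) T (opp T)
            (tensor_map R (T \<boxtimes>\<^bsub>R\<^esub> opp T \<boxtimes>\<^bsub>R\<^esub> T) (opp T) (tmu T) id z)) =
        tensor_map R T (opp T \<boxtimes>\<^bsub>R\<^esub> T \<boxtimes>\<^bsub>R\<^esub> opp T) id (tmu_op R T) z}\<rparr>"

definition right_algebra ::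
  "'k ring \<Rightarrow> ('k, 'a, 'm) torsor_scheme \<Rightarrow> ('k, ('a, 'a) tens) module" where
  "right_algebra R T = (opp T \<boxtimes>\<^bsub>R\<^esub> T)\<lparr>carrier :=
     {z \<in> carrier (opp T \<boxtimes>\<^bsub>R\<^esub> T).
        tensor_map R (opp T) (T \<boxtimes>\<^bsub>R\<^esub> opp T \<boxtimes>\<^bsub>R\<^esub> T) id
          (tensor_map R T (opp T \<boxtimes>\<^bsub>R\<^esub> T) (theta T) id)
          (tensor_map R (opp T) (T \<boxtimes>\<^bsub>R\<^esub> opp T \<boxtimes>\<^bsub>R\<^esub> T) id (tmu T) z) =
        assoc3 R (opp T) T (opp T) T
          (tensor_map R (opp T \<boxtimes>\<^bsub>R\<^esub> T \<boxtimes>\<^bsub>R\<^esub> opp T) T (tmu_op R T) id z)}\<rparr>"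

definition with_coalgebra ::
  "('k, 'a, 'm) module_scheme \<Rightarrow> ('a \<Rightarrow> ('a, 'a) tens) \<Rightarrow> ('a \<Rightarrow> 'k) \<Rightarrow> ('k, 'a) bialgebra" where
  "with_coalgebra A delta eps =
     \<lparr>carrier = carrier A, monoid.mult = monoid.mult A, one = \<one>\<^bsub>A\<^esub>, zero = \<zero>\<^bsub>A\<^esub>,
      add = add A, smult = smult A, comult = delta, counit = eps\<rparr>"

text \<open>
  The comultiplications induced by \<open>\<mu> \<otimes> T\<^sup>o\<^sup>p\<close> and \<open>T\<^sup>o\<^sup>p \<otimes> \<mu>\<close> take values in the tensor
  square of the subalgebra; the value is the unique element whose image in the fourfold tensor
  product is the prescribed one. The counit is the scalar \<open>c\<close> such that \<open>\<nabla>\<close> takes the value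
  \<open>c 1\<close>.
\<close>

definition left_hopf ::
  "'k ring \<Rightarrow> ('k, 'a, 'm) torsor_scheme \<Rightarrow> ('k, ('a, 'a) tens) bialgebra" where
  "left_hopf R T =
     (let L = left_algebra R T in
      with_coalgebra L
        (\<lambda>z. THE w. w \<in> carrier (L \<boxtimes>\<^bsub>R\<^esub> L) \<and>
           assoc R T (opp T) (T \<boxtimes>\<^bsub>R\<^esub> opp T)
             (tensor_map R (T \<boxtimes>\<^bsub>R\<^esub> opp T) (T \<boxtimes>\<^bsub>R\<^esub> opp T) id id w) =
           assoc3 R T (opp T) T (opp T)
             (tensor_map R (T \<boxtimes>\<^bsub>R\<^esub> opp T \<boxtimes>\<^bsub>R\<^esub> T) (opp T) (tmu T) id z))
        (\<lambda>z. THE c. c \<in> carrier R \<and> nabla T z = c \<odot>\<^bsub>T\<^esub> \<one>\<^bsub>T\<^esub>))"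

definition right_hopf ::
  "'k ring \<Rightarrow> ('k, 'a, 'm) torsor_scheme \<Rightarrow> ('k, ('a, 'a) tens) bialgebra" where
  "right_hopf R T =
     (let K = right_algebra R T in
      with_coalgebra K
        (\<lambda>z. THE w. w \<in> carrier (K \<boxtimes>\<^bsub>R\<^esub> K) \<and>
           assoc R (opp T) T (opp T \<boxtimes>\<^bsub>R\<^esub> T)
             (tensor_map R (opp T \<boxtimes>\<^bsub>R\<^esub> T) (opp T \<boxtimes>\<^bsub>R\<^esub> T) id id w) =
           tensor_map R (opp T) (T \<boxtimes>\<^bsub>R\<^esub> opp T \<boxtimes>\<^bsub>R\<^esub> T) id (tmu T) z)
        (\<lambda>z. THE c. c \<in> carrier R \<and> nabla T z = c \<odot>\<^bsub>T\<^esub> \<one>\<^bsub>T\<^esub>))"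

text \<open>\<open>\<mu>\<close> viewed as a map to \<open>H\<^sub>l(T) \<otimes> T\<close> and as a map to \<open>T \<otimes> H\<^sub>r(T)\<close>.\<close>

definition left_torsor_coaction ::
  "'k ring \<Rightarrow> ('k, 'a, 'm) torsor_scheme \<Rightarrow> 'a \<Rightarrow> (('a, 'a) tens, 'a) tens" where
  "left_torsor_coaction R T x = (THE w. w \<in> carrier (left_hopf R T \<boxtimes>\<^bsub>R\<^esub> T) \<and>
     assoc R T (opp T) T (tensor_map R (T \<boxtimes>\<^bsub>R\<^esub> opp T) T id id w) = tmu T x)"

definition right_torsor_coaction ::
  "'k ring \<Rightarrow> ('k, 'a, 'm) torsor_scheme \<Rightarrow> 'a \<Rightarrow> ('a, ('a, 'a) tens) tens" where
  "right_torsor_coaction R T x = (THE w. w \<in> carrier (T \<boxtimes>\<^bsub>R\<^esub> right_hopf R T) \<and>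
     tensor_map R T (opp T \<boxtimes>\<^bsub>R\<^esub> T) id id w = tmu T x)"


section \<open>The group of quantum torsors over a Hopf algebra\<close>

record ('k, 'h, 'a) torsor_over = "('k, 'a) torsor" +
  left_ident :: "'h \<Rightarrow> ('a, 'a) tens"
  right_ident :: "'h \<Rightarrow> ('a, 'a) tens"

definition tor_objects :: "'k ring \<Rightarrow> ('k, 'h) bialgebra \<Rightarrow> ('k, 'h, 'u) torsor_over set" where
  "tor_objects R H = {T. quantum_torsor R T \<and>
     hopf_iso R H (left_hopf R T) (left_ident T) \<and>
     hopf_iso R H (right_hopf R T) (right_ident T)}"

definition torsor_over_iso ::
  "'k ring \<Rightarrow> ('k, 'h) bialgebra \<Rightarrow> ('k, 'h, 'a) torsor_over \<Rightarrow> ('k, 'h, 'b) torsor_over \<Rightarrow> bool"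
where
  "torsor_over_iso R H T T' \<longleftrightarrow>
     (\<exists>f. algebra_iso R T T' f \<and>
        (\<forall>x\<in>carrier T.
           tmu T' (f x) =
             tensor_map R T' (opp T' \<boxtimes>\<^bsub>R\<^esub> T') f (tensor_map R (opp T') T' f f) (tmu T x) \<and>
           theta T' (f x) = f (theta T x)) \<and>
        (\<forall>h\<in>carrier H.
           left_ident T' h = tensor_map R T' (opp T') f f (left_ident T h) \<and>
           right_ident T' h = tensor_map R (opp T') T' f f (right_ident T h)))"

definition tor_rel :: "'k ring \<Rightarrow> ('k, 'h) bialgebra \<Rightarrow> ('k, 'h, 'u) torsor_over rel" where
  "tor_rel R H = {(T, T'). T \<in> tor_objects R H \<and> T' \<in> tor_objects R H \<and> torsor_over_iso R H T T'}"

definition torsor_bicomodule_algebra ::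
  "'k ring \<Rightarrow> ('k, 'h) bialgebra \<Rightarrow> ('k, 'h, 'a) torsor_over \<Rightarrow>
   ('k, 'h, 'h, 'a) bicomodule_algebra" where
  "torsor_bicomodule_algebra R H T =
     with_coactions T
       (\<lambda>x. tensor_map R H T (inv_into (carrier H) (left_ident T)) id (left_torsor_coaction R T x))
       (\<lambda>x. tensor_map R T H id (inv_into (carrier H) (right_ident T)) (right_torsor_coaction R T x))"

definition tor_inclusion ::
  "'k ring \<Rightarrow> ('k, 'h) bialgebra \<Rightarrow> ('k, 'h, 'u) torsor_over set \<Rightarrow>
   ('k, 'h, 'h, 'u) bicomodule_algebra set" where
  "tor_inclusion R H X = {A \<in> bigal_objects R H.
     \<exists>T\<in>X. bicomodule_algebra_iso R H H A (torsor_bicomodule_algebra R H T)}"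

text \<open>
  The group structure of \<open>Tor\<close> is the one inherited from \<open>BiGal\<close> along the inclusion.
\<close>

definition Tor ::
  "'k ring \<Rightarrow> ('k, 'h) bialgebra \<Rightarrow> ('k, 'h, 'u) torsor_over set monoid" where
  "Tor R H =
     \<lparr>carrier = tor_objects R H // tor_rel R H,
      monoid.mult = (\<lambda>X Y. {T \<in> tor_objects R H.
         torsor_bicomodule_algebra R H T
           \<in> tor_inclusion R H X \<otimes>\<^bsub>BiGal R H\<^esub> tor_inclusion R H Y}),
      one = {T \<in> tor_objects R H.
         torsor_bicomodule_algebra R H T \<in> \<one>\<^bsub>BiGal R H\<^esub>}\<rparr>"

end

theory Submission
  imports Defs
begin

text \<open>
  The antipode determines the torsor structure of a bi-Galois object. Let \<open>\<beta>\<^sub>r\<close> and \<open>\<beta>\<^sub>l\<close> be the two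
  Galois maps of \<open>A\<close> and put \<open>r h = \<beta>\<^sub>r\<^sup>-\<^sup>1 (1 \<otimes> h)\<close> and \<open>l h = \<beta>\<^sub>l\<^sup>-\<^sup>1 (h \<otimes> 1)\<close>. The two formulas
  \<open>\<mu> x = x\<^sub>0 \<otimes> r x\<^sub>1 = l x\<^sub>-\<^sub>1 \<otimes> x\<^sub>0\<close> agree because the coactions commute. Writing \<open>r h = h' \<otimes> h''\<close>, the
  element \<open>x\<^sub>0 (S x\<^sub>1)'' \<otimes> (S x\<^sub>1)'\<close> is coinvariant in its first factor, hence equal to \<open>1 \<otimes> \<theta> x\<close> for
  some \<open>\<theta> x\<close> by faithfully flat descent; replacing \<open>S\<close> by \<open>S\<^sup>-\<^sup>2\<close> suitably gives the inverse of
  \<open>\<theta>\<close>. The multiplication of \<open>T\<close> maps \<open>H\<^sub>l(T)\<close> to the scalars, again by descent, so \<open>\<beta>\<^sub>l\<close> maps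
  \<open>H\<^sub>l(T)\<close> into \<open>H \<otimes> 1\<close> and \<open>l\<close> identifies \<open>H\<close> with \<open>H\<^sub>l(T)\<close>; likewise \<open>r\<close> identifies \<open>H\<close> with
  \<open>H\<^sub>r(T)\<close>. Since \<open>l\<close>, \<open>r\<close>, \<open>\<mu>\<close> and \<open>\<theta>\<close> can all be recovered from the two coactions and conversely,
  torsors and bi-Galois objects have the same isomorphisms.
\<close>

section \<open>Sums over tensors\<close>

text \<open>The form of \<theta> is forced by the torsor axioms. Multiplying the five factors of the
  axiom that links \<mu> and \<theta> expresses \<open>\<theta> x\<close> through \<mu> alone, and
  inserting \<open>x_0 \<otimes> r x_1\<close> for \<mu> leaves
  \<open>x_0 (S x_1)'' (S x_1)'\<close>. The power S^-2 has a similar origin: the coaction on the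
  first factor of \<open>r k\<close> contributes \<open>S k_1\<close>, and with
  \<open>k = S^-2 h\<close> this is \<open>S^-1 h_1\<close>, standing to the left of the preceding
  Sweedler component, which is the product that cancels. The two kinds of flatness have different
  tasks. Flatness embeds \<open>H \<otimes> X\<close> into \<open>T \<otimes> T \<otimes> X\<close>,
  so that identities over \<open>H\<close> can be compared in tensor powers of \<open>T\<close>,
  where the torsor axioms live. Faithful flatness of \<open>T\<close> removes a tensor factor 1. The
  main obstacle is that a tensor product with \<open>H_l(T)\<close> is not a subset of a tensor
  power of \<open>T\<close>. Coactions and comultiplications are given only by their images there,
  so every value must first be lifted through an injective map.\<close>

definition lsum :: "('k, 'c, 'p) module_scheme \<Rightarrow> ('a \<Rightarrow> 'b \<Rightarrow> 'c) \<Rightarrow> ('a \<times> 'b) list \<Rightarrow> 'c" where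
  "lsum P f u = foldr (\<lambda>(x, y) s. f x y \<oplus>\<^bsub>P\<^esub> s) u \<zero>\<^bsub>P\<^esub>"

text \<open>
  A Sweedler sum: \<open>sw R M N P f z\<close> stands for \<open>\<Sum> f z' z''\<close>. The junk value \<open>\<zero>\<close> outside the
  tensor product makes the congruence and exchange rules for these sums hold without a typing
  condition on \<open>z\<close>.
\<close>

definition sw ::
  "'k ring \<Rightarrow> ('k, 'a, 'm) module_scheme \<Rightarrow> ('k, 'b, 'n) module_scheme \<Rightarrow>
   ('k, 'c, 'p) module_scheme \<Rightarrow> ('a \<Rightarrow> 'b \<Rightarrow> 'c) \<Rightarrow> ('a, 'b) tens \<Rightarrow> 'c" where
  "sw R M N P f z = (if z \<in> carrier (M \<boxtimes>\<^bsub>R\<^esub> N) then tensor_lift P f z else \<zero>\<^bsub>P\<^esub>)"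

definition bilinear ::
  "'k ring \<Rightarrow> ('k, 'a, 'm) module_scheme \<Rightarrow> ('k, 'b, 'n) module_scheme \<Rightarrow>
   ('k, 'c, 'p) module_scheme \<Rightarrow> ('a \<Rightarrow> 'b \<Rightarrow> 'c) \<Rightarrow> bool" where
  "bilinear R M N P f \<longleftrightarrow> (\<forall>y\<in>carrier N. linear_map R M P (\<lambda>x. f x y)) \<and>
     (\<forall>x\<in>carrier M. linear_map R N P (f x))"

lemma lin_closed: "linear_map R M N f \<Longrightarrow> x \<in> carrier M \<Longrightarrow> f x \<in> carrier N"
  by (auto simp: linear_map_def)

lemma lin_add: "linear_map R M N f \<Longrightarrow> x \<in> carrier M \<Longrightarrow> y \<in> carrier M \<Longrightarrow>
    f (x \<oplus>\<^bsub>M\<^esub> y) = f x \<oplus>\<^bsub>N\<^esub> f y"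
  by (auto simp: linear_map_def)

lemma lin_smult: "linear_map R M N f \<Longrightarrow> c \<in> carrier R \<Longrightarrow> x \<in> carrier M \<Longrightarrow>
    f (c \<odot>\<^bsub>M\<^esub> x) = c \<odot>\<^bsub>N\<^esub> f x"
  by (auto simp: linear_map_def)

lemma lin_zero: "linear_map R M N f \<Longrightarrow> module R M \<Longrightarrow> module R N \<Longrightarrow> f \<zero>\<^bsub>M\<^esub> = \<zero>\<^bsub>N\<^esub>"
proof -
  assume l: "linear_map R M N f" and M: "module R M" and N: "module R N"
  interpret M: module R M by fact
  interpret N: module R N by fact
  have "f (\<zero>\<^bsub>R\<^esub> \<odot>\<^bsub>M\<^esub> \<zero>\<^bsub>M\<^esub>) = \<zero>\<^bsub>R\<^esub> \<odot>\<^bsub>N\<^esub> f \<zero>\<^bsub>M\<^esub>"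
    using l by (auto simp: linear_map_def simp del: M.smult_l_null M.smult_r_null)
  then show ?thesis using lin_closed[OF l] by auto
qed

lemma lin_cong: "(\<And>x. x \<in> carrier M \<Longrightarrow> f x = g x) \<Longrightarrow> module R M \<Longrightarrow>
    linear_map R M N f = linear_map R M N g"
proof -
  assume e: "\<And>x. x \<in> carrier M \<Longrightarrow> f x = g x" and M: "module R M"
  interpret M: module R M by fact
  show ?thesis unfolding linear_map_def using e by (auto simp: Pi_iff)
qed

lemma lin_comp: "linear_map R M N f \<Longrightarrow> linear_map R N P g \<Longrightarrow> linear_map R M P (\<lambda>x. g (f x))"
  by (auto simp: linear_map_def Pi_iff)

lemma lin_id: "linear_map R M M (\<lambda>x. x)"
  by (auto simp: linear_map_def)

lemma bilinearI:
  "(\<And>y. y \<in> carrier N \<Longrightarrow> linear_map R M P (\<lambda>x. f x y)) \<Longrightarrow>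
   (\<And>x. x \<in> carrier M \<Longrightarrow> linear_map R N P (\<lambda>y. f x y)) \<Longrightarrow> bilinear R M N P f"
  by (auto simp: bilinear_def)

lemma bilinear_closed:
  "bilinear R M N P f \<Longrightarrow> x \<in> carrier M \<Longrightarrow> y \<in> carrier N \<Longrightarrow> f x y \<in> carrier P"
  by (auto simp: bilinear_def linear_map_def)

section \<open>Sums over formal lists and the universal property of the tensor product\<close>

context
  fixes P :: "('k, 'c, 'p) module_scheme" and R :: "'k ring"
  assumes P: "module R P"
begin

interpretation P: module R P by (rule P)

lemma lsum_Nil: "lsum P f [] = \<zero>\<^bsub>P\<^esub>" by (simp add: lsum_def)

lemma lsum_Cons: "lsum P f ((x, y) # u) = f x y \<oplus>\<^bsub>P\<^esub> lsum P f u" by (simp add: lsum_def)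

lemma lsum_closed:
  "(\<And>x y. (x, y) \<in> set u \<Longrightarrow> f x y \<in> carrier P) \<Longrightarrow> lsum P f u \<in> carrier P"
  by (induction u) (auto simp: lsum_Nil lsum_Cons)

lemma lsum_append:
  "(\<And>x y. (x, y) \<in> set u \<Longrightarrow> f x y \<in> carrier P) \<Longrightarrow>
   (\<And>x y. (x, y) \<in> set v \<Longrightarrow> f x y \<in> carrier P) \<Longrightarrow>
   lsum P f (u @ v) = lsum P f u \<oplus>\<^bsub>P\<^esub> lsum P f v"
  by (induction u) (auto simp: lsum_Nil lsum_Cons lsum_closed P.M.a_assoc)

lemma lsum_cong:
  "(\<And>x y. (x, y) \<in> set u \<Longrightarrow> f x y = g x y) \<Longrightarrow> lsum P f u = lsum P g u"
  by (induction u) (auto simp: lsum_Nil lsum_Cons)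

lemma lsum_add:
  "(\<And>x y. (x, y) \<in> set u \<Longrightarrow> f x y \<in> carrier P) \<Longrightarrow>
   (\<And>x y. (x, y) \<in> set u \<Longrightarrow> g x y \<in> carrier P) \<Longrightarrow>
   lsum P (\<lambda>x y. f x y \<oplus>\<^bsub>P\<^esub> g x y) u = lsum P f u \<oplus>\<^bsub>P\<^esub> lsum P g u"
proof (induction u)
  case (Cons a u)
  obtain x y where a: "a = (x, y)" by (cases a)
  have *: "lsum P f u \<in> carrier P" "lsum P g u \<in> carrier P"
    using Cons.prems by (auto intro!: lsum_closed)
  have "f x y \<in> carrier P" "g x y \<in> carrier P" using Cons.prems by (auto simp: a)
  then show ?case using Cons * by (auto simp: a lsum_Cons P.M.a_ac)
qed (auto simp: lsum_Nil)

lemma lsum_zero: "lsum P (\<lambda>x y. \<zero>\<^bsub>P\<^esub>) u = \<zero>\<^bsub>P\<^esub>"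
  by (induction u) (auto simp: lsum_Nil lsum_Cons)

lemma lsum_swap:
  "(\<And>x y a b. (x, y) \<in> set u \<Longrightarrow> (a, b) \<in> set v \<Longrightarrow> f x y a b \<in> carrier P) \<Longrightarrow>
   lsum P (\<lambda>x y. lsum P (\<lambda>a b. f x y a b) v) u = lsum P (\<lambda>a b. lsum P (\<lambda>x y. f x y a b) u) v"
proof (induction u)
  case (Cons c u)
  obtain x y where c: "c = (x, y)" by (cases c)
  have "lsum P (\<lambda>a b. lsum P (\<lambda>x y. f x y a b) (c # u)) v =
      lsum P (\<lambda>a b. f x y a b \<oplus>\<^bsub>P\<^esub> lsum P (\<lambda>x y. f x y a b) u) v"
    by (simp add: c lsum_Cons)
  also have "\<dots> = lsum P (\<lambda>a b. f x y a b) v \<oplus>\<^bsub>P\<^esub> lsum P (\<lambda>a b. lsum P (\<lambda>x y. f x y a b) u) v"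
    using Cons.prems by (intro lsum_add lsum_closed) (auto simp: c)
  finally show ?case using Cons by (simp add: c lsum_Cons)
qed (auto simp: lsum_Nil lsum_zero)

text \<open>This is the universal property: each generating relation of \<open>tensor_eq\<close> is
  an identity satisfied by a bilinear map, and \<open>zero\<close> is respected because a linear map
  preserves zero. The carrier conditions are carried through the induction since
  \<open>append\<close> and \<open>commute\<close> need both sides to be typed.\<close>

lemma lsum_tensor_eq:
  assumes M: "module R M" and N: "module R N" and f: "bilinear R M N P f" and e: "tensor_eq R M N u v"
  shows "lsum P f u = lsum P f v"
proof -
  interpret M: module R M by fact
  interpret N: module R N by fact
  note cl = bilinear_closed[OF f]
  have l1: "y \<in> carrier N \<Longrightarrow> linear_map R M P (\<lambda>x. f x y)" for y
    using f by (auto simp: bilinear_def)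
  have l2: "x \<in> carrier M \<Longrightarrow> linear_map R N P (f x)" for x
    using f by (auto simp: bilinear_def)
  have "lsum P f u = lsum P f v \<and> set u \<subseteq> carrier M \<times> carrier N \<and> set v \<subseteq> carrier M \<times> carrier N"
    using e
  proof induction
    case (append u u' v v')
    then show ?case using cl by (subst (1 2) lsum_append) auto
  next
    case (commute u v)
    then have "lsum P f u \<in> carrier P" "lsum P f v \<in> carrier P"
      using cl by (auto intro!: lsum_closed)
    then show ?case using commute cl
      by (subst (1 2) lsum_append) (auto simp: P.M.a_comm)
  next
    case (add_left x x' y)
    then show ?case using lin_add[OF l1] by (auto simp: lsum_Cons lsum_Nil cl)
  next
    case (add_right x y y')
    then show ?case using lin_add[OF l2] by (auto simp: lsum_Cons lsum_Nil cl)
  next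
    case (smult c x y)
    then show ?case using lin_smult[OF l1] lin_smult[OF l2] by (auto simp: lsum_Cons lsum_Nil cl)
  next
    case (zero y)
    then show ?case using lin_zero[OF l1 M P] by (auto simp: lsum_Cons lsum_Nil)
  qed auto
  then show ?thesis by simp
qed

end

section \<open>The module structure of the tensor product\<close>

lemma tensor_eq_set:
  assumes "module R M" "module R N" "tensor_eq R M N u v"
  shows "set u \<subseteq> carrier M \<times> carrier N" "set v \<subseteq> carrier M \<times> carrier N"
proof -
  interpret M: module R M by fact
  interpret N: module R N by fact
  have "set u \<subseteq> carrier M \<times> carrier N \<and> set v \<subseteq> carrier M \<times> carrier N"
    using assms(3) by induction auto
  then show "set u \<subseteq> carrier M \<times> carrier N" "set v \<subseteq> carrier M \<times> carrier N" by auto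
qed

lemma tensor_class_eqI: "tensor_eq R M N u v \<Longrightarrow> tensor_class R M N u = tensor_class R M N v"
  unfolding tensor_class_def
  using tensor_eq.sym[of R M N] tensor_eq.trans[of R M N] by blast

lemma tensor_class_eqD:
  "tensor_class R M N u = tensor_class R M N v \<Longrightarrow> set u \<subseteq> carrier M \<times> carrier N \<Longrightarrow> tensor_eq R M N u v"
  unfolding tensor_class_def
  using tensor_eq.refl[of u M N R] tensor_eq.sym[of R M N] by blast

lemma tensor_carrierI: "set u \<subseteq> carrier M \<times> carrier N \<Longrightarrow> tensor_class R M N u \<in> carrier (M \<boxtimes>\<^bsub>R\<^esub> N)"
  by (auto simp: tensor_def)

lemma tensor_carrierE:
  assumes "z \<in> carrier (M \<boxtimes>\<^bsub>R\<^esub> N)"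
  obtains u where "set u \<subseteq> carrier M \<times> carrier N" "z = tensor_class R M N u"
  using assms by (auto simp: tensor_def)

text \<open>\<open>tensor_rep\<close> is an arbitrary choice. What is known about the chosen list is
  derived from this: it is related to every list that represents the same class.\<close>

lemma tensor_rep_eq:
  assumes "set u \<subseteq> carrier M \<times> carrier N"
  shows "tensor_eq R M N u (tensor_rep (tensor_class R M N u))"
proof -
  have "u \<in> tensor_class R M N u" using assms by (auto simp: tensor_class_def intro: tensor_eq.refl)
  then have "tensor_rep (tensor_class R M N u) \<in> tensor_class R M N u"
    unfolding tensor_rep_def by (rule someI)
  then show ?thesis by (simp add: tensor_class_def)
qed

lemma tensor_rep_set:
  assumes "module R M" "module R N" "z \<in> carrier (M \<boxtimes>\<^bsub>R\<^esub> N)"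
  shows "set (tensor_rep z) \<subseteq> carrier M \<times> carrier N"
  using assms(3) tensor_eq_set(2)[OF assms(1,2) tensor_rep_eq] by (auto elim!: tensor_carrierE)

lemma tensor_class_rep:
  assumes "z \<in> carrier (M \<boxtimes>\<^bsub>R\<^esub> N)"
  shows "tensor_class R M N (tensor_rep z) = z"
  using assms by (metis tensor_carrierE tensor_class_eqI tensor_rep_eq)

text \<open>Scalars act on the left entries of a list, and this makes the action on classes well
  defined. The case \<open>smult\<close> is where commutativity of \<open>R\<close> enters, because
  two scalars have to trade places.\<close>

lemma tensor_eq_smult:
  assumes M: "module R M" and N: "module R N" and e: "tensor_eq R M N u v" and c: "c \<in> carrier R"
  shows "tensor_eq R M N (map (\<lambda>(x, y). (c \<odot>\<^bsub>M\<^esub> x, y)) u) (map (\<lambda>(x, y). (c \<odot>\<^bsub>M\<^esub> x, y)) v)"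
proof -
  interpret M: module R M by fact
  interpret N: module R N by fact
  show ?thesis using e
  proof induction
    case (refl u)
    then show ?case using c by (intro tensor_eq.refl) auto
  next
    case (sym u v)
    then show ?case by (blast intro: tensor_eq.sym)
  next
    case (trans u v w)
    then show ?case by (blast intro: tensor_eq.trans)
  next
    case (append u u' v v')
    then show ?case by (auto intro: tensor_eq.append)
  next
    case (commute u v)
    then show ?case using c by (simp only: map_append) (rule tensor_eq.commute, auto)
  next
    case (add_left x x' y)
    then show ?case using c by (auto simp: M.smult_r_distr intro: tensor_eq.add_left)
  next
    case (add_right x y y')
    then show ?case using c by (auto intro: tensor_eq.add_right)
  next
    case (smult d x y)
    have "tensor_eq R M N [(d \<odot>\<^bsub>M\<^esub> (c \<odot>\<^bsub>M\<^esub> x), y)] [(c \<odot>\<^bsub>M\<^esub> x, d \<odot>\<^bsub>N\<^esub> y)]"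
      using smult c by (intro tensor_eq.smult) auto
    then show ?case using smult c
      by (simp add: M.smult_assoc1[symmetric] M.R.m_comm)
  next
    case (zero y)
    then show ?case using c by (auto intro: tensor_eq.zero)
  qed
qed

lemma class_add:
  assumes u: "set u \<subseteq> carrier M \<times> carrier N" and v: "set v \<subseteq> carrier M \<times> carrier N"
  shows "tensor_class R M N u \<oplus>\<^bsub>M \<boxtimes>\<^bsub>R\<^esub> N\<^esub> tensor_class R M N v = tensor_class R M N (u @ v)"
  using tensor_rep_eq[OF u] tensor_rep_eq[OF v]
  by (auto simp: tensor_def intro!: tensor_class_eqI tensor_eq.append intro: tensor_eq.sym)

lemma class_zero: "\<zero>\<^bsub>M \<boxtimes>\<^bsub>R\<^esub> N\<^esub> = tensor_class R M N []"
  by (simp add: tensor_def)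

lemma class_smult:
  assumes "module R M" "module R N" "set u \<subseteq> carrier M \<times> carrier N" "c \<in> carrier R"
  shows "c \<odot>\<^bsub>M \<boxtimes>\<^bsub>R\<^esub> N\<^esub> tensor_class R M N u = tensor_class R M N (map (\<lambda>(x, y). (c \<odot>\<^bsub>M\<^esub> x, y)) u)"
  using tensor_eq_smult[OF assms(1,2) tensor_rep_eq[OF assms(3)] assms(4)]
  by (auto simp: tensor_def intro!: tensor_class_eqI intro: tensor_eq.sym)

lemma class_Cons:
  assumes "set (p # u) \<subseteq> carrier M \<times> carrier N"
  shows "tensor_class R M N (p # u) = pure_tensor R M N (fst p) (snd p) \<oplus>\<^bsub>M \<boxtimes>\<^bsub>R\<^esub> N\<^esub> tensor_class R M N u"
  using assms by (auto simp: pure_tensor_def class_add)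

lemma pure_closed: "x \<in> carrier M \<Longrightarrow> y \<in> carrier N \<Longrightarrow> pure_tensor R M N x y \<in> carrier (M \<boxtimes>\<^bsub>R\<^esub> N)"
  unfolding pure_tensor_def by (rule tensor_carrierI) auto

text \<open>Supplies additive inverses: negating every left entry gives a list that cancels
  \<open>u\<close>. In the induction the pair \<open>(x, y)\<close> must be moved past the negatives
  of the tail before it meets its own negative, hence the use of \<open>commute\<close>.\<close>

lemma tensor_eq_neg:
  assumes M: "module R M" and N: "module R N" and u: "set u \<subseteq> carrier M \<times> carrier N"
  shows "tensor_eq R M N (map (\<lambda>(x, y). (\<ominus>\<^bsub>M\<^esub> x, y)) u @ u) []"
  using u
proof (induction u)
  case Nil
  then show ?case by (auto intro: tensor_eq.refl)
next
  case (Cons p u)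
  interpret M: module R M by fact
  interpret N: module R N by fact
  obtain x y where p: "p = (x, y)" by (cases p)
  have xy: "x \<in> carrier M" "y \<in> carrier N" using Cons.prems by (auto simp: p)
  let ?n = "map (\<lambda>(x, y). (\<ominus>\<^bsub>M\<^esub> x, y))"
  have n: "set (?n u) \<subseteq> carrier M \<times> carrier N" using Cons.prems by auto
  have "tensor_eq R M N (?n u @ [(x, y)]) ([(x, y)] @ ?n u)"
    using Cons.prems n xy by (intro tensor_eq.commute) auto
  then have "tensor_eq R M N ([(\<ominus>\<^bsub>M\<^esub> x, y)] @ (?n u @ [(x, y)]) @ u)
      ([(\<ominus>\<^bsub>M\<^esub> x, y)] @ ([(x, y)] @ ?n u) @ u)"
    using Cons.prems xy by (intro tensor_eq.append[OF _ tensor_eq.append[OF _ tensor_eq.refl]] tensor_eq.refl) auto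
  moreover have "tensor_eq R M N [(\<ominus>\<^bsub>M\<^esub> x, y), (x, y)] []"
    using tensor_eq.add_left[of "\<ominus>\<^bsub>M\<^esub> x" M x y N R] xy M.M.l_neg[of x] tensor_eq.zero[of y N R M]
    by (auto intro: tensor_eq.sym tensor_eq.trans)
  then have "tensor_eq R M N ([(\<ominus>\<^bsub>M\<^esub> x, y), (x, y)] @ (?n u @ u)) ([] @ [])"
    using Cons by (intro tensor_eq.append) auto
  ultimately show ?case by (auto simp: p intro: tensor_eq.trans)
qed

lemma tensor_abelian_group:
  fixes R (structure)
  assumes M: "module R M" and N: "module R N"
  shows "abelian_group (M \<boxtimes> N)"
proof (rule abelian_groupI)
  fix x assume "x \<in> carrier (M \<boxtimes> N)"
  then obtain u where u: "set u \<subseteq> carrier M \<times> carrier N" "x = tensor_class R M N u"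
    by (rule tensor_carrierE)
  interpret M: module R M by fact
  let ?v = "map (\<lambda>(x, y). (\<ominus>\<^bsub>M\<^esub> x, y)) u"
  have "set ?v \<subseteq> carrier M \<times> carrier N" using u by (auto simp: subset_iff)
  then show "\<exists>y\<in>carrier (M \<boxtimes> N). y \<oplus>\<^bsub>M \<boxtimes> N\<^esub> x = \<zero>\<^bsub>M \<boxtimes> N\<^esub>"
    using u tensor_eq_neg[OF M N u(1)] tensor_carrierI[of ?v M N R]
    by (intro bexI[of _ "tensor_class R M N ?v"])
      (auto simp: class_add class_zero simp del: set_map intro!: tensor_class_eqI)
next
  fix x y assume "x \<in> carrier (M \<boxtimes> N)" "y \<in> carrier (M \<boxtimes> N)"
  then show "x \<oplus>\<^bsub>M \<boxtimes> N\<^esub> y = y \<oplus>\<^bsub>M \<boxtimes> N\<^esub> x"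
    by (elim tensor_carrierE) (simp add: class_add, intro tensor_class_eqI tensor_eq.commute, simp)
qed (use tensor_carrierI[of "u @ v" M N R for u v] tensor_carrierI[of "[]" M N R] in
    \<open>auto elim!: tensor_carrierE simp: class_add class_zero\<close>)

text \<open>Every class is a finite sum of pure tensors, so induction on a representing list becomes
  an induction on classes that no longer mentions lists.\<close>

lemma class_induct [consumes 1, case_names zero pure]:
  fixes R (structure)
  assumes z: "z \<in> carrier (M \<boxtimes> N)"
    and zero: "Q \<zero>\<^bsub>M \<boxtimes> N\<^esub>"
    and pure: "\<And>x y w. x \<in> carrier M \<Longrightarrow> y \<in> carrier N \<Longrightarrow> w \<in> carrier (M \<boxtimes> N) \<Longrightarrow> Q w \<Longrightarrow>
      Q (pure_tensor R M N x y \<oplus>\<^bsub>M \<boxtimes> N\<^esub> w)"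
  shows "Q z"
proof -
  obtain u where u: "set u \<subseteq> carrier M \<times> carrier N" "z = tensor_class R M N u"
    using z by (rule tensor_carrierE)
  have "Q (tensor_class R M N u)" using u(1)
  proof (induction u)
    case Nil
    then show ?case using zero by (simp add: class_zero)
  next
    case (Cons p u)
    then show ?case
      by (subst class_Cons) (auto intro!: pure tensor_carrierI)
  qed
  then show ?thesis by (simp add: u)
qed

lemma pure_add_left: "x \<in> carrier M \<Longrightarrow> x' \<in> carrier M \<Longrightarrow> y \<in> carrier N \<Longrightarrow>
    pure_tensor R M N (x \<oplus>\<^bsub>M\<^esub> x') y = pure_tensor R M N x y \<oplus>\<^bsub>M \<boxtimes>\<^bsub>R\<^esub> N\<^esub> pure_tensor R M N x' y"
  by (auto simp: pure_tensor_def class_add intro!: tensor_class_eqI tensor_eq.add_left)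

lemma pure_add_right: "x \<in> carrier M \<Longrightarrow> y \<in> carrier N \<Longrightarrow> y' \<in> carrier N \<Longrightarrow>
    pure_tensor R M N x (y \<oplus>\<^bsub>N\<^esub> y') = pure_tensor R M N x y \<oplus>\<^bsub>M \<boxtimes>\<^bsub>R\<^esub> N\<^esub> pure_tensor R M N x y'"
  by (auto simp: pure_tensor_def class_add intro!: tensor_class_eqI tensor_eq.add_right)

lemma pure_smult_left: "module R M \<Longrightarrow> module R N \<Longrightarrow> c \<in> carrier R \<Longrightarrow> x \<in> carrier M \<Longrightarrow> y \<in> carrier N \<Longrightarrow>
    pure_tensor R M N (c \<odot>\<^bsub>M\<^esub> x) y = c \<odot>\<^bsub>M \<boxtimes>\<^bsub>R\<^esub> N\<^esub> pure_tensor R M N x y"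
  by (auto simp: pure_tensor_def class_smult)

lemma pure_smult_right: "module R M \<Longrightarrow> module R N \<Longrightarrow> c \<in> carrier R \<Longrightarrow> x \<in> carrier M \<Longrightarrow> y \<in> carrier N \<Longrightarrow>
    pure_tensor R M N x (c \<odot>\<^bsub>N\<^esub> y) = c \<odot>\<^bsub>M \<boxtimes>\<^bsub>R\<^esub> N\<^esub> pure_tensor R M N x y"
  by (auto simp: pure_tensor_def class_smult
      intro!: tensor_class_eqI tensor_eq.sym[OF tensor_eq.smult])

lemma tensor_module:
  fixes R (structure)
  assumes M: "module R M" and N: "module R N"
  shows "module R (M \<boxtimes> N)"
proof -
  interpret M: module R M by fact
  interpret N: module R N by fact
  interpret G: abelian_group "M \<boxtimes> N" by (rule tensor_abelian_group[OF M N])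
    have cl: "c \<odot>\<^bsub>M \<boxtimes> N\<^esub> w \<in> carrier (M \<boxtimes> N)" if "c \<in> carrier R" "w \<in> carrier (M \<boxtimes> N)" for c w
      using that by (force elim!: tensor_carrierE simp: class_smult[OF M N] intro!: tensor_carrierI)
    have d: "c \<odot>\<^bsub>M \<boxtimes> N\<^esub> (v \<oplus>\<^bsub>M \<boxtimes> N\<^esub> w) = c \<odot>\<^bsub>M \<boxtimes> N\<^esub> v \<oplus>\<^bsub>M \<boxtimes> N\<^esub> c \<odot>\<^bsub>M \<boxtimes> N\<^esub> w"
      if a: "c \<in> carrier R" "w \<in> carrier (M \<boxtimes> N)" "v \<in> carrier (M \<boxtimes> N)" for c v w
    proof -
      obtain u1 where u1: "set u1 \<subseteq> carrier M \<times> carrier N" "v = tensor_class R M N u1"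
        using a(3) by (rule tensor_carrierE)
      obtain u2 where u2: "set u2 \<subseteq> carrier M \<times> carrier N" "w = tensor_class R M N u2"
        using a(2) by (rule tensor_carrierE)
      have "set (map (\<lambda>(x, y). (c \<odot>\<^bsub>M\<^esub> x, y)) u1) \<subseteq> carrier M \<times> carrier N"
        "set (map (\<lambda>(x, y). (c \<odot>\<^bsub>M\<^esub> x, y)) u2) \<subseteq> carrier M \<times> carrier N"
        "set (u1 @ u2) \<subseteq> carrier M \<times> carrier N"
        using u1(1) u2(1) a(1) by auto
      then show ?thesis using u1 u2 a(1) by (simp add: class_add class_smult[OF M N])
    qed
    have p: "c \<odot>\<^bsub>M \<boxtimes> N\<^esub> pure_tensor R M N x y = pure_tensor R M N (c \<odot>\<^bsub>M\<^esub> x) y"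
      if "c \<in> carrier R" "x \<in> carrier M" "y \<in> carrier N" for c x y
      using that by (simp add: pure_smult_left[OF M N])
    have z: "c \<odot>\<^bsub>M \<boxtimes> N\<^esub> \<zero>\<^bsub>M \<boxtimes> N\<^esub> = \<zero>\<^bsub>M \<boxtimes> N\<^esub>" if "c \<in> carrier R" for c
      using class_smult[OF M N, of "[]" c] that by (simp add: class_zero)
  have h1: "(a \<oplus>\<^bsub>R\<^esub> b) \<odot>\<^bsub>M \<boxtimes> N\<^esub> x = a \<odot>\<^bsub>M \<boxtimes> N\<^esub> x \<oplus>\<^bsub>M \<boxtimes> N\<^esub> b \<odot>\<^bsub>M \<boxtimes> N\<^esub> x" if ab: "a \<in> carrier R" "b \<in> carrier R" and x: "x \<in> carrier (M \<boxtimes> N)" for a b x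
    using x by (induction rule: class_induct)
      (use ab in \<open>auto simp: z d p cl pure_closed M.smult_l_distr pure_add_left G.a_ac\<close>)
  have h2: "(a \<otimes>\<^bsub>R\<^esub> b) \<odot>\<^bsub>M \<boxtimes> N\<^esub> x = a \<odot>\<^bsub>M \<boxtimes> N\<^esub> (b \<odot>\<^bsub>M \<boxtimes> N\<^esub> x)" if ab: "a \<in> carrier R" "b \<in> carrier R" and x: "x \<in> carrier (M \<boxtimes> N)" for a b x
    using x by (induction rule: class_induct)
      (use ab in \<open>auto simp: z d p cl pure_closed M.smult_assoc1 G.a_ac\<close>)
  have h3: "\<one>\<^bsub>R\<^esub> \<odot>\<^bsub>M \<boxtimes> N\<^esub> x = x" if x: "x \<in> carrier (M \<boxtimes> N)" for x
    using x by (induction rule: class_induct)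
      (auto simp: z d p cl pure_closed)
  show ?thesis
  by (rule moduleI) (use M.R.is_cring G.abelian_group_axioms in \<open>auto simp: cl d h1 h2 h3\<close>)
qed

lemma lin_pure_left: "module R M \<Longrightarrow> module R N \<Longrightarrow> y \<in> carrier N \<Longrightarrow> linear_map R A M f \<Longrightarrow>
    linear_map R A (M \<boxtimes>\<^bsub>R\<^esub> N) (\<lambda>x. pure_tensor R M N (f x) y)"
  by (auto simp: linear_map_def Pi_iff pure_closed pure_add_left pure_smult_left)

lemma lin_pure_right: "module R M \<Longrightarrow> module R N \<Longrightarrow> y \<in> carrier M \<Longrightarrow> linear_map R A N f \<Longrightarrow>
    linear_map R A (M \<boxtimes>\<^bsub>R\<^esub> N) (\<lambda>x. pure_tensor R M N y (f x))"
  by (auto simp: linear_map_def Pi_iff pure_closed pure_add_right pure_smult_right)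

section \<open>Calculus of Sweedler sums\<close>

lemma sw_class:
  assumes M: "module R M" and N: "module R N" and P: "module R P" and f: "bilinear R M N P f"
    and u: "set u \<subseteq> carrier M \<times> carrier N"
  shows "sw R M N P f (tensor_class R M N u) = lsum P f u"
  using lsum_tensor_eq[OF P M N f tensor_rep_eq[OF u]] tensor_carrierI[OF u]
  by (simp add: sw_def tensor_lift_def lsum_def)

lemma sw_lsum: "z \<in> carrier (M \<boxtimes>\<^bsub>R\<^esub> N) \<Longrightarrow> sw R M N P f z = lsum P f (tensor_rep z)"
  by (simp add: sw_def tensor_lift_def lsum_def)

lemma sw_closed:
  assumes "module R M" "module R N" "module R P"
    and "\<And>x y. x \<in> carrier M \<Longrightarrow> y \<in> carrier N \<Longrightarrow> f x y \<in> carrier P"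
  shows "sw R M N P f z \<in> carrier P"
proof -
  interpret P: module R P by fact
  show ?thesis
    using tensor_rep_set[OF assms(1,2)] assms(4)
    by (cases "z \<in> carrier (M \<boxtimes>\<^bsub>R\<^esub> N)")
      (fastforce simp: sw_lsum intro!: lsum_closed[OF assms(3)], simp add: sw_def)
qed

lemma sw_cong:
  assumes "module R M" "module R N" 
    and "\<And>x y. x \<in> carrier M \<Longrightarrow> y \<in> carrier N \<Longrightarrow> f x y = g x y"
  shows "sw R M N P f z = sw R M N P g z"
proof (cases "z \<in> carrier (M \<boxtimes>\<^bsub>R\<^esub> N)")
  case True
  have "foldr (\<lambda>(x, y) s. f x y \<oplus>\<^bsub>P\<^esub> s) u \<zero>\<^bsub>P\<^esub> = foldr (\<lambda>(x, y) s. g x y \<oplus>\<^bsub>P\<^esub> s) u \<zero>\<^bsub>P\<^esub>"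
    if "set u \<subseteq> carrier M \<times> carrier N" for u
    using that assms(3) by (induction u) auto
  then show ?thesis using tensor_rep_set[OF assms(1,2) True] by (simp add: sw_def tensor_lift_def)
qed (simp add: sw_def)

text \<open>Both sums run over the same chosen list, so this is additivity of \<open>g\<close> along
  that list. The junk value of \<open>sw\<close> is zero, which \<open>g\<close> preserves.\<close>

lemma lin_sw_apply:
  assumes "module R M" "module R N" "module R P" "module R Q" and g: "linear_map R P Q g"
    and f: "\<And>x y. x \<in> carrier M \<Longrightarrow> y \<in> carrier N \<Longrightarrow> f x y \<in> carrier P"
  shows "g (sw R M N P f z) = sw R M N Q (\<lambda>x y. g (f x y)) z"
proof (cases "z \<in> carrier (M \<boxtimes>\<^bsub>R\<^esub> N)")
  case True
  have "g (lsum P f u) = lsum Q (\<lambda>x y. g (f x y)) u" if "set u \<subseteq> carrier M \<times> carrier N" for u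
    using that
  proof (induction u)
    case Nil
    then show ?case by (simp add: lsum_def lin_zero[OF g assms(3,4)])
  next
    case (Cons p u)
    have "lsum P f u \<in> carrier P" using Cons.prems f by (auto intro!: lsum_closed[OF assms(3)])
    then show ?case using Cons f
      by (cases p) (auto simp: lsum_Cons[OF assms(3)] lsum_Cons[OF assms(4)] lin_add[OF g])
  qed
  then show ?thesis using tensor_rep_set[OF assms(1,2) True] True by (simp add: sw_lsum)
qed (simp add: sw_def lin_zero[OF g assms(3,4)])

lemma sw_pure:
  assumes "module R M" "module R N" "module R P" "x \<in> carrier M" "y \<in> carrier N"
    and "\<And>y. y \<in> carrier N \<Longrightarrow> linear_map R M P (\<lambda>x. f x y)"
    and "\<And>x. x \<in> carrier M \<Longrightarrow> linear_map R N P (\<lambda>y. f x y)"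
  shows "sw R M N P f (pure_tensor R M N x y) = f x y"
proof -
  have b: "bilinear R M N P f" using assms(6,7) by (rule bilinearI)
  interpret P: module R P by fact
  show ?thesis using assms bilinear_closed[OF b] unfolding pure_tensor_def
    by (subst sw_class[OF assms(1-3) b]) (auto simp: lsum_def)
qed

text \<open>A bilinear map induces a linear map on the tensor product. An arbitrary linear
  \<open>g\<close> is allowed in the argument so that the rule applies to nested sums.\<close>

lemma lin_sw_arg:
  fixes R (structure)
  assumes M: "module R M" and N: "module R N" and P: "module R P"
    and f: "\<And>y. y \<in> carrier N \<Longrightarrow> linear_map R M P (\<lambda>x. f x y)"
      "\<And>x. x \<in> carrier M \<Longrightarrow> linear_map R N P (\<lambda>y. f x y)"
    and g: "linear_map R A (M \<boxtimes> N) g"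
  shows "linear_map R A P (\<lambda>z. sw R M N P f (g z))"
proof -
  have b: "bilinear R M N P f" using f by (rule bilinearI)
  note cl = bilinear_closed[OF b]
  interpret P: module R P by fact
  interpret M: module R M by fact
  have "linear_map R (M \<boxtimes> N) P (sw R M N P f)"
    unfolding linear_map_def
  proof (intro conjI ballI)
    show "sw R M N P f \<in> carrier (M \<boxtimes> N) \<rightarrow> carrier P"
      using cl by (auto intro!: sw_closed[OF M N P])
    fix z assume z: "z \<in> carrier (M \<boxtimes> N)"
    obtain u where u: "set u \<subseteq> carrier M \<times> carrier N" "z = tensor_class R M N u"
      using z by (rule tensor_carrierE)
    {
      fix w assume w: "w \<in> carrier (M \<boxtimes> N)"
      obtain v where v: "set v \<subseteq> carrier M \<times> carrier N" "w = tensor_class R M N v"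
        using w by (rule tensor_carrierE)
      have "set (u @ v) \<subseteq> carrier M \<times> carrier N" using u v by auto
      then show "sw R M N P f (z \<oplus>\<^bsub>M \<boxtimes> N\<^esub> w) = sw R M N P f z \<oplus>\<^bsub>P\<^esub> sw R M N P f w"
        using u v cl by (auto simp: class_add sw_class[OF M N P b] lsum_append[OF P] subset_iff)
    next
      fix c assume c: "c \<in> carrier R"
      have s: "set (map (\<lambda>(x, y). (c \<odot>\<^bsub>M\<^esub> x, y)) u) \<subseteq> carrier M \<times> carrier N"
        using u c by auto
      have "lsum P f (map (\<lambda>(x, y). (c \<odot>\<^bsub>M\<^esub> x, y)) u) = c \<odot>\<^bsub>P\<^esub> lsum P f u" using u(1)
      proof (induction u)
        case (Cons p u)
        have "lsum P f u \<in> carrier P" using Cons.prems cl by (auto intro!: lsum_closed[OF P])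
        then show ?case using Cons lin_smult[OF f(1) c] cl c
          by (cases p) (auto simp: lsum_Cons[OF P] P.smult_r_distr)
      qed (simp add: lsum_def c)
      then show "sw R M N P f (c \<odot>\<^bsub>M \<boxtimes> N\<^esub> z) = c \<odot>\<^bsub>P\<^esub> sw R M N P f z"
        using u c s by (simp add: class_smult[OF M N] sw_class[OF M N P b])
    }
  qed
  then show ?thesis using g by (rule lin_comp[rotated])
qed

lemma sw_add:
  assumes M: "module R M" and N: "module R N" and P: "module R P"
    and f: "\<And>x y. x \<in> carrier M \<Longrightarrow> y \<in> carrier N \<Longrightarrow> f x y \<in> carrier P"
    and g: "\<And>x y. x \<in> carrier M \<Longrightarrow> y \<in> carrier N \<Longrightarrow> g x y \<in> carrier P"
  shows "sw R M N P (\<lambda>x y. f x y \<oplus>\<^bsub>P\<^esub> g x y) z = sw R M N P f z \<oplus>\<^bsub>P\<^esub> sw R M N P g z"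
proof (cases "z \<in> carrier (M \<boxtimes>\<^bsub>R\<^esub> N)")
  case True
  then show ?thesis using tensor_rep_set[OF M N True] f g
    by (simp add: sw_lsum subset_iff lsum_add[OF P])
next
  case False
  interpret P: module R P by fact
  show ?thesis using False by (simp add: sw_def)
qed

text \<open>Interchange of two independent finite sums. It is used whenever the Sweedler components
  of two unrelated elements have been introduced in the wrong order.\<close>

lemma sw_swap:
  fixes R (structure)
  assumes "module R M" "module R N" "module R M'" "module R N'" "module R P"
    and f: "\<And>x y a b. x \<in> carrier M \<Longrightarrow> y \<in> carrier N \<Longrightarrow> a \<in> carrier M' \<Longrightarrow> b \<in> carrier N' \<Longrightarrow>
      f x y a b \<in> carrier P"
  shows "sw R M N P (\<lambda>x y. sw R M' N' P (\<lambda>a b. f x y a b) w) z =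
    sw R M' N' P (\<lambda>a b. sw R M N P (\<lambda>x y. f x y a b) z) w"
proof -
  interpret P: module R P by fact
  note z = lsum_zero[OF assms(5), of "tensor_rep z"]
  note w = lsum_zero[OF assms(5), of "tensor_rep w"]
  show ?thesis
    using tensor_rep_set[OF assms(1,2), of z] tensor_rep_set[OF assms(3,4), of w] f
    by (cases "z \<in> carrier (M \<boxtimes> N)"; cases "w \<in> carrier (M' \<boxtimes> N')")
      (auto simp: sw_lsum subset_iff z w intro!: lsum_swap[OF assms(5)], auto simp: sw_def z w)
qed

text \<open>Companion of \<open>lin_sw_arg\<close> for a parameter that occurs in the summand rather
  than in the element summed over. Together they establish linearity of expressions built by nesting
  sums.\<close>

lemma lin_sw_fun:
  assumes M: "module R M" and N: "module R N" and P: "module R P"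
    and f: "\<And>x y. x \<in> carrier M \<Longrightarrow> y \<in> carrier N \<Longrightarrow> linear_map R A P (\<lambda>a. f a x y)"
  shows "linear_map R A P (\<lambda>a. sw R M N P (f a) z)"
proof -
  interpret P: module R P by fact
  have cl: "\<And>a x y. a \<in> carrier A \<Longrightarrow> x \<in> carrier M \<Longrightarrow> y \<in> carrier N \<Longrightarrow> f a x y \<in> carrier P"
    using lin_closed[OF f] by blast
  show ?thesis unfolding linear_map_def
  proof (intro conjI ballI funcsetI)
    fix a assume a: "a \<in> carrier A"
    then show "sw R M N P (f a) z \<in> carrier P" using cl by (intro sw_closed[OF M N P])
    {
      fix b assume b: "b \<in> carrier A"
      have "sw R M N P (f (a \<oplus>\<^bsub>A\<^esub> b)) z = sw R M N P (\<lambda>x y. f a x y \<oplus>\<^bsub>P\<^esub> f b x y) z"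
        using lin_add[OF f] a b by (intro sw_cong[OF M N]) auto
      also have "\<dots> = sw R M N P (f a) z \<oplus>\<^bsub>P\<^esub> sw R M N P (f b) z"
        using cl a b by (intro sw_add[OF M N P]) auto
      finally show "sw R M N P (f (a \<oplus>\<^bsub>A\<^esub> b)) z = sw R M N P (f a) z \<oplus>\<^bsub>P\<^esub> sw R M N P (f b) z" .
    next
      fix c assume c: "c \<in> carrier R"
      have l: "linear_map R P P (\<lambda>x. c \<odot>\<^bsub>P\<^esub> x)"
        using c by (auto simp: linear_map_def P.smult_r_distr P.smult_assoc1[symmetric] P.R.m_comm)
      have "sw R M N P (f (c \<odot>\<^bsub>A\<^esub> a)) z = sw R M N P (\<lambda>x y. c \<odot>\<^bsub>P\<^esub> f a x y) z"
        using lin_smult[OF f] a c by (intro sw_cong[OF M N]) auto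
      also have "\<dots> = c \<odot>\<^bsub>P\<^esub> sw R M N P (f a) z"
        using cl a by (intro lin_sw_apply[OF M N P P l, symmetric]) auto
      finally show "sw R M N P (f (c \<odot>\<^bsub>A\<^esub> a)) z = c \<odot>\<^bsub>P\<^esub> sw R M N P (f a) z" .
    }
  qed
qed

lemma sw_eta:
  fixes R (structure)
  assumes "module R M" "module R N" "z \<in> carrier (M \<boxtimes> N)"
  shows "sw R M N (M \<boxtimes> N) (\<lambda>x y. pure_tensor R M N x y) z = z"
proof -
  have "lsum (M \<boxtimes> N) (\<lambda>x y. pure_tensor R M N x y) u = tensor_class R M N u"
    if "set u \<subseteq> carrier M \<times> carrier N" for u
    using that
  proof (induction u)
    case Nil
    then show ?case by (simp add: lsum_def class_zero)
  next
    case (Cons p u)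
    then show ?case by (subst class_Cons) (auto simp: lsum_def split: prod.split)
  qed
  then show ?thesis using tensor_rep_set[OF assms] assms(3)
    by (simp add: sw_lsum tensor_class_rep)
qed

lemma lin_eq_sw:
  fixes R (structure)
  assumes "module R M" "module R N" "module R P" "linear_map R (M \<boxtimes> N) P g"
    "z \<in> carrier (M \<boxtimes> N)"
  shows "g z = sw R M N P (\<lambda>x y. g (pure_tensor R M N x y)) z"
proof -
  have "g (sw R M N (M \<boxtimes> N) (\<lambda>x y. pure_tensor R M N x y) z) =
      sw R M N P (\<lambda>x y. g (pure_tensor R M N x y)) z"
    by (rule lin_sw_apply) (auto simp: assms tensor_module pure_closed)
  then show ?thesis by (simp add: assms sw_eta)
qed

lemma lin_tensor_ext:
  fixes R (structure)
  assumes "module R M" "module R N" "module R P" "linear_map R (M \<boxtimes> N) P g"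
    "linear_map R (M \<boxtimes> N) P h" "z \<in> carrier (M \<boxtimes> N)"
    and "\<And>x y. x \<in> carrier M \<Longrightarrow> y \<in> carrier N \<Longrightarrow>
      g (pure_tensor R M N x y) = h (pure_tensor R M N x y)"
  shows "g z = h z"
  using assms(7) by (subst (1 2) lin_eq_sw[OF assms(1-3) _ assms(6)]) (auto simp: assms intro!: sw_cong)

lemma sw_sw:
  fixes R (structure)
  assumes "module R M" "module R N" "module R A" "module R B" "module R Q"
    and "\<And>x y. x \<in> carrier M \<Longrightarrow> y \<in> carrier N \<Longrightarrow> g x y \<in> carrier (A \<boxtimes> B)"
    and "\<And>y. y \<in> carrier B \<Longrightarrow> linear_map R A Q (\<lambda>x. f x y)"
    and "\<And>x. x \<in> carrier A \<Longrightarrow> linear_map R B Q (\<lambda>y. f x y)"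
  shows "sw R A B Q f (sw R M N (A \<boxtimes> B) g z) = sw R M N Q (\<lambda>x y. sw R A B Q f (g x y)) z"
  by (rule lin_sw_apply) (auto simp: assms tensor_module intro!: lin_sw_arg lin_id)

lemma pure_sw_left:
  assumes "module R M" "module R N" "module R A" "module R B" "b \<in> carrier B"
    and "\<And>x y. x \<in> carrier M \<Longrightarrow> y \<in> carrier N \<Longrightarrow> f x y \<in> carrier A"
  shows "pure_tensor R A B (sw R M N A f z) b =
    sw R M N (A \<boxtimes>\<^bsub>R\<^esub> B) (\<lambda>x y. pure_tensor R A B (f x y) b) z"
  by (rule lin_sw_apply[where g = "\<lambda>a. pure_tensor R A B a b"])
    (auto simp: assms tensor_module intro!: lin_pure_left lin_id)

lemma pure_sw_right:
  assumes "module R M" "module R N" "module R A" "module R B" "a \<in> carrier A"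
    and "\<And>x y. x \<in> carrier M \<Longrightarrow> y \<in> carrier N \<Longrightarrow> f x y \<in> carrier B"
  shows "pure_tensor R A B a (sw R M N B f z) =
    sw R M N (A \<boxtimes>\<^bsub>R\<^esub> B) (\<lambda>x y. pure_tensor R A B a (f x y)) z"
  by (rule lin_sw_apply[where g = "\<lambda>b. pure_tensor R A B a b"])
    (auto simp: assms tensor_module intro!: lin_pure_right lin_id)

text \<open>As rewrite rules these move sums outwards and evaluate them at pure tensors, discharging
  the linearity and typing conditions on the way. Many identities between structure maps become
  identical nested sums after this normalisation.\<close>

lemmas sw_lin = lin_id lin_pure_left lin_pure_right lin_sw_arg lin_sw_fun
lemmas sw_typ = tensor_module sw_closed pure_closed
lemmas sw_norm = sw_pure sw_sw pure_sw_left pure_sw_right sw_eta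
lemmas sws = sw_lin sw_typ sw_norm

section \<open>The structure maps as sums\<close>

lemma lift_cong:
  assumes "module R M" "module R N" "z \<in> carrier (M \<boxtimes>\<^bsub>R\<^esub> N)"
    and "\<And>x y. x \<in> carrier M \<Longrightarrow> y \<in> carrier N \<Longrightarrow> f x y = g x y"
  shows "tensor_lift P f z = sw R M N P g z"
  using sw_cong[of R M N f g P z, OF assms(1,2,4)] assms(3) by (simp add: sw_def)

lemma tensor_map_sw:
  fixes R (structure)
  assumes "z \<in> carrier (A \<boxtimes> B)"
  shows "tensor_map R M N f g z = sw R A B (M \<boxtimes> N) (\<lambda>x y. pure_tensor R M N (f x) (g y)) z"
  using assms by (simp add: tensor_map_def sw_def)

lemma assoc_sw:
  fixes R (structure)
  assumes "module R M" "module R N" "module R P" "z \<in> carrier ((M \<boxtimes> N) \<boxtimes> P)"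
  shows "assoc R M N P z = sw R (M \<boxtimes> N) P (M \<boxtimes> N \<boxtimes> P) (\<lambda>u z. sw R M N (M \<boxtimes> N \<boxtimes> P)
    (\<lambda>x y. pure_tensor R M (N \<boxtimes> P) x (pure_tensor R N P y z)) u) z"
  unfolding assoc_def using assms
  by (intro lift_cong) (auto simp: sw_typ intro!: lift_cong)

lemma assoc_inv_sw:
  fixes R (structure)
  assumes "module R M" "module R N" "module R P" "z \<in> carrier (M \<boxtimes> N \<boxtimes> P)"
  shows "assoc_inv R M N P z = sw R M (N \<boxtimes> P) ((M \<boxtimes> N) \<boxtimes> P) (\<lambda>x v. sw R N P ((M \<boxtimes> N) \<boxtimes> P)
    (\<lambda>y z. pure_tensor R (M \<boxtimes> N) P (pure_tensor R M N x y) z) v) z"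
  unfolding assoc_inv_def using assms
  by (intro lift_cong) (auto simp: sw_typ intro!: lift_cong)

lemma flip13_sw:
  fixes R (structure)
  assumes "module R M" "module R N" "module R P" "z \<in> carrier (M \<boxtimes> N \<boxtimes> P)"
  shows "flip13 R M N P z = sw R M (N \<boxtimes> P) (P \<boxtimes> N \<boxtimes> M) (\<lambda>x v. sw R N P (P \<boxtimes> N \<boxtimes> M)
    (\<lambda>y z. pure_tensor R P (N \<boxtimes> M) z (pure_tensor R N M y x)) v) z"
  unfolding flip13_def using assms
  by (intro lift_cong) (auto simp: sw_typ intro!: lift_cong)

lemma assoc3_sw:
  fixes R (structure)
  assumes m: "module R M" "module R N" "module R P" "module R Q"
    and z: "z \<in> carrier ((M \<boxtimes> N \<boxtimes> P) \<boxtimes> Q)"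
  shows "assoc3 R M N P Q z = sw R (M \<boxtimes> N \<boxtimes> P) Q (M \<boxtimes> N \<boxtimes> P \<boxtimes> Q)
    (\<lambda>u w. sw R M (N \<boxtimes> P) (M \<boxtimes> N \<boxtimes> P \<boxtimes> Q) (\<lambda>x v. sw R N P (M \<boxtimes> N \<boxtimes> P \<boxtimes> Q)
    (\<lambda>y z. pure_tensor R M (N \<boxtimes> P \<boxtimes> Q) x (pure_tensor R N (P \<boxtimes> Q) y (pure_tensor R P Q z w))) v) u) z"
proof -
  have "assoc R M (N \<boxtimes> P) Q z \<in> carrier (M \<boxtimes> (N \<boxtimes> P) \<boxtimes> Q)"
    using m z by (simp add: assoc_sw sws)
  then show ?thesis using m z
    by (simp add: assoc3_def tensor_map_sw[where A = M and B = "(N \<boxtimes> P) \<boxtimes> Q"] assoc_sw sws cong: sw_cong)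
qed

section \<open>Flatness with respect to all modules\<close>

lemma submodule_module: "submodule K R M \<Longrightarrow> module R M \<Longrightarrow> module R (M\<lparr>carrier := K\<rparr>)"
  by (rule submodule.submodule_is_module)

lemma lin_minus:
  assumes "module R M" "module R N" "linear_map R M N f" "linear_map R M N g"
  shows "linear_map R M N (\<lambda>x. f x \<ominus>\<^bsub>N\<^esub> g x)"
proof -
  interpret N: module R N by fact
  show ?thesis
    using assms(3,4) unfolding linear_map_def
    by (auto simp: Pi_iff a_minus_def N.M.a_ac N.M.minus_add N.smult_r_distr N.smult_r_minus)
qed

lemma minus_zero_iff:
  assumes "module R N" "x \<in> carrier N" "y \<in> carrier N"
  shows "x \<ominus>\<^bsub>N\<^esub> y = \<zero>\<^bsub>N\<^esub> \<longleftrightarrow> x = y"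
proof -
  interpret N: module R N by fact
  have "x = (x \<ominus>\<^bsub>N\<^esub> y) \<oplus>\<^bsub>N\<^esub> y"
    using assms(2,3) by (simp add: a_minus_def N.M.a_assoc N.M.l_neg)
  then show ?thesis using assms(2,3) by (auto simp: a_minus_def N.M.r_neg)
qed

lemma lin_zero_map: "module R M \<Longrightarrow> module R N \<Longrightarrow> linear_map R M N (\<lambda>x. \<zero>\<^bsub>N\<^esub>)"
proof -
  assume "module R N"
  interpret N: module R N by fact
  show ?thesis by (auto simp: linear_map_def)
qed

lemma lin_inj:
  assumes "module R M" "module R N" "linear_map R M N f"
    and "\<And>x. x \<in> carrier M \<Longrightarrow> f x = \<zero>\<^bsub>N\<^esub> \<Longrightarrow> x = \<zero>\<^bsub>M\<^esub>"
  shows "inj_on f (carrier M)"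
proof (rule inj_onI)
  fix x y assume xy: "x \<in> carrier M" "y \<in> carrier M" "f x = f y"
  interpret M: module R M by fact
  interpret N: module R N by fact
  have "f (x \<ominus>\<^bsub>M\<^esub> y) = f x \<oplus>\<^bsub>N\<^esub> f (\<ominus>\<^bsub>M\<^esub> y)"
    using xy by (simp add: a_minus_def lin_add[OF assms(3)])
  also have "\<dots> = f y \<oplus>\<^bsub>N\<^esub> f (\<ominus>\<^bsub>M\<^esub> y)" using xy by simp
  also have "\<dots> = f (y \<oplus>\<^bsub>M\<^esub> \<ominus>\<^bsub>M\<^esub> y)" using xy by (simp add: lin_add[OF assms(3)])
  also have "\<dots> = \<zero>\<^bsub>N\<^esub>" using xy by (simp add: M.M.r_neg lin_zero[OF assms(3,1,2)])
  finally show "x = y" using assms(4)[of "x \<ominus>\<^bsub>M\<^esub> y"] xy minus_zero_iff[OF assms(1)] by simp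
qed

lemma equalizer_submodule:
  assumes "module R M" "module R N" "linear_map R M N f" "linear_map R M N g"
  shows "submodule {x \<in> carrier M. f x = g x} R M"
proof -
  interpret M: module R M by fact
  have "\<ominus>\<^bsub>M\<^esub> a = (\<ominus>\<^bsub>R\<^esub> \<one>\<^bsub>R\<^esub>) \<odot>\<^bsub>M\<^esub> a" if "a \<in> carrier M" for a
    using that by (simp add: M.smult_l_minus)
  then show ?thesis
    using lin_add[OF assms(3)] lin_add[OF assms(4)] lin_smult[OF assms(3)] lin_smult[OF assms(4)]
      lin_zero[OF assms(3,1,2)] lin_zero[OF assms(4,1,2)]
    by (intro M.submoduleI) auto
qed

lemma linear_restrict:
  "linear_map R M N f \<Longrightarrow> K \<subseteq> carrier M \<Longrightarrow> f ` K \<subseteq> L \<Longrightarrow>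
   linear_map R (M\<lparr>carrier := K\<rparr>) (N\<lparr>carrier := L\<rparr>) f"
  by (auto simp: linear_map_def subset_iff)

lemma tensor_map_class:
  fixes R (structure)
  assumes "module R M" "module R N" "module R A" "module R B"
    and f: "linear_map R A M f" and g: "linear_map R B N g"
    and u: "set u \<subseteq> carrier A \<times> carrier B"
  shows "tensor_map R M N f g (tensor_class R A B u) = tensor_class R M N (map (\<lambda>(x, y). (f x, g y)) u)"
proof -
  have b: "bilinear R A B (M \<boxtimes> N) (\<lambda>x y. pure_tensor R M N (f x) (g y))"
    by (rule bilinearI)
      (auto simp: assms lin_closed[OF f] lin_closed[OF g] intro!: lin_pure_left lin_pure_right)
  have *: "lsum (M \<boxtimes> N) (\<lambda>x y. pure_tensor R M N (f x) (g y)) u =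
      tensor_class R M N (map (\<lambda>(x, y). (f x, g y)) u)"
    using u
  proof (induction u)
    case Nil
    then show ?case by (simp add: lsum_def class_zero)
  next
    case (Cons p u)
    then show ?case
      by (cases p, simp, subst class_Cons)
        (auto simp: lsum_def subset_iff lin_closed[OF f] lin_closed[OF g])
  qed
  show ?thesis
    by (simp add: tensor_map_sw[OF tensor_carrierI[OF u]] sw_class assms b tensor_module *)
qed

text \<open>
  Flatness is tested only on modules over one particular type. Finitely generated submodules
  embed into that type, and an equation in a tensor product involves only finitely many elements.
\<close>

definition transport :: "('k, 'a, 'm) module_scheme \<Rightarrow> ('a \<Rightarrow> 'b) \<Rightarrow> ('k, 'b) module" where
  "transport N j = (let i = inv_into (carrier N) j in
     \<lparr>carrier = j ` carrier N, monoid.mult = undefined, one = undefined, zero = j \<zero>\<^bsub>N\<^esub>,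
      add = (\<lambda>x y. j (i x \<oplus>\<^bsub>N\<^esub> i y)), smult = (\<lambda>c x. j (c \<odot>\<^bsub>N\<^esub> i x))\<rparr>)"

lemma transport_module:
  assumes N: "module R N" and j: "inj_on j (carrier N)"
  shows "module R (transport N j)"
    and "linear_map R N (transport N j) j"
    and "linear_map R (transport N j) N (inv_into (carrier N) j)"
proof -
  interpret N: module R N by fact
  note [simp] = transport_def Let_def inv_into_f_f[OF j]
  have "abelian_group (transport N j)"
  proof (rule abelian_groupI)
    fix x assume "x \<in> carrier (transport N j)"
    then obtain a where a: "a \<in> carrier N" "x = j a" by auto
    then show "\<exists>y\<in>carrier (transport N j). y \<oplus>\<^bsub>transport N j\<^esub> x = \<zero>\<^bsub>transport N j\<^esub>"
      by (intro bexI[of _ "j (\<ominus>\<^bsub>N\<^esub> a)"]) (auto simp: N.M.l_neg)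
  qed (auto simp: N.M.a_ac)
  then show "module R (transport N j)"
    by (intro moduleI N.R.is_cring)
      (auto simp: N.smult_l_distr N.smult_r_distr N.smult_assoc1)
  show "linear_map R N (transport N j) j" "linear_map R (transport N j) N (inv_into (carrier N) j)"
    by (auto simp: linear_map_def)
qed

primrec lincomb :: "('k, 'a, 'm) module_scheme \<Rightarrow> (nat \<Rightarrow> 'k) \<Rightarrow> 'a list \<Rightarrow> 'a" where
  "lincomb M s [] = \<zero>\<^bsub>M\<^esub>"
| "lincomb M s (m # ms) = s 0 \<odot>\<^bsub>M\<^esub> m \<oplus>\<^bsub>M\<^esub> lincomb M (\<lambda>i. s (Suc i)) ms"

text \<open>The span of a finite list is coded in the test type by fibres: an element goes to the
  set of all coefficient sequences that produce it. Fibres over different elements of the span are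
  nonempty and disjoint, so the code is injective. \<open>lincomb\<close> ignores coefficients
  beyond the length of the list, so plain functions on \<open>nat\<close> can serve as coefficient
  vectors.\<close>

lemma span_embedding:
  assumes M: "module R M" and ms: "set ms \<subseteq> carrier M"
  obtains K and j :: "'b \<Rightarrow> (nat \<Rightarrow> 'k) set"
  where "submodule K (R :: 'k ring) (M :: ('k, 'b, 'm) module_scheme)" "set ms \<subseteq> K" "inj_on j K"
    "\<And>L. submodule L R M \<Longrightarrow> set ms \<subseteq> L \<Longrightarrow> K \<subseteq> L"
proof -
  interpret M: module R M by fact
  let ?V = "{s. \<forall>i. s i \<in> carrier R}"
  have cl: "lincomb M s ms \<in> L" if "submodule L R M" "set ms \<subseteq> L" "s \<in> ?V" for L s ms
    using that(2,3)
  proof (induction ms arbitrary: s)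
    case Nil
    then show ?case using submodule.axioms(1)[OF that(1)] by (auto dest: subgroup.one_closed)
  next
    case (Cons m ms)
    then have "lincomb M (\<lambda>i. s (Suc i)) ms \<in> L" by auto
    then show ?case using M.submoduleE(4,5)[OF that(1)] Cons.prems by auto
  qed
  have car: "submodule (carrier M) R M" by (rule M.carrier_is_submodule)
  have ad: "lincomb M (\<lambda>i. s i \<oplus>\<^bsub>R\<^esub> t i) ms = lincomb M s ms \<oplus>\<^bsub>M\<^esub> lincomb M t ms"
    if "set ms \<subseteq> carrier M" "s \<in> ?V" "t \<in> ?V" for s t ms
    using that
  proof (induction ms arbitrary: s t)
    case (Cons m ms)
    then show ?case
      using cl[OF car, of ms "\<lambda>i. s (Suc i)"] cl[OF car, of ms "\<lambda>i. t (Suc i)"]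
      by (auto simp: M.smult_l_distr M.M.a_ac)
  qed auto
  have sm: "lincomb M (\<lambda>i. c \<otimes>\<^bsub>R\<^esub> s i) ms = c \<odot>\<^bsub>M\<^esub> lincomb M s ms"
    if "set ms \<subseteq> carrier M" "s \<in> ?V" "c \<in> carrier R" for s c ms
    using that
  proof (induction ms arbitrary: s)
    case (Cons m ms)
    then show ?case
      using cl[OF car, of ms "\<lambda>i. s (Suc i)"]
      by (auto simp: M.smult_r_distr M.smult_assoc1)
  qed auto
  have z: "lincomb M (\<lambda>i. \<zero>\<^bsub>R\<^esub>) ms = \<zero>\<^bsub>M\<^esub>" if "set ms \<subseteq> carrier M" for ms
    using that by (induction ms) auto
  have gen: "\<exists>s\<in>?V. lincomb M s ms = m" if "set ms \<subseteq> carrier M" "m \<in> set ms" for m ms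
    using that
  proof (induction ms)
    case (Cons a ms)
    show ?case
    proof (cases "m = a")
      case True
      then show ?thesis using Cons.prems z[of ms]
        by (intro bexI[of _ "\<lambda>i. if i = 0 then \<one>\<^bsub>R\<^esub> else \<zero>\<^bsub>R\<^esub>"]) auto
    next
      case False
      then obtain s where s: "s \<in> ?V" "lincomb M s ms = m" using Cons by auto
      then show ?thesis using Cons.prems
        by (intro bexI[of _ "\<lambda>i. case i of 0 \<Rightarrow> \<zero>\<^bsub>R\<^esub> | Suc k \<Rightarrow> s k"]) (auto split: nat.split)
    qed
  qed auto
  let ?K = "(\<lambda>s. lincomb M s ms) ` ?V"
  let ?j = "\<lambda>m. {s \<in> ?V. lincomb M s ms = m}"
  show ?thesis
  proof (rule that[of ?K ?j])
    show "submodule ?K R M"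
    proof (rule M.submoduleI)
      show "?K \<subseteq> carrier M" using cl[OF car ms] by auto
      show "\<zero>\<^bsub>M\<^esub> \<in> ?K" using z[OF ms] by (force intro!: image_eqI[of _ _ "\<lambda>i. \<zero>\<^bsub>R\<^esub>"])
      fix a assume a: "a \<in> ?K"
      then obtain s where s: "s \<in> ?V" "a = lincomb M s ms" by auto
      have "a \<in> carrier M" using s cl[OF car ms] by auto
      then have "\<ominus>\<^bsub>M\<^esub> a = (\<ominus>\<^bsub>R\<^esub> \<one>\<^bsub>R\<^esub>) \<odot>\<^bsub>M\<^esub> a" by (simp add: M.smult_l_minus)
      then show "\<ominus>\<^bsub>M\<^esub> a \<in> ?K"
        using s sm[OF ms s(1), of "\<ominus>\<^bsub>R\<^esub> \<one>\<^bsub>R\<^esub>"]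
        by (auto intro!: image_eqI[of _ _ "\<lambda>i. (\<ominus>\<^bsub>R\<^esub> \<one>\<^bsub>R\<^esub>) \<otimes>\<^bsub>R\<^esub> s i"])
      fix b assume "b \<in> ?K"
      then obtain t where t: "t \<in> ?V" "b = lincomb M t ms" by auto
      then show "a \<oplus>\<^bsub>M\<^esub> b \<in> ?K" using s ad[OF ms s(1) t(1)]
        by (auto intro!: image_eqI[of _ _ "\<lambda>i. s i \<oplus>\<^bsub>R\<^esub> t i"])
    next
      fix c x assume c: "c \<in> carrier R" and "x \<in> ?K"
      then obtain s where s: "s \<in> ?V" "x = lincomb M s ms" by auto
      then show "c \<odot>\<^bsub>M\<^esub> x \<in> ?K" using c sm[OF ms s(1) c]
        by (auto intro!: image_eqI[of _ _ "\<lambda>i. c \<otimes>\<^bsub>R\<^esub> s i"])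
    qed
    show "set ms \<subseteq> ?K" using gen[OF ms] by blast
    show "inj_on ?j ?K" by (rule inj_onI) blast
    show "?K \<subseteq> L" if "submodule L R M" "set ms \<subseteq> L" for L
      using cl[OF that] by auto
  qed
qed

text \<open>A derivation of \<open>tensor_eq\<close> mentions only finitely many elements of
  \<open>M\<close>. Over any submodule that contains them the same derivation remains valid,
  although the map from the tensor product with a submodule need not be injective.\<close>

lemma tensor_eq_finite_support:
  assumes T: "module R T" and M: "module R M" and e: "tensor_eq R T M u v"
  shows "\<exists>ms. set ms \<subseteq> carrier M \<and> (\<forall>L. submodule L R M \<and> set ms \<subseteq> L \<longrightarrow>
    tensor_eq R T (M\<lparr>carrier := L\<rparr>) u v)"
  using e
proof induction
  case (refl u)
  then show ?case by (intro exI[of _ "map snd u"]) (auto intro!: tensor_eq.refl)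
next
  case (sym u v)
  then show ?case by (meson tensor_eq.sym)
next
  case (trans u v w)
  then obtain ms ns where "set ms \<subseteq> carrier M" "set ns \<subseteq> carrier M"
    "\<And>L. submodule L R M \<Longrightarrow> set ms \<subseteq> L \<Longrightarrow> tensor_eq R T (M\<lparr>carrier := L\<rparr>) u v"
    "\<And>L. submodule L R M \<Longrightarrow> set ns \<subseteq> L \<Longrightarrow> tensor_eq R T (M\<lparr>carrier := L\<rparr>) v w" by auto
  then show ?case using tensor_eq.trans[of R T "M\<lparr>carrier := L\<rparr>" u v w for L]
    by (intro exI[of _ "ms @ ns"]) (simp add: subset_iff)
next
  case (append u u' v v')
  then obtain ms ns where "set ms \<subseteq> carrier M" "set ns \<subseteq> carrier M"
    "\<And>L. submodule L R M \<Longrightarrow> set ms \<subseteq> L \<Longrightarrow> tensor_eq R T (M\<lparr>carrier := L\<rparr>) u u'"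
    "\<And>L. submodule L R M \<Longrightarrow> set ns \<subseteq> L \<Longrightarrow> tensor_eq R T (M\<lparr>carrier := L\<rparr>) v v'" by auto
  then show ?case by (intro exI[of _ "ms @ ns"]) (auto intro: tensor_eq.append)
next
  case (commute u v)
  then show ?case
    by (intro exI[of _ "map snd (u @ v)"]) (force intro!: tensor_eq.commute simp: image_subset_iff)
next
  case (add_left x x' y)
  then show ?case
    using tensor_eq.add_left[of x T x' y "M\<lparr>carrier := L\<rparr>" R for L]
    by (intro exI[of _ "[y]"]) auto
next
  case (add_right x y y')
  then show ?case
    using tensor_eq.add_right[of x T y "M\<lparr>carrier := L\<rparr>" y' R for L]
    by (intro exI[of _ "[y, y']"]) auto
next
  case (smult c x y)
  then show ?case
    using tensor_eq.smult[of c R x T y "M\<lparr>carrier := L\<rparr>" for L]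
    by (intro exI[of _ "[y]"]) auto
next
  case (zero y)
  then show ?case
    using tensor_eq.zero[of y "M\<lparr>carrier := L\<rparr>" R T for L]
    by (intro exI[of _ "[y]"]) auto
qed

text \<open>Flatness for modules on arbitrary types. The equation for \<open>z\<close> involves
  finitely many elements, so it holds over finitely generated submodules \<open>K\<close> and
  \<open>K2\<close>, which are coded in the test type. There the exact sequence of a kernel may be
  tensored with \<open>T\<close>, and decoding the result gives tensors of kernel elements.\<close>

lemma flat_kernel:
  fixes R (structure)
  assumes flat: "flat R T" and M: "module R M" and M2: "module R M2" and g: "linear_map R M M2 g"
    and z: "z \<in> carrier (T \<boxtimes> M)" and gz: "tensor_map R T M2 id g z = \<zero>\<^bsub>T \<boxtimes> M2\<^esub>"
  obtains v where "set v \<subseteq> carrier T \<times> {x \<in> carrier M. g x = \<zero>\<^bsub>M2\<^esub>}" "z = tensor_class R T M v"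
proof -
  have T: "module R T" using flat by (simp add: flat_def)
  interpret M: module R M by fact
  interpret M2: module R M2 by fact
  have idT: "linear_map R T T id" by (simp add: linear_map_def)
  obtain u where u: "set u \<subseteq> carrier T \<times> carrier M" "z = tensor_class R T M u"
    using z by (rule tensor_carrierE)
  let ?gu = "map (\<lambda>(x, y). (id x, g y)) u"
  have gu: "set ?gu \<subseteq> carrier T \<times> carrier M2" using u(1) lin_closed[OF g] by auto
  have "tensor_eq R T M2 ?gu []"
    using gz by (intro tensor_class_eqD[OF _ gu])
      (simp add: u tensor_map_class[OF T M2 T M idT g u(1)] class_zero)
  then obtain ns where ns: "set ns \<subseteq> carrier M2"
    "\<And>L. submodule L R M2 \<Longrightarrow> set ns \<subseteq> L \<Longrightarrow> tensor_eq R T (M2\<lparr>carrier := L\<rparr>) ?gu []"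
    using tensor_eq_finite_support[OF T M2] by blast
  have ms: "set (map snd u) \<subseteq> carrier M" using u(1) by auto
  obtain K and j :: "'d \<Rightarrow> (nat \<Rightarrow> 'a) set" where K: "submodule K R M" "set (map snd u) \<subseteq> K"
    and j: "inj_on j K" and Kmin: "\<And>L. submodule L R M \<Longrightarrow> set (map snd u) \<subseteq> L \<Longrightarrow> K \<subseteq> L"
    using span_embedding[OF M ms] by metis
  have ms2: "set (ns @ map g (map snd u)) \<subseteq> carrier M2" using ns(1) ms lin_closed[OF g] by auto
  \<comment> \<open>Besides the images of the right entries of \<open>z\<close>, \<open>K2\<close>
    has to contain \<open>ns\<close>, the elements witnessing that the image of \<open>z\<close>
    vanishes; then it vanishes already over \<open>K2\<close>.\<close>
  obtain K2 and j2 :: "'f \<Rightarrow> (nat \<Rightarrow> 'a) set" where K2: "submodule K2 R M2"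
    "set (ns @ map g (map snd u)) \<subseteq> K2" and j2: "inj_on j2 K2"
    using span_embedding[OF M2 ms2] by metis
  note KM = M.submoduleE(1)[OF K(1)] and KM2 = M2.submoduleE(1)[OF K2(1)]
  define N where "N = M\<lparr>carrier := K\<rparr>"
  define N2 where "N2 = M2\<lparr>carrier := K2\<rparr>"
  have N: "module R N" and N2: "module R N2"
    using submodule_module[OF K(1) M] submodule_module[OF K2(1) M2] by (simp_all add: N_def N2_def)
  \<comment> \<open>The preimage of \<open>K2\<close> is a submodule containing the generators of
    \<open>K\<close>, so minimality of \<open>K\<close> makes \<open>g\<close> restrict to a map
    from \<open>K\<close> to \<open>K2\<close>.\<close>
  have "submodule {x \<in> carrier M. g x \<in> K2} R M"
    using M2.submoduleE[OF K2(1)] lin_add[OF g] lin_smult[OF g] lin_zero[OF g M M2]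
      module.smult_l_minus[OF M] module.smult_l_minus[OF M2]
    apply (intro M.submoduleI)
    subgoal by auto
    subgoal using submodule.axioms(1)[OF K2(1)] by (auto dest: subgroup.one_closed)
    subgoal for a using lin_smult[OF g, of "\<ominus>\<^bsub>R\<^esub> \<one>\<^bsub>R\<^esub>" a] lin_closed[OF g, of a] by (auto simp: M.smult_l_minus M2.smult_l_minus)
    by auto
  then have gK: "g ` K \<subseteq> K2" using Kmin[of "{x \<in> carrier M. g x \<in> K2}"] K2(2) ms by auto
  have gN: "linear_map R N N2 g" unfolding N_def N2_def by (rule linear_restrict[OF g KM gK])
  have jN: "inj_on j (carrier N)" "inj_on j2 (carrier N2)" using j j2 by (simp_all add: N_def N2_def)
  define Q where "Q = transport N j"
  define Q2 where "Q2 = transport N2 j2"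
  note Q = transport_module[OF N jN(1), folded Q_def] and Q2 = transport_module[OF N2 jN(2), folded Q2_def]
  define i where "i = inv_into (carrier N) j"
  define g0 where "g0 X = j2 (g (i X))" for X
  have g0: "linear_map R Q Q2 g0"
    unfolding g0_def by (rule lin_comp[OF lin_comp[OF Q(3)[folded i_def] gN] Q2(2)])
  \<comment> \<open>The kernel of the transported map, so that \<open>Q1\<close>, \<open>Q\<close>,
    \<open>Q2\<close> is an exact sequence of test modules.\<close>
  define Q1 where "Q1 = Q\<lparr>carrier := {X \<in> carrier Q. g0 X = \<zero>\<^bsub>Q2\<^esub>}\<rparr>"
  have Q1: "module R Q1" unfolding Q1_def
    using equalizer_submodule[OF Q(1) Q2(1) g0 lin_zero_map[OF Q(1) Q2(1)]] submodule_module Q(1) by blast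
  have idQ: "linear_map R Q1 Q id" by (auto simp: Q1_def linear_map_def)
  have "exact_at (carrier Q1) Q Q2 id g0" by (auto simp: exact_at_def Q1_def)
  then have ex: "tensor_map R T Q id id ` carrier (T \<boxtimes> Q1) =
      {x \<in> carrier (T \<boxtimes> Q). tensor_map R T Q2 id g0 x = \<zero>\<^bsub>T \<boxtimes> Q2\<^esub>}"
    using flat Q1 Q(1) Q2(1) idQ g0 unfolding flat_def exact_at_def by blast
  have uN: "set u \<subseteq> carrier T \<times> carrier N" using u(1) K(2) by (auto simp: N_def)
  have guN: "set ?gu \<subseteq> carrier T \<times> carrier N2"
    using uN lin_closed[OF gN] by auto
  let ?z0 = "tensor_class R T Q (map (\<lambda>(x, y). (id x, j y)) u)"
  have ju: "set (map (\<lambda>(x, y). (id x, j y)) u) \<subseteq> carrier T \<times> carrier Q"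
    using uN lin_closed[OF Q(2)] by auto
  have ij: "i (j y) = y" if "y \<in> carrier N" for y using that jN(1) by (simp add: i_def)
  have ij2: "i (j y) = y" if "(x, y) \<in> set u" for x y using that uN ij by auto
  have "tensor_map R T Q2 id g0 ?z0 = tensor_map R T Q2 id j2 (tensor_class R T N2 ?gu)"
    by (subst tensor_map_class[OF T Q2(1) T Q(1) idT g0 ju],
        subst tensor_map_class[OF T Q2(1) T N2 idT Q2(2) guN])
      (auto intro!: arg_cong[where f = "tensor_class R T Q2"] simp: g0_def ij2)
  also have "tensor_class R T N2 ?gu = tensor_class R T N2 []"
    using ns(2)[OF K2(1)] K2(2) by (intro tensor_class_eqI) (auto simp: N2_def)
  also have "tensor_map R T Q2 id j2 (tensor_class R T N2 []) = \<zero>\<^bsub>T \<boxtimes> Q2\<^esub>"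
    by (subst tensor_map_class[OF T Q2(1) T N2 idT Q2(2)]) (auto simp: class_zero)
  finally have "?z0 \<in> tensor_map R T Q id id ` carrier (T \<boxtimes> Q1)"
    unfolding ex mem_Collect_eq using tensor_carrierI[OF ju] by (rule conjI[rotated])
  then obtain w where w: "set w \<subseteq> carrier T \<times> carrier Q1" "?z0 = tensor_map R T Q id id (tensor_class R T Q1 w)"
    by (auto elim!: tensor_carrierE)
  have wQ: "set w \<subseteq> carrier T \<times> carrier Q" using w(1) by (auto simp: Q1_def)
  have z0: "?z0 = tensor_class R T Q w"
    unfolding w(2) by (subst tensor_map_class[OF T Q(1) T Q1 idT idQ w(1)]) (simp add: split_def)
  have iM: "linear_map R Q M i"
    using Q(3) KM unfolding i_def N_def by (auto simp: linear_map_def)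
  have "tensor_map R T M id i ?z0 = z"
    unfolding u(2) by (subst tensor_map_class[OF T M T Q(1) idT iM ju])
      (auto intro!: arg_cong[where f = "tensor_class R T M"] map_idI simp: ij2)
  then have zw: "z = tensor_class R T M (map (\<lambda>(x, y). (id x, i y)) w)"
    unfolding z0 by (simp add: tensor_map_class[OF T M T Q(1) idT iM wQ])
  \<comment> \<open>Decoding: an element of \<open>Q1\<close> comes from an element of
    \<open>K\<close> killed by \<open>g\<close>, because \<open>j2\<close> is injective on
    \<open>K2\<close> and sends zero to the zero of \<open>Q2\<close>.\<close>
  have "g (i X) = \<zero>\<^bsub>M2\<^esub>" if "X \<in> carrier Q1" for X
  proof -
    have X: "X \<in> carrier Q" "j2 (g (i X)) = \<zero>\<^bsub>Q2\<^esub>" using that by (auto simp: Q1_def g0_def)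
    have c: "g (i X) \<in> carrier N2" using X(1) lin_closed[OF gN] lin_closed[OF Q(3)[folded i_def]] by auto
    have c0: "\<zero>\<^bsub>M2\<^esub> \<in> carrier N2"
      using submodule.axioms(1)[OF K2(1)] by (auto simp: N2_def dest: subgroup.one_closed)
    have "\<zero>\<^bsub>Q2\<^esub> = j2 \<zero>\<^bsub>M2\<^esub>" by (simp add: Q2_def transport_def Let_def N2_def)
    then show ?thesis using X(2) jN(2) c c0 by (auto dest: inj_onD)
  qed
  then have "set (map (\<lambda>(x, y). (id x, i y)) w) \<subseteq> carrier T \<times> {x \<in> carrier M. g x = \<zero>\<^bsub>M2\<^esub>}"
    using w(1) wQ lin_closed[OF iM] by auto
  then show ?thesis using zw by (rule that)
qed

lemma class_null:
  fixes R (structure)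
  assumes "module R T" "module R M" "set v \<subseteq> carrier T \<times> {\<zero>\<^bsub>M\<^esub>}"
  shows "tensor_class R T M v = \<zero>\<^bsub>T \<boxtimes> M\<^esub>"
  using assms(3)
proof (induction v)
  case Nil
  then show ?case by (simp add: class_zero)
next
  case (Cons p v)
  interpret M: module R M by fact
  interpret T: module R T by fact
  interpret G: module R "T \<boxtimes> M" by (rule tensor_module[OF assms(1,2)])
  obtain t where p: "p = (t, \<zero>\<^bsub>M\<^esub>)" "t \<in> carrier T" using Cons.prems by auto
  have "set v \<subseteq> carrier T \<times> carrier M" using Cons.prems by auto
  moreover have "pure_tensor R T M t \<zero>\<^bsub>M\<^esub> = \<zero>\<^bsub>T \<boxtimes> M\<^esub>"
    using lin_zero[OF lin_pure_right[OF assms(1,2) p(2) lin_id] assms(2) tensor_module[OF assms(1,2)]] .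
  ultimately show ?case using Cons p by (subst class_Cons) auto
qed

lemma lin_tensor_map:
  fixes R (structure)
  assumes "module R A" "module R B" "module R M" "module R N" "linear_map R A M f" "linear_map R B N g"
  shows "linear_map R (A \<boxtimes> B) (M \<boxtimes> N) (tensor_map R M N f g)"
proof -
  have "linear_map R (A \<boxtimes> B) (M \<boxtimes> N) (\<lambda>z. sw R A B (M \<boxtimes> N) (\<lambda>x y. pure_tensor R M N (f x) (g y)) z)"
    by (simp add: assms sws lin_closed[OF assms(5)] lin_closed[OF assms(6)])
  then show ?thesis
    by (subst lin_cong[where g = "sw R A B (M \<boxtimes> N) (\<lambda>x y. pure_tensor R M N (f x) (g y))"])
      (auto simp: tensor_map_sw assms tensor_module)
qed

section \<open>Injections and equalizers under flat tensoring\<close>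

lemma flat_inj:
  fixes R (structure)
  assumes flat: "flat R T" and M: "module R M" and N: "module R N" and f: "linear_map R M N f"
    and inj: "inj_on f (carrier M)"
  shows "inj_on (tensor_map R T N id f) (carrier (T \<boxtimes> M))"
proof -
  have T: "module R T" using flat by (simp add: flat_def)
  have idT: "linear_map R T T id" by (simp add: linear_map_def)
  interpret M: module R M by fact
  have ker: "{x \<in> carrier M. f x = \<zero>\<^bsub>N\<^esub>} \<subseteq> {\<zero>\<^bsub>M\<^esub>}"
    by (auto intro!: inj_onD[OF inj] simp: lin_zero[OF f M N])
  show ?thesis
  proof (rule lin_inj[OF tensor_module tensor_module lin_tensor_map])
    fix x assume "x \<in> carrier (T \<boxtimes> M)" "tensor_map R T N id f x = \<zero>\<^bsub>T \<boxtimes> N\<^esub>"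
    then obtain v where "set v \<subseteq> carrier T \<times> {x \<in> carrier M. f x = \<zero>\<^bsub>N\<^esub>}" "x = tensor_class R T M v"
      using flat_kernel[OF flat M N f] by blast
    then show "x = \<zero>\<^bsub>T \<boxtimes> M\<^esub>" using class_null[OF T M, of v] ker by auto
  qed (fact T M N idT f)+
qed

text \<open>The equalizer of \<open>f\<close> and \<open>g\<close> is the kernel of their
  difference, and tensoring with \<open>T\<close> commutes with taking the difference.\<close>

lemma flat_equalizer:
  fixes R (structure)
  assumes flat: "flat R T" and M: "module R M" and N: "module R N"
    and f: "linear_map R M N f" and g: "linear_map R M N g"
    and z: "z \<in> carrier (T \<boxtimes> M)" and e: "tensor_map R T N id f z = tensor_map R T N id g z"
  obtains v where "set v \<subseteq> carrier T \<times> {x \<in> carrier M. f x = g x}" "z = tensor_class R T M v"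
proof -
  have T: "module R T" using flat by (simp add: flat_def)
  have idT: "linear_map R T T id" by (simp add: linear_map_def)
  interpret G: module R "T \<boxtimes> N" by (rule tensor_module[OF T N])
  interpret N: module R N by fact
  note lf = lin_tensor_map[OF T M T N idT f] and lg = lin_tensor_map[OF T M T N idT g]
    and lm = lin_tensor_map[OF T M T N idT lin_minus[OF M N f g]]
  have "tensor_map R T N id (\<lambda>x. f x \<ominus>\<^bsub>N\<^esub> g x) z = tensor_map R T N id f z \<ominus>\<^bsub>T \<boxtimes> N\<^esub> tensor_map R T N id g z"
  proof (rule lin_tensor_ext[OF T M tensor_module[OF T N] lm lin_minus[OF tensor_module[OF T M] tensor_module[OF T N] lf lg] z])
    fix t x assume tx: "t \<in> carrier T" "x \<in> carrier M"
    have p: "tensor_map R T N id h (pure_tensor R T M t x) = pure_tensor R T N t (h x)" if "linear_map R M N h" for h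
      unfolding pure_tensor_def using tx by (subst tensor_map_class[OF T N T M idT that]) auto
    have fg: "f x \<in> carrier N" "g x \<in> carrier N" using tx lin_closed[OF f] lin_closed[OF g] by auto
    have m: "pure_tensor R T N t (a \<ominus>\<^bsub>N\<^esub> b) = pure_tensor R T N t a \<ominus>\<^bsub>T \<boxtimes> N\<^esub> pure_tensor R T N t b"
      if "a \<in> carrier N" "b \<in> carrier N" for a b
    proof -
      have "\<ominus>\<^bsub>N\<^esub> b = (\<ominus>\<^bsub>R\<^esub> \<one>\<^bsub>R\<^esub>) \<odot>\<^bsub>N\<^esub> b" using that by (simp add: N.smult_l_minus)
      then show ?thesis using that tx
        by (simp add: a_minus_def pure_add_right pure_smult_right[OF T N] G.smult_l_minus pure_closed)
    qed
    show "tensor_map R T N id (\<lambda>x. f x \<ominus>\<^bsub>N\<^esub> g x) (pure_tensor R T M t x) =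
      tensor_map R T N id f (pure_tensor R T M t x) \<ominus>\<^bsub>T \<boxtimes> N\<^esub> tensor_map R T N id g (pure_tensor R T M t x)"
      by (simp add: p f g lin_minus[OF M N f g] m fg)
  qed
  also have "\<dots> = \<zero>\<^bsub>T \<boxtimes> N\<^esub>" using e lin_closed[OF lf z] lin_closed[OF lg z] minus_zero_iff[OF tensor_module[OF T N]] by simp
  finally obtain v where v: "set v \<subseteq> carrier T \<times> {x \<in> carrier M. f x \<ominus>\<^bsub>N\<^esub> g x = \<zero>\<^bsub>N\<^esub>}" "z = tensor_class R T M v"
    using flat_kernel[OF flat M N lin_minus[OF M N f g] z] by blast
  have "{x \<in> carrier M. f x \<ominus>\<^bsub>N\<^esub> g x = \<zero>\<^bsub>N\<^esub>} = {x \<in> carrier M. f x = g x}"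
    using minus_zero_iff[OF N lin_closed[OF f] lin_closed[OF g]] by auto
  then show ?thesis using v by (intro that) auto
qed

text \<open>A tensor whose entries lie in the images of \<open>f\<close> and \<open>g\<close> is
  lifted by choosing preimages entry by entry in a representing list.\<close>

lemma class_image:
  fixes R (structure)
  assumes "module R M" "module R N" "module R A" "module R B"
    and f: "linear_map R A M f" and g: "linear_map R B N g"
    and v: "set v \<subseteq> f ` carrier A \<times> g ` carrier B"
  obtains w where "w \<in> carrier (A \<boxtimes> B)"
    "tensor_class R M N v = sw R A B (M \<boxtimes> N) (\<lambda>x y. pure_tensor R M N (f x) (g y)) w"
proof -
  let ?u = "map (\<lambda>(x, y). (inv_into (carrier A) f x, inv_into (carrier B) g y)) v"
  have u: "set ?u \<subseteq> carrier A \<times> carrier B" using v by (auto simp: inv_into_into subset_iff)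
  have "map (\<lambda>(x, y). (f x, g y)) ?u = v"
    using v by (auto intro!: map_idI simp: f_inv_into_f subset_iff)
  then have "tensor_class R M N v = tensor_map R M N f g (tensor_class R A B ?u)"
    using tensor_map_class[OF assms(1-4) f g u] by simp
  then show ?thesis
    using that[OF tensor_carrierI[OF u]] by (simp only: tensor_map_sw[OF tensor_carrierI[OF u]])
qed

lemma sw_eta2:
  fixes R (structure)
  assumes "module R M" "module R N" "module R A" "z \<in> carrier (M \<boxtimes> N)" "a \<in> carrier A"
  shows "sw R M N ((M \<boxtimes> N) \<boxtimes> A) (\<lambda>x y. pure_tensor R (M \<boxtimes> N) A (pure_tensor R M N x y) a) z =
      pure_tensor R (M \<boxtimes> N) A z a"
    and "sw R M N (A \<boxtimes> (M \<boxtimes> N)) (\<lambda>x y. pure_tensor R A (M \<boxtimes> N) a (pure_tensor R M N x y)) z =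
      pure_tensor R A (M \<boxtimes> N) a z"
  using pure_sw_left[of R M N "M \<boxtimes> N" A a "\<lambda>x y. pure_tensor R M N x y" z]
    pure_sw_right[of R M N A "M \<boxtimes> N" a "\<lambda>x y. pure_tensor R M N x y" z] assms
  by (simp_all add: sw_typ sw_eta)

lemma swap_swap:
  fixes R (structure)
  assumes "module R M" "module R N" "z \<in> carrier (M \<boxtimes> N)"
  shows "sw R N M (M \<boxtimes> N) (\<lambda>y x. pure_tensor R M N x y)
    (sw R M N (N \<boxtimes> M) (\<lambda>x y. pure_tensor R N M y x) z) = z"
  using assms by (simp add: sws cong: sw_cong)

lemma flat_inj_right:
  fixes R (structure)
  assumes flat: "flat R T" and M: "module R M" and N: "module R N" and f: "linear_map R M N f"
    and inj: "inj_on f (carrier M)"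
  shows "inj_on (sw R T M (T \<boxtimes> N) (\<lambda>t m. pure_tensor R T N t (f m))) (carrier (T \<boxtimes> M))"
  using flat_inj[OF assms] by (auto simp: inj_on_def tensor_map_sw)

text \<open>Flatness is formulated with \<open>T\<close> as the left factor; conjugating with the
  flip carries it to the right factor.\<close>

lemma flat_inj_left:
  fixes R (structure)
  assumes flat: "flat R T" and M: "module R M" and N: "module R N" and f: "linear_map R M N f"
    and inj: "inj_on f (carrier M)"
  shows "inj_on (sw R M T (N \<boxtimes> T) (\<lambda>m t. pure_tensor R N T (f m) t)) (carrier (M \<boxtimes> T))"
proof (rule inj_onI)
  fix x y assume x: "x \<in> carrier (M \<boxtimes> T)" and y: "y \<in> carrier (M \<boxtimes> T)"
    and e: "sw R M T (N \<boxtimes> T) (\<lambda>m t. pure_tensor R N T (f m) t) x =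
      sw R M T (N \<boxtimes> T) (\<lambda>m t. pure_tensor R N T (f m) t) y"
  have T: "module R T" using flat by (simp add: flat_def)
  let ?s = "\<lambda>z. sw R M T (T \<boxtimes> M) (\<lambda>m t. pure_tensor R T M t m) z"
  have "sw R T M (T \<boxtimes> N) (\<lambda>t m. pure_tensor R T N t (f m)) (?s z) =
      sw R N T (T \<boxtimes> N) (\<lambda>n t. pure_tensor R T N t n) (sw R M T (N \<boxtimes> T) (\<lambda>m t. pure_tensor R N T (f m) t) z)"
    for z
    using T M N f by (simp add: sws lin_closed[OF f] cong: sw_cong)
  then have "?s x = ?s y"
    using inj_onD[OF flat_inj_right[OF assms], of "?s x" "?s y"] e T M N by (simp add: sws)
  from arg_cong[OF this, of "sw R T M (M \<boxtimes> T) (\<lambda>y x. pure_tensor R M T x y)"]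
  show "x = y" unfolding swap_swap[OF M T x] swap_swap[OF M T y] .
qed

text \<open>The form in which equalizers are used for descent. \<open>B\<close> maps through
  \<open>h\<close> onto a set containing the equalizer, so the answer is an element of
  \<open>T \<boxtimes> B\<close> itself and not merely a special element of
  \<open>T \<boxtimes> M\<close>.\<close>

lemma flat_equalizer_right:
  fixes R (structure)
  assumes flat: "flat R T" and M: "module R M" and N: "module R N"
    and f: "linear_map R M N f" and g: "linear_map R M N g" and B: "module R B" and h: "linear_map R B M h"
    and z: "z \<in> carrier (T \<boxtimes> M)"
    and e: "sw R T M (T \<boxtimes> N) (\<lambda>t m. pure_tensor R T N t (f m)) z =
      sw R T M (T \<boxtimes> N) (\<lambda>t m. pure_tensor R T N t (g m)) z"
    and sub: "\<And>m. m \<in> carrier M \<Longrightarrow> f m = g m \<Longrightarrow> m \<in> h ` carrier B"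
  obtains w where "w \<in> carrier (T \<boxtimes> B)" "z = sw R T B (T \<boxtimes> M) (\<lambda>t b. pure_tensor R T M t (h b)) w"
proof -
  have T: "module R T" using flat by (simp add: flat_def)
  have "tensor_map R T N id f z = tensor_map R T N id g z" using e z by (simp add: tensor_map_sw)
  then obtain v where v: "set v \<subseteq> carrier T \<times> {x \<in> carrier M. f x = g x}" "z = tensor_class R T M v"
    using flat_equalizer[OF flat M N f g z] by blast
  have "set v \<subseteq> (\<lambda>x. x) ` carrier T \<times> h ` carrier B" using v(1) sub by auto
  then show ?thesis using class_image[OF T M T B lin_id h] v(2) that by metis
qed

lemma flat_equalizer_left:
  fixes R (structure)
  assumes flat: "flat R T" and M: "module R M" and N: "module R N"
    and f: "linear_map R M N f" and g: "linear_map R M N g" and B: "module R B" and h: "linear_map R B M h"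
    and z: "z \<in> carrier (M \<boxtimes> T)"
    and e: "sw R M T (N \<boxtimes> T) (\<lambda>m t. pure_tensor R N T (f m) t) z =
      sw R M T (N \<boxtimes> T) (\<lambda>m t. pure_tensor R N T (g m) t) z"
    and sub: "\<And>m. m \<in> carrier M \<Longrightarrow> f m = g m \<Longrightarrow> m \<in> h ` carrier B"
  obtains w where "w \<in> carrier (B \<boxtimes> T)" "z = sw R B T (M \<boxtimes> T) (\<lambda>b t. pure_tensor R M T (h b) t) w"
proof -
  have T: "module R T" using flat by (simp add: flat_def)
  let ?s = "\<lambda>z. sw R M T (T \<boxtimes> M) (\<lambda>m t. pure_tensor R T M t m) z"
  have *: "sw R T M (T \<boxtimes> N) (\<lambda>t m. pure_tensor R T N t (f m)) (?s z) =
      sw R N T (T \<boxtimes> N) (\<lambda>n t. pure_tensor R T N t n) (sw R M T (N \<boxtimes> T) (\<lambda>m t. pure_tensor R N T (f m) t) z)"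
    if "linear_map R M N f" for f
    using T M N that by (simp add: sws lin_closed[OF that] cong: sw_cong)
  obtain w where w: "w \<in> carrier (T \<boxtimes> B)" "?s z = sw R T B (T \<boxtimes> M) (\<lambda>t b. pure_tensor R T M t (h b)) w"
    using flat_equalizer_right[OF flat M N f g B h, of "?s z"] *[OF f] *[OF g] e T M sub
    by (auto simp: sws)
  have "sw R T M (M \<boxtimes> T) (\<lambda>t m. pure_tensor R M T m t) (?s z) =
     sw R B T (M \<boxtimes> T) (\<lambda>b t. pure_tensor R M T (h b) t) (sw R T B (B \<boxtimes> T) (\<lambda>t b. pure_tensor R B T b t) w)"
    unfolding w(2) using T M B h by (simp add: sws lin_closed[OF h] cong: sw_cong)
  then show ?thesis using that[of "sw R T B (B \<boxtimes> T) (\<lambda>t b. pure_tensor R B T b t) w"] swap_swap[OF M T z] T M B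
    by (simp add: sws)
qed

text \<open>Exactness for \<open>X \<boxtimes> Y\<close> is exactness for \<open>X\<close> applied
  to a sequence already tensored with \<open>Y\<close>, carried across by associativity.
  \<open>Y \<boxtimes> M\<close> does not live on the test type, so \<open>X\<close> enters through
  \<open>flat_kernel\<close>. The purpose is flatness of the tensor powers of
  \<open>T\<close>.\<close>

lemma flat_tensor:
  fixes R (structure)
  assumes X: "flat R X" and Y: "flat R (Y :: ('k, 'y, 'n) module_scheme)"
  shows "flat R (X \<boxtimes> Y)"
proof -
  have mX: "module R X" and mY: "module R Y" using X Y by (auto simp: flat_def)
  show ?thesis unfolding flat_def
  proof (intro conjI allI impI)
    show "module R (X \<boxtimes> Y)" by (rule tensor_module[OF mX mY])
    fix M' M M'' :: "'k test_module" and f g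
    assume *: "module R M' \<and> module R M \<and> module R M'' \<and> linear_map R M' M f \<and> linear_map R M M'' g \<and>
      exact_at (carrier M') M M'' f g"
    then have m: "module R M'" "module R M" "module R M''" and f: "linear_map R M' M f"
      and g: "linear_map R M M'' g" by auto
    note cl = lin_closed[OF f] lin_closed[OF g]
    have e: "exact_at (carrier (Y \<boxtimes> M')) (Y \<boxtimes> M) (Y \<boxtimes> M'') (tensor_map R Y M id f) (tensor_map R Y M'' id g)"
      using * Y unfolding flat_def by blast
    have idX: "linear_map R X X id" and idY: "linear_map R Y Y id" and idXY: "linear_map R (X \<boxtimes> Y) (X \<boxtimes> Y) id"
      by (auto simp: linear_map_def)
    note lin_f = lin_tensor_map[OF mY m(1) mY m(2) idY f] and lin_g = lin_tensor_map[OF mY m(2) mY m(3) idY g]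
    let ?XY = "X \<boxtimes> Y"
    let ?F = "tensor_map R ?XY M id f" and ?G = "tensor_map R ?XY M'' id g"
    have gf: "g (f x) = \<zero>\<^bsub>M''\<^esub>" if "x \<in> carrier M'" for x
      using * that cl by (auto simp: exact_at_def)
    have pz: "pure_tensor R ?XY M'' u \<zero>\<^bsub>M''\<^esub> = \<zero>\<^bsub>?XY \<boxtimes> M''\<^esub>" if "u \<in> carrier ?XY" for u
      using lin_zero[OF lin_pure_right[OF tensor_module[OF mX mY] m(3) that lin_id] m(3) tensor_module[OF tensor_module[OF mX mY] m(3)]] .
    show "exact_at (carrier (?XY \<boxtimes> M')) (?XY \<boxtimes> M) (?XY \<boxtimes> M'') ?F ?G"
      unfolding exact_at_def
    proof (intro equalityI subsetI)
      fix z assume "z \<in> ?F ` carrier (?XY \<boxtimes> M')"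
      then obtain w where w: "w \<in> carrier (?XY \<boxtimes> M')" "z = ?F w" by auto
      have z: "z \<in> carrier (?XY \<boxtimes> M)"
        using w lin_closed[OF lin_tensor_map[OF tensor_module[OF mX mY] m(1) tensor_module[OF mX mY] m(2) idXY f]] by auto
      have "?G z = sw R ?XY M' (?XY \<boxtimes> M'') (\<lambda>u x. pure_tensor R ?XY M'' u (g (f x))) w"
        using g f m mX mY by (subst tensor_map_sw[OF z], simp only: w(2) tensor_map_sw[OF w(1)])
          (simp add: sws cl lin_comp[OF f g] cong: sw_cong)
      also have "\<dots> = sw R ?XY M' (?XY \<boxtimes> M'') (\<lambda>u x. \<zero>\<^bsub>?XY \<boxtimes> M''\<^esub>) w"
        using gf pz m mX mY by (simp add: sws cong: sw_cong)
      also have "\<dots> = \<zero>\<^bsub>?XY \<boxtimes> M''\<^esub>"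
        using w lsum_zero[OF tensor_module[OF tensor_module[OF mX mY] m(3)], of "tensor_rep w"] by (simp add: sw_lsum)
      finally show "z \<in> {x \<in> carrier (?XY \<boxtimes> M). ?G x = \<zero>\<^bsub>?XY \<boxtimes> M''\<^esub>}" using z by simp
    next
      fix z assume "z \<in> {x \<in> carrier (?XY \<boxtimes> M). ?G x = \<zero>\<^bsub>?XY \<boxtimes> M''\<^esub>}"
      then have z: "z \<in> carrier (?XY \<boxtimes> M)" "?G z = \<zero>\<^bsub>?XY \<boxtimes> M''\<^esub>" by auto
      have az: "assoc R X Y M z \<in> carrier (X \<boxtimes> (Y \<boxtimes> M))"
        using z m mX mY by (simp add: assoc_sw sws)
      have zz: "assoc R X Y M'' \<zero>\<^bsub>?XY \<boxtimes> M''\<^esub> = \<zero>\<^bsub>X \<boxtimes> (Y \<boxtimes> M'')\<^esub>"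
        unfolding assoc_def tensor_lift_def
        using sw_class[OF tensor_module[OF mX mY] m(3) tensor_module[OF mX tensor_module[OF mY m(3)]], of "\<lambda>u z. sw R X Y (X \<boxtimes> (Y \<boxtimes> M'')) (\<lambda>x y. pure_tensor R X (Y \<boxtimes> M'') x (pure_tensor R Y M'' y z)) u" "[]"]
          assoc_sw[OF mX mY m(3) tensor_carrierI[of "[]"]] m mX mY
        by (simp add: class_zero[symmetric] assoc_def tensor_lift_def bilinear_def sws lsum_def)
      have "tensor_map R X (Y \<boxtimes> M'') id (tensor_map R Y M'' id g) (assoc R X Y M z) = assoc R X Y M'' (?G z)"
        using z(1) az g m mX mY lin_closed[OF lin_tensor_map[OF tensor_module[OF mX mY] m(2) tensor_module[OF mX mY] m(3) idXY g] z(1)]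
          lin_g lin_closed[OF lin_g]
        by (simp add: tensor_map_sw[where A = X and B = "Y \<boxtimes> M"] tensor_map_sw[where A = ?XY and B = M]
            tensor_map_sw[where A = Y and B = M] assoc_sw sws cl cong: sw_cong)
      then have "tensor_map R X (Y \<boxtimes> M'') id (tensor_map R Y M'' id g) (assoc R X Y M z) = \<zero>\<^bsub>X \<boxtimes> (Y \<boxtimes> M'')\<^esub>"
        by (simp add: z(2) zz)
      then obtain v where v: "set v \<subseteq> carrier X \<times> {x \<in> carrier (Y \<boxtimes> M). tensor_map R Y M'' id g x = \<zero>\<^bsub>Y \<boxtimes> M''\<^esub>}"
        "assoc R X Y M z = tensor_class R X (Y \<boxtimes> M) v"
        using flat_kernel[OF X tensor_module[OF mY m(2)] tensor_module[OF mY m(3)] lin_g az] by blast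
      have "set v \<subseteq> (\<lambda>x. x) ` carrier X \<times> tensor_map R Y M id f ` carrier (Y \<boxtimes> M')"
        using v(1) e by (auto simp: exact_at_def)
      then obtain w where w: "w \<in> carrier (X \<boxtimes> (Y \<boxtimes> M'))"
        "assoc R X Y M z = sw R X (Y \<boxtimes> M') (X \<boxtimes> (Y \<boxtimes> M)) (\<lambda>x y. pure_tensor R X (Y \<boxtimes> M) x (tensor_map R Y M id f y)) w"
        using class_image[OF mX tensor_module[OF mY m(2)] mX tensor_module[OF mY m(1)] lin_id lin_f] unfolding v(2) by metis
      have "z = assoc_inv R X Y M (assoc R X Y M z)"
        using z(1) az m mX mY by (simp add: assoc_sw assoc_inv_sw sws sw_eta2 cong: sw_cong)
      also have "assoc_inv R X Y M (assoc R X Y M z) = ?F (assoc_inv R X Y M' w)"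
      proof -
        have "assoc_inv R X Y M' w \<in> carrier (?XY \<boxtimes> M')"
          using w(1) m mX mY by (simp add: assoc_inv_sw sws)
        then show ?thesis unfolding w(2) using w(1) f m mX mY lin_closed[OF lin_f] lin_f
          by (simp add: tensor_map_sw[where A = ?XY and B = M'] tensor_map_sw[where A = Y and B = M'] assoc_inv_sw sws cl cong: sw_cong)
      qed
      finally show "z \<in> ?F ` carrier (?XY \<boxtimes> M')"
        using w(1) m mX mY by (simp add: assoc_inv_sw sws)
    qed
  qed
qed

text \<open>Here faithful flatness enters beyond flatness: if all tensors
  \<open>t \<otimes> m\<close> with a generator \<open>m\<close> come from
  \<open>T \<boxtimes> K\<close>, then \<open>K\<close> is the whole span of \<open>ms\<close>. By
  \<open>Kmin\<close> the submodule \<open>K\<close> lies inside the span, so both can be coded in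
  the test type, and exactness of \<open>K \<rightarrow> span \<rightarrow> 0\<close> is read
  backwards.\<close>

lemma ff_generators:
  fixes R (structure)
  assumes ff: "faithfully_flat R T" and M: "module R M" and ms: "set ms \<subseteq> carrier M"
    and K: "submodule K R M" and Kmin: "\<And>L. submodule L R M \<Longrightarrow> set ms \<subseteq> L \<Longrightarrow> K \<subseteq> L"
    and gen: "\<And>t m. t \<in> carrier T \<Longrightarrow> m \<in> set ms \<Longrightarrow>
      \<exists>v. set v \<subseteq> carrier T \<times> K \<and> pure_tensor R T M t m = tensor_class R T M v"
  shows "set ms \<subseteq> K"
proof -
  have T: "module R T" and flat: "flat R T" using ff by (auto simp: faithfully_flat_def flat_def)
  have idT: "linear_map R T T id" by (simp add: linear_map_def)
  interpret M: module R M by fact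
  obtain K1 and j :: "'d \<Rightarrow> (nat \<Rightarrow> 'a) set" where K1: "submodule K1 R M" "set ms \<subseteq> K1"
    and j: "inj_on j K1" and K1min: "\<And>L. submodule L R M \<Longrightarrow> set ms \<subseteq> L \<Longrightarrow> K1 \<subseteq> L"
    using span_embedding[OF M ms] by metis
  have KK: "K \<subseteq> K1" by (rule Kmin[OF K1])
  note K1M = M.submoduleE(1)[OF K1(1)]
  define N where "N = M\<lparr>carrier := K1\<rparr>"
  have N: "module R N" using submodule_module[OF K1(1) M] by (simp add: N_def)
  have jN: "inj_on j (carrier N)" using j by (simp add: N_def)
  define Q where "Q = transport N j"
  note Q = transport_module[OF N jN, folded Q_def]
  have KM: "module R (M\<lparr>carrier := K\<rparr>)" by (rule submodule_module[OF K M])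
  have jK: "inj_on j (carrier (M\<lparr>carrier := K\<rparr>))" using inj_on_subset[OF j KK] by simp
  have incl: "linear_map R N M (\<lambda>x. x)" using K1M by (auto simp: linear_map_def N_def)
  define Q1 where "Q1 = transport (M\<lparr>carrier := K\<rparr>) j"
  note Q1 = transport_module[OF KM jK, folded Q1_def]
  define f where "f X = j (inv_into K j X)" for X
  have f: "linear_map R Q1 Q f"
  proof -
    have "linear_map R (M\<lparr>carrier := K\<rparr>) N (\<lambda>x. x)" using KK by (auto simp: linear_map_def N_def)
    from lin_comp[OF lin_comp[OF Q1(3) this] Q(2)] show ?thesis by (simp add: f_def[abs_def])
  qed
  have fim: "f ` carrier Q1 = j ` K"
    using inv_into_f_f[OF inj_on_subset[OF j KK]]
    by (simp add: f_def[abs_def] Q1_def transport_def Let_def image_image cong: image_cong)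
  interpret Q: module R Q by (rule Q(1))
  \<comment> \<open>The zero module, realised on the test type: the third term of the
    sequence.\<close>
  define Z where "Z = Q\<lparr>carrier := {\<zero>\<^bsub>Q\<^esub>}\<rparr>"
  have "{x \<in> carrier Q. x = \<zero>\<^bsub>Q\<^esub>} = {\<zero>\<^bsub>Q\<^esub>}" by auto
  then have "submodule {\<zero>\<^bsub>Q\<^esub>} R Q"
    using equalizer_submodule[OF Q(1) Q(1) lin_id lin_zero_map[OF Q(1) Q(1)]] by simp
  then have Z: "module R Z" unfolding Z_def using submodule_module Q(1) by blast
  have zZ: "\<zero>\<^bsub>Z\<^esub> = \<zero>\<^bsub>Q\<^esub>" by (simp add: Z_def)
  have g: "linear_map R Q Z (\<lambda>_. \<zero>\<^bsub>Q\<^esub>)" using lin_zero_map[OF Q(1) Z] by (simp add: zZ)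
  have iff: "exact_at (carrier Q1) Q Z f (\<lambda>_. \<zero>\<^bsub>Q\<^esub>) \<longleftrightarrow>
      exact_at (carrier (T \<boxtimes> Q1)) (T \<boxtimes> Q) (T \<boxtimes> Z) (tensor_map R T Q id f) (tensor_map R T Z id (\<lambda>_. \<zero>\<^bsub>Q\<^esub>))"
    using ff Q1(1) Q(1) Z f g unfolding faithfully_flat_def by blast
  have gz: "tensor_map R T Z id (\<lambda>_. \<zero>\<^bsub>Q\<^esub>) x = \<zero>\<^bsub>T \<boxtimes> Z\<^esub>" if x: "x \<in> carrier (T \<boxtimes> Q)" for x
  proof -
    obtain u where u: "set u \<subseteq> carrier T \<times> carrier Q" "x = tensor_class R T Q u" using x by (rule tensor_carrierE)
    have "set (map (\<lambda>(x, y). (id x, \<zero>\<^bsub>Q\<^esub>)) u) \<subseteq> carrier T \<times> {\<zero>\<^bsub>Z\<^esub>}" using u(1) by (auto simp: zZ)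
    then show ?thesis
      unfolding u(2) tensor_map_class[OF T Z T Q(1) idT g u(1)] by (rule class_null[OF T Z])
  qed
  let ?Im = "tensor_map R T Q id f ` carrier (T \<boxtimes> Q1)"
  have lf: "linear_map R (T \<boxtimes> Q1) (T \<boxtimes> Q) (tensor_map R T Q id f)"
    by (rule lin_tensor_map[OF T Q1(1) T Q(1) idT f])
  interpret TQ1: module R "T \<boxtimes> Q1" by (rule tensor_module[OF T Q1(1)])
  interpret TQ: module R "T \<boxtimes> Q" by (rule tensor_module[OF T Q(1)])
  have imadd: "x \<oplus>\<^bsub>T \<boxtimes> Q\<^esub> y \<in> ?Im" if "x \<in> ?Im" "y \<in> ?Im" for x y
    using that by (auto simp: lin_add[OF lf, symmetric])
  have imsm: "c \<odot>\<^bsub>T \<boxtimes> Q\<^esub> x \<in> ?Im" if "x \<in> ?Im" "c \<in> carrier R" for x c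
    using that by (auto simp: lin_smult[OF lf, symmetric])
  have imz: "\<zero>\<^bsub>T \<boxtimes> Q\<^esub> \<in> ?Im"
    by (rule image_eqI[of _ _ "\<zero>\<^bsub>T \<boxtimes> Q1\<^esub>"]) (simp_all add: lin_zero[OF lf tensor_module[OF T Q1(1)] tensor_module[OF T Q(1)]])
  \<comment> \<open>The elements of the span all of whose tensors are images form a submodule. It is
    therefore enough to put the generators into it.\<close>
  define L where "L = {m \<in> K1. \<forall>t\<in>carrier T. pure_tensor R T Q t (j m) \<in> ?Im}"
  have jadd: "j (x \<oplus>\<^bsub>M\<^esub> y) = j x \<oplus>\<^bsub>Q\<^esub> j y" if "x \<in> K1" "y \<in> K1" for x y
    using lin_add[OF Q(2), of x y] that by (simp add: N_def)
  have jsm: "j (c \<odot>\<^bsub>M\<^esub> x) = c \<odot>\<^bsub>Q\<^esub> j x" if "x \<in> K1" "c \<in> carrier R" for x c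
    using lin_smult[OF Q(2), of c x] that by (simp add: N_def)
  have jcl: "j x \<in> carrier Q" if "x \<in> K1" for x using lin_closed[OF Q(2), of x] that by (simp add: N_def)
  have LM: "submodule L R M"
  proof (rule M.submoduleI)
    show "L \<subseteq> carrier M" using K1M by (auto simp: L_def)
    have z: "\<zero>\<^bsub>M\<^esub> \<in> K1" using submodule.axioms(1)[OF K1(1)] by (auto dest: subgroup.one_closed)
    have "j \<zero>\<^bsub>M\<^esub> = \<zero>\<^bsub>Q\<^esub>" by (simp add: Q_def transport_def Let_def N_def)
    then show "\<zero>\<^bsub>M\<^esub> \<in> L" using z imz lin_zero[OF lin_pure_right[OF T Q(1) _ lin_id] Q(1) tensor_module[OF T Q(1)]]
      by (simp add: L_def)
    have sm: "c \<odot>\<^bsub>M\<^esub> x \<in> L" if "c \<in> carrier R" "x \<in> L" for c x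
      using that imsm M.submoduleE(4)[OF K1(1)] by (auto simp: L_def jsm pure_smult_right[OF T Q(1)] jcl)
    show "c \<odot>\<^bsub>M\<^esub> x \<in> L" if "c \<in> carrier R" "x \<in> L" for c x using sm that .
    show "\<ominus>\<^bsub>M\<^esub> x \<in> L" if "x \<in> L" for x
      using sm[OF _ that, of "\<ominus>\<^bsub>R\<^esub> \<one>\<^bsub>R\<^esub>"] that K1M by (auto simp: L_def M.smult_l_minus subset_iff)
    show "x \<oplus>\<^bsub>M\<^esub> y \<in> L" if "x \<in> L" "y \<in> L" for x y
      using that imadd M.submoduleE(5)[OF K1(1)] by (auto simp: L_def jadd pure_add_right jcl)
  qed
  have "set ms \<subseteq> L"
  proof
    fix m assume m: "m \<in> set ms"
    have mK: "m \<in> K1" using m K1(2) by auto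
    have "pure_tensor R T Q t (j m) \<in> ?Im" if t: "t \<in> carrier T" for t
    proof -
      obtain v where v: "set v \<subseteq> carrier T \<times> K" "pure_tensor R T M t m = tensor_class R T M v"
        using gen[OF t m] by blast
      have vN: "set v \<subseteq> carrier T \<times> carrier N" using v(1) KK by (auto simp: N_def)
      have tN: "set [(t, m)] \<subseteq> carrier T \<times> carrier N" using t mK by (auto simp: N_def)
      have i: "tensor_map R T M id (\<lambda>x. x) (tensor_class R T N u) = tensor_class R T M u"
        if "set u \<subseteq> carrier T \<times> carrier N" for u
        by (simp add: tensor_map_class[OF T M T N idT incl that] split_def)
      have inj: "inj_on (\<lambda>x. x) (carrier N)" by simp
      \<comment> \<open>The hypothesis \<open>gen\<close> compares tensors over \<open>M\<close>;
        flatness of \<open>T\<close> brings the equation down to the span, where the coding is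
        available.\<close>
      have "tensor_class R T N [(t, m)] = tensor_class R T N v"
        using inj_onD[OF flat_inj[OF flat N M incl inj]] v(2) i[OF tN] i[OF vN] tensor_carrierI[OF tN] tensor_carrierI[OF vN]
        by (simp add: pure_tensor_def)
      then have "tensor_map R T Q id j (tensor_class R T N [(t, m)]) = tensor_map R T Q id j (tensor_class R T N v)" by simp
      then have e: "pure_tensor R T Q t (j m) = tensor_class R T Q (map (\<lambda>(x, y). (id x, j y)) v)"
        by (simp add: tensor_map_class[OF T Q(1) T N idT Q(2) tN] tensor_map_class[OF T Q(1) T N idT Q(2) vN] pure_tensor_def)
      have v1: "set (map (\<lambda>(x, y). (id x, j y)) v) \<subseteq> carrier T \<times> carrier Q1"
        using v(1) by (auto simp: Q1_def transport_def Let_def)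
      have fj: "f (j x) = j x" if "x \<in> K" for x using that inj_on_subset[OF j KK] by (simp add: f_def)
      have "tensor_map R T Q id f (tensor_class R T Q1 (map (\<lambda>(x, y). (id x, j y)) v)) = pure_tensor R T Q t (j m)"
        unfolding tensor_map_class[OF T Q(1) T Q1(1) idT f v1] e
        using v(1) by (intro arg_cong[where f = "tensor_class R T Q"]) (auto simp: fj)
      then show ?thesis by (rule image_eqI[OF HOL.sym tensor_carrierI[OF v1]])
    qed
    then show "m \<in> L" using mK by (simp add: L_def)
  qed
  then have KL: "K1 \<subseteq> L" using K1min[OF LM] by simp
  have "x \<in> ?Im" if "x \<in> carrier (T \<boxtimes> Q)" for x
    using that
  proof (induction rule: class_induct)
    case zero
    then show ?case by (rule imz)
  next
    case (pure t q w)
    then have "pure_tensor R T Q t q \<in> ?Im" using KL by (auto simp: L_def Q_def transport_def Let_def N_def)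
    then show ?case using imadd pure by blast
  qed
  then have "carrier (T \<boxtimes> Q) \<subseteq> ?Im" by blast
  moreover have "?Im \<subseteq> carrier (T \<boxtimes> Q)" using lin_closed[OF lf] by blast
  ultimately have "?Im = {x \<in> carrier (T \<boxtimes> Q). tensor_map R T Z id (\<lambda>_. \<zero>\<^bsub>Q\<^esub>) x = \<zero>\<^bsub>T \<boxtimes> Z\<^esub>}"
    using gz by blast
  then have "exact_at (carrier Q1) Q Z f (\<lambda>_. \<zero>\<^bsub>Q\<^esub>)"
    unfolding iff unfolding exact_at_def .
  then have "j ` K = j ` K1"
    unfolding exact_at_def fim by (simp add: zZ) (simp add: Q_def transport_def Let_def N_def)
  then have "K = K1" using j KK by (simp add: inj_on_image_eq_iff)
  then show ?thesis using K1(2) by simp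
qed

section \<open>Algebras\<close>

text \<open>Records the bilinear part of an algebra structure together with its unit. This passes to
  opposite algebras and to tensor products at once and supplies the rewrite rules for products;
  associativity is invoked separately where it is used.\<close>

definition bimult :: "'k ring \<Rightarrow> ('k, 'a, 'm) module_scheme \<Rightarrow> bool" where
  "bimult R A \<longleftrightarrow> module R A \<and> \<one>\<^bsub>A\<^esub> \<in> carrier A \<and> bilinear R A A A (\<lambda>x y. x \<otimes>\<^bsub>A\<^esub> y)"

lemma bimult_module: "bimult R A \<Longrightarrow> module R A" by (simp add: bimult_def)

lemma bimult_closed: "bimult R A \<Longrightarrow> x \<in> carrier A \<Longrightarrow> y \<in> carrier A \<Longrightarrow> x \<otimes>\<^bsub>A\<^esub> y \<in> carrier A"
  by (auto simp: bimult_def dest: bilinear_closed)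

lemma bimult_one: "bimult R A \<Longrightarrow> \<one>\<^bsub>A\<^esub> \<in> carrier A" by (simp add: bimult_def)

lemma assoc_algebra_bimult:
  assumes "assoc_algebra R A"
  shows "bimult R A"
proof -
  interpret assoc_algebra R A by fact
  show ?thesis unfolding bimult_def bilinear_def linear_map_def
    by (auto simp: A.l_distr A.r_distr smult_mult_left smult_mult_right module_axioms)
qed

lemma lin_mult_left: "bimult R A \<Longrightarrow> c \<in> carrier A \<Longrightarrow> linear_map R B A f \<Longrightarrow> linear_map R B A (\<lambda>x. f x \<otimes>\<^bsub>A\<^esub> c)"
  by (rule lin_comp) (auto simp: bimult_def bilinear_def)

lemma lin_mult_right: "bimult R A \<Longrightarrow> c \<in> carrier A \<Longrightarrow> linear_map R B A f \<Longrightarrow> linear_map R B A (\<lambda>x. c \<otimes>\<^bsub>A\<^esub> f x)"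
  by (rule lin_comp[where g = "\<lambda>y. c \<otimes>\<^bsub>A\<^esub> y"]) (auto simp: bimult_def bilinear_def)

lemma lin_smult_right:
  assumes "module R A" "c \<in> carrier R" "linear_map R B A f"
  shows "linear_map R B A (\<lambda>x. c \<odot>\<^bsub>A\<^esub> f x)"
proof -
  interpret A: module R A by fact
  have "linear_map R A A (\<lambda>x. c \<odot>\<^bsub>A\<^esub> x)"
    using assms(2) by (auto simp: linear_map_def A.smult_r_distr A.smult_assoc1[symmetric] A.R.m_comm)
  from lin_comp[OF assms(3) this] show ?thesis .
qed

lemma mult_sw_left:
  assumes "bimult R A" "module R M" "module R N" "c \<in> carrier A"
    and "\<And>x y. x \<in> carrier M \<Longrightarrow> y \<in> carrier N \<Longrightarrow> f x y \<in> carrier A"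
  shows "sw R M N A f z \<otimes>\<^bsub>A\<^esub> c = sw R M N A (\<lambda>x y. f x y \<otimes>\<^bsub>A\<^esub> c) z"
  by (rule lin_sw_apply[where g = "\<lambda>x. x \<otimes>\<^bsub>A\<^esub> c"]) (auto simp: assms bimult_module intro!: lin_mult_left lin_id)

lemma mult_sw_right:
  assumes "bimult R A" "module R M" "module R N" "c \<in> carrier A"
    and "\<And>x y. x \<in> carrier M \<Longrightarrow> y \<in> carrier N \<Longrightarrow> f x y \<in> carrier A"
  shows "c \<otimes>\<^bsub>A\<^esub> sw R M N A f z = sw R M N A (\<lambda>x y. c \<otimes>\<^bsub>A\<^esub> f x y) z"
  by (rule lin_sw_apply[where g = "\<lambda>x. c \<otimes>\<^bsub>A\<^esub> x"]) (auto simp: assms bimult_module intro!: lin_mult_right lin_id)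

lemma smult_sw:
  assumes "module R A" "module R M" "module R N" "c \<in> carrier R"
    and "\<And>x y. x \<in> carrier M \<Longrightarrow> y \<in> carrier N \<Longrightarrow> f x y \<in> carrier A"
  shows "c \<odot>\<^bsub>A\<^esub> sw R M N A f z = sw R M N A (\<lambda>x y. c \<odot>\<^bsub>A\<^esub> f x y) z"
  by (rule lin_sw_apply[where g = "\<lambda>x. c \<odot>\<^bsub>A\<^esub> x"]) (auto simp: assms intro!: lin_smult_right lin_id)

lemma mult_smult:
  assumes "bimult R A" "c \<in> carrier R" "x \<in> carrier A" "y \<in> carrier A"
  shows "(c \<odot>\<^bsub>A\<^esub> x) \<otimes>\<^bsub>A\<^esub> y = c \<odot>\<^bsub>A\<^esub> (x \<otimes>\<^bsub>A\<^esub> y)" "x \<otimes>\<^bsub>A\<^esub> (c \<odot>\<^bsub>A\<^esub> y) = c \<odot>\<^bsub>A\<^esub> (x \<otimes>\<^bsub>A\<^esub> y)"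
  using lin_smult[OF lin_mult_left[OF assms(1,4) lin_id] assms(2,3)]
    lin_smult[OF lin_mult_right[OF assms(1,3) lin_id] assms(2,4)] by simp_all

text \<open>The product of tensors is defined from chosen lists. As a double Sweedler sum it no
  longer depends on the choice, and the general rules for sums apply to it.\<close>

lemma tensor_mult:
  fixes R (structure)
  assumes A: "bimult R A" and B: "bimult R B" and X: "X \<in> carrier (A \<boxtimes> B)" and Y: "Y \<in> carrier (A \<boxtimes> B)"
  shows "X \<otimes>\<^bsub>A \<boxtimes> B\<^esub> Y = sw R A B (A \<boxtimes> B) (\<lambda>x y. sw R A B (A \<boxtimes> B)
    (\<lambda>x' y'. pure_tensor R A B (x \<otimes>\<^bsub>A\<^esub> x') (y \<otimes>\<^bsub>B\<^esub> y')) Y) X"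
proof -
  note m = bimult_module[OF A] bimult_module[OF B]
  have AB: "module R (A \<boxtimes> B)" by (rule tensor_module[OF m])
  have 1: "lsum (A \<boxtimes> B) (\<lambda>x' y'. pure_tensor R A B (x \<otimes>\<^bsub>A\<^esub> x') (y \<otimes>\<^bsub>B\<^esub> y')) v =
      tensor_class R A B (map (\<lambda>(x', y'). (x \<otimes>\<^bsub>A\<^esub> x', y \<otimes>\<^bsub>B\<^esub> y')) v)"
    if "set v \<subseteq> carrier A \<times> carrier B" "x \<in> carrier A" "y \<in> carrier B" for v x y
    using that
  proof (induction v)
    case (Cons p v)
    then show ?case
      by (cases p, simp, subst class_Cons)
        (auto simp: lsum_Cons[OF AB] subset_iff bimult_closed[OF A] bimult_closed[OF B])
  qed (simp add: lsum_Nil[OF AB] class_zero)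
  have 2: "lsum (A \<boxtimes> B) (\<lambda>x y. tensor_class R A B (map (\<lambda>(x', y'). (x \<otimes>\<^bsub>A\<^esub> x', y \<otimes>\<^bsub>B\<^esub> y')) v)) u =
      tensor_class R A B [(x \<otimes>\<^bsub>A\<^esub> x', y \<otimes>\<^bsub>B\<^esub> y'). (x, y) \<leftarrow> u, (x', y') \<leftarrow> v]"
    if "set v \<subseteq> carrier A \<times> carrier B" "set u \<subseteq> carrier A \<times> carrier B" for u v
    using that
  proof (induction u)
    case (Cons p u)
    have "set (concat (map (\<lambda>(x, y). map (\<lambda>(x', y'). (x \<otimes>\<^bsub>A\<^esub> x', y \<otimes>\<^bsub>B\<^esub> y')) v) w)) \<subseteq> carrier A \<times> carrier B"
      if "set w \<subseteq> carrier A \<times> carrier B" for w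
      using that Cons.prems by (fastforce simp: bimult_closed[OF A] bimult_closed[OF B])
    from this[of u] this[of "[p]"] show ?case using Cons
      by (cases p) (simp add: lsum_Cons[OF AB] class_add)
  qed (simp add: lsum_Nil[OF AB] class_zero)
  have "sw R A B (A \<boxtimes> B) (\<lambda>x y. sw R A B (A \<boxtimes> B)
    (\<lambda>x' y'. pure_tensor R A B (x \<otimes>\<^bsub>A\<^esub> x') (y \<otimes>\<^bsub>B\<^esub> y')) Y) X =
    lsum (A \<boxtimes> B) (\<lambda>x y. tensor_class R A B (map (\<lambda>(x', y'). (x \<otimes>\<^bsub>A\<^esub> x', y \<otimes>\<^bsub>B\<^esub> y')) (tensor_rep Y))) (tensor_rep X)"
    using tensor_rep_set[OF m X] tensor_rep_set[OF m Y] X Y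
    by (auto simp: sw_lsum 1 intro!: lsum_cong[OF AB])
  then show ?thesis using 2[OF tensor_rep_set[OF m Y] tensor_rep_set[OF m X]] by (simp add: tensor_def)
qed

lemma tensor_bimult:
  fixes R (structure)
  assumes A: "bimult R A" and B: "bimult R B"
  shows "bimult R (A \<boxtimes> B)"
proof -
  note m = bimult_module[OF A] bimult_module[OF B]
  have 1: "linear_map R (A \<boxtimes> B) (A \<boxtimes> B) (\<lambda>X. X \<otimes>\<^bsub>A \<boxtimes> B\<^esub> Y)" if Y: "Y \<in> carrier (A \<boxtimes> B)" for Y
  proof -
    have "linear_map R (A \<boxtimes> B) (A \<boxtimes> B) (\<lambda>X. sw R A B (A \<boxtimes> B) (\<lambda>x y. sw R A B (A \<boxtimes> B)
      (\<lambda>x' y'. pure_tensor R A B (x \<otimes>\<^bsub>A\<^esub> x') (y \<otimes>\<^bsub>B\<^esub> y')) Y) X)"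
      using A B by (simp add: sws bimult_module lin_mult_left lin_mult_right bimult_closed)
    then show ?thesis by (subst lin_cong[OF tensor_mult[OF A B _ Y] tensor_module[OF m]])
  qed
  have 2: "linear_map R (A \<boxtimes> B) (A \<boxtimes> B) (\<lambda>Y. X \<otimes>\<^bsub>A \<boxtimes> B\<^esub> Y)" if X: "X \<in> carrier (A \<boxtimes> B)" for X
  proof -
    have "linear_map R (A \<boxtimes> B) (A \<boxtimes> B) (\<lambda>Y. sw R A B (A \<boxtimes> B) (\<lambda>x y. sw R A B (A \<boxtimes> B)
      (\<lambda>x' y'. pure_tensor R A B (x \<otimes>\<^bsub>A\<^esub> x') (y \<otimes>\<^bsub>B\<^esub> y')) Y) X)"
      using A B by (simp add: sws bimult_module lin_mult_left lin_mult_right bimult_closed)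
    then show ?thesis by (subst lin_cong[OF tensor_mult[OF A B X] tensor_module[OF m]])
  qed
  have "\<one>\<^bsub>A \<boxtimes> B\<^esub> \<in> carrier (A \<boxtimes> B)"
    using pure_closed[OF bimult_one[OF A] bimult_one[OF B]] by (simp add: tensor_def pure_tensor_def)
  then show ?thesis unfolding bimult_def bilinear_def using 1 2 tensor_module[OF m] by blast
qed

lemma tensor_one: "\<one>\<^bsub>A \<boxtimes>\<^bsub>R\<^esub> B\<^esub> = pure_tensor R A B \<one>\<^bsub>A\<^esub> \<one>\<^bsub>B\<^esub>"
  by (simp add: tensor_def pure_tensor_def)

lemma opp_simps: "carrier (opp A) = carrier A" "add (opp A) = add A" "\<zero>\<^bsub>opp A\<^esub> = \<zero>\<^bsub>A\<^esub>"
  "smult (opp A) = smult A" "\<one>\<^bsub>opp A\<^esub> = \<one>\<^bsub>A\<^esub>" "x \<otimes>\<^bsub>opp A\<^esub> y = y \<otimes>\<^bsub>A\<^esub> x"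
  by (simp_all add: opp_def)

section \<open>Independence of the multiplication\<close>

text \<open>
  Tensor products only depend on the module structures of their factors, so that \<open>opp T\<close> may
  be replaced by \<open>T\<close> wherever no multiplication is involved.
\<close>

definition same :: "('k, 'a, 'm) module_scheme \<Rightarrow> ('k, 'a, 'n) module_scheme \<Rightarrow> bool" where
  "same M M' \<longleftrightarrow> carrier M = carrier M' \<and> add M = add M' \<and> \<zero>\<^bsub>M\<^esub> = \<zero>\<^bsub>M'\<^esub> \<and> smult M = smult M'"

lemma same_refl: "same M M" by (simp add: same_def)

lemma same_sym: "same M M' \<Longrightarrow> same M' M" by (simp add: same_def)

lemma same_opp: "same (opp A) A" by (simp add: same_def opp_simps)

lemma same_module: "same M M' \<Longrightarrow> module R M \<Longrightarrow> module R M'"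
proof -
  assume s: "same M M'" and M: "module R M"
  interpret M: module R M by fact
  have [simp]: "carrier M' = carrier M" "add M' = add M" "\<zero>\<^bsub>M'\<^esub> = \<zero>\<^bsub>M\<^esub>" "smult M' = smult M"
    using s by (simp_all add: same_def)
  have "abelian_group M'"
    by (rule abelian_groupI) (auto simp: M.M.a_ac intro: bexI[of _ "\<ominus>\<^bsub>M\<^esub> x" for x] M.M.l_neg)
  then show ?thesis
    by (intro moduleI M.R.is_cring) (auto simp: M.smult_l_distr M.smult_r_distr M.smult_assoc1)
qed

lemma same_tensor_eq:
  assumes "tensor_eq R M N u v" "same M M'" "same N N'"
  shows "tensor_eq R M' N' u v"
proof -
  have s: "carrier M = carrier M'" "add M = add M'" "\<zero>\<^bsub>M\<^esub> = \<zero>\<^bsub>M'\<^esub>" "smult M = smult M'"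
    "carrier N = carrier N'" "add N = add N'" "\<zero>\<^bsub>N\<^esub> = \<zero>\<^bsub>N'\<^esub>" "smult N = smult N'"
    using assms(2,3) by (auto simp: same_def)
  show ?thesis using assms(1)
  proof induction
    case (refl u)
    then show ?case by (intro tensor_eq.refl) (simp add: s)
  next
    case (sym u v)
    show ?case by (rule tensor_eq.sym) fact
  next
    case (trans u v w)
    show ?case by (rule tensor_eq.trans) fact+
  next
    case (append u u' v v')
    show ?case by (rule tensor_eq.append) fact+
  next
    case (commute u v)
    then show ?case by (intro tensor_eq.commute) (simp add: s)
  next
    case (add_left x x' y)
    then show ?case using tensor_eq.add_left[of x M' x' y N' R] by (simp add: s)
  next
    case (add_right x y y')
    then show ?case using tensor_eq.add_right[of x M' y N' y' R] by (simp add: s)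
  next
    case (smult c x y)
    then show ?case using tensor_eq.smult[of c R x M' y N'] by (simp add: s)
  next
    case (zero y)
    then show ?case using tensor_eq.zero[of y N' R M'] by (simp add: s)
  qed
qed

lemma same_tensor_class:
  assumes "same M M'" "same N N'"
  shows "tensor_class R M N = tensor_class R M' N'"
  using same_tensor_eq[OF _ assms] same_tensor_eq[OF _ same_sym[OF assms(1)] same_sym[OF assms(2)]]
  unfolding tensor_class_def by blast

lemma same_tensor:
  fixes R (structure)
  assumes "same M M'" "same N N'"
  shows "same (M \<boxtimes> N) (M' \<boxtimes> N')"
  using assms same_tensor_class[OF assms, of R] by (simp add: same_def tensor_def)

lemma same_pure:
  assumes "same M M'" "same N N'"
  shows "pure_tensor R M N = pure_tensor R M' N'"
  using same_tensor_class[OF assms, of R] by (simp add: pure_tensor_def fun_eq_iff)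

lemma same_lift: "same P P' \<Longrightarrow> tensor_lift P = tensor_lift P'"
  by (simp add: same_def tensor_lift_def fun_eq_iff)

lemma same_map:
  assumes "same M M'" "same N N'"
  shows "tensor_map R M N = tensor_map R M' N'"
  by (intro ext) (simp add: tensor_map_def same_pure[OF assms] same_lift[OF same_tensor[OF assms]])

lemma same_assoc:
  assumes "same M M'" "same N N'" "same P P'"
  shows "assoc R M N P = assoc R M' N' P'"
  by (intro ext) (simp add: assoc_def
    same_lift[OF same_tensor[OF assms(1) same_tensor[OF assms(2,3)]]]
    same_pure[OF assms(1) same_tensor[OF assms(2,3)]] same_pure[OF assms(2,3)])

lemma same_assoc_inv:
  assumes "same M M'" "same N N'" "same P P'"
  shows "assoc_inv R M N P = assoc_inv R M' N' P'"
  by (intro ext) (simp add: assoc_inv_def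
    same_lift[OF same_tensor[OF same_tensor[OF assms(1,2)] assms(3)]]
    same_pure[OF same_tensor[OF assms(1,2)] assms(3)] same_pure[OF assms(1,2)])

lemma same_assoc3:
  assumes "same M M'" "same N N'" "same P P'" "same Q Q'"
  shows "assoc3 R M N P Q = assoc3 R M' N' P' Q'"
  by (intro ext) (simp add: assoc3_def
    same_map[OF assms(1) same_tensor[OF assms(2) same_tensor[OF assms(3,4)]]]
    same_assoc[OF assms(2-4)] same_assoc[OF assms(1) same_tensor[OF assms(2,3)] assms(4)])

lemma same_flip13:
  assumes "same M M'" "same N N'" "same P P'"
  shows "flip13 R M N P = flip13 R M' N' P'"
  by (intro ext) (simp add: flip13_def
    same_lift[OF same_tensor[OF assms(3) same_tensor[OF assms(2,1)]]]
    same_pure[OF assms(3) same_tensor[OF assms(2,1)]] same_pure[OF assms(2,1)])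

lemma same_linear: "same M M' \<Longrightarrow> same N N' \<Longrightarrow> linear_map R M N f = linear_map R M' N' f"
  by (simp add: same_def linear_map_def)

lemma same_carrier: "same M M' \<Longrightarrow> carrier M = carrier M'"
  by (simp add: same_def)

lemmas same_rules = same_refl same_opp same_tensor

lemma opp_bimult: "bimult R A \<Longrightarrow> bimult R (opp A)"
  using same_module[OF same_sym[OF same_opp], of R A]
  by (auto simp: bimult_def bilinear_def opp_simps same_linear[OF same_opp same_opp, of R A A])

section \<open>Descent along a faithfully flat algebra\<close>

lemma ff_flat: "faithfully_flat R T \<Longrightarrow> flat R T"
  by (auto simp: faithfully_flat_def flat_def)

lemma submodule_zero: "submodule L R M \<Longrightarrow> \<zero>\<^bsub>M\<^esub> \<in> L"
  using subgroup.one_closed[OF submodule.axioms(1), of L R M] by simp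

lemma zero_submodule: "module (R :: 'k ring) M \<Longrightarrow> submodule {\<zero>\<^bsub>M\<^esub>} R M"
proof -
  assume M: "module R M"
  interpret M: module R M by fact
  have "{x \<in> carrier M. x = \<zero>\<^bsub>M\<^esub>} = {\<zero>\<^bsub>M\<^esub>}" by auto
  then show ?thesis using equalizer_submodule[OF M M lin_id lin_zero_map[OF M M]] by simp
qed

context
  fixes R :: "'k ring" (structure) and T :: "('k, 'a, 'm) module_scheme"
  assumes T: "assoc_algebra R T" and ff: "faithfully_flat R T"
begin

interpretation T: assoc_algebra R T by (rule T)

text \<open>Multiplying the left factor by \<open>t\<close> turns \<open>1 \<otimes> m = 0\<close>
  into \<open>t \<otimes> m = 0\<close> for every \<open>t\<close>, so \<open>ff_generators\<close>
  applies to the zero submodule and yields \<open>m = 0\<close>.\<close>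

lemma ff_one_right:
  assumes M: "module R M" and m: "m \<in> carrier M" "m' \<in> carrier M"
    and e: "pure_tensor R T M \<one>\<^bsub>T\<^esub> m = pure_tensor R T M \<one>\<^bsub>T\<^esub> m'"
  shows "m = m'"
proof -
  have b: "bimult R T" by (rule assoc_algebra_bimult[OF T])
  interpret M: module R M by fact
  interpret TM: module R "T \<boxtimes> M" by (rule tensor_module[OF T.module_axioms M])
  have inj: "inj_on (\<lambda>m. pure_tensor R T M \<one>\<^bsub>T\<^esub> m) (carrier M)"
  proof (rule lin_inj[OF M TM.module_axioms lin_pure_right[OF T.module_axioms M T.A.one_closed lin_id]])
    fix m assume m: "m \<in> carrier M" "pure_tensor R T M \<one>\<^bsub>T\<^esub> m = \<zero>\<^bsub>T \<boxtimes> M\<^esub>"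
    have "pure_tensor R T M t m = \<zero>\<^bsub>T \<boxtimes> M\<^esub>" if t: "t \<in> carrier T" for t
    proof -
      have "linear_map R (T \<boxtimes> M) (T \<boxtimes> M) (\<lambda>z. sw R T M (T \<boxtimes> M) (\<lambda>s m. pure_tensor R T M (t \<otimes>\<^bsub>T\<^esub> s) m) z)"
        using t b M T.module_axioms by (simp add: sws lin_mult_left lin_mult_right)
      from lin_zero[OF this TM.module_axioms TM.module_axioms]
      have "sw R T M (T \<boxtimes> M) (\<lambda>s m. pure_tensor R T M (t \<otimes>\<^bsub>T\<^esub> s) m) (pure_tensor R T M \<one>\<^bsub>T\<^esub> m) = \<zero>\<^bsub>T \<boxtimes> M\<^esub>"
        by (simp add: m(2))
      then show ?thesis using t b M T.module_axioms m(1) by (simp add: sws lin_mult_left lin_mult_right)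
    qed
    then have "set [m] \<subseteq> {\<zero>\<^bsub>M\<^esub>}"
      using m(1) by (intro ff_generators[OF ff M _ zero_submodule[OF M]])
        (auto intro!: exI[of _ "[]"] simp: class_zero submodule_zero)
    then show "m = \<zero>\<^bsub>M\<^esub>" by simp
  qed
  then show ?thesis using e m by (auto dest: inj_onD)
qed

lemma ff_one_left:
  assumes M: "module R M" and m: "m \<in> carrier M" "m' \<in> carrier M"
    and e: "pure_tensor R M T m \<one>\<^bsub>T\<^esub> = pure_tensor R M T m' \<one>\<^bsub>T\<^esub>"
  shows "m = m'"
proof -
  have "sw R M T (T \<boxtimes> M) (\<lambda>x t. pure_tensor R T M t x) (pure_tensor R M T m \<one>\<^bsub>T\<^esub>) =
    sw R M T (T \<boxtimes> M) (\<lambda>x t. pure_tensor R T M t x) (pure_tensor R M T m' \<one>\<^bsub>T\<^esub>)" by (simp add: e)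
  then show ?thesis using m M T.module_axioms by (intro ff_one_right[OF M m]) (simp add: sws)
qed

lemma ff_unit_inj: "inj_on (\<lambda>c. c \<odot>\<^bsub>T\<^esub> \<one>\<^bsub>T\<^esub>) (carrier R)"
proof (rule inj_onI)
  fix c d assume cd: "c \<in> carrier R" "d \<in> carrier R" "c \<odot>\<^bsub>T\<^esub> \<one>\<^bsub>T\<^esub> = d \<odot>\<^bsub>T\<^esub> \<one>\<^bsub>T\<^esub>"
  \<comment> \<open>The base ring as a module over itself. In the tensor product with it
    \<open>c 1 \<otimes> 1 = 1 \<otimes> c\<close>, which reduces the claim to
    \<open>ff_one_right\<close>.\<close>
  let ?R = "\<lparr>carrier = carrier R, monoid.mult = monoid.mult R, one = \<one>\<^bsub>R\<^esub>, zero = \<zero>\<^bsub>R\<^esub>, add = add R, smult = monoid.mult R\<rparr>"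
  have "abelian_group ?R"
    by (rule abelian_groupI) (auto simp: T.R.a_ac intro: bexI[of _ "\<ominus>\<^bsub>R\<^esub> x" for x] T.R.l_neg)
  then have M: "module R ?R"
    by (intro moduleI T.R.is_cring) (auto simp: T.R.l_distr T.R.r_distr T.R.m_assoc)
  have "pure_tensor R T ?R \<one>\<^bsub>T\<^esub> c = pure_tensor R T ?R (c \<odot>\<^bsub>T\<^esub> \<one>\<^bsub>T\<^esub>) \<one>\<^bsub>R\<^esub>" if "c \<in> carrier R" for c
    using that pure_smult_left[OF T.module_axioms M that, of "\<one>\<^bsub>T\<^esub>" "\<one>\<^bsub>R\<^esub>"]
      pure_smult_right[OF T.module_axioms M that, of "\<one>\<^bsub>T\<^esub>" "\<one>\<^bsub>R\<^esub>"] by simp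
  then show "c = d" using cd ff_one_right[OF M, of c d] by simp
qed

lemma unit_submodule: "submodule ((\<lambda>c. c \<odot>\<^bsub>T\<^esub> \<one>\<^bsub>T\<^esub>) ` carrier R) R T"
proof (rule T.submoduleI)
  show "\<zero>\<^bsub>T\<^esub> \<in> (\<lambda>c. c \<odot>\<^bsub>T\<^esub> \<one>\<^bsub>T\<^esub>) ` carrier R" by (rule image_eqI[of _ _ "\<zero>\<^bsub>R\<^esub>"]) auto
  show "\<ominus>\<^bsub>T\<^esub> a \<in> (\<lambda>c. c \<odot>\<^bsub>T\<^esub> \<one>\<^bsub>T\<^esub>) ` carrier R" if "a \<in> (\<lambda>c. c \<odot>\<^bsub>T\<^esub> \<one>\<^bsub>T\<^esub>) ` carrier R" for a
    using that by (auto simp: T.smult_l_minus[symmetric])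
  show "a \<oplus>\<^bsub>T\<^esub> b \<in> (\<lambda>c. c \<odot>\<^bsub>T\<^esub> \<one>\<^bsub>T\<^esub>) ` carrier R"
    if "a \<in> (\<lambda>c. c \<odot>\<^bsub>T\<^esub> \<one>\<^bsub>T\<^esub>) ` carrier R" "b \<in> (\<lambda>c. c \<odot>\<^bsub>T\<^esub> \<one>\<^bsub>T\<^esub>) ` carrier R" for a b
    using that by (auto simp: T.smult_l_distr[symmetric])
  show "a \<odot>\<^bsub>T\<^esub> b \<in> (\<lambda>c. c \<odot>\<^bsub>T\<^esub> \<one>\<^bsub>T\<^esub>) ` carrier R"
    if "a \<in> carrier R" "b \<in> (\<lambda>c. c \<odot>\<^bsub>T\<^esub> \<one>\<^bsub>T\<^esub>) ` carrier R" for a b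
    using that by (auto simp: T.smult_assoc1[symmetric])
qed auto

text \<open>Multiplying the equation by \<open>s\<close> on the left gives
  \<open>s \<otimes> t = s t \<otimes> 1\<close>, so every \<open>s \<otimes> t\<close> comes from
  \<open>T \<otimes> k 1\<close>, and faithful flatness puts \<open>t\<close> into
  \<open>k 1\<close>. The unit joins the generating list so that \<open>k 1\<close> is contained in
  the span.\<close>

lemma ff_descent:
  assumes t: "t \<in> carrier T" and e: "pure_tensor R T T t \<one>\<^bsub>T\<^esub> = pure_tensor R T T \<one>\<^bsub>T\<^esub> t"
  shows "t \<in> (\<lambda>c. c \<odot>\<^bsub>T\<^esub> \<one>\<^bsub>T\<^esub>) ` carrier R"
proof -
  have b: "bimult R T" by (rule assoc_algebra_bimult[OF T])
  let ?K = "(\<lambda>c. c \<odot>\<^bsub>T\<^esub> \<one>\<^bsub>T\<^esub>) ` carrier R"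
  have one: "\<one>\<^bsub>T\<^esub> \<in> ?K" by (rule image_eqI[of _ _ "\<one>\<^bsub>R\<^esub>"]) auto
  have "set [\<one>\<^bsub>T\<^esub>, t] \<subseteq> ?K"
  proof (rule ff_generators[OF ff T.module_axioms _ unit_submodule])
    show "?K \<subseteq> L" if "submodule L R T" "set [\<one>\<^bsub>T\<^esub>, t] \<subseteq> L" for L
      using that T.submoduleE(4)[OF that(1)] by auto
    fix s m assume s: "s \<in> carrier T" and m: "m \<in> set [\<one>\<^bsub>T\<^esub>, t]"
    have "pure_tensor R T T s t = pure_tensor R T T (s \<otimes>\<^bsub>T\<^esub> t) \<one>\<^bsub>T\<^esub>"
    proof -
      have "sw R T T (T \<boxtimes> T) (\<lambda>x y. pure_tensor R T T (s \<otimes>\<^bsub>T\<^esub> x) y) (pure_tensor R T T \<one>\<^bsub>T\<^esub> t) =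
        sw R T T (T \<boxtimes> T) (\<lambda>x y. pure_tensor R T T (s \<otimes>\<^bsub>T\<^esub> x) y) (pure_tensor R T T t \<one>\<^bsub>T\<^esub>)" by (simp add: e)
      then show ?thesis using s t b T.module_axioms by (simp add: sws lin_mult_left lin_mult_right)
    qed
    then show "\<exists>v. set v \<subseteq> carrier T \<times> ?K \<and> pure_tensor R T T s m = tensor_class R T T v"
      using m s t one by (intro exI[of _ "if m = \<one>\<^bsub>T\<^esub> then [(s, \<one>\<^bsub>T\<^esub>)] else [(s \<otimes>\<^bsub>T\<^esub> t, \<one>\<^bsub>T\<^esub>)]"])
        (auto simp: pure_tensor_def)
  qed (use t in auto)
  then show ?thesis by simp
qed

text \<open>Descent with coefficients: since \<open>H\<close> is flat, the equalizer of
  \<open>t \<otimes> 1\<close> and \<open>1 \<otimes> t\<close> may be computed in the factor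
  \<open>T\<close>, where \<open>ff_descent\<close> identifies it with \<open>k 1\<close>.\<close>

lemma flat_scalar_right:
  assumes H: "flat R H" and z: "z \<in> carrier (H \<boxtimes> T)"
    and e: "sw R H T (H \<boxtimes> (T \<boxtimes> T)) (\<lambda>h t. pure_tensor R H (T \<boxtimes> T) h (pure_tensor R T T t \<one>\<^bsub>T\<^esub>)) z =
      sw R H T (H \<boxtimes> (T \<boxtimes> T)) (\<lambda>h t. pure_tensor R H (T \<boxtimes> T) h (pure_tensor R T T \<one>\<^bsub>T\<^esub> t)) z"
  obtains h where "h \<in> carrier H" "z = pure_tensor R H T h \<one>\<^bsub>T\<^esub>"
proof -
  have mH: "module R H" using H by (simp add: flat_def)
  interpret H: module R H by fact
  define K where "K = T\<lparr>carrier := (\<lambda>c. c \<odot>\<^bsub>T\<^esub> \<one>\<^bsub>T\<^esub>) ` carrier R\<rparr>"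
  have K: "module R K" unfolding K_def by (rule submodule_module[OF unit_submodule T.module_axioms])
  have lK: "linear_map R K T (\<lambda>x. x)" by (auto simp: K_def linear_map_def)
  note TT = tensor_module[OF T.module_axioms T.module_axioms]
  obtain w where w: "w \<in> carrier (H \<boxtimes> K)" "z = sw R H K (H \<boxtimes> T) (\<lambda>h t. pure_tensor R H T h t) w"
    using flat_equalizer_right[OF H T.module_axioms TT
        lin_pure_left[OF T.module_axioms T.module_axioms T.A.one_closed lin_id]
        lin_pure_right[OF T.module_axioms T.module_axioms T.A.one_closed lin_id] K lK z e] ff_descent
    by (auto simp: K_def)
  \<comment> \<open>An element of \<open>H \<otimes> k 1\<close> is a single tensor
    \<open>h \<otimes> 1\<close>: the scalars pass to the left factors, and the sum is then
    collected there.\<close>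
  have "\<exists>h\<in>carrier H. sw R H K (H \<boxtimes> T) (\<lambda>h t. pure_tensor R H T h t) w = pure_tensor R H T h \<one>\<^bsub>T\<^esub>"
    using w(1)
  proof (induction rule: class_induct)
    case zero
    have l: "linear_map R (H \<boxtimes> K) (H \<boxtimes> T) (\<lambda>w. sw R H K (H \<boxtimes> T) (\<lambda>h t. pure_tensor R H T h t) w)"
      using mH K T.module_axioms lK by (simp add: sws lin_closed[OF lK])
    show ?case
      using lin_zero[OF l] lin_zero[OF lin_pure_left[OF mH T.module_axioms T.A.one_closed lin_id] mH]
        tensor_module[OF mH K] tensor_module[OF mH T.module_axioms] by (intro bexI[of _ "\<zero>\<^bsub>H\<^esub>"]) auto
  next
    case (pure x y w)
    have l: "linear_map R (H \<boxtimes> K) (H \<boxtimes> T) (\<lambda>w. sw R H K (H \<boxtimes> T) (\<lambda>h t. pure_tensor R H T h t) w)"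
      using mH K T.module_axioms lK by (simp add: sws lin_closed[OF lK])
    obtain c where c: "c \<in> carrier R" "y = c \<odot>\<^bsub>T\<^esub> \<one>\<^bsub>T\<^esub>" using pure(2) by (auto simp: K_def)
    obtain h where h: "h \<in> carrier H" "sw R H K (H \<boxtimes> T) (\<lambda>h t. pure_tensor R H T h t) w = pure_tensor R H T h \<one>\<^bsub>T\<^esub>"
      using pure by auto
    have "sw R H K (H \<boxtimes> T) (\<lambda>h t. pure_tensor R H T h t) (pure_tensor R H K x y) = pure_tensor R H T x y"
      using mH K T.module_axioms lK pure(1,2) c by (subst sw_pure) (auto simp: sws lin_closed[OF lK])
    also have "\<dots> = pure_tensor R H T (c \<odot>\<^bsub>H\<^esub> x) \<one>\<^bsub>T\<^esub>"
      using pure(1) c by (simp add: pure_smult_left[OF mH T.module_axioms] pure_smult_right[OF mH T.module_axioms])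
    finally show ?case using h pure c
      by (intro bexI[of _ "c \<odot>\<^bsub>H\<^esub> x \<oplus>\<^bsub>H\<^esub> h"]) (auto simp: lin_add[OF l] pure_closed pure_add_left)
  qed
  then show ?thesis using w(2) that by auto
qed

lemma flat_scalar_left:
  assumes H: "flat R H" and z: "z \<in> carrier (T \<boxtimes> H)"
    and e: "sw R T H ((T \<boxtimes> T) \<boxtimes> H) (\<lambda>t h. pure_tensor R (T \<boxtimes> T) H (pure_tensor R T T t \<one>\<^bsub>T\<^esub>) h) z =
      sw R T H ((T \<boxtimes> T) \<boxtimes> H) (\<lambda>t h. pure_tensor R (T \<boxtimes> T) H (pure_tensor R T T \<one>\<^bsub>T\<^esub> t) h) z"
  obtains h where "h \<in> carrier H" "z = pure_tensor R T H \<one>\<^bsub>T\<^esub> h"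
proof -
  have mH: "module R H" using H by (simp add: flat_def)
  note m = mH T.module_axioms
  let ?z = "sw R T H (H \<boxtimes> T) (\<lambda>t h. pure_tensor R H T h t) z"
  let ?f = "sw R (T \<boxtimes> T) H (H \<boxtimes> (T \<boxtimes> T)) (\<lambda>t h. pure_tensor R H (T \<boxtimes> T) h t)"
  obtain h where h: "h \<in> carrier H" "?z = pure_tensor R H T h \<one>\<^bsub>T\<^esub>"
  proof (rule flat_scalar_right[OF H])
    show "?z \<in> carrier (H \<boxtimes> T)" using m by (simp add: sws)
    show "sw R H T (H \<boxtimes> (T \<boxtimes> T)) (\<lambda>h t. pure_tensor R H (T \<boxtimes> T) h (pure_tensor R T T t \<one>\<^bsub>T\<^esub>)) ?z =
      sw R H T (H \<boxtimes> (T \<boxtimes> T)) (\<lambda>h t. pure_tensor R H (T \<boxtimes> T) h (pure_tensor R T T \<one>\<^bsub>T\<^esub> t)) ?z"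
      using arg_cong[OF e, of ?f] m by (simp add: sws cong: sw_cong)
  qed
  have "z = sw R H T (T \<boxtimes> H) (\<lambda>h t. pure_tensor R T H t h) ?z" by (rule swap_swap[OF m(2,1) z, symmetric])
  also have "\<dots> = pure_tensor R T H \<one>\<^bsub>T\<^esub> h" unfolding h(2) using h(1) m by (simp add: sws)
  finally show ?thesis using h(1) that by blast
qed

end

section \<open>The torsor axioms as identities of sums\<close>

lemmas sw_all = sws sw_eta2 lin_mult_left lin_mult_right bimult_module bimult_closed bimult_one
  mult_sw_left mult_sw_right tensor_bimult opp_bimult

text \<open>Only linearity of \<mu> and \<theta> is assumed, so the translation of the axioms into
  sums is available for a given torsor and also for a candidate whose axioms are still to be
  verified.\<close>

locale pretorsor = T?: assoc_algebra R T
  for R :: "'k ring" (structure) and T :: "('k, 'a, 'm) torsor_scheme" +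
  assumes mu_lin: "linear_map R T (T \<boxtimes> (T \<boxtimes> T)) (tmu T)"
    and theta_lin: "linear_map R T T (theta T)"
begin

abbreviation mul (infixl \<open>\<bullet>\<close> 70) where "x \<bullet> y \<equiv> x \<otimes>\<^bsub>T\<^esub> y"

abbreviation unit (\<open>\<^bold>1\<close>) where "\<^bold>1 \<equiv> \<one>\<^bsub>T\<^esub>"

abbreviation "pt \<equiv> pure_tensor R"

abbreviation "T2 \<equiv> T \<boxtimes> T"
abbreviation "T3 \<equiv> T \<boxtimes> T2"
abbreviation "T4 \<equiv> T \<boxtimes> T3"
abbreviation "T5 \<equiv> T \<boxtimes> T4"
abbreviation "t2 \<equiv> pt T T"
abbreviation "t3 a b c \<equiv> pt T T2 a (t2 b c)"
abbreviation "t4 a b c d \<equiv> pt T T3 a (t3 b c d)"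
abbreviation "t5 a b c d e \<equiv> pt T T4 a (t4 b c d e)"
abbreviation "duo P F z \<equiv> sw R T T P F z"
abbreviation "tri P F z \<equiv> sw R T T2 P (\<lambda>a v. sw R T T P (\<lambda>b c. F a b c) v) z"
abbreviation "\<mu> \<equiv> tmu T"
abbreviation "\<theta> \<equiv> theta T"

lemma T_bimult: "bimult R T" by (rule assoc_algebra_bimult) unfold_locales

lemma T_module: "module R T" by unfold_locales

lemma lin_mu: "linear_map R A T f \<Longrightarrow> linear_map R A T3 (\<lambda>x. \<mu> (f x))"
  by (rule lin_comp[OF _ mu_lin])

lemma lin_theta: "linear_map R A T f \<Longrightarrow> linear_map R A T (\<lambda>x. \<theta> (f x))"
  by (rule lin_comp[OF _ theta_lin])

lemma mu_typ: "x \<in> carrier T \<Longrightarrow> \<mu> x \<in> carrier T3" by (rule lin_closed[OF mu_lin])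

lemma theta_typ: "x \<in> carrier T \<Longrightarrow> \<theta> x \<in> carrier T" by (rule lin_closed[OF theta_lin])

lemma theta_sw:
  assumes "module R M" "module R N"
    and "\<And>x y. x \<in> carrier M \<Longrightarrow> y \<in> carrier N \<Longrightarrow> f x y \<in> carrier T"
  shows "\<theta> (sw R M N T f z) = sw R M N T (\<lambda>x y. \<theta> (f x y)) z"
  by (rule lin_sw_apply[OF assms(1,2) T_module T_module theta_lin assms(3)])

lemma mu_sw:
  assumes "module R M" "module R N"
    and "\<And>x y. x \<in> carrier M \<Longrightarrow> y \<in> carrier N \<Longrightarrow> f x y \<in> carrier T"
  shows "\<mu> (sw R M N T f z) = sw R M N T3 (\<lambda>x y. \<mu> (f x y)) z"
  using assms by (intro lin_sw_apply[OF assms(1,2) T_module _ mu_lin assms(3)]) (simp_all add: sw_typ T_module)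

lemmas T_simps = sw_all T_bimult T_module lin_mu lin_theta mu_typ theta_typ theta_sw mu_sw

text \<open>\<open>T_simps\<close> moves sums outwards, whereas \<open>T_fold\<close> pulls them
  back into pure tensors. Structure maps nested under \<open>tensor_map\<close> leave sums at
  different depths on the two sides of an equation, so several proofs expand first and fold
  afterwards.\<close>

lemmas T_fold = sw_lin sw_typ sw_eta pure_sw_left[symmetric] pure_sw_right[symmetric]
  T_bimult T_module lin_mu lin_theta mu_typ theta_typ

text \<open>Splits the second component of an element of \<open>T3\<close> into its two factors when
  a linear map \<open>G a\<close> treats that component as one block.\<close>

lemma tri_expand:
  assumes "module R P" "\<And>a. a \<in> carrier T \<Longrightarrow> linear_map R T2 P (G a)"
  shows "sw R T T2 P G z = tri P (\<lambda>a b c. G a (t2 b c)) z"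
proof (rule sw_cong)
  fix a v assume "a \<in> carrier T" "v \<in> carrier T2"
  then show "G a v = duo P (\<lambda>b c. G a (t2 b c)) v"
    using lin_eq_sw[OF T_module T_module assms(1,2)] by blast
qed (simp_all add: T_simps)

lemma nabla_sw: "z \<in> carrier T2 \<Longrightarrow> nabla T z = sw R T T T (\<lambda>x y. x \<bullet> y) z"
  by (simp add: nabla_def sw_def)

lemmas tm = tensor_map_sw[where A = T and B = T] tensor_map_sw[where A = T and B = T2]
  tensor_map_sw[where A = T and B = T3] tensor_map_sw[where A = T and B = "T3 \<boxtimes> T"]
  tensor_map_sw[where A = T2 and B = T] tensor_map_sw[where A = T and B = T4]
  tensor_map_sw[where A = T3 and B = T] tensor_map_sw[where A = T3 and B = T2]

text \<open>Tensor maps do not see the multiplication, so \<open>opp T\<close> can be replaced by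
  \<open>T\<close> in all of them. The opposite product becomes visible only in
  \<open>mult_T_opT\<close>, \<open>mult_opT_T\<close> and \<open>mult_T3\<close>.\<close>

lemma opp_eqs:
  "tensor_map R T (opp T \<boxtimes> T \<boxtimes> opp T \<boxtimes> T) = tensor_map R T T4"
  "tensor_map R (opp T) (T \<boxtimes> opp T \<boxtimes> T) = tensor_map R T T3"
  "tensor_map R (T \<boxtimes> opp T \<boxtimes> T) (opp T \<boxtimes> T) = tensor_map R T3 T2"
  "tensor_map R T (opp T \<boxtimes> T) = tensor_map R T T2"
  "tensor_map R T ((opp T \<boxtimes> T \<boxtimes> opp T) \<boxtimes> T) = tensor_map R T (T3 \<boxtimes> T)"
  "tensor_map R (opp T \<boxtimes> T \<boxtimes> opp T) T = tensor_map R T3 T"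
  "tensor_map R (opp T) T = tensor_map R T T"
  "tensor_map R T (opp T \<boxtimes> T \<boxtimes> opp T) = tensor_map R T T3"
  "tensor_map R (opp T) (T \<boxtimes> opp T) = tensor_map R T T2"
  "tensor_map R T (opp T) = tensor_map R T T"
  "tensor_map R (T \<boxtimes> opp T \<boxtimes> T) (opp T) = tensor_map R T3 T"
  "tensor_map R (T \<boxtimes> opp T) T = tensor_map R T2 T"
  "tensor_map R (T \<boxtimes> opp T) (T \<boxtimes> opp T) = tensor_map R T2 T2"
  "tensor_map R (opp T \<boxtimes> T) (opp T \<boxtimes> T) = tensor_map R T2 T2"
  by (intro same_map same_rules)+

lemma opp_assoc_eqs:
  "assoc_inv R T (opp T) T = assoc_inv R T T T"
  "assoc3 R T (opp T) T (opp T \<boxtimes> T) = assoc3 R T T T T2"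
  "assoc3 R (opp T) T (opp T) T = assoc3 R T T T T"
  "assoc3 R T (opp T) T (opp T) = assoc3 R T T T T"
  "flip13 R (opp T) T (opp T) = flip13 R T T T"
  "assoc R T (opp T) T = assoc R T T T"
  "assoc R T (opp T) (T \<boxtimes> opp T) = assoc R T T T2"
  "assoc R (opp T) T (opp T \<boxtimes> T) = assoc R T T T2"
  by (intro same_assoc same_assoc_inv same_assoc3 same_flip13 same_rules)+

lemmas opp_all = opp_eqs opp_assoc_eqs

lemma opp_carriers: "carrier (T \<boxtimes> opp T) = carrier T2" "carrier (opp T \<boxtimes> T) = carrier T2"
  "carrier (T \<boxtimes> opp T \<boxtimes> T) = carrier T3"
  by (intro same_carrier same_rules)+

section \<open>The torsor identities as iterated sums\<close>

lemma conv_tmu_op: "x \<in> carrier T \<Longrightarrow> tmu_op R T x = tri T3 (\<lambda>a b c. t3 c b a) (\<mu> x)"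
  by (simp add: tmu_op_def opp_all flip13_sw T_simps)

lemma conv_nabla_right: "x \<in> carrier T \<Longrightarrow>
    tensor_map R T T id (nabla T) (\<mu> x) = tri T2 (\<lambda>a b c. t2 a (b \<bullet> c)) (\<mu> x)"
  by (simp add: tm T_simps nabla_sw cong: sw_cong; simp add: T_fold cong: sw_cong)

lemma conv_nabla_left: "x \<in> carrier T \<Longrightarrow>
    tensor_map R T T (nabla T) id (assoc_inv R T (opp T) T (\<mu> x)) = tri T2 (\<lambda>a b c. t2 (a \<bullet> b) c) (\<mu> x)"
  by (simp add: tm T_simps opp_all assoc_inv_sw nabla_sw cong: sw_cong; simp add: T_fold cong: sw_cong)

lemma conv_assoc1: "x \<in> carrier T \<Longrightarrow>
    tensor_map R T (opp T \<boxtimes> T \<boxtimes> opp T \<boxtimes> T) id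
        (tensor_map R (opp T) (T \<boxtimes> opp T \<boxtimes> T) id \<mu>) (\<mu> x) =
    tri T5 (\<lambda>a b c. tri T5 (\<lambda>d e f. t5 a b d e f) (\<mu> c)) (\<mu> x)"
  by (simp add: tm T_simps opp_all cong: sw_cong; simp add: T_fold cong: sw_cong)

lemma conv_assoc2: "x \<in> carrier T \<Longrightarrow>
    assoc3 R T (opp T) T (opp T \<boxtimes> T)
        (tensor_map R (T \<boxtimes> opp T \<boxtimes> T) (opp T \<boxtimes> T) \<mu> id (\<mu> x)) =
    tri T5 (\<lambda>a b c. tri T5 (\<lambda>d e f. t5 d e f b c) (\<mu> a)) (\<mu> x)"
  apply (simp add: tm T_simps opp_all assoc3_sw cong: sw_cong)
  apply (subst tri_expand[where G = "\<lambda>a y. tri T5 (\<lambda>d e f. pt T T4 d (pt T T3 e (pt T T2 f y))) (\<mu> a)"])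
  by (simp_all add: T_simps cong: sw_cong)

lemma conv_theta1: "x \<in> carrier T \<Longrightarrow>
    tensor_map R T (opp T \<boxtimes> T \<boxtimes> opp T \<boxtimes> T) id
        (tensor_map R (opp T) (T \<boxtimes> opp T \<boxtimes> T) id
          (tensor_map R T (opp T \<boxtimes> T) \<theta> id))
        (assoc3 R T (opp T) T (opp T \<boxtimes> T)
          (tensor_map R (T \<boxtimes> opp T \<boxtimes> T) (opp T \<boxtimes> T) \<mu> id (\<mu> x))) =
    tri T5 (\<lambda>a b c. tri T5 (\<lambda>d e f. t5 d e (\<theta> f) b c) (\<mu> a)) (\<mu> x)"
  apply (simp add: tm T_simps opp_all assoc3_sw cong: sw_cong)
  apply (subst tri_expand[where G = "\<lambda>a y. tri T5 (\<lambda>d e f. pt T T4 d (pt T T3 e (pt T T2 (\<theta> f) y))) (\<mu> a)"])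
  by (simp_all add: T_simps cong: sw_cong)

text \<open>A variant matching the form in which the \<theta> axiom appears once its inner term has
  been rewritten by \<open>conv_assoc2\<close>.\<close>

lemma conv_theta1': "x \<in> carrier T \<Longrightarrow>
    tensor_map R T (opp T \<boxtimes> T \<boxtimes> opp T \<boxtimes> T) id
        (tensor_map R (opp T) (T \<boxtimes> opp T \<boxtimes> T) id
          (tensor_map R T (opp T \<boxtimes> T) \<theta> id))
        (tri T5 (\<lambda>a b c. tri T5 (\<lambda>d e f. t5 d e f b c) (\<mu> a)) (\<mu> x)) =
    tri T5 (\<lambda>a b c. tri T5 (\<lambda>d e f. t5 d e (\<theta> f) b c) (\<mu> a)) (\<mu> x)"
  using conv_theta1 by (simp only: conv_assoc2)

lemma conv_theta2: "x \<in> carrier T \<Longrightarrow>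
    tensor_map R T (opp T \<boxtimes> T \<boxtimes> opp T \<boxtimes> T) id
        (assoc3 R (opp T) T (opp T) T)
        (tensor_map R T ((opp T \<boxtimes> T \<boxtimes> opp T) \<boxtimes> T) id
          (tensor_map R (opp T \<boxtimes> T \<boxtimes> opp T) T (tmu_op R T) id) (\<mu> x)) =
    tri T5 (\<lambda>a b c. tri T5 (\<lambda>d e f. t5 a f e d c) (\<mu> b)) (\<mu> x)"
  by (simp add: tm T_simps opp_all assoc3_sw conv_tmu_op cong: sw_cong; simp add: T_fold cong: sw_cong)

lemma conv_theta_mu: "x \<in> carrier T \<Longrightarrow>
    tensor_map R T (opp T \<boxtimes> T) \<theta> (tensor_map R (opp T) T \<theta> \<theta>) (\<mu> x) =
    tri T3 (\<lambda>a b c. t3 (\<theta> a) (\<theta> b) (\<theta> c)) (\<mu> x)"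
  by (simp add: tm T_simps opp_all cong: sw_cong; simp add: T_fold cong: sw_cong)

definition "Hl_eq z \<longleftrightarrow> z \<in> carrier T2 \<and>
  duo T4 (\<lambda>a b. tri T4 (\<lambda>d e f. t4 d e (\<theta> f) b) (\<mu> a)) z = duo T4 (\<lambda>a b. tri T4 (\<lambda>d e f. t4 a f e d) (\<mu> b)) z"

definition "Hr_eq z \<longleftrightarrow> z \<in> carrier T2 \<and>
  duo T4 (\<lambda>a b. tri T4 (\<lambda>d e f. t4 a (\<theta> d) e f) (\<mu> b)) z = duo T4 (\<lambda>a b. tri T4 (\<lambda>d e f. t4 f e d b) (\<mu> a)) z"

lemma conv_left_algebra: "z \<in> carrier (left_algebra R T) \<longleftrightarrow> Hl_eq z"
proof -
  have "tensor_map R T (opp T \<boxtimes> T \<boxtimes> opp T) id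
          (tensor_map R (opp T) (T \<boxtimes> opp T) id (tensor_map R T (opp T) \<theta> id))
          (assoc3 R T (opp T) T (opp T)
            (tensor_map R (T \<boxtimes> opp T \<boxtimes> T) (opp T) \<mu> id z)) =
      duo T4 (\<lambda>a b. tri T4 (\<lambda>d e f. t4 d e (\<theta> f) b) (\<mu> a)) z" if "z \<in> carrier T2"
    using that by (simp add: tm T_simps opp_all assoc3_sw cong: sw_cong; simp add: T_fold cong: sw_cong)
  moreover have "tensor_map R T (opp T \<boxtimes> T \<boxtimes> opp T) id (tmu_op R T) z =
      duo T4 (\<lambda>a b. tri T4 (\<lambda>d e f. t4 a f e d) (\<mu> b)) z" if "z \<in> carrier T2"
    using that by (simp add: tm T_simps opp_all conv_tmu_op cong: sw_cong; simp add: T_fold cong: sw_cong)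
  ultimately show ?thesis unfolding left_algebra_def Hl_eq_def by (auto simp: opp_carriers)
qed

lemma conv_right_algebra: "z \<in> carrier (right_algebra R T) \<longleftrightarrow> Hr_eq z"
proof -
  have "tensor_map R (opp T) (T \<boxtimes> opp T \<boxtimes> T) id
          (tensor_map R T (opp T \<boxtimes> T) \<theta> id)
          (tensor_map R (opp T) (T \<boxtimes> opp T \<boxtimes> T) id \<mu> z) =
      duo T4 (\<lambda>a b. tri T4 (\<lambda>d e f. t4 a (\<theta> d) e f) (\<mu> b)) z" if "z \<in> carrier T2"
    using that by (simp add: tm T_simps opp_all cong: sw_cong; simp add: T_fold cong: sw_cong)
  moreover have "assoc3 R (opp T) T (opp T) T
          (tensor_map R (opp T \<boxtimes> T \<boxtimes> opp T) T (tmu_op R T) id z) =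
      duo T4 (\<lambda>a b. tri T4 (\<lambda>d e f. t4 f e d b) (\<mu> a)) z" if "z \<in> carrier T2"
    using that by (simp add: tm T_simps opp_all assoc3_sw conv_tmu_op cong: sw_cong; simp add: T_fold cong: sw_cong)
  ultimately show ?thesis unfolding right_algebra_def Hr_eq_def by (auto simp: opp_carriers)
qed

lemma conv_left_comult: "z \<in> carrier T2 \<Longrightarrow>
    assoc3 R T (opp T) T (opp T) (tensor_map R (T \<boxtimes> opp T \<boxtimes> T) (opp T) \<mu> id z) =
    duo T4 (\<lambda>a b. tri T4 (\<lambda>d e f. t4 d e f b) (\<mu> a)) z"
  by (simp add: tm T_simps opp_all assoc3_sw cong: sw_cong; simp add: T_fold cong: sw_cong)

lemma conv_right_comult: "z \<in> carrier T2 \<Longrightarrow>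
    tensor_map R (opp T) (T \<boxtimes> opp T \<boxtimes> T) id \<mu> z =
    duo T4 (\<lambda>a b. tri T4 (\<lambda>d e f. t4 a d e f) (\<mu> b)) z"
  by (simp add: tm T_simps opp_all cong: sw_cong; simp add: T_fold cong: sw_cong)

text \<open>Turns the axioms into identities of iterated sums in tensor powers of \<open>T\<close>.
  It is read forwards for a given torsor and backwards for the torsor of a bi-Galois object.\<close>

lemma quantum_torsor_iff:
  "quantum_torsor R T \<longleftrightarrow> faithfully_flat R T \<and>
    algebra_hom R T (T \<boxtimes> opp T \<boxtimes> T) \<mu> \<and> algebra_iso R T T \<theta> \<and>
    (\<forall>x\<in>carrier T.
      tri T2 (\<lambda>a b c. t2 a (b \<bullet> c)) (\<mu> x) = t2 x \<^bold>1 \<and>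
      tri T2 (\<lambda>a b c. t2 (a \<bullet> b) c) (\<mu> x) = t2 \<^bold>1 x \<and>
      tri T5 (\<lambda>a b c. tri T5 (\<lambda>d e f. t5 a b d e f) (\<mu> c)) (\<mu> x) =
        tri T5 (\<lambda>a b c. tri T5 (\<lambda>d e f. t5 d e f b c) (\<mu> a)) (\<mu> x) \<and>
      tri T5 (\<lambda>a b c. tri T5 (\<lambda>d e f. t5 d e (\<theta> f) b c) (\<mu> a)) (\<mu> x) =
        tri T5 (\<lambda>a b c. tri T5 (\<lambda>d e f. t5 a f e d c) (\<mu> b)) (\<mu> x) \<and>
      tri T3 (\<lambda>a b c. t3 (\<theta> a) (\<theta> b) (\<theta> c)) (\<mu> x) = \<mu> (\<theta> x))"
proof -
  have "assoc_algebra R T" by unfold_locales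
  then show ?thesis
    unfolding quantum_torsor_def quantum_torsor_axioms_def
    by (simp add: conv_nabla_right conv_nabla_left conv_assoc1 conv_assoc2 conv_theta1' conv_theta2 conv_theta_mu
        Ball_def imp_conjR all_conj_distrib)
qed

end

lemma sw_cong2:
  assumes "z = z'" "module R M" "module R N"
    and "\<And>x y. x \<in> carrier M \<Longrightarrow> y \<in> carrier N \<Longrightarrow> f x y = g x y"
  shows "sw R M N P f z = sw R M N P g z'"
  unfolding assms(1) by (rule sw_cong[OF assms(2-4)])

text \<open>Maps obtained as preimages under an injective linear map are shown to be linear by
  composing them with that map.\<close>

lemma lin_of_inj:
  assumes "module R N" "linear_map R N P e" "inj_on e (carrier N)" "module R M"
    and "\<And>x. x \<in> carrier M \<Longrightarrow> f x \<in> carrier N" "linear_map R M P (\<lambda>x. e (f x))"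
  shows "linear_map R M N f"
proof -
  interpret M: module R M by fact
  interpret N: module R N by fact
  show ?thesis unfolding linear_map_def
  proof (intro conjI ballI)
    fix x y assume "x \<in> carrier M" "y \<in> carrier M"
    then show "f (x \<oplus>\<^bsub>M\<^esub> y) = f x \<oplus>\<^bsub>N\<^esub> f y"
      using lin_add[OF assms(6), of x y] lin_add[OF assms(2), of "f x" "f y"] assms(5)
      by (intro inj_onD[OF assms(3)]) auto
  next
    fix c x assume "c \<in> carrier R" "x \<in> carrier M"
    then show "f (c \<odot>\<^bsub>M\<^esub> x) = c \<odot>\<^bsub>N\<^esub> f x"
      using lin_smult[OF assms(6), of c x] lin_smult[OF assms(2), of c "f x"] assms(5)
      by (intro inj_onD[OF assms(3)]) auto
  qed (use assms(5) in auto)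
qed

section \<open>The left Hopf algebra of a quantum torsor\<close>

context pretorsor
begin

lemma tri_swap:
  assumes "module R M" "module R N" "module R P"
    and "\<And>x y a b c. x \<in> carrier M \<Longrightarrow> y \<in> carrier N \<Longrightarrow> a \<in> carrier T \<Longrightarrow> b \<in> carrier T \<Longrightarrow> c \<in> carrier T \<Longrightarrow>
      G x y a b c \<in> carrier P"
  shows "tri P (\<lambda>a b c. sw R M N P (\<lambda>x y. G x y a b c) z) w = sw R M N P (\<lambda>x y. tri P (\<lambda>a b c. G x y a b c) w) z"
proof -
  have "tri P (\<lambda>a b c. sw R M N P (\<lambda>x y. G x y a b c) z) w =
      sw R T T2 P (\<lambda>a v. sw R M N P (\<lambda>x y. duo P (\<lambda>b c. G x y a b c) v) z) w"
    using assms by (intro sw_cong sw_swap) (simp_all add: T_simps)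
  also have "\<dots> = sw R M N P (\<lambda>x y. tri P (\<lambda>a b c. G x y a b c) w) z"
    using assms by (intro sw_swap) (simp_all add: T_simps)
  finally show ?thesis .
qed

abbreviation "T6 \<equiv> T \<boxtimes> T5"
abbreviation "t6 a b c d e f \<equiv> pt T T5 a (t5 b c d e f)"
abbreviation "ev4 P F z \<equiv> sw R T T3 P (\<lambda>a v. tri P (\<lambda>b c d. F a b c d) v) z"
abbreviation "ev5 P F z \<equiv> sw R T T4 P (\<lambda>a v. ev4 P (\<lambda>b c d e. F a b c d e) v) z"

end

lemma (in quantum_torsor) pretorsor: "pretorsor R T"
proof -
  have "same (T \<boxtimes> opp T \<boxtimes> T) (T \<boxtimes> T \<boxtimes> T)"
    by (intro same_rules)
  then have "linear_map R T (T \<boxtimes> T \<boxtimes> T) (tmu T)"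
    using tmu_hom same_linear[OF same_refl, of "T \<boxtimes> opp T \<boxtimes> T" "T \<boxtimes> T \<boxtimes> T" R T "tmu T"]
    by (simp add: algebra_hom_def)
  moreover have "linear_map R T T (theta T)" using theta_aut by (simp add: algebra_iso_def algebra_hom_def)
  ultimately show ?thesis by unfold_locales
qed

sublocale quantum_torsor \<subseteq> pretorsor by (rule pretorsor)

context quantum_torsor
begin

lemma torsor_flat: "flat R T" by (rule ff_flat[OF torsor_faithfully_flat])

lemma T_alg: "assoc_algebra R T" by unfold_locales

lemma torsor_axioms:
  assumes "x \<in> carrier T"
  shows mu_nabla_right: "tri T2 (\<lambda>a b c. t2 a (b \<bullet> c)) (\<mu> x) = t2 x \<^bold>1"
    and mu_nabla_left: "tri T2 (\<lambda>a b c. t2 (a \<bullet> b) c) (\<mu> x) = t2 \<^bold>1 x"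
    and mu_assoc: "tri T5 (\<lambda>a b c. tri T5 (\<lambda>d e f. t5 a b d e f) (\<mu> c)) (\<mu> x) =
        tri T5 (\<lambda>a b c. tri T5 (\<lambda>d e f. t5 d e f b c) (\<mu> a)) (\<mu> x)"
    and mu_theta: "tri T5 (\<lambda>a b c. tri T5 (\<lambda>d e f. t5 d e (\<theta> f) b c) (\<mu> a)) (\<mu> x) =
        tri T5 (\<lambda>a b c. tri T5 (\<lambda>d e f. t5 a f e d c) (\<mu> b)) (\<mu> x)"
    and theta_mu: "tri T3 (\<lambda>a b c. t3 (\<theta> a) (\<theta> b) (\<theta> c)) (\<mu> x) = \<mu> (\<theta> x)"
  using quantum_torsor_iff assms quantum_torsor_axioms by blast+

lemma T_one: "\<^bold>1 \<in> carrier T" by simp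

lemma T_assoc: "x \<in> carrier T \<Longrightarrow> y \<in> carrier T \<Longrightarrow> z \<in> carrier T \<Longrightarrow>
    (x \<bullet> y) \<bullet> z = x \<bullet> (y \<bullet> z)"
  by (rule T.A.m_assoc)

lemma nabla_typ: "z \<in> carrier T2 \<Longrightarrow> nabla T z \<in> carrier T"
  by (simp add: nabla_sw T_simps)

text \<open>Multiply the first two factors of the equation defining \<open>H_l(T)\<close>, and the
  last two in the opposite order. For \<open>z = a \<otimes> b\<close> (sums suppressed) the unit
  axiom of \<mu> leaves \<open>1 \<otimes> b \<theta>(a) = a b \<otimes> 1\<close>. Multiplying out
  gives \<open>b \<theta>(a) = a b\<close>, hence \<open>1 \<otimes> a b = a b \<otimes> 1\<close>.
  By descent \<nabla> is scalar on \<open>H_l(T)\<close>, and this scalar is the counit.\<close>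

lemma Hl_nabla:
  assumes "Hl_eq z"
  shows "t2 (nabla T z) \<^bold>1 = t2 \<^bold>1 (nabla T z)"
proof -
  have z: "z \<in> carrier T2" using assms by (simp add: Hl_eq_def)
  have 1: "tri T2 (\<lambda>d e f. t2 (d \<bullet> e) (b \<bullet> \<theta> f)) (\<mu> a) = t2 \<^bold>1 (b \<bullet> \<theta> a)"
    if "a \<in> carrier T" "b \<in> carrier T" for a b
    using arg_cong[OF mu_nabla_left[OF that(1)], of "duo T2 (\<lambda>p q. t2 p (b \<bullet> \<theta> q))"] that T_one
    by (simp add: T_simps cong: sw_cong2)
  have 2: "tri T2 (\<lambda>d e f. t2 (a \<bullet> f) (d \<bullet> e)) (\<mu> b) = t2 (a \<bullet> b) \<^bold>1"
    if "a \<in> carrier T" "b \<in> carrier T" for a b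
    using arg_cong[OF mu_nabla_left[OF that(2)], of "duo T2 (\<lambda>p q. t2 (a \<bullet> q) p)"] that T_one
    by (simp add: T_simps cong: sw_cong2)
  have "duo T4 (\<lambda>a b. tri T4 (\<lambda>d e f. t4 d e (\<theta> f) b) (\<mu> a)) z = duo T4 (\<lambda>a b. tri T4 (\<lambda>d e f. t4 a f e d) (\<mu> b)) z"
    using assms by (simp add: Hl_eq_def)
  from arg_cong[OF this, of "ev4 T2 (\<lambda>p q r s. t2 (p \<bullet> q) (s \<bullet> r))"]
  have 3: "duo T2 (\<lambda>a b. t2 \<^bold>1 (b \<bullet> \<theta> a)) z = duo T2 (\<lambda>a b. t2 (a \<bullet> b) \<^bold>1) z"
    by (simp add: T_simps 1 2 cong: sw_cong2)
  have 4: "duo T (\<lambda>a b. b \<bullet> \<theta> a) z = duo T (\<lambda>a b. a \<bullet> b) z"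
    using arg_cong[OF 3, of "duo T (\<lambda>p q. p \<bullet> q)"] T_one by (simp add: T_simps cong: sw_cong2)
  show ?thesis using 3 4 z T_one by (simp add: nabla_sw T_fold cong: sw_cong2)
qed

lemma Hl_nabla_scalar: "Hl_eq z \<Longrightarrow> nabla T z \<in> (\<lambda>c. c \<odot>\<^bsub>T\<^esub> \<^bold>1) ` carrier R"
  using ff_descent[OF T_alg torsor_faithfully_flat nabla_typ Hl_nabla] by (simp add: Hl_eq_def)

end

text \<open>\<open>ell\<close> is an injective linear parametrisation of elements of
  \<open>H_l(T)\<close> by a flat module. This covers a given isomorphism onto \<open>H_l(T)\<close>
  as well as the map obtained by inverting a Galois map, whose surjectivity is established only
  afterwards.\<close>

locale left_ell = quantum_torsor R T
  for R :: "'k ring" (structure) and T :: "('k, 'a, 'm) torsor_scheme" +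
  fixes H :: "('k, 'h, 'n) module_scheme" and ell :: "'h \<Rightarrow> ('a, 'a) tens"
  assumes H_flat: "flat R H"
    and ell_lin: "linear_map R H T2 ell"
    and ell_inj: "inj_on ell (carrier H)"
    and ell_Hl: "h \<in> carrier H \<Longrightarrow> Hl_eq (ell h)"
begin

lemma H_module: "module R H" using H_flat by (simp add: flat_def)

lemma ell_typ: "h \<in> carrier H \<Longrightarrow> ell h \<in> carrier T2" by (rule lin_closed[OF ell_lin])

lemma lin_ell: "linear_map R A H f \<Longrightarrow> linear_map R A T2 (\<lambda>x. ell (f x))" by (rule lin_comp[OF _ ell_lin])

text \<open>\<open>E X\<close> is \<open>ell \<otimes> X\<close> followed by reassociation. For flat
  \<open>X\<close> it is injective, and this is the device by which identities in
  \<open>H \<otimes> X\<close> are checked in tensor powers of \<open>T\<close>.\<close>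

definition "E X w = sw R H X (T \<boxtimes> (T \<boxtimes> X)) (\<lambda>h x. duo (T \<boxtimes> (T \<boxtimes> X))
  (\<lambda>a b. pt T (T \<boxtimes> X) a (pt T X b x)) (ell h)) w"

lemmas E_simps0 = T_simps H_module ell_typ lin_ell

lemma E_inj:
  assumes X: "flat R X"
  shows "inj_on (E X) (carrier (H \<boxtimes> X))"
proof -
  have mX: "module R X" using X by (simp add: flat_def)
  let ?J = "sw R H X (T2 \<boxtimes> X) (\<lambda>h x. pt T2 X (ell h) x)"
  have J: "inj_on ?J (carrier (H \<boxtimes> X))"
    by (rule flat_inj_left[OF X H_module _ ell_lin ell_inj]) (simp add: T_simps)
  \<comment> \<open>The map \<open>ell \<otimes> X\<close> is recovered from \<open>E X\<close> by
    the inverse associator, so its injectivity carries over to \<open>E X\<close>.\<close>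
  have A: "?J w = assoc_inv R T T X (E X w)" if "w \<in> carrier (H \<boxtimes> X)" for w
    using that mX by (simp add: E_def E_simps0 assoc_inv_sw cong: sw_cong2)
  show ?thesis
  proof (rule inj_onI)
    fix v w assume vw: "v \<in> carrier (H \<boxtimes> X)" "w \<in> carrier (H \<boxtimes> X)" and e: "E X v = E X w"
    from J _ vw show "v = w"
      by (rule inj_onD) (simp only: A[OF vw(1)] A[OF vw(2)] e)
  qed
qed

lemma E_lin: "module R X \<Longrightarrow> linear_map R (H \<boxtimes> X) (T \<boxtimes> (T \<boxtimes> X)) (E X)"
  by (simp add: E_def[abs_def] E_simps0)

end

locale left_torsor_data = left_ell R T H ell
  for R :: "'k ring" (structure) and T :: "('k, 'a, 'm) torsor_scheme" and H :: "('k, 'h, 'n) module_scheme"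
    and ell :: "'h \<Rightarrow> ('a, 'a) tens" +
  fixes lam :: "'a \<Rightarrow> ('h, 'a) tens"
  assumes lam_typ: "x \<in> carrier T \<Longrightarrow> lam x \<in> carrier (H \<boxtimes> T)"
    and lam_mu: "x \<in> carrier T \<Longrightarrow> sw R H T T3 (\<lambda>h t. duo T3 (\<lambda>a b. t3 a b t) (ell h)) (lam x) = \<mu> x"
begin

lemma E_lam: "x \<in> carrier T \<Longrightarrow> E T (lam x) = \<mu> x"
  using lam_mu by (simp add: E_def)

lemma lam_lin: "linear_map R T (H \<boxtimes> T) lam"
proof (rule lin_of_inj[OF _ E_lin E_inj])
  show "linear_map R T T3 (\<lambda>x. E T (lam x))"
    using mu_lin lin_cong[of T "\<lambda>x. E T (lam x)" \<mu> R T3] E_lam T_module by blast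
qed (simp_all add: T_simps H_module torsor_flat lam_typ)

lemma lin_lam: "linear_map R A T f \<Longrightarrow> linear_map R A (H \<boxtimes> T) (\<lambda>x. lam (f x))" by (rule lin_comp[OF _ lam_lin])

lemmas E_simps = E_simps0 lam_typ lin_lam

text \<open>Exchanges a sum over the coaction and \<open>ell\<close> for a sum over \<mu>; through
  it expressions in \<open>lam\<close> reach the torsor axioms.\<close>

lemma mu_to_lam:
  assumes "x \<in> carrier T" "module R P"
    and "\<And>b c. b \<in> carrier T \<Longrightarrow> c \<in> carrier T \<Longrightarrow> linear_map R T P (\<lambda>a. F a b c)"
    and "\<And>a c. a \<in> carrier T \<Longrightarrow> c \<in> carrier T \<Longrightarrow> linear_map R T P (\<lambda>b. F a b c)"
    and "\<And>a b. a \<in> carrier T \<Longrightarrow> b \<in> carrier T \<Longrightarrow> linear_map R T P (\<lambda>c. F a b c)"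
  shows "sw R H T P (\<lambda>h t. duo P (\<lambda>a b. F a b t) (ell h)) (lam x) = tri P F (\<mu> x)"
  using arg_cong[OF lam_mu[OF assms(1)], of "tri P F"] assms
  by (simp add: E_simps lin_closed[OF assms(3)] cong: sw_cong2)

definition "W z = duo (H \<boxtimes> T2) (\<lambda>a b. sw R H T (H \<boxtimes> T2) (\<lambda>h t. pt H T2 h (t2 t b)) (lam a)) z"

lemma W_typ: "z \<in> carrier T2 \<Longrightarrow> W z \<in> carrier (H \<boxtimes> T2)"
  by (simp add: W_def E_simps)

lemma E_W: "z \<in> carrier T2 \<Longrightarrow> E T2 (W z) = duo T4 (\<lambda>a b. tri T4 (\<lambda>d e f. t4 d e f b) (\<mu> a)) z"
proof -
  assume z: "z \<in> carrier T2"
  have 1: "sw R H T T4 (\<lambda>h t. duo T4 (\<lambda>p q. t4 p q t b) (ell h)) (lam a) = tri T4 (\<lambda>d e f. t4 d e f b) (\<mu> a)"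
    if "a \<in> carrier T" "b \<in> carrier T" for a b
    using that by (intro mu_to_lam) (simp_all add: E_simps)
  show ?thesis using z by (simp add: E_def W_def E_simps 1 cong: sw_cong2)
qed

text \<open>
  \<open>W\<close> is \<open>\<lambda> \<otimes> T\<close>. The module \<open>H\<^sub>l(T)\<close> is the equalizer of two linear maps, and \<open>H\<close> is flat, so it
  suffices to see that \<open>W z\<close> is equalized by the tensor products of these maps with \<open>H\<close>.
\<close>

lemma W_Hl:
  assumes z: "Hl_eq z" and B: "module R B" and j: "linear_map R B T2 j"
    and onto: "\<And>z. Hl_eq z \<Longrightarrow> z \<in> j ` carrier B"
  obtains v where "v \<in> carrier (H \<boxtimes> B)" "W z = sw R H B (H \<boxtimes> T2) (\<lambda>h b. pt H T2 h (j b)) v"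
proof -
  let ?A = "duo T4 (\<lambda>a b. tri T4 (\<lambda>d e f. t4 d e (\<theta> f) b) (\<mu> a))"
  let ?B = "duo T4 (\<lambda>a b. tri T4 (\<lambda>d e f. t4 a f e d) (\<mu> b))"
  let ?HA = "\<lambda>w. sw R H T2 (H \<boxtimes> T4) (\<lambda>h v. pt H T4 h (?A v)) w"
  let ?HB = "\<lambda>w. sw R H T2 (H \<boxtimes> T4) (\<lambda>h v. pt H T4 h (?B v)) w"
  have zT: "z \<in> carrier T2" and zAB: "?A z = ?B z" using z by (simp_all add: Hl_eq_def)
  have A: "linear_map R T2 T4 ?A" and B': "linear_map R T2 T4 ?B" by (simp_all add: T_simps)
  have fl: "flat R T4" using torsor_flat by (intro flat_tensor)
  \<comment> \<open>Associativity of \<mu> shows that the result is \<mu> applied to the first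
    factor of one side of the equation for \<open>z\<close>. For the other side, in
    \<open>2\<close>, an exchange of independent sums is enough.\<close>
  have 1: "E T4 (?HA (W z)) = duo T6 (\<lambda>a b. tri T6 (\<lambda>x e f. tri T6 (\<lambda>p q d. t6 p q d e (\<theta> f) b) (\<mu> x)) (\<mu> a)) z"
  proof -
    have a: "sw R H T T6 (\<lambda>h t. duo T6 (\<lambda>p q. tri T6 (\<lambda>d e f. t6 p q d e (\<theta> f) b) (\<mu> t)) (ell h)) (lam a) =
        tri T6 (\<lambda>p q t. tri T6 (\<lambda>d e f. t6 p q d e (\<theta> f) b) (\<mu> t)) (\<mu> a)"
      if "a \<in> carrier T" "b \<in> carrier T" for a b
      using that by (intro mu_to_lam) (simp_all add: E_simps)
    have b: "tri T6 (\<lambda>p q t. tri T6 (\<lambda>d e f. t6 p q d e (\<theta> f) b) (\<mu> t)) (\<mu> a) =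
        tri T6 (\<lambda>x e f. tri T6 (\<lambda>p q d. t6 p q d e (\<theta> f) b) (\<mu> x)) (\<mu> a)"
      if "a \<in> carrier T" "b \<in> carrier T" for a b
      using arg_cong[OF mu_assoc[OF that(1)], of "ev5 T6 (\<lambda>p q d e f. t6 p q d e (\<theta> f) b)"] that
      by (simp add: E_simps cong: sw_cong2)
    have c: "sw R H T T6 (\<lambda>h t. tri T6 (\<lambda>d e f. duo T6 (\<lambda>p q. t6 p q d e (\<theta> f) b) (ell h)) (\<mu> t)) (lam a) =
        sw R H T T6 (\<lambda>h t. duo T6 (\<lambda>p q. tri T6 (\<lambda>d e f. t6 p q d e (\<theta> f) b) (\<mu> t)) (ell h)) (lam a)"
      if "a \<in> carrier T" "b \<in> carrier T" for a b
      using that by (intro sw_cong tri_swap) (simp_all add: E_simps)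
    show ?thesis using zT by (simp add: E_def W_def E_simps a b c cong: sw_cong2)
  qed
  have 2: "E T4 (?HB (W z)) = duo T6 (\<lambda>a b. tri T6 (\<lambda>d e f. tri T6 (\<lambda>p q x. t6 p q x f e d) (\<mu> a)) (\<mu> b)) z"
  proof -
    have a: "sw R H T T6 (\<lambda>h t. tri T6 (\<lambda>d e f. duo T6 (\<lambda>p q. t6 p q t f e d) (ell h)) (\<mu> b)) (lam a) =
        tri T6 (\<lambda>d e f. sw R H T T6 (\<lambda>h t. duo T6 (\<lambda>p q. t6 p q t f e d) (ell h)) (lam a)) (\<mu> b)"
      if "a \<in> carrier T" "b \<in> carrier T" for a b
      using that by (intro tri_swap[symmetric]) (simp_all add: E_simps)
    have b: "sw R H T T6 (\<lambda>h t. duo T6 (\<lambda>p q. t6 p q t f e d) (ell h)) (lam a) = tri T6 (\<lambda>p q x. t6 p q x f e d) (\<mu> a)"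
      if "a \<in> carrier T" "d \<in> carrier T" "e \<in> carrier T" "f \<in> carrier T" for a d e f
      using that by (intro mu_to_lam) (simp_all add: E_simps)
    show ?thesis using zT by (simp add: E_def W_def E_simps a b cong: sw_cong2)
  qed
  have 3: "duo T6 (\<lambda>a b. tri T6 (\<lambda>x e f. tri T6 (\<lambda>p q d. t6 p q d e (\<theta> f) b) (\<mu> x)) (\<mu> a)) z =
      duo T6 (\<lambda>a b. tri T6 (\<lambda>d e f. tri T6 (\<lambda>p q x. t6 p q x f e d) (\<mu> a)) (\<mu> b)) z"
    using arg_cong[OF zAB, of "ev4 T6 (\<lambda>x e f b. tri T6 (\<lambda>p q d. t6 p q d e f b) (\<mu> x))"]
    by (simp add: E_simps cong: sw_cong2)
  have "?HA (W z) = ?HB (W z)"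
    by (rule inj_onD[OF E_inj[OF fl]]) (use zT 1 2 3 in \<open>simp_all add: E_simps\<close>)
  then show ?thesis
    using that flat_equalizer_right[OF H_flat _ _ A B' B j W_typ[OF zT]] onto zT T_module
    by (auto simp: Hl_eq_def T_simps)
qed

end

lemma same_sw:
  assumes "same M M'" "same N N'" "same P P'"
  shows "sw R M N P = sw R M' N' P'"
  using same_carrier[OF same_tensor[OF assms(1,2)]] assms(3)
  by (intro ext) (simp add: sw_def same_lift[OF assms(3)] same_def)

context pretorsor
begin

lemma mult_T_opT:
  assumes "x \<in> carrier T2" "y \<in> carrier T2"
  shows "x \<otimes>\<^bsub>T \<boxtimes> opp T\<^esub> y = duo T2 (\<lambda>a b. duo T2 (\<lambda>c d. t2 (a \<bullet> c) (d \<bullet> b)) y) x"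
proof -
  have s: "sw R T (opp T) (T \<boxtimes> opp T) = sw R T T T2" "pt T (opp T) = pt T T"
    by (intro same_sw same_pure same_rules)+
  show ?thesis using tensor_mult[OF T_bimult opp_bimult[OF T_bimult]] assms
    by (simp add: opp_carriers s opp_simps)
qed

lemma mult_opT_T:
  assumes "x \<in> carrier T2" "y \<in> carrier T2"
  shows "x \<otimes>\<^bsub>opp T \<boxtimes> T\<^esub> y = duo T2 (\<lambda>a b. duo T2 (\<lambda>c d. t2 (c \<bullet> a) (b \<bullet> d)) y) x"
proof -
  have s: "sw R (opp T) T (opp T \<boxtimes> T) = sw R T T T2" "pt (opp T) T = pt T T"
    by (intro same_sw same_pure same_rules)+
  show ?thesis using tensor_mult[OF opp_bimult[OF T_bimult] T_bimult] assms
    by (simp add: opp_carriers s opp_simps)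
qed

lemma mult_T3:
  assumes "x \<in> carrier T3" "y \<in> carrier T3"
  shows "x \<otimes>\<^bsub>T \<boxtimes> opp T \<boxtimes> T\<^esub> y =
    tri T3 (\<lambda>a b c. tri T3 (\<lambda>d e f. t3 (a \<bullet> d) (e \<bullet> b) (c \<bullet> f)) y) x"
proof -
  have s: "sw R T (opp T \<boxtimes> T) (T \<boxtimes> opp T \<boxtimes> T) = sw R T T2 T3"
    "pt T (opp T \<boxtimes> T) = pt T T2"
    by (intro same_sw same_pure same_rules)+
  have "x \<otimes>\<^bsub>T \<boxtimes> opp T \<boxtimes> T\<^esub> y = sw R T T2 T3 (\<lambda>a v. sw R T T2 T3
      (\<lambda>d w. pt T T2 (a \<bullet> d) (v \<otimes>\<^bsub>opp T \<boxtimes> T\<^esub> w)) y) x"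
    using tensor_mult[OF T_bimult tensor_bimult[OF opp_bimult[OF T_bimult] T_bimult]] assms
    by (simp add: opp_carriers s)
  also have "\<dots> = sw R T T2 T3 (\<lambda>a v. sw R T T2 T3 (\<lambda>d w. duo T3 (\<lambda>b c. duo T3
      (\<lambda>e f. t3 (a \<bullet> d) (e \<bullet> b) (c \<bullet> f)) w) v) y) x"
    by (simp add: mult_opT_T T_simps cong: sw_cong2)
  also have "\<dots> = tri T3 (\<lambda>a b c. tri T3 (\<lambda>d e f. t3 (a \<bullet> d) (e \<bullet> b) (c \<bullet> f)) y) x"
    by (intro sw_cong sw_swap) (simp_all add: T_simps)
  finally show ?thesis .
qed

end

context quantum_torsor
begin

lemma mu_one: "\<mu> \<^bold>1 = t3 \<^bold>1 \<^bold>1 \<^bold>1"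
  using tmu_hom same_pure[OF same_refl, of "opp T \<boxtimes> T" T2 R T] same_pure[OF same_opp same_refl, of R T T]
  by (simp add: algebra_hom_def ring_hom_def tensor_one opp_simps same_rules)

lemma mu_mult:
  "x \<in> carrier T \<Longrightarrow> y \<in> carrier T \<Longrightarrow> \<mu> (x \<bullet> y) =
    tri T3 (\<lambda>a b c. tri T3 (\<lambda>d e f. t3 (a \<bullet> d) (e \<bullet> b) (c \<bullet> f)) (\<mu> y)) (\<mu> x)"
  using tmu_hom mult_T3[OF mu_typ mu_typ] by (simp add: algebra_hom_def ring_hom_def)

end

section \<open>The left Galois object of a torsor\<close>

lemma (in bialgebra) lin_counit:
  assumes "linear_map R A H f" "module R P" "p \<in> carrier P"
  shows "linear_map R A P (\<lambda>x. counit H (f x) \<odot>\<^bsub>P\<^esub> p)"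
proof -
  interpret P: module R P by fact
  have c: "counit H h \<in> carrier R" if "h \<in> carrier H" for h
    using that counit_hom by (auto simp: ring_hom_def)
  have "linear_map R H P (\<lambda>h. counit H h \<odot>\<^bsub>P\<^esub> p)"
    using c assms(3) counit_hom by (auto simp: linear_map_def ring_hom_def P.smult_l_distr P.smult_assoc1 counit_smult)
  then show ?thesis using assms(1) by (rule lin_comp[rotated])
qed

lemma (in bialgebra) counit_closed: "h \<in> carrier H \<Longrightarrow> counit H h \<in> carrier R"
  using counit_hom by (auto simp: ring_hom_def)

lemma (in bialgebra) comult_lin: "linear_map R H (H \<boxtimes> H) (comult H)"
  using comult_hom by (simp add: algebra_hom_def)

lemma (in bialgebra) H_bimult: "bimult R H"
  by (rule assoc_algebra_bimult) unfold_locales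

lemma (in bialgebra) counit_right_sw: "h \<in> carrier H \<Longrightarrow>
    sw R H H H (\<lambda>x y. counit H y \<odot>\<^bsub>H\<^esub> x) (comult H h) = h"
  using counit_right lin_closed[OF comult_lin] by (simp add: sw_def)

lemma (in bialgebra) counit_left_sw: "h \<in> carrier H \<Longrightarrow>
    sw R H H H (\<lambda>x y. counit H x \<odot>\<^bsub>H\<^esub> y) (comult H h) = h"
  using counit_left lin_closed[OF comult_lin] by (simp add: sw_def)

text \<open>Says that \<open>ell\<close> is an isomorphism of bialgebras from \<open>H\<close> onto
  \<open>H_l(T)\<close> and that \<open>lam\<close> is the resulting coaction. The conditions are
  written in tensor powers of \<open>T\<close>, which avoids the definite descriptions in
  \<open>left_hopf\<close>; \<open>left_torsor_of_hopf_iso\<close> and \<open>left_hopf_iso\<close>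
  translate in the two directions.\<close>

locale left_torsor = left_torsor_data R T H ell lam + H: bialgebra R H
  for R :: "'k ring" (structure) and T :: "('k, 'a, 'm) torsor_scheme" and H :: "('k, 'h) bialgebra"
    and ell :: "'h \<Rightarrow> ('a, 'a) tens" and lam :: "'a \<Rightarrow> ('h, 'a) tens" +
  assumes ell_onto: "Hl_eq z \<Longrightarrow> z \<in> ell ` carrier H"
    and ell_comult: "h \<in> carrier H \<Longrightarrow>
      sw R H H T4 (\<lambda>g k. duo T4 (\<lambda>a b. duo T4 (\<lambda>c d. t4 a b c d) (ell k)) (ell g)) (comult H h) =
      duo T4 (\<lambda>a b. tri T4 (\<lambda>d e f. t4 d e f b) (\<mu> a)) (ell h)"
    and ell_counit: "h \<in> carrier H \<Longrightarrow> nabla T (ell h) = counit H h \<odot>\<^bsub>T\<^esub> \<^bold>1"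
    and ell_mult: "g \<in> carrier H \<Longrightarrow> h \<in> carrier H \<Longrightarrow> ell (g \<otimes>\<^bsub>H\<^esub> h) = ell g \<otimes>\<^bsub>T \<boxtimes> opp T\<^esub> ell h"
    and ell_one: "ell \<one>\<^bsub>H\<^esub> = t2 \<^bold>1 \<^bold>1"
begin

lemma lin_comult: "linear_map R A H f \<Longrightarrow> linear_map R A (H \<boxtimes> H) (\<lambda>x. comult H (f x))"
  by (rule lin_comp[OF _ H.comult_lin])

lemma comult_typ: "h \<in> carrier H \<Longrightarrow> comult H h \<in> carrier (H \<boxtimes> H)"
  by (rule lin_closed[OF H.comult_lin])

lemma H_one: "\<one>\<^bsub>H\<^esub> \<in> carrier H" by simp

lemmas F_simps = E_simps H.H_bimult lin_comult comult_typ H.lin_counit H.counit_closed T_one H_one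
  bimult_closed[of R] bimult_one[of R]

lemma ell_mult_sw: "g \<in> carrier H \<Longrightarrow> h \<in> carrier H \<Longrightarrow>
    ell (g \<otimes>\<^bsub>H\<^esub> h) = duo T2 (\<lambda>a b. duo T2 (\<lambda>c d. t2 (a \<bullet> c) (d \<bullet> b)) (ell h)) (ell g)"
  by (simp add: ell_mult mult_T_opT ell_typ)

text \<open>On the first factor of \<open>ell h\<close> the coaction acts as the comultiplication of
  \<open>h\<close>: after embedding, both sides are \<mu> applied to that factor.\<close>

lemma W_ell: "h \<in> carrier H \<Longrightarrow> W (ell h) = sw R H H (H \<boxtimes> T2) (\<lambda>g k. pt H T2 g (ell k)) (comult H h)"
proof -
  assume h: "h \<in> carrier H"
  have "flat R T2" using torsor_flat by (intro flat_tensor)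
  note inj_onD[OF E_inj[OF this]]
  moreover have "E T2 (W (ell h)) = E T2 (sw R H H (H \<boxtimes> T2) (\<lambda>g k. pt H T2 g (ell k)) (comult H h))"
    unfolding E_W[OF ell_typ[OF h]] ell_comult[OF h, symmetric]
    using h by (simp add: E_def F_simps cong: sw_cong2; simp add: T_fold ell_typ lin_ell H_module cong: sw_cong2)
  moreover have "sw R H H (H \<boxtimes> T2) (\<lambda>g k. pt H T2 g (ell k)) (comult H h) \<in> carrier (H \<boxtimes> T2)"
    by (intro sw_closed pure_closed ell_typ) (simp_all add: F_simps)
  ultimately show ?thesis using W_typ[OF ell_typ[OF h]] by blast
qed

definition "beta z = duo (H \<boxtimes> T) (\<lambda>a b. sw R H T (H \<boxtimes> T) (\<lambda>g t. pt H T g (t \<bullet> b)) (lam a)) z"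

text \<open>Multiply the last two factors in \<open>W_ell\<close>: \<nabla> turns \<open>ell\<close>
  into the counit and a counit axiom finishes. So \<open>ell h\<close> is the preimage of
  \<open>h \<otimes> 1\<close> under the Galois map.\<close>

lemma beta_ell: "h \<in> carrier H \<Longrightarrow> beta (ell h) = pt H T h \<^bold>1"
proof -
  assume h: "h \<in> carrier H"
  have n: "duo T (\<lambda>a b. a \<bullet> b) (ell k) = counit H k \<odot>\<^bsub>T\<^esub> \<^bold>1" if "k \<in> carrier H" for k
    using ell_counit[OF that] nabla_sw[OF ell_typ[OF that]] by simp
  have "beta (ell h) = sw R H T2 (H \<boxtimes> T) (\<lambda>g v. pt H T g (duo T (\<lambda>a b. a \<bullet> b) v)) (W (ell h))"
    using h by (simp add: beta_def W_def F_simps cong: sw_cong2)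
  also have "\<dots> = sw R H H (H \<boxtimes> T) (\<lambda>g k. pt H T g (duo T (\<lambda>a b. a \<bullet> b) (ell k))) (comult H h)"
    unfolding W_ell[OF h] using h by (simp add: F_simps cong: sw_cong2)
  also have "\<dots> = sw R H H (H \<boxtimes> T) (\<lambda>g k. pt H T (counit H k \<odot>\<^bsub>H\<^esub> g) \<^bold>1) (comult H h)"
    by (intro sw_cong) (simp_all add: n F_simps pure_smult_left pure_smult_right)
  also have "\<dots> = pt H T (sw R H H H (\<lambda>g k. counit H k \<odot>\<^bsub>H\<^esub> g) (comult H h)) \<^bold>1"
    using h by (intro pure_sw_left[symmetric]) (simp_all add: F_simps)
  finally show ?thesis by (simp add: H.counit_right_sw h)
qed

text \<open>Left colinearity of \<mu>. After embedding the factor \<open>H\<close> by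
  \<open>E\<close> it is the associativity axiom of \<mu>.\<close>

lemma lam_mu_colinear:
  assumes x: "x \<in> carrier T"
  shows "sw R H T (H \<boxtimes> T3) (\<lambda>h t. pt H T3 h (\<mu> t)) (lam x) =
    tri (H \<boxtimes> T3) (\<lambda>a b c. sw R H T (H \<boxtimes> T3) (\<lambda>h t. pt H T3 h (t3 t b c)) (lam a)) (\<mu> x)"
    (is "?l = ?r")
proof (rule inj_onD[OF E_inj])
  show "flat R T3" using torsor_flat by (intro flat_tensor)
  show "?l \<in> carrier (H \<boxtimes> T3)" "?r \<in> carrier (H \<boxtimes> T3)"
    by (intro sw_closed pure_closed mu_typ; simp add: F_simps)+
  have a: "sw R H T T5 (\<lambda>h t. duo T5 (\<lambda>p q. pt T T4 p (pt T T3 q (\<mu> t))) (ell h)) (lam x) =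
      tri T5 (\<lambda>p q t. pt T T4 p (pt T T3 q (\<mu> t))) (\<mu> x)"
    using x by (intro mu_to_lam) (simp_all add: F_simps)
  have b: "sw R H T T5 (\<lambda>h t. duo T5 (\<lambda>p q. t5 p q t b c) (ell h)) (lam a) = tri T5 (\<lambda>p q t. t5 p q t b c) (\<mu> a)"
    if "a \<in> carrier T" "b \<in> carrier T" "c \<in> carrier T" for a b c
    using that by (intro mu_to_lam) (simp_all add: F_simps)
  have c: "tri T5 (\<lambda>a b c. tri T5 (\<lambda>d e f. t5 a b d e f) (\<mu> c)) (\<mu> x) = tri T5 (\<lambda>p q t. pt T T4 p (pt T T3 q (\<mu> t))) (\<mu> x)"
    using x by (simp add: T_fold cong: sw_cong2)
  show "E T3 ?l = E T3 ?r"
    using a mu_assoc[OF x] c x by (simp add: E_def F_simps b cong: sw_cong2)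
qed

text \<open>Only the last \<open>H \<otimes> T\<close> is embedded into \<open>T3\<close>, while the
  first \<open>H\<close> stays. Then \<open>W_ell\<close> rewrites the comultiplication, and what
  remains is the colinearity of \<mu>.\<close>

lemma coassoc_lam:
  assumes x: "x \<in> carrier T"
  shows "sw R H T (H \<boxtimes> (H \<boxtimes> T)) (\<lambda>h t. sw R H H (H \<boxtimes> (H \<boxtimes> T))
      (\<lambda>g k. pt H (H \<boxtimes> T) g (pt H T k t)) (comult H h)) (lam x) =
    sw R H T (H \<boxtimes> (H \<boxtimes> T)) (\<lambda>h t. pt H (H \<boxtimes> T) h (lam t)) (lam x)"
    (is "?l = ?r")
proof (rule inj_onD[OF flat_inj_right[OF H_flat _ _ E_lin E_inj]])
  let ?P = "H \<boxtimes> T3"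
  show "?l \<in> carrier (H \<boxtimes> (H \<boxtimes> T))" "?r \<in> carrier (H \<boxtimes> (H \<boxtimes> T))"
    by (intro sw_closed pure_closed lam_typ; simp add: F_simps)+
  have w: "sw R H H ?P (\<lambda>g k. duo ?P (\<lambda>c d. pt H T3 g (t3 c d t)) (ell k)) (comult H h) =
      duo ?P (\<lambda>a b. sw R H T ?P (\<lambda>g s. pt H T3 g (t3 s b t)) (lam a)) (ell h)"
    if "h \<in> carrier H" "t \<in> carrier T" for h t
    using arg_cong[OF W_ell[OF that(1)], of "sw R H T2 ?P (\<lambda>g v. duo ?P (\<lambda>c d. pt H T3 g (t3 c d t)) v)"] that
    by (simp add: W_def F_simps cong: sw_cong2)
  have m: "sw R H T ?P (\<lambda>h t. duo ?P (\<lambda>a b. sw R H T ?P (\<lambda>g s. pt H T3 g (t3 s b t)) (lam a)) (ell h)) (lam x) =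
      tri ?P (\<lambda>a b t. sw R H T ?P (\<lambda>g s. pt H T3 g (t3 s b t)) (lam a)) (\<mu> x)"
    using x by (intro mu_to_lam) (simp_all add: F_simps)
  have l: "sw R H (H \<boxtimes> T) ?P (\<lambda>h w. pt H T3 h (E T w)) ?l =
      sw R H T ?P (\<lambda>h t. sw R H H ?P (\<lambda>g k. duo ?P (\<lambda>c d. pt H T3 g (t3 c d t)) (ell k)) (comult H h)) (lam x)"
    using x by (simp add: E_def F_simps cong: sw_cong2)
  have r: "sw R H (H \<boxtimes> T) ?P (\<lambda>h w. pt H T3 h (E T w)) ?r =
      sw R H T ?P (\<lambda>h t. pt H T3 h (\<mu> t)) (lam x)"
  proof -
    have "sw R H (H \<boxtimes> T) ?P (\<lambda>h w. pt H T3 h (E T w)) ?r =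
      sw R H T ?P (\<lambda>h t. pt H T3 h (E T (lam t))) (lam x)"
      using x by (simp add: lin_comp[OF _ E_lin[OF T_module]] lin_closed[OF E_lin[OF T_module]] F_simps cong: sw_cong2)
    then show ?thesis using x by (simp add: F_simps E_lam cong: sw_cong2)
  qed
  show "sw R H (H \<boxtimes> T) ?P (\<lambda>h w. pt H T3 h (E T w)) ?l =
      sw R H (H \<boxtimes> T) ?P (\<lambda>h w. pt H T3 h (E T w)) ?r"
    unfolding l r lam_mu_colinear[OF x] m[symmetric] using x by (intro sw_cong w) (simp_all add: F_simps)
qed (simp_all add: F_simps torsor_flat)

text \<open>Multiplying all three factors of \<mu> gives back \<open>x\<close> by a unit axiom,
  while \<nabla> on the first two factors is the counit.\<close>

lemma counit_lam:
  assumes x: "x \<in> carrier T"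
  shows "sw R H T T (\<lambda>h y. counit H h \<odot>\<^bsub>T\<^esub> y) (lam x) = x"
proof -
  have n: "duo T (\<lambda>a b. a \<bullet> b) (ell k) = counit H k \<odot>\<^bsub>T\<^esub> \<^bold>1" if "k \<in> carrier H" for k
    using ell_counit[OF that] nabla_sw[OF ell_typ[OF that]] by simp
  have "sw R H T T (\<lambda>h t. duo T (\<lambda>a b. (a \<bullet> b) \<bullet> t) (ell h)) (lam x) = tri T (\<lambda>a b c. (a \<bullet> b) \<bullet> c) (\<mu> x)"
    using x by (intro mu_to_lam) (simp_all add: F_simps)
  also have "\<dots> = x"
    using arg_cong[OF mu_nabla_left[OF x], of "duo T (\<lambda>p q. p \<bullet> q)"] x by (simp add: F_simps cong: sw_cong2)
  also have "sw R H T T (\<lambda>h t. duo T (\<lambda>a b. (a \<bullet> b) \<bullet> t) (ell h)) (lam x) =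
      sw R H T T (\<lambda>h t. duo T (\<lambda>a b. a \<bullet> b) (ell h) \<bullet> t) (lam x)"
    by (simp add: F_simps cong: sw_cong2)
  also have "\<dots> = sw R H T T (\<lambda>h y. counit H h \<odot>\<^bsub>T\<^esub> y) (lam x)"
    by (simp add: n F_simps mult_smult[of R] cong: sw_cong2)
  finally show ?thesis .
qed

lemma lam_one: "lam \<^bold>1 = pt H T \<one>\<^bsub>H\<^esub> \<^bold>1"
proof (rule inj_onD[OF E_inj[OF torsor_flat]])
  show "E T (lam \<^bold>1) = E T (pt H T \<one>\<^bsub>H\<^esub> \<^bold>1)"
    by (simp add: E_lam mu_one F_simps) (simp add: E_def F_simps ell_one)
qed (simp_all add: F_simps)

text \<open>\<open>ell\<close> and \<mu> are multiplicative for the same product, opposite in the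
  second factor, so the two sides agree after applying the injective \<open>E\<close>.\<close>

lemma lam_mult:
  assumes x: "x \<in> carrier T" and y: "y \<in> carrier T"
  shows "lam (x \<bullet> y) = lam x \<otimes>\<^bsub>H \<boxtimes> T\<^esub> lam y"
proof (rule inj_onD[OF E_inj[OF torsor_flat]])
  have m: "lam x \<otimes>\<^bsub>H \<boxtimes> T\<^esub> lam y = sw R H T (H \<boxtimes> T) (\<lambda>h s. sw R H T (H \<boxtimes> T)
      (\<lambda>k t. pt H T (h \<otimes>\<^bsub>H\<^esub> k) (s \<bullet> t)) (lam y)) (lam x)"
    using x y by (simp add: tensor_mult F_simps)
  show "lam x \<otimes>\<^bsub>H \<boxtimes> T\<^esub> lam y \<in> carrier (H \<boxtimes> T)" using x y by (simp add: F_simps)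
  have a: "sw R H T T3 (\<lambda>h s. duo T3 (\<lambda>a b. tri T3 (\<lambda>d e f. t3 (a \<bullet> d) (e \<bullet> b) (s \<bullet> f)) (\<mu> y)) (ell h)) (lam x) =
      tri T3 (\<lambda>a b s. tri T3 (\<lambda>d e f. t3 (a \<bullet> d) (e \<bullet> b) (s \<bullet> f)) (\<mu> y)) (\<mu> x)"
    using x y by (intro mu_to_lam) (simp_all add: F_simps)
  have b: "tri T3 (\<lambda>d e f. t3 (a \<bullet> d) (e \<bullet> b) (s \<bullet> f)) (\<mu> y) =
      sw R H T T3 (\<lambda>k t. duo T3 (\<lambda>d e. t3 (a \<bullet> d) (e \<bullet> b) (s \<bullet> t)) (ell k)) (lam y)"
    if "a \<in> carrier T" "b \<in> carrier T" "s \<in> carrier T" for a b s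
    using y that by (intro mu_to_lam[symmetric]) (simp_all add: F_simps)
  have c: "sw R H T T3 (\<lambda>k t. duo T3 (\<lambda>a b. duo T3 (\<lambda>d e. t3 (a \<bullet> d) (e \<bullet> b) (s \<bullet> t)) (ell k)) (ell h)) (lam y) =
      duo T3 (\<lambda>a b. sw R H T T3 (\<lambda>k t. duo T3 (\<lambda>d e. t3 (a \<bullet> d) (e \<bullet> b) (s \<bullet> t)) (ell k)) (lam y)) (ell h)"
    if "s \<in> carrier T" for s h
    using that by (intro sw_swap) (simp_all add: F_simps)
  have "E T (lam x \<otimes>\<^bsub>H \<boxtimes> T\<^esub> lam y) = sw R H T T3 (\<lambda>h s. sw R H T T3 (\<lambda>k t. duo T3 (\<lambda>a b. duo T3
      (\<lambda>d e. t3 (a \<bullet> d) (e \<bullet> b) (s \<bullet> t)) (ell k)) (ell h)) (lam y)) (lam x)"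
    unfolding m using x y by (simp add: E_def F_simps ell_mult_sw cong: sw_cong2)
  also have "\<dots> = \<mu> (x \<bullet> y)"
    unfolding mu_mult[OF x y] a[symmetric] using x y by (simp add: F_simps b c cong: sw_cong2)
  finally show "E T (lam (x \<bullet> y)) = E T (lam x \<otimes>\<^bsub>H \<boxtimes> T\<^esub> lam y)" using x y by (simp add: E_lam F_simps)
qed (use x y in \<open>simp_all add: F_simps\<close>)

lemma lam_hom: "algebra_hom R T (H \<boxtimes> T) lam"
  unfolding algebra_hom_def ring_hom_def
  using lam_lin lam_mult lam_one lin_add[OF lam_lin] lam_typ by (auto simp: tensor_one)

lemma left_comodule: "left_comodule_algebra R H T lam"
proof -
  have t: "tensor_map R (H \<boxtimes> H) T (comult H) id (lam x) = sw R H T ((H \<boxtimes> H) \<boxtimes> T)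
      (\<lambda>h t. pt (H \<boxtimes> H) T (comult H h) t) (lam x)" if "x \<in> carrier T" for x
    using that by (simp add: tensor_map_sw[OF lam_typ])
  have "assoc R H H T (tensor_map R (H \<boxtimes> H) T (comult H) id (lam x)) =
      sw R H T (H \<boxtimes> (H \<boxtimes> T)) (\<lambda>h t. sw R H H (H \<boxtimes> (H \<boxtimes> T))
      (\<lambda>g k. pt H (H \<boxtimes> T) g (pt H T k t)) (comult H h)) (lam x)" if "x \<in> carrier T" for x
    unfolding t[OF that] using that by (simp add: assoc_sw F_simps cong: sw_cong2)
  moreover have "tensor_map R H (H \<boxtimes> T) id lam (lam x) =
      sw R H T (H \<boxtimes> (H \<boxtimes> T)) (\<lambda>h t. pt H (H \<boxtimes> T) h (lam t)) (lam x)" if "x \<in> carrier T" for x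
    using that by (simp add: tensor_map_sw[OF lam_typ])
  moreover have "tensor_lift T (\<lambda>h y. counit H h \<odot>\<^bsub>T\<^esub> y) (lam x) = x" if "x \<in> carrier T" for x
    using counit_lam[OF that] lam_typ[OF that] by (simp add: sw_def)
  ultimately show ?thesis
    by (intro left_comodule_algebra.intro left_comodule_algebra_axioms.intro T_alg H.bialgebra_axioms lam_hom)
      (simp_all add: coassoc_lam)
qed

text \<open>For a coinvariant \<open>t\<close> the element \<open>\<mu> t\<close> is
  \<open>1 \<otimes> 1 \<otimes> t\<close>. Multiplying its last two factors gives
  \<open>1 \<otimes> t\<close>, and by the unit axiom also \<open>t \<otimes> 1\<close>, so descent
  applies.\<close>

lemma left_coinvariant:
  assumes t: "t \<in> carrier T" and e: "lam t = pt H T \<one>\<^bsub>H\<^esub> t"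
  shows "t \<in> (\<lambda>c. c \<odot>\<^bsub>T\<^esub> \<^bold>1) ` carrier R"
proof (rule ff_descent[OF T_alg torsor_faithfully_flat t])
  have "\<mu> t = t3 \<^bold>1 \<^bold>1 t"
    using E_lam[OF t] t unfolding e by (simp add: E_def F_simps ell_one)
  then show "t2 t \<^bold>1 = t2 \<^bold>1 t"
    using mu_nabla_right[OF t] t by (simp add: F_simps)
qed

lemma galois_ell:
  assumes x: "x \<in> carrier T" and y: "y \<in> carrier T"
  shows "sw R H T T2 (\<lambda>g s. duo T2 (\<lambda>a b. t2 a (b \<bullet> (s \<bullet> y))) (ell g)) (lam x) = t2 x y"
proof -
  have "sw R H T T2 (\<lambda>g s. duo T2 (\<lambda>a b. t2 a (b \<bullet> (s \<bullet> y))) (ell g)) (lam x) =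
      tri T2 (\<lambda>a b c. t2 a (b \<bullet> (c \<bullet> y))) (\<mu> x)"
    using x y by (intro mu_to_lam) (simp_all add: F_simps)
  also have "\<dots> = t2 x y"
    using arg_cong[OF mu_nabla_right[OF x], of "duo T2 (\<lambda>p q. t2 p (q \<bullet> y))"] x y
    by (simp add: F_simps T_assoc cong: sw_cong2)
  finally show ?thesis .
qed

text \<open>The inverse of the Galois map sends \<open>h \<otimes> y\<close> to \<open>ell h\<close>
  with its second factor multiplied by \<open>y\<close> on the right. One composite is
  \<open>galois_ell\<close>; the other follows from \<open>beta_ell\<close> by right linearity over
  \<open>T\<close>.\<close>

lemma left_galois: "left_galois R H T lam"
proof (intro left_galois.intro left_galois_axioms.intro left_comodule)
  show "bij_betw (\<lambda>c. c \<odot>\<^bsub>T\<^esub> \<^bold>1) (carrier R) {t \<in> carrier T. lam t = pt H T \<one>\<^bsub>H\<^esub> t}"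
    unfolding bij_betw_def
  proof (intro conjI equalityI subsetI)
    fix t assume "t \<in> (\<lambda>c. c \<odot>\<^bsub>T\<^esub> \<^bold>1) ` carrier R"
    then obtain c where c: "c \<in> carrier R" "t = c \<odot>\<^bsub>T\<^esub> \<^bold>1" by auto
    then show "t \<in> {t \<in> carrier T. lam t = pt H T \<one>\<^bsub>H\<^esub> t}"
      using lin_smult[OF lam_lin c(1) T_one]
      by (simp add: lam_one pure_smult_right[OF H_module T_module])
  qed (use left_coinvariant ff_unit_inj[OF T_alg torsor_faithfully_flat] in auto)
  let ?b = "tensor_lift (H \<boxtimes> T) (\<lambda>x y. tensor_map R H T id (\<lambda>x0. x0 \<bullet> y) (lam x))"
  have b: "?b z = beta z" if "z \<in> carrier T2" for z
    unfolding beta_def using that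
    by (intro lift_cong) (simp_all add: T_module tensor_map_sw[OF lam_typ])
  let ?g = "sw R H T T2 (\<lambda>h y. duo T2 (\<lambda>a b. t2 a (b \<bullet> y)) (ell h))"
  have gb: "?g (beta z) = z" if "z \<in> carrier T2" for z
    using that unfolding beta_def by (simp add: F_simps galois_ell cong: sw_cong2)
  have be: "beta (duo T2 (\<lambda>a b. t2 a (b \<bullet> y)) (ell h)) = pt H T h y"
    if "h \<in> carrier H" "y \<in> carrier T" for h y
    using arg_cong[OF beta_ell[OF that(1)], of "sw R H T (H \<boxtimes> T) (\<lambda>g t. pt H T g (t \<bullet> y))"] that
    by (simp add: beta_def F_simps T_assoc cong: sw_cong2)
  have bg: "beta (?g w) = w" if w: "w \<in> carrier (H \<boxtimes> T)" for w
  proof -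
    have bl: "linear_map R T2 (H \<boxtimes> T) beta" by (simp add: beta_def[abs_def] F_simps)
    have "beta (?g w) = sw R H T (H \<boxtimes> T) (\<lambda>h y. beta (duo T2 (\<lambda>a b. t2 a (b \<bullet> y)) (ell h))) w"
      by (rule lin_sw_apply[OF _ _ _ _ bl]) (simp_all add: F_simps)
    then show ?thesis using w by (simp add: be F_simps cong: sw_cong2)
  qed
  show "bij_betw ?b (carrier T2) (carrier (H \<boxtimes> T))"
  proof (rule bij_betw_byWitness[where f' = ?g])
    show "?b ` carrier T2 \<subseteq> carrier (H \<boxtimes> T)"
      using b by (auto simp: beta_def F_simps)
    show "?g ` carrier (H \<boxtimes> T) \<subseteq> carrier T2" by (auto simp: F_simps)
    then show "\<forall>w\<in>carrier (H \<boxtimes> T). ?b (?g w) = w" using b bg by auto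
    show "\<forall>z\<in>carrier T2. ?g (?b z) = z" using b gb by auto
  qed
qed

end

section \<open>The Hopf algebra \<open>H_l(T)\<close> and its coaction\<close>

context quantum_torsor
begin

lemma left_hopf_fields:
  "carrier (left_hopf R T) = {z. Hl_eq z}" "add (left_hopf R T) = add T2" "\<zero>\<^bsub>left_hopf R T\<^esub> = \<zero>\<^bsub>T2\<^esub>"
  "smult (left_hopf R T) = smult T2" "monoid.mult (left_hopf R T) = monoid.mult (T \<boxtimes> opp T)"
  "\<one>\<^bsub>left_hopf R T\<^esub> = t2 \<^bold>1 \<^bold>1"
proof -
  have s: "same (T \<boxtimes> opp T) T2" by (intro same_rules)
  have "carrier (left_hopf R T) = carrier (left_algebra R T)" by (simp add: left_hopf_def Let_def with_coalgebra_def)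
  then show "carrier (left_hopf R T) = {z. Hl_eq z}" using conv_left_algebra by blast
  show "add (left_hopf R T) = add T2" "\<zero>\<^bsub>left_hopf R T\<^esub> = \<zero>\<^bsub>T2\<^esub>" "smult (left_hopf R T) = smult T2"
    "monoid.mult (left_hopf R T) = monoid.mult (T \<boxtimes> opp T)"
    using s by (simp_all add: left_hopf_def Let_def with_coalgebra_def left_algebra_def same_def)
  have "pt T (opp T) = pt T T" by (intro same_pure same_rules)
  then show "\<one>\<^bsub>left_hopf R T\<^esub> = t2 \<^bold>1 \<^bold>1"
    by (simp add: left_hopf_def Let_def with_coalgebra_def left_algebra_def tensor_one opp_simps)
qed

lemma left_hopf_module: "module R (left_hopf R T)"
proof -
  have "{z. Hl_eq z} = {z \<in> carrier T2. duo T4 (\<lambda>a b. tri T4 (\<lambda>d e f. t4 d e (\<theta> f) b) (\<mu> a)) z =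
      duo T4 (\<lambda>a b. tri T4 (\<lambda>d e f. t4 a f e d) (\<mu> b)) z}" by (auto simp: Hl_eq_def)
  moreover have "submodule \<dots> R T2"
    by (rule equalizer_submodule[of _ _ T4]) (simp_all add: T_simps)
  ultimately have "module R (T2\<lparr>carrier := {z. Hl_eq z}\<rparr>)"
    using submodule_module[of "{z. Hl_eq z}" R T2] by (simp add: T_simps)
  then show ?thesis by (rule same_module[rotated]) (simp add: same_def left_hopf_fields)
qed

text \<open>Justifies the description in the counit: the scalar exists because \<nabla> is scalar on
  \<open>H_l(T)\<close>, and it is unique because \<open>k \<rightarrow> T\<close> is
  injective.\<close>

lemma left_hopf_counit:
  assumes "Hl_eq z" "c \<in> carrier R"
  shows "counit (left_hopf R T) z = c \<longleftrightarrow> nabla T z = c \<odot>\<^bsub>T\<^esub> \<^bold>1"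
proof -
  note inj = inj_onD[OF ff_unit_inj[OF T_alg torsor_faithfully_flat]]
  obtain d where d: "d \<in> carrier R" "nabla T z = d \<odot>\<^bsub>T\<^esub> \<^bold>1" using Hl_nabla_scalar[OF assms(1)] by auto
  have "counit (left_hopf R T) z = (THE c. c \<in> carrier R \<and> nabla T z = c \<odot>\<^bsub>T\<^esub> \<^bold>1)"
    by (simp add: left_hopf_def Let_def with_coalgebra_def)
  also have "\<dots> = d" using d inj by (intro the_equality) auto
  finally show ?thesis using d inj assms(2) by auto
qed

end

locale left_onto = left_ell R T H ell
  for R :: "'k ring" (structure) and T :: "('k, 'a, 'm) torsor_scheme" and H :: "('k, 'h, 'n) module_scheme"
    and ell :: "'h \<Rightarrow> ('a, 'a) tens" +
  assumes ell_onto: "Hl_eq z \<Longrightarrow> z \<in> ell ` carrier H"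
begin

abbreviation "L \<equiv> left_hopf R T"
abbreviation "i \<equiv> inv_into (carrier H) ell"

lemma L_typ: "l \<in> carrier L \<Longrightarrow> l \<in> carrier T2" by (simp add: left_hopf_fields Hl_eq_def)

lemma ell_L: "linear_map R H L ell"
  using ell_lin ell_Hl by (auto simp: linear_map_def left_hopf_fields)

lemma L_T2: "linear_map R L T2 (\<lambda>x. x)"
  using L_typ by (auto simp: linear_map_def left_hopf_fields)

lemma i_ell: "h \<in> carrier H \<Longrightarrow> i (ell h) = h" by (rule inv_into_f_f[OF ell_inj])

lemma ell_i: "l \<in> carrier L \<Longrightarrow> ell (i l) = l"
  using ell_onto by (simp add: left_hopf_fields f_inv_into_f)

lemma i_lin: "linear_map R L H i"
proof (rule lin_of_inj[OF H_module ell_lin ell_inj left_hopf_module])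
  show "i l \<in> carrier H" if "l \<in> carrier L" for l
    using that ell_onto by (auto simp: left_hopf_fields intro: inv_into_into)
  show "linear_map R L T2 (\<lambda>x. ell (i x))"
    using L_T2 lin_cong[of L "\<lambda>x. ell (i x)" "\<lambda>x. x" R T2] ell_i left_hopf_module by blast
qed

lemmas L_simps = E_simps0 left_hopf_module L_typ lin_comp[OF _ ell_L] lin_comp[OF _ i_lin] lin_comp[OF _ L_T2]
  lin_closed[OF ell_L] lin_closed[OF i_lin] i_ell ell_i

lemma E_i:
  assumes w: "w \<in> carrier (L \<boxtimes> T)"
  shows "assoc R T (opp T) T (tensor_map R (T \<boxtimes> opp T) T id id w) = E T (sw R L T (H \<boxtimes> T) (\<lambda>l t. pt H T (i l) t) w)"
  using w by (simp add: opp_all tensor_map_sw[OF w] E_def assoc_sw L_simps cong: sw_cong2)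

text \<open>Regroup \<mu> as an element of \<open>T2 \<otimes> T\<close>. The axiom on \<theta> says
  that its first component satisfies the equation of \<open>H_l(T)\<close> after tensoring with
  \<open>T\<close>. Flatness of \<open>T\<close> makes it an honest element of
  \<open>H_l(T) \<otimes> T\<close>, hence of \<open>H \<otimes> T\<close>.\<close>

lemma coaction_exists:
  assumes x: "x \<in> carrier T"
  obtains w where "w \<in> carrier (H \<boxtimes> T)" "E T w = \<mu> x"
proof -
  let ?A = "duo T4 (\<lambda>a b. tri T4 (\<lambda>d e f. t4 d e (\<theta> f) b) (\<mu> a))"
  let ?B = "duo T4 (\<lambda>a b. tri T4 (\<lambda>d e f. t4 a f e d) (\<mu> b))"
  let ?m = "tri (T2 \<boxtimes> T) (\<lambda>a b c. pt T2 T (t2 a b) c) (\<mu> x)"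
  have A: "linear_map R T2 T4 ?A" and B: "linear_map R T2 T4 ?B" by (simp_all add: T_simps)
  have m: "?m \<in> carrier (T2 \<boxtimes> T)" using x by (simp add: T_simps)
  have e: "sw R T2 T (T4 \<boxtimes> T) (\<lambda>v t. pt T4 T (?A v) t) ?m =
      sw R T2 T (T4 \<boxtimes> T) (\<lambda>v t. pt T4 T (?B v) t) ?m"
    using arg_cong[OF mu_theta[OF x], of "ev5 (T4 \<boxtimes> T) (\<lambda>p q r s c. pt T4 T (t4 p q r s) c)"] x
    by (simp add: T_simps cong: sw_cong2)
  have o: "z \<in> ell ` carrier H" if "z \<in> carrier T2" "?A z = ?B z" for z
    using that by (intro ell_onto) (simp add: Hl_eq_def)
  obtain w where w: "w \<in> carrier (H \<boxtimes> T)" "?m = sw R H T (T2 \<boxtimes> T) (\<lambda>h t. pt T2 T (ell h) t) w"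
    by (rule flat_equalizer_left[OF torsor_flat _ _ A B H_module ell_lin m e o]) (simp_all only: tensor_module T_module)
  have "\<mu> x = assoc R T T T ?m"
    using x m by (simp add: assoc_sw T_simps cong: sw_cong2)
  also have "\<dots> = E T w"
    unfolding w(2) using w(1) by (simp add: assoc_sw E_def L_simps cong: sw_cong2)
  finally show ?thesis using that w(1) by simp
qed

definition "lamT x = tensor_map R H T i id (left_torsor_coaction R T x)"

text \<open>Existence from \<open>coaction_exists\<close> and uniqueness from injectivity of
  \<open>E\<close> make the description in \<open>left_torsor_coaction\<close> meaningful. The maps
  \<open>?l\<close> and \<open>?i\<close> change between \<open>H\<close> and
  \<open>H_l(T)\<close>.\<close>

lemma lamT: assumes x: "x \<in> carrier T" shows "lamT x \<in> carrier (H \<boxtimes> T)" "E T (lamT x) = \<mu> x"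
proof -
  obtain w where w: "w \<in> carrier (H \<boxtimes> T)" "E T w = \<mu> x" using coaction_exists[OF x] .
  let ?l = "sw R H T (L \<boxtimes> T) (\<lambda>h t. pt L T (ell h) t)"
  let ?i = "sw R L T (H \<boxtimes> T) (\<lambda>l t. pt H T (i l) t)"
  have li: "?l (?i v) = v" if "v \<in> carrier (L \<boxtimes> T)" for v using that by (simp add: L_simps cong: sw_cong2)
  have il: "?i (?l v) = v" if "v \<in> carrier (H \<boxtimes> T)" for v using that by (simp add: L_simps cong: sw_cong2)
  have lw: "?l w \<in> carrier (L \<boxtimes> T)" by (simp add: L_simps)
  have "left_torsor_coaction R T x = ?l w"
    unfolding left_torsor_coaction_def
  proof (rule the_equality)
    show "?l w \<in> carrier (L \<boxtimes> T) \<and> assoc R T (opp T) T (tensor_map R (T \<boxtimes> opp T) T id id (?l w)) = \<mu> x"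
      using lw by (simp only: E_i[OF lw] il[OF w(1)] w(2))
    fix v assume v: "v \<in> carrier (L \<boxtimes> T) \<and> assoc R T (opp T) T (tensor_map R (T \<boxtimes> opp T) T id id v) = \<mu> x"
    have "?i v = w"
    proof (rule inj_onD[OF E_inj[OF torsor_flat] _ _ w(1)])
      show "E T (?i v) = E T w" using v E_i[of v] w(2) by simp
      show "?i v \<in> carrier (H \<boxtimes> T)" by (simp add: L_simps)
    qed
    then show "v = ?l w" using li[of v] v by simp
  qed
  then have "lamT x = ?i (?l w)" unfolding lamT_def by (simp only: tensor_map_sw[OF lw] id_apply)
  then show "lamT x \<in> carrier (H \<boxtimes> T)" "E T (lamT x) = \<mu> x" using il[OF w(1)] w by simp_all
qed

lemma left_torsor_data: "left_torsor_data R T H ell lamT"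
  by unfold_locales (use lamT in \<open>simp_all add: E_def\<close>)

definition "E2 v = sw R H H T4 (\<lambda>g k. duo T4 (\<lambda>a b. duo T4 (\<lambda>c d. t4 a b c d) (ell k)) (ell g)) v"

lemma E2_eq: "v \<in> carrier (H \<boxtimes> H) \<Longrightarrow> E2 v = E T2 (sw R H H (H \<boxtimes> T2) (\<lambda>g k. pt H T2 g (ell k)) v)"
  by (simp add: E2_def E_def E_simps0 cong: sw_cong2; simp add: T_fold ell_typ lin_ell H_module cong: sw_cong2)

text \<open>A composite of two embeddings: the second \<open>H\<close> is embedded using flatness of
  \<open>H\<close>, then the first one using flatness of \<open>T2\<close>.\<close>

lemma E2_inj: "inj_on E2 (carrier (H \<boxtimes> H))"
proof (rule inj_onI)
  fix v w assume v: "v \<in> carrier (H \<boxtimes> H)" and w: "w \<in> carrier (H \<boxtimes> H)" and e: "E2 v = E2 w"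
  let ?j = "sw R H H (H \<boxtimes> T2) (\<lambda>g k. pt H T2 g (ell k))"
  have f: "flat R T2" using torsor_flat by (intro flat_tensor)
  have t: "?j u \<in> carrier (H \<boxtimes> T2)" for u by (simp add: E_simps0)
  have "?j v = ?j w" using e E2_eq[OF v] E2_eq[OF w] by (intro inj_onD[OF E_inj[OF f] _ t t]) simp
  moreover have "inj_on ?j (carrier (H \<boxtimes> H))"
    by (rule flat_inj_right[OF H_flat H_module _ ell_lin ell_inj]) (simp add: T_simps)
  ultimately show "v = w" using v w by (blast dest: inj_onD)
qed

text \<open>Evaluates the description of the comultiplication of \<open>H_l(T)\<close> as soon as an
  element \<open>v\<close> of \<open>H \<otimes> H\<close> with the prescribed image in
  \<open>T4\<close> is known.\<close>

lemma comult_eq: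
  assumes h: "h \<in> carrier H" and v: "v \<in> carrier (H \<boxtimes> H)"
    and e: "E2 v = duo T4 (\<lambda>a b. tri T4 (\<lambda>d e f. t4 d e f b) (\<mu> a)) (ell h)"
  shows "comult L (ell h) = tensor_map R L L ell ell v"
proof -
  let ?l = "sw R H H (L \<boxtimes> L) (\<lambda>g k. pt L L (ell g) (ell k))"
  let ?i = "sw R L L (H \<boxtimes> H) (\<lambda>g k. pt H H (i g) (i k))"
  have li: "?l (?i v) = v" if "v \<in> carrier (L \<boxtimes> L)" for v using that by (simp add: L_simps cong: sw_cong2)
  have il: "?i (?l v) = v" if "v \<in> carrier (H \<boxtimes> H)" for v using that by (simp add: L_simps cong: sw_cong2)
  have Ei: "assoc R T (opp T) (T \<boxtimes> opp T) (tensor_map R (T \<boxtimes> opp T) (T \<boxtimes> opp T) id id w) = E2 (?i w)"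
    if w: "w \<in> carrier (L \<boxtimes> L)" for w
    using w by (simp add: opp_all tensor_map_sw[OF w] E2_def assoc_sw L_simps cong: sw_cong2; simp add: T_fold L_simps cong: sw_cong2)
  have lv: "?l v \<in> carrier (L \<boxtimes> L)" by (simp add: L_simps)
  have "comult L (ell h) = (THE w. w \<in> carrier (L \<boxtimes> L) \<and>
      assoc R T (opp T) (T \<boxtimes> opp T) (tensor_map R (T \<boxtimes> opp T) (T \<boxtimes> opp T) id id w) = E2 v)"
  proof -
    have "same L (left_algebra R T)" by (simp add: same_def left_hopf_def Let_def with_coalgebra_def)
    from same_carrier[OF same_tensor[OF this this, of R]]
    have "carrier (left_algebra R T \<boxtimes> left_algebra R T) = carrier (L \<boxtimes> L)" ..
    then show ?thesis using conv_left_comult[OF ell_typ[OF h]]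
      by (simp add: e left_hopf_def Let_def with_coalgebra_def)
  qed
  also have "\<dots> = ?l v"
  proof (rule the_equality)
    show "?l v \<in> carrier (L \<boxtimes> L) \<and>
      assoc R T (opp T) (T \<boxtimes> opp T) (tensor_map R (T \<boxtimes> opp T) (T \<boxtimes> opp T) id id (?l v)) = E2 v"
      using lv by (simp only: Ei[OF lv] il[OF v])
    fix w assume w: "w \<in> carrier (L \<boxtimes> L) \<and>
      assoc R T (opp T) (T \<boxtimes> opp T) (tensor_map R (T \<boxtimes> opp T) (T \<boxtimes> opp T) id id w) = E2 v"
    have t: "?i w \<in> carrier (H \<boxtimes> H)" by (simp add: L_simps)
    have "E2 (?i w) = E2 v" using w Ei[of w] by simp
    then have "?i w = v" by (rule inj_onD[OF E2_inj _ t v])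
    then show "w = ?l v" using li[of w] w by simp
  qed
  also have "\<dots> = tensor_map R L L ell ell v" by (rule tensor_map_sw[OF v, symmetric])
  finally show ?thesis .
qed

end

context quantum_torsor
begin

lemma left_onto_of_iso:
  assumes H: "flat R H" and iso: "algebra_iso R H (left_hopf R T) ell"
  shows "left_onto R T H ell"
proof -
  have bij: "bij_betw ell (carrier H) {z. Hl_eq z}" and lin: "linear_map R H (left_hopf R T) ell"
    using iso by (simp_all add: algebra_iso_def algebra_hom_def left_hopf_fields)
  show ?thesis
  proof unfold_locales
    show "linear_map R H T2 ell" using lin by (auto simp: linear_map_def left_hopf_fields Hl_eq_def)
    show "inj_on ell (carrier H)" using bij by (rule bij_betw_imp_inj_on)
    show "Hl_eq (ell h)" if "h \<in> carrier H" for h using bij that by (auto simp: bij_betw_def)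
    show "z \<in> ell ` carrier H" if "Hl_eq z" for z using bij that by (auto simp: bij_betw_def)
  qed (fact H)
qed

lemma left_torsor_of_hopf_iso:
  assumes H: "flat R H" and bi: "bialgebra R H" and iso: "hopf_iso R H (left_hopf R T) ell"
  shows "left_torsor R T H ell (left_onto.lamT R T H ell)"
proof -
  have alg: "algebra_iso R H (left_hopf R T) ell" using iso by (simp add: hopf_iso_def)
  interpret left_onto R T H ell by (rule left_onto_of_iso[OF H alg])
  interpret D: left_torsor_data R T H ell lamT by (rule left_torsor_data)
  interpret H: bialgebra R H by (rule bi)
  show ?thesis
  proof unfold_locales
    show "z \<in> ell ` carrier H" if "Hl_eq z" for z by (rule ell_onto[OF that])
    show "ell (g \<otimes>\<^bsub>H\<^esub> h) = ell g \<otimes>\<^bsub>T \<boxtimes> opp T\<^esub> ell h" if "g \<in> carrier H" "h \<in> carrier H" for g h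
      using alg that by (simp add: algebra_iso_def algebra_hom_def ring_hom_def left_hopf_fields)
    show "ell \<one>\<^bsub>H\<^esub> = t2 \<^bold>1 \<^bold>1"
      using alg by (simp add: algebra_iso_def algebra_hom_def ring_hom_def left_hopf_fields)
    fix h assume h: "h \<in> carrier H"
    show "nabla T (ell h) = counit H h \<odot>\<^bsub>T\<^esub> \<^bold>1"
      using iso h left_hopf_counit[OF ell_Hl[OF h] H.counit_closed[OF h]] by (simp add: hopf_iso_def)
    \<comment> \<open>By \<open>W_Hl\<close> the coaction on the first factor of
      \<open>ell h\<close> lies in \<open>H \<otimes> H\<close>, which provides a candidate for the
      comultiplication. Both \<open>v\<close> and \<open>comult H h\<close> are sent to the
      comultiplication of \<open>ell h\<close> in \<open>H_l(T)\<close>, so they coincide.\<close>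
    obtain v where v: "v \<in> carrier (H \<boxtimes> H)"
      "D.W (ell h) = sw R H H (H \<boxtimes> T2) (\<lambda>h b. pt H T2 h (ell b)) v"
      using D.W_Hl[OF ell_Hl[OF h] H_module ell_lin ell_onto] by metis
    have e: "E2 v = duo T4 (\<lambda>a b. tri T4 (\<lambda>d e f. t4 d e f b) (\<mu> a)) (ell h)"
      using D.E_W[OF ell_typ[OF h]] E2_eq[OF v(1)] v(2) by simp
    have dh: "comult H h \<in> carrier (H \<boxtimes> H)" using h by (rule lin_closed[OF H.comult_lin])
    have "tensor_map R L L ell ell v = tensor_map R L L ell ell (comult H h)"
      using comult_eq[OF h v(1) e] iso h by (simp add: hopf_iso_def)
    from arg_cong[OF this, of "sw R L L (H \<boxtimes> H) (\<lambda>g k. pt H H (i g) (i k))"]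
    have "v = comult H h"
      using v(1) dh by (simp add: tensor_map_sw[OF v(1)] tensor_map_sw[OF dh] L_simps cong: sw_cong2)
    then show "sw R H H T4 (\<lambda>g k. duo T4 (\<lambda>a b. duo T4 (\<lambda>c d. t4 a b c d) (ell k)) (ell g)) (comult H h) =
      duo T4 (\<lambda>a b. tri T4 (\<lambda>d e f. t4 d e f b) (\<mu> a)) (ell h)" using e by (simp add: E2_def)
  qed
qed

end

context left_torsor
begin

lemma left_onto: "left_onto R T H ell"
  by unfold_locales (rule ell_onto)

lemma left_hopf_iso: "hopf_iso R H (left_hopf R T) ell"
proof -
  interpret O: left_onto R T H ell by (rule left_onto)
  have "bij_betw ell (carrier H) {z. Hl_eq z}"
    using ell_inj ell_Hl ell_onto by (auto simp: bij_betw_def)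
  then have "algebra_iso R H (left_hopf R T) ell"
    using O.ell_L ell_mult ell_one lin_add[OF O.ell_L] lin_closed[OF O.ell_L]
    by (auto simp: algebra_iso_def algebra_hom_def ring_hom_def left_hopf_fields)
  moreover have "comult (left_hopf R T) (ell h) = tensor_map R (left_hopf R T) (left_hopf R T) ell ell (comult H h)"
    if "h \<in> carrier H" for h
    using ell_comult[OF that] that by (intro O.comult_eq) (simp_all add: O.E2_def comult_typ)
  ultimately show ?thesis
    using left_hopf_counit[OF ell_Hl H.counit_closed] ell_counit by (auto simp: hopf_iso_def)
qed

text \<open>The coaction recovered from the torsor is the one started with, since \<open>E\<close>
  sends both to \<mu>. This makes the passage from bi-Galois objects to torsors and back the
  identity on coactions.\<close>

lemma lamT_eq: "x \<in> carrier T \<Longrightarrow> left_onto.lamT R T H ell x = lam x"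
proof -
  assume x: "x \<in> carrier T"
  interpret O: left_onto R T H ell by (rule left_onto)
  show ?thesis using O.lamT[OF x] E_lam[OF x] lam_typ[OF x] by (intro inj_onD[OF E_inj[OF torsor_flat]]) simp_all
qed

end

section \<open>The right Hopf algebra of a quantum torsor\<close>

context quantum_torsor
begin

text \<open>The mirror computation: the first two factors are multiplied in the opposite order and
  the last two as they stand, giving
  \<open>\<theta>(b) a \<otimes> 1 = 1 \<otimes> a b\<close>.\<close>

lemma Hr_nabla:
  assumes "Hr_eq z"
  shows "t2 (nabla T z) \<^bold>1 = t2 \<^bold>1 (nabla T z)"
proof -
  have z: "z \<in> carrier T2" using assms by (simp add: Hr_eq_def)
  have 1: "tri T2 (\<lambda>d e f. t2 (\<theta> d \<bullet> a) (e \<bullet> f)) (\<mu> b) = t2 (\<theta> b \<bullet> a) \<^bold>1"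
    if "a \<in> carrier T" "b \<in> carrier T" for a b
    using arg_cong[OF mu_nabla_right[OF that(2)], of "duo T2 (\<lambda>p q. t2 (\<theta> p \<bullet> a) q)"] that T_one
    by (simp add: T_simps cong: sw_cong2)
  have 2: "tri T2 (\<lambda>d e f. t2 (e \<bullet> f) (d \<bullet> b)) (\<mu> a) = t2 \<^bold>1 (a \<bullet> b)"
    if "a \<in> carrier T" "b \<in> carrier T" for a b
    using arg_cong[OF mu_nabla_right[OF that(1)], of "duo T2 (\<lambda>p q. t2 q (p \<bullet> b))"] that T_one
    by (simp add: T_simps cong: sw_cong2)
  have "duo T4 (\<lambda>a b. tri T4 (\<lambda>d e f. t4 a (\<theta> d) e f) (\<mu> b)) z = duo T4 (\<lambda>a b. tri T4 (\<lambda>d e f. t4 f e d b) (\<mu> a)) z"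
    using assms by (simp add: Hr_eq_def)
  from arg_cong[OF this, of "ev4 T2 (\<lambda>p q r s. t2 (q \<bullet> p) (r \<bullet> s))"]
  have 3: "duo T2 (\<lambda>a b. t2 (\<theta> b \<bullet> a) \<^bold>1) z = duo T2 (\<lambda>a b. t2 \<^bold>1 (a \<bullet> b)) z"
    by (simp add: T_simps 1 2 cong: sw_cong2)
  have 4: "duo T (\<lambda>a b. \<theta> b \<bullet> a) z = duo T (\<lambda>a b. a \<bullet> b) z"
    using arg_cong[OF 3, of "duo T (\<lambda>p q. p \<bullet> q)"] T_one by (simp add: T_simps cong: sw_cong2)
  show ?thesis using 3 4 z T_one by (simp add: nabla_sw T_fold cong: sw_cong2)
qed

lemma Hr_nabla_scalar: "Hr_eq z \<Longrightarrow> nabla T z \<in> (\<lambda>c. c \<odot>\<^bsub>T\<^esub> \<^bold>1) ` carrier R"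
  using ff_descent[OF T_alg torsor_faithfully_flat nabla_typ Hr_nabla] by (simp add: Hr_eq_def)

end

locale right_ell = quantum_torsor R T
  for R :: "'k ring" (structure) and T :: "('k, 'a, 'm) torsor_scheme" +
  fixes H :: "('k, 'h, 'n) module_scheme" and r :: "'h \<Rightarrow> ('a, 'a) tens"
  assumes H_flat: "flat R H"
    and r_lin: "linear_map R H T2 r"
    and r_inj: "inj_on r (carrier H)"
    and r_Hr: "h \<in> carrier H \<Longrightarrow> Hr_eq (r h)"
begin

lemma H_module: "module R H" using H_flat by (simp add: flat_def)

lemma r_typ: "h \<in> carrier H \<Longrightarrow> r h \<in> carrier T2" by (rule lin_closed[OF r_lin])

lemma lin_r: "linear_map R A H f \<Longrightarrow> linear_map R A T2 (\<lambda>x. r (f x))" by (rule lin_comp[OF _ r_lin])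

text \<open>Tensor products nest to the right, so the block \<open>T2\<close> produced by
  \<open>r\<close> keeps its place, whereas the left-hand map of this name has to reassociate. For
  this reason some sums below keep a component of \<open>T2\<close> undivided, as in
  \<open>mu_to_rho_sw\<close>.\<close>

definition "E X w = sw R X H (X \<boxtimes> T2) (\<lambda>x h. duo (X \<boxtimes> T2) (\<lambda>b c. pt X T2 x (t2 b c)) (r h)) w"

lemmas E_simps0 = T_simps H_module r_typ lin_r

lemma E_fold:
  assumes "module R X"
  shows "E X w = sw R X H (X \<boxtimes> T2) (\<lambda>x h. pt X T2 x (r h)) w"
  using assms by (simp add: E_def T_fold H_module r_typ lin_r cong: sw_cong2)

lemma E_inj:
  assumes X: "flat R X"
  shows "inj_on (E X) (carrier (X \<boxtimes> H))"
proof -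
  have mX: "module R X" using X by (simp add: flat_def)
  show ?thesis unfolding E_fold[OF mX, abs_def]
    by (rule flat_inj_right[OF X H_module _ r_lin r_inj]) (simp add: T_simps)
qed

lemma E_lin: "module R X \<Longrightarrow> linear_map R (X \<boxtimes> H) (X \<boxtimes> T2) (E X)"
  by (simp add: E_def[abs_def] E_simps0)

end

locale right_torsor_data = right_ell R T H r
  for R :: "'k ring" (structure) and T :: "('k, 'a, 'm) torsor_scheme" and H :: "('k, 'h, 'n) module_scheme"
    and r :: "'h \<Rightarrow> ('a, 'a) tens" +
  fixes rho :: "'a \<Rightarrow> ('a, 'h) tens"
  assumes rho_typ: "x \<in> carrier T \<Longrightarrow> rho x \<in> carrier (T \<boxtimes> H)"
    and rho_mu: "x \<in> carrier T \<Longrightarrow> sw R T H T3 (\<lambda>t h. duo T3 (\<lambda>b c. t3 t b c) (r h)) (rho x) = \<mu> x"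
begin

lemma E_rho: "x \<in> carrier T \<Longrightarrow> E T (rho x) = \<mu> x"
  using rho_mu by (simp add: E_def)

lemma rho_lin: "linear_map R T (T \<boxtimes> H) rho"
proof (rule lin_of_inj[OF _ E_lin E_inj])
  show "linear_map R T T3 (\<lambda>x. E T (rho x))"
    using mu_lin lin_cong[of T "\<lambda>x. E T (rho x)" \<mu> R T3] E_rho T_module by blast
qed (simp_all add: T_simps H_module torsor_flat rho_typ)

lemma lin_rho: "linear_map R A T f \<Longrightarrow> linear_map R A (T \<boxtimes> H) (\<lambda>x. rho (f x))" by (rule lin_comp[OF _ rho_lin])

lemmas E_simps = E_simps0 rho_typ lin_rho

lemma mu_to_rho:
  assumes "x \<in> carrier T" "module R P"
    and "\<And>b c. b \<in> carrier T \<Longrightarrow> c \<in> carrier T \<Longrightarrow> linear_map R T P (\<lambda>a. F a b c)"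
    and "\<And>a c. a \<in> carrier T \<Longrightarrow> c \<in> carrier T \<Longrightarrow> linear_map R T P (\<lambda>b. F a b c)"
    and "\<And>a b. a \<in> carrier T \<Longrightarrow> b \<in> carrier T \<Longrightarrow> linear_map R T P (\<lambda>c. F a b c)"
  shows "sw R T H P (\<lambda>t h. duo P (\<lambda>b c. F t b c) (r h)) (rho x) = tri P F (\<mu> x)"
  using arg_cong[OF rho_mu[OF assms(1)], of "tri P F"] assms
  by (simp add: E_simps lin_closed[OF assms(3)] cong: sw_cong)

lemma mu_to_rho_sw:
  assumes "x \<in> carrier T" "module R P"
    and "\<And>v. v \<in> carrier T2 \<Longrightarrow> linear_map R T P (\<lambda>t. G t v)"
    and "\<And>t. t \<in> carrier T \<Longrightarrow> linear_map R T2 P (\<lambda>v. G t v)"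
  shows "sw R T H P (\<lambda>t h. G t (r h)) (rho x) = sw R T T2 P G (\<mu> x)"
  using arg_cong[OF E_rho[OF assms(1)], of "sw R T T2 P G"] assms
  by (simp add: E_fold E_simps lin_closed[OF assms(3)] cong: sw_cong2)

definition "W z = duo (T2 \<boxtimes> H) (\<lambda>a b. sw R T H (T2 \<boxtimes> H) (\<lambda>t h. pt T2 H (t2 a t) h) (rho b)) z"

lemma W_typ: "z \<in> carrier T2 \<Longrightarrow> W z \<in> carrier (T2 \<boxtimes> H)"
  by (simp add: W_def E_simps)

lemma E_W: "z \<in> carrier T2 \<Longrightarrow>
    E T2 (W z) = duo (T2 \<boxtimes> T2) (\<lambda>a b. tri (T2 \<boxtimes> T2) (\<lambda>d e f. pt T2 T2 (t2 a d) (t2 e f)) (\<mu> b)) z"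
proof -
  assume z: "z \<in> carrier T2"
  let ?P = "T2 \<boxtimes> T2"
  have 1: "sw R T H ?P (\<lambda>t h. pt T2 T2 (t2 a t) (r h)) (rho b) =
      sw R T T2 ?P (\<lambda>d v. pt T2 T2 (t2 a d) v) (\<mu> b)"
    if "a \<in> carrier T" "b \<in> carrier T" for a b
    using that by (intro mu_to_rho_sw) (simp_all add: E_simps)
  show ?thesis using z by (simp add: E_def W_def E_simps 1 cong: sw_cong2)
qed

text \<open>\<open>H_r(T)\<close> is the equalizer of two linear maps and \<open>H\<close> is flat,
  so it suffices to verify its equation on the first component of \<open>W z\<close>. That equation
  is the one for \<open>z\<close> with \<mu> applied to the last factor, up to associativity of
  \<mu>.\<close>

lemma W_Hr:
  assumes z: "Hr_eq z" and B: "module R B" and j: "linear_map R B T2 j"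
    and onto: "\<And>z. Hr_eq z \<Longrightarrow> z \<in> j ` carrier B"
  obtains v where "v \<in> carrier (B \<boxtimes> H)" "W z = sw R B H (T2 \<boxtimes> H) (\<lambda>b h. pt T2 H (j b) h) v"
proof -
  let ?A = "duo T4 (\<lambda>a b. tri T4 (\<lambda>d e f. t4 a (\<theta> d) e f) (\<mu> b))"
  let ?B = "duo T4 (\<lambda>a b. tri T4 (\<lambda>d e f. t4 f e d b) (\<mu> a))"
  let ?HA = "\<lambda>w. sw R T2 H (T4 \<boxtimes> H) (\<lambda>v h. pt T4 H (?A v) h) w"
  let ?HB = "\<lambda>w. sw R T2 H (T4 \<boxtimes> H) (\<lambda>v h. pt T4 H (?B v) h) w"
  let ?P = "T4 \<boxtimes> T2"
  let ?t = "\<lambda>a b c d e f. pt T4 T2 (t4 a b c d) (t2 e f)"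
  have zT: "z \<in> carrier T2" and zAB: "?A z = ?B z" using z by (simp_all add: Hr_eq_def)
  have A: "linear_map R T2 T4 ?A" and B': "linear_map R T2 T4 ?B" by (simp_all add: T_simps)
  have fl: "flat R T4" using torsor_flat by (intro flat_tensor)
  have 1: "E T4 (?HA (W z)) = duo ?P (\<lambda>a b. tri ?P (\<lambda>d e x. tri ?P (\<lambda>f p q. ?t a (\<theta> d) e f p q) (\<mu> x)) (\<mu> b)) z"
  proof -
    let ?G = "\<lambda>a t v. tri ?P (\<lambda>d e f. pt T4 T2 (t4 a (\<theta> d) e f) v) (\<mu> t)"
    have a: "sw R T H ?P (\<lambda>t h. ?G a t (r h)) (rho b) = sw R T T2 ?P (?G a) (\<mu> b)"
      if "a \<in> carrier T" "b \<in> carrier T" for a b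
      using that by (intro mu_to_rho_sw[of _ ?P "?G a"]) (simp_all add: E_simps)
    have b: "sw R T T2 ?P (?G a) (\<mu> b) =
        tri ?P (\<lambda>d e x. sw R T T2 ?P (\<lambda>f v. pt T4 T2 (t4 a (\<theta> d) e f) v) (\<mu> x)) (\<mu> b)"
      if "a \<in> carrier T" "b \<in> carrier T" for a b
    proof -
      have "sw R T T2 ?P (?G a) (\<mu> b) = tri ?P (\<lambda>t p q. ?G a t (t2 p q)) (\<mu> b)"
        using that by (intro tri_expand) (simp_all add: E_simps)
      then show ?thesis
        using arg_cong[OF mu_assoc[OF that(2)], of "ev5 ?P (\<lambda>d e f p q. ?t a (\<theta> d) e f p q)"] that
        by (simp add: E_simps cong: sw_cong)
    qed
    show ?thesis using zT by (simp add: E_def W_def E_simps a b cong: sw_cong2)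
  qed
  have 2: "E T4 (?HB (W z)) = duo ?P (\<lambda>a b. tri ?P (\<lambda>d e f. tri ?P (\<lambda>x p q. ?t f e d x p q) (\<mu> b)) (\<mu> a)) z"
  proof -
    have a: "sw R T H ?P (\<lambda>t h. tri ?P (\<lambda>d e f. pt T4 T2 (t4 f e d t) (r h)) (\<mu> a)) (rho b) =
        tri ?P (\<lambda>d e f. sw R T H ?P (\<lambda>t h. pt T4 T2 (t4 f e d t) (r h)) (rho b)) (\<mu> a)"
      if "a \<in> carrier T" "b \<in> carrier T" for a b
      using that by (intro tri_swap[symmetric]) (simp_all add: E_simps)
    have b: "sw R T H ?P (\<lambda>t h. pt T4 T2 (t4 f e d t) (r h)) (rho b) =
        sw R T T2 ?P (\<lambda>t v. pt T4 T2 (t4 f e d t) v) (\<mu> b)"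
      if "b \<in> carrier T" "d \<in> carrier T" "e \<in> carrier T" "f \<in> carrier T" for b d e f
      using that by (intro mu_to_rho_sw) (simp_all add: E_simps)
    show ?thesis using zT by (simp add: E_def W_def E_simps a b cong: sw_cong2)
  qed
  have 3: "duo ?P (\<lambda>a b. tri ?P (\<lambda>d e x. tri ?P (\<lambda>f p q. ?t a (\<theta> d) e f p q) (\<mu> x)) (\<mu> b)) z =
      duo ?P (\<lambda>a b. tri ?P (\<lambda>d e f. tri ?P (\<lambda>x p q. ?t f e d x p q) (\<mu> b)) (\<mu> a)) z"
    using arg_cong[OF zAB, of "ev4 ?P (\<lambda>a d e x. tri ?P (\<lambda>f p q. ?t a d e f p q) (\<mu> x))"]
    by (simp add: E_simps cong: sw_cong)
  have "?HA (W z) = ?HB (W z)"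
    by (rule inj_onD[OF E_inj[OF fl]]) (use zT 1 2 3 in \<open>simp_all add: E_simps\<close>)
  then show ?thesis
    using that flat_equalizer_left[OF H_flat _ _ A B' B j W_typ[OF zT]] onto zT T_module
    by (auto simp: Hr_eq_def T_simps)
qed

end

section \<open>The right Galois object of a torsor\<close>

locale right_torsor = right_torsor_data R T H r rho + H: bialgebra R H
  for R :: "'k ring" (structure) and T :: "('k, 'a, 'm) torsor_scheme" and H :: "('k, 'h) bialgebra"
    and r :: "'h \<Rightarrow> ('a, 'a) tens" and rho :: "'a \<Rightarrow> ('a, 'h) tens" +
  assumes r_onto: "Hr_eq z \<Longrightarrow> z \<in> r ` carrier H"
    and r_comult: "h \<in> carrier H \<Longrightarrow>
      sw R H H T4 (\<lambda>g k. duo T4 (\<lambda>a b. duo T4 (\<lambda>c d. t4 a b c d) (r k)) (r g)) (comult H h) =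
      duo T4 (\<lambda>a b. tri T4 (\<lambda>d e f. t4 a d e f) (\<mu> b)) (r h)"
    and r_counit: "h \<in> carrier H \<Longrightarrow> nabla T (r h) = counit H h \<odot>\<^bsub>T\<^esub> \<^bold>1"
    and r_mult: "g \<in> carrier H \<Longrightarrow> h \<in> carrier H \<Longrightarrow> r (g \<otimes>\<^bsub>H\<^esub> h) = r g \<otimes>\<^bsub>opp T \<boxtimes> T\<^esub> r h"
    and r_one: "r \<one>\<^bsub>H\<^esub> = t2 \<^bold>1 \<^bold>1"
begin

lemma lin_comult: "linear_map R A H f \<Longrightarrow> linear_map R A (H \<boxtimes> H) (\<lambda>x. comult H (f x))"
  by (rule lin_comp[OF _ H.comult_lin])

lemma comult_typ: "h \<in> carrier H \<Longrightarrow> comult H h \<in> carrier (H \<boxtimes> H)"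
  by (rule lin_closed[OF H.comult_lin])

lemma H_one: "\<one>\<^bsub>H\<^esub> \<in> carrier H" by simp

lemmas F_simps = E_simps H.H_bimult lin_comult comult_typ H.lin_counit H.counit_closed T_one H_one
  bimult_closed[of R] bimult_one[of R]

lemma r_mult_sw: "g \<in> carrier H \<Longrightarrow> h \<in> carrier H \<Longrightarrow>
    r (g \<otimes>\<^bsub>H\<^esub> h) = duo T2 (\<lambda>a b. duo T2 (\<lambda>c d. t2 (c \<bullet> a) (b \<bullet> d)) (r h)) (r g)"
  by (simp add: r_mult mult_opT_T r_typ)

lemma W_r: "h \<in> carrier H \<Longrightarrow> W (r h) = sw R H H (T2 \<boxtimes> H) (\<lambda>k l. pt T2 H (r k) l) (comult H h)"
proof -
  assume h: "h \<in> carrier H"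
  let ?P = "T2 \<boxtimes> T2"
  have "flat R T2" using torsor_flat by (intro flat_tensor)
  note inj_onD[OF E_inj[OF this]]
  moreover have "E T2 (W (r h)) = E T2 (sw R H H (T2 \<boxtimes> H) (\<lambda>k l. pt T2 H (r k) l) (comult H h))"
    unfolding E_W[OF r_typ[OF h]]
    using arg_cong[OF r_comult[OF h, symmetric], of "ev4 ?P (\<lambda>a b c d. pt T2 T2 (t2 a b) (t2 c d))"] h
    by (simp add: E_def F_simps cong: sw_cong2; simp add: T_fold r_typ lin_r H_module cong: sw_cong2)
  moreover have "sw R H H (T2 \<boxtimes> H) (\<lambda>k l. pt T2 H (r k) l) (comult H h) \<in> carrier (T2 \<boxtimes> H)"
    by (intro sw_closed pure_closed r_typ) (simp_all add: F_simps)
  ultimately show ?thesis using W_typ[OF r_typ[OF h]] by blast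
qed

definition "beta z = duo (T \<boxtimes> H) (\<lambda>a b. sw R T H (T \<boxtimes> H) (\<lambda>t g. pt T H (a \<bullet> t) g) (rho b)) z"

lemma beta_r: "h \<in> carrier H \<Longrightarrow> beta (r h) = pt T H \<^bold>1 h"
proof -
  assume h: "h \<in> carrier H"
  have n: "duo T (\<lambda>a b. a \<bullet> b) (r k) = counit H k \<odot>\<^bsub>T\<^esub> \<^bold>1" if "k \<in> carrier H" for k
    using r_counit[OF that] nabla_sw[OF r_typ[OF that]] by simp
  have "beta (r h) = sw R T2 H (T \<boxtimes> H) (\<lambda>v g. pt T H (duo T (\<lambda>a b. a \<bullet> b) v) g) (W (r h))"
    using h by (simp add: beta_def W_def F_simps cong: sw_cong2)
  also have "\<dots> = sw R H H (T \<boxtimes> H) (\<lambda>k g. pt T H (duo T (\<lambda>a b. a \<bullet> b) (r k)) g) (comult H h)"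
    unfolding W_r[OF h] using h by (simp add: F_simps cong: sw_cong2)
  also have "\<dots> = sw R H H (T \<boxtimes> H) (\<lambda>k g. pt T H \<^bold>1 (counit H k \<odot>\<^bsub>H\<^esub> g)) (comult H h)"
    by (intro sw_cong) (simp_all add: n F_simps pure_smult_left pure_smult_right)
  also have "\<dots> = pt T H \<^bold>1 (sw R H H H (\<lambda>k g. counit H k \<odot>\<^bsub>H\<^esub> g) (comult H h))"
    using h by (intro pure_sw_right[symmetric]) (simp_all add: F_simps)
  finally show ?thesis by (simp add: H.counit_left_sw h)
qed

lemma rho_mu_colinear:
  assumes x: "x \<in> carrier T"
  shows "sw R T H (T3 \<boxtimes> H) (\<lambda>t h. pt T3 H (\<mu> t) h) (rho x) =
    tri (T3 \<boxtimes> H) (\<lambda>a b c. sw R T H (T3 \<boxtimes> H) (\<lambda>t h. pt T3 H (t3 a b t) h) (rho c)) (\<mu> x)"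
    (is "?l = ?r")
proof (rule inj_onD[OF E_inj])
  let ?P = "T3 \<boxtimes> T2"
  show "flat R T3" using torsor_flat by (intro flat_tensor)
  show "?l \<in> carrier (T3 \<boxtimes> H)" "?r \<in> carrier (T3 \<boxtimes> H)"
    by (intro sw_closed pure_closed mu_typ; simp add: F_simps)+
  have a: "sw R T H ?P (\<lambda>t h. duo ?P (\<lambda>p q. pt T3 T2 (\<mu> t) (t2 p q)) (r h)) (rho x) =
      tri ?P (\<lambda>t p q. pt T3 T2 (\<mu> t) (t2 p q)) (\<mu> x)"
    using x by (intro mu_to_rho) (simp_all add: F_simps)
  have b: "sw R T H ?P (\<lambda>t h. pt T3 T2 (t3 a b t) (r h)) (rho c) =
      sw R T T2 ?P (\<lambda>t v. pt T3 T2 (t3 a b t) v) (\<mu> c)"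
    if "a \<in> carrier T" "b \<in> carrier T" "c \<in> carrier T" for a b c
    using that by (intro mu_to_rho_sw) (simp_all add: F_simps)
  have c: "tri ?P (\<lambda>t p q. tri ?P (\<lambda>a b c. pt T3 T2 (t3 a b c) (t2 p q)) (\<mu> t)) (\<mu> x) =
      tri ?P (\<lambda>t p q. pt T3 T2 (\<mu> t) (t2 p q)) (\<mu> x)"
    using x by (simp add: T_fold cong: sw_cong2)
  have d: "tri ?P (\<lambda>a b c. tri ?P (\<lambda>t p q. pt T3 T2 (t3 a b t) (t2 p q)) (\<mu> c)) (\<mu> x) =
      tri ?P (\<lambda>t p q. tri ?P (\<lambda>a b c. pt T3 T2 (t3 a b c) (t2 p q)) (\<mu> t)) (\<mu> x)"
    using arg_cong[OF mu_assoc[OF x], of "ev5 ?P (\<lambda>a b c p q. pt T3 T2 (t3 a b c) (t2 p q))"] x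
    by (simp add: F_simps cong: sw_cong2)
  show "E T3 ?l = E T3 ?r"
    using a c d x by (simp add: E_def F_simps b cong: sw_cong2)
qed

text \<open>Here the inner \<open>T \<otimes> H\<close> is embedded and the outer \<open>H\<close>
  stays. The comparison therefore takes place in \<open>(T \<otimes> H) \<otimes> H\<close>, and
  \<open>right_comodule\<close> reassociates at the end.\<close>

lemma coassoc_rho:
  assumes x: "x \<in> carrier T"
  shows "sw R T H ((T \<boxtimes> H) \<boxtimes> H) (\<lambda>t h. sw R H H ((T \<boxtimes> H) \<boxtimes> H)
      (\<lambda>k l. pt (T \<boxtimes> H) H (pt T H t k) l) (comult H h)) (rho x) =
    sw R T H ((T \<boxtimes> H) \<boxtimes> H) (\<lambda>t h. pt (T \<boxtimes> H) H (rho t) h) (rho x)"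
    (is "?l = ?r")
proof (rule inj_onD[OF flat_inj_left[OF H_flat _ _ E_lin E_inj]])
  let ?P = "T3 \<boxtimes> H"
  show "?l \<in> carrier ((T \<boxtimes> H) \<boxtimes> H)" "?r \<in> carrier ((T \<boxtimes> H) \<boxtimes> H)"
    by (intro sw_closed pure_closed rho_typ; simp add: F_simps)+
  have w: "sw R H H ?P (\<lambda>k l. duo ?P (\<lambda>c d. pt T3 H (t3 t c d) l) (r k)) (comult H h) =
      duo ?P (\<lambda>a b. sw R T H ?P (\<lambda>s l. pt T3 H (t3 t a s) l) (rho b)) (r h)"
    if "h \<in> carrier H" "t \<in> carrier T" for h t
    using arg_cong[OF W_r[OF that(1)], of "sw R T2 H ?P (\<lambda>v l. duo ?P (\<lambda>c d. pt T3 H (t3 t c d) l) v)"] that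
    by (simp add: W_def F_simps cong: sw_cong2)
  have m: "sw R T H ?P (\<lambda>t h. duo ?P (\<lambda>a b. sw R T H ?P (\<lambda>s l. pt T3 H (t3 t a s) l) (rho b)) (r h)) (rho x) =
      tri ?P (\<lambda>t a b. sw R T H ?P (\<lambda>s l. pt T3 H (t3 t a s) l) (rho b)) (\<mu> x)"
    using x by (intro mu_to_rho) (simp_all add: F_simps)
  have l: "sw R (T \<boxtimes> H) H ?P (\<lambda>w h. pt T3 H (E T w) h) ?l =
      sw R T H ?P (\<lambda>t h. sw R H H ?P (\<lambda>k l. duo ?P (\<lambda>c d. pt T3 H (t3 t c d) l) (r k)) (comult H h)) (rho x)"
    using x by (simp add: E_def F_simps cong: sw_cong2; simp add: T_fold r_typ lin_r H_module cong: sw_cong2)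
  have r: "sw R (T \<boxtimes> H) H ?P (\<lambda>w h. pt T3 H (E T w) h) ?r =
      sw R T H ?P (\<lambda>t h. pt T3 H (\<mu> t) h) (rho x)"
  proof -
    have "sw R (T \<boxtimes> H) H ?P (\<lambda>w h. pt T3 H (E T w) h) ?r =
      sw R T H ?P (\<lambda>t h. pt T3 H (E T (rho t)) h) (rho x)"
      using x by (simp add: lin_comp[OF _ E_lin[OF T_module]] lin_closed[OF E_lin[OF T_module]] F_simps cong: sw_cong2)
    then show ?thesis using x by (simp add: F_simps E_rho cong: sw_cong2)
  qed
  show "sw R (T \<boxtimes> H) H ?P (\<lambda>w h. pt T3 H (E T w) h) ?l =
      sw R (T \<boxtimes> H) H ?P (\<lambda>w h. pt T3 H (E T w) h) ?r"
    unfolding l r rho_mu_colinear[OF x] m[symmetric] using x by (intro sw_cong w) (simp_all add: F_simps)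
qed (simp_all add: F_simps torsor_flat)

lemma counit_rho:
  assumes x: "x \<in> carrier T"
  shows "sw R T H T (\<lambda>y h. counit H h \<odot>\<^bsub>T\<^esub> y) (rho x) = x"
proof -
  have n: "duo T (\<lambda>a b. a \<bullet> b) (r k) = counit H k \<odot>\<^bsub>T\<^esub> \<^bold>1" if "k \<in> carrier H" for k
    using r_counit[OF that] nabla_sw[OF r_typ[OF that]] by simp
  have "sw R T H T (\<lambda>t h. duo T (\<lambda>a b. t \<bullet> (a \<bullet> b)) (r h)) (rho x) = tri T (\<lambda>a b c. a \<bullet> (b \<bullet> c)) (\<mu> x)"
    using x by (intro mu_to_rho) (simp_all add: F_simps)
  also have "\<dots> = x"
    using arg_cong[OF mu_nabla_right[OF x], of "duo T (\<lambda>p q. p \<bullet> q)"] x by (simp add: F_simps cong: sw_cong2)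
  also have "sw R T H T (\<lambda>t h. duo T (\<lambda>a b. t \<bullet> (a \<bullet> b)) (r h)) (rho x) =
      sw R T H T (\<lambda>t h. t \<bullet> duo T (\<lambda>a b. a \<bullet> b) (r h)) (rho x)"
    by (simp add: F_simps cong: sw_cong2)
  also have "\<dots> = sw R T H T (\<lambda>y h. counit H h \<odot>\<^bsub>T\<^esub> y) (rho x)"
    by (simp add: n F_simps mult_smult[of R] cong: sw_cong2)
  finally show ?thesis .
qed

lemma rho_one: "rho \<^bold>1 = pt T H \<^bold>1 \<one>\<^bsub>H\<^esub>"
proof (rule inj_onD[OF E_inj[OF torsor_flat]])
  show "E T (rho \<^bold>1) = E T (pt T H \<^bold>1 \<one>\<^bsub>H\<^esub>)"
    by (simp add: E_rho mu_one F_simps) (simp add: E_def F_simps r_one)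
qed (simp_all add: F_simps)

lemma rho_mult:
  assumes x: "x \<in> carrier T" and y: "y \<in> carrier T"
  shows "rho (x \<bullet> y) = rho x \<otimes>\<^bsub>T \<boxtimes> H\<^esub> rho y"
proof (rule inj_onD[OF E_inj[OF torsor_flat]])
  have m: "rho x \<otimes>\<^bsub>T \<boxtimes> H\<^esub> rho y = sw R T H (T \<boxtimes> H) (\<lambda>s h. sw R T H (T \<boxtimes> H)
      (\<lambda>t k. pt T H (s \<bullet> t) (h \<otimes>\<^bsub>H\<^esub> k)) (rho y)) (rho x)"
    using x y by (simp add: tensor_mult F_simps)
  show "rho x \<otimes>\<^bsub>T \<boxtimes> H\<^esub> rho y \<in> carrier (T \<boxtimes> H)" using x y by (simp add: F_simps)
  have a: "sw R T H T3 (\<lambda>s h. duo T3 (\<lambda>a b. tri T3 (\<lambda>d e f. t3 (s \<bullet> d) (e \<bullet> a) (b \<bullet> f)) (\<mu> y)) (r h)) (rho x) =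
      tri T3 (\<lambda>s a b. tri T3 (\<lambda>d e f. t3 (s \<bullet> d) (e \<bullet> a) (b \<bullet> f)) (\<mu> y)) (\<mu> x)"
    using x y by (intro mu_to_rho) (simp_all add: F_simps)
  have b: "tri T3 (\<lambda>d e f. t3 (s \<bullet> d) (e \<bullet> a) (b \<bullet> f)) (\<mu> y) =
      sw R T H T3 (\<lambda>t k. duo T3 (\<lambda>e f. t3 (s \<bullet> t) (e \<bullet> a) (b \<bullet> f)) (r k)) (rho y)"
    if "a \<in> carrier T" "b \<in> carrier T" "s \<in> carrier T" for a b s
    using y that by (intro mu_to_rho[symmetric]) (simp_all add: F_simps)
  have c: "sw R T H T3 (\<lambda>t k. duo T3 (\<lambda>a b. duo T3 (\<lambda>e f. t3 (s \<bullet> t) (e \<bullet> a) (b \<bullet> f)) (r k)) (r h)) (rho y) =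
      duo T3 (\<lambda>a b. sw R T H T3 (\<lambda>t k. duo T3 (\<lambda>e f. t3 (s \<bullet> t) (e \<bullet> a) (b \<bullet> f)) (r k)) (rho y)) (r h)"
    if "s \<in> carrier T" for s h
    using that by (intro sw_swap) (simp_all add: F_simps)
  have "E T (rho x \<otimes>\<^bsub>T \<boxtimes> H\<^esub> rho y) = sw R T H T3 (\<lambda>s h. sw R T H T3 (\<lambda>t k. duo T3 (\<lambda>a b. duo T3
      (\<lambda>e f. t3 (s \<bullet> t) (e \<bullet> a) (b \<bullet> f)) (r k)) (r h)) (rho y)) (rho x)"
    unfolding m using x y by (simp add: E_def F_simps r_mult_sw cong: sw_cong2)
  also have "\<dots> = \<mu> (x \<bullet> y)"
    unfolding mu_mult[OF x y] a[symmetric] using x y by (simp add: F_simps b c cong: sw_cong2)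
  finally show "E T (rho (x \<bullet> y)) = E T (rho x \<otimes>\<^bsub>T \<boxtimes> H\<^esub> rho y)" using x y by (simp add: E_rho F_simps)
qed (use x y in \<open>simp_all add: F_simps\<close>)

lemma rho_hom: "algebra_hom R T (T \<boxtimes> H) rho"
  unfolding algebra_hom_def ring_hom_def
  using rho_lin rho_mult rho_one lin_add[OF rho_lin] rho_typ by (auto simp: tensor_one)

lemma right_comodule: "right_comodule_algebra R H T rho"
proof -
  let ?S = "(T \<boxtimes> H) \<boxtimes> H"
  have 1: "tensor_map R (T \<boxtimes> H) H rho id (rho x) = sw R T H ?S (\<lambda>t h. pt (T \<boxtimes> H) H (rho t) h) (rho x)"
    if "x \<in> carrier T" for x
    using that by (simp add: tensor_map_sw[OF rho_typ])
  have 2: "tensor_map R T (H \<boxtimes> H) id (comult H) (rho x) = sw R T H (T \<boxtimes> (H \<boxtimes> H))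
      (\<lambda>t h. pt T (H \<boxtimes> H) t (comult H h)) (rho x)"
    if "x \<in> carrier T" for x
    using that by (simp add: tensor_map_sw[OF rho_typ])
  have "assoc R T H H (tensor_map R (T \<boxtimes> H) H rho id (rho x)) = tensor_map R T (H \<boxtimes> H) id (comult H) (rho x)"
    if x: "x \<in> carrier T" for x
    unfolding 1[OF x] 2[OF x] coassoc_rho[OF x, symmetric]
    using x by (simp add: assoc_sw F_simps cong: sw_cong2; simp add: T_fold comult_typ lin_comult H_module cong: sw_cong2)
  moreover have "tensor_lift T (\<lambda>y h. counit H h \<odot>\<^bsub>T\<^esub> y) (rho x) = x" if "x \<in> carrier T" for x
    using counit_rho[OF that] rho_typ[OF that] by (simp add: sw_def)
  ultimately show ?thesis
    by (intro right_comodule_algebra.intro right_comodule_algebra_axioms.intro T_alg H.bialgebra_axioms rho_hom)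
      simp_all
qed

lemma right_coinvariant:
  assumes t: "t \<in> carrier T" and e: "rho t = pt T H t \<one>\<^bsub>H\<^esub>"
  shows "t \<in> (\<lambda>c. c \<odot>\<^bsub>T\<^esub> \<^bold>1) ` carrier R"
proof (rule ff_descent[OF T_alg torsor_faithfully_flat t])
  have "\<mu> t = t3 t \<^bold>1 \<^bold>1"
    using E_rho[OF t] t unfolding e by (simp add: E_def F_simps r_one)
  then show "t2 t \<^bold>1 = t2 \<^bold>1 t"
    using mu_nabla_left[OF t] t by (simp add: F_simps)
qed

lemma galois_r:
  assumes x: "x \<in> carrier T" and y: "y \<in> carrier T"
  shows "sw R T H T2 (\<lambda>s g. duo T2 (\<lambda>a b. t2 ((y \<bullet> s) \<bullet> a) b) (r g)) (rho x) = t2 y x"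
proof -
  have "sw R T H T2 (\<lambda>s g. duo T2 (\<lambda>a b. t2 ((y \<bullet> s) \<bullet> a) b) (r g)) (rho x) =
      tri T2 (\<lambda>a b c. t2 ((y \<bullet> a) \<bullet> b) c) (\<mu> x)"
    using x y by (intro mu_to_rho) (simp_all add: F_simps)
  also have "\<dots> = t2 y x"
    using arg_cong[OF mu_nabla_left[OF x], of "duo T2 (\<lambda>p q. t2 (y \<bullet> p) q)"] x y
    by (simp add: F_simps T_assoc cong: sw_cong2)
  finally show ?thesis .
qed

text \<open>With \<open>r h = h' \<otimes> h''\<close> the inverse of the Galois map is
  \<open>y \<otimes> h \<mapsto> y h' \<otimes> h''\<close>; \<open>galois_r\<close> and
  \<open>beta_r\<close> give the two composites.\<close>

lemma right_galois: "right_galois R H T rho"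
proof (intro right_galois.intro right_galois_axioms.intro right_comodule)
  show "bij_betw (\<lambda>c. c \<odot>\<^bsub>T\<^esub> \<^bold>1) (carrier R) {t \<in> carrier T. rho t = pt T H t \<one>\<^bsub>H\<^esub>}"
    unfolding bij_betw_def
  proof (intro conjI equalityI subsetI)
    fix t assume "t \<in> (\<lambda>c. c \<odot>\<^bsub>T\<^esub> \<^bold>1) ` carrier R"
    then obtain c where c: "c \<in> carrier R" "t = c \<odot>\<^bsub>T\<^esub> \<^bold>1" by auto
    then show "t \<in> {t \<in> carrier T. rho t = pt T H t \<one>\<^bsub>H\<^esub>}"
      using lin_smult[OF rho_lin c(1) T_one]
      by (simp add: rho_one pure_smult_left[OF T_module H_module])
  qed (use right_coinvariant ff_unit_inj[OF T_alg torsor_faithfully_flat] in auto)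
  let ?b = "tensor_lift (T \<boxtimes> H) (\<lambda>x y. tensor_map R T H (\<lambda>y0. x \<bullet> y0) id (rho y))"
  have b: "?b z = beta z" if "z \<in> carrier T2" for z
    unfolding beta_def using that
    by (intro lift_cong) (simp_all add: T_module tensor_map_sw[OF rho_typ])
  let ?g = "sw R T H T2 (\<lambda>y h. duo T2 (\<lambda>a b. t2 (y \<bullet> a) b) (r h))"
  have gb: "?g (beta z) = z" if "z \<in> carrier T2" for z
    using that unfolding beta_def by (simp add: F_simps galois_r cong: sw_cong2)
  have be: "beta (duo T2 (\<lambda>a b. t2 (y \<bullet> a) b) (r h)) = pt T H y h"
    if "h \<in> carrier H" "y \<in> carrier T" for h y
    using arg_cong[OF beta_r[OF that(1)], of "sw R T H (T \<boxtimes> H) (\<lambda>t g. pt T H (y \<bullet> t) g)"] that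
    by (simp add: beta_def F_simps T_assoc cong: sw_cong2)
  have bg: "beta (?g w) = w" if w: "w \<in> carrier (T \<boxtimes> H)" for w
  proof -
    have bl: "linear_map R T2 (T \<boxtimes> H) beta" by (simp add: beta_def[abs_def] F_simps)
    have "beta (?g w) = sw R T H (T \<boxtimes> H) (\<lambda>y h. beta (duo T2 (\<lambda>a b. t2 (y \<bullet> a) b) (r h))) w"
      by (rule lin_sw_apply[OF _ _ _ _ bl]) (simp_all add: F_simps)
    then show ?thesis using w by (simp add: be F_simps cong: sw_cong2)
  qed
  show "bij_betw ?b (carrier T2) (carrier (T \<boxtimes> H))"
  proof (rule bij_betw_byWitness[where f' = ?g])
    show "?b ` carrier T2 \<subseteq> carrier (T \<boxtimes> H)"
      using b by (auto simp: beta_def F_simps)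
    show "?g ` carrier (T \<boxtimes> H) \<subseteq> carrier T2" by (auto simp: F_simps)
    then show "\<forall>w\<in>carrier (T \<boxtimes> H). ?b (?g w) = w" using b bg by auto
    show "\<forall>z\<in>carrier T2. ?g (?b z) = z" using b gb by auto
  qed
qed

end

section \<open>The Hopf algebra \<open>H_r(T)\<close> and its coaction\<close>

context quantum_torsor
begin

lemma right_hopf_fields:
  "carrier (right_hopf R T) = {z. Hr_eq z}" "add (right_hopf R T) = add T2" "\<zero>\<^bsub>right_hopf R T\<^esub> = \<zero>\<^bsub>T2\<^esub>"
  "smult (right_hopf R T) = smult T2" "monoid.mult (right_hopf R T) = monoid.mult (opp T \<boxtimes> T)"
  "\<one>\<^bsub>right_hopf R T\<^esub> = t2 \<^bold>1 \<^bold>1"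
proof -
  have s: "same (opp T \<boxtimes> T) T2" by (intro same_rules)
  have "carrier (right_hopf R T) = carrier (right_algebra R T)" by (simp add: right_hopf_def Let_def with_coalgebra_def)
  then show "carrier (right_hopf R T) = {z. Hr_eq z}" using conv_right_algebra by blast
  show "add (right_hopf R T) = add T2" "\<zero>\<^bsub>right_hopf R T\<^esub> = \<zero>\<^bsub>T2\<^esub>" "smult (right_hopf R T) = smult T2"
    "monoid.mult (right_hopf R T) = monoid.mult (opp T \<boxtimes> T)"
    using s by (simp_all add: right_hopf_def Let_def with_coalgebra_def right_algebra_def same_def)
  have "pt (opp T) T = pt T T" by (intro same_pure same_rules)
  then show "\<one>\<^bsub>right_hopf R T\<^esub> = t2 \<^bold>1 \<^bold>1"
    by (simp add: right_hopf_def Let_def with_coalgebra_def right_algebra_def tensor_one opp_simps)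
qed

lemma right_hopf_module: "module R (right_hopf R T)"
proof -
  have "{z. Hr_eq z} = {z \<in> carrier T2. duo T4 (\<lambda>a b. tri T4 (\<lambda>d e f. t4 a (\<theta> d) e f) (\<mu> b)) z =
      duo T4 (\<lambda>a b. tri T4 (\<lambda>d e f. t4 f e d b) (\<mu> a)) z}" by (auto simp: Hr_eq_def)
  moreover have "submodule \<dots> R T2"
    by (rule equalizer_submodule[of _ _ T4]) (simp_all add: T_simps)
  ultimately have "module R (T2\<lparr>carrier := {z. Hr_eq z}\<rparr>)"
    using submodule_module[of "{z. Hr_eq z}" R T2] by (simp add: T_simps)
  then show ?thesis by (rule same_module[rotated]) (simp add: same_def right_hopf_fields)
qed

lemma right_hopf_counit:
  assumes "Hr_eq z" "c \<in> carrier R"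
  shows "counit (right_hopf R T) z = c \<longleftrightarrow> nabla T z = c \<odot>\<^bsub>T\<^esub> \<^bold>1"
proof -
  note inj = inj_onD[OF ff_unit_inj[OF T_alg torsor_faithfully_flat]]
  obtain d where d: "d \<in> carrier R" "nabla T z = d \<odot>\<^bsub>T\<^esub> \<^bold>1" using Hr_nabla_scalar[OF assms(1)] by auto
  have "counit (right_hopf R T) z = (THE c. c \<in> carrier R \<and> nabla T z = c \<odot>\<^bsub>T\<^esub> \<^bold>1)"
    by (simp add: right_hopf_def Let_def with_coalgebra_def)
  also have "\<dots> = d" using d inj by (intro the_equality) auto
  finally show ?thesis using d inj assms(2) by auto
qed

end

locale right_onto = right_ell R T H r
  for R :: "'k ring" (structure) and T :: "('k, 'a, 'm) torsor_scheme" and H :: "('k, 'h, 'n) module_scheme"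
    and r :: "'h \<Rightarrow> ('a, 'a) tens" +
  assumes r_onto: "Hr_eq z \<Longrightarrow> z \<in> r ` carrier H"
begin

abbreviation "K \<equiv> right_hopf R T"
abbreviation "i \<equiv> inv_into (carrier H) r"

lemma K_typ: "l \<in> carrier K \<Longrightarrow> l \<in> carrier T2" by (simp add: right_hopf_fields Hr_eq_def)

lemma r_K: "linear_map R H K r"
  using r_lin r_Hr by (auto simp: linear_map_def right_hopf_fields)

lemma K_T2: "linear_map R K T2 (\<lambda>x. x)"
  using K_typ by (auto simp: linear_map_def right_hopf_fields)

lemma i_r: "h \<in> carrier H \<Longrightarrow> i (r h) = h" by (rule inv_into_f_f[OF r_inj])

lemma r_i: "l \<in> carrier K \<Longrightarrow> r (i l) = l"
  using r_onto by (simp add: right_hopf_fields f_inv_into_f)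

lemma i_lin: "linear_map R K H i"
proof (rule lin_of_inj[OF H_module r_lin r_inj right_hopf_module])
  show "i l \<in> carrier H" if "l \<in> carrier K" for l
    using that r_onto by (auto simp: right_hopf_fields intro: inv_into_into)
  show "linear_map R K T2 (\<lambda>x. r (i x))"
    using K_T2 lin_cong[of K "\<lambda>x. r (i x)" "\<lambda>x. x" R T2] r_i right_hopf_module by blast
qed

lemmas K_simps = E_simps0 right_hopf_module K_typ lin_comp[OF _ r_K] lin_comp[OF _ i_lin] lin_comp[OF _ K_T2]
  lin_closed[OF r_K] lin_closed[OF i_lin] i_r r_i

lemma E_i:
  assumes w: "w \<in> carrier (T \<boxtimes> K)"
  shows "tensor_map R T (opp T \<boxtimes> T) id id w = E T (sw R T K (T \<boxtimes> H) (\<lambda>t l. pt T H t (i l)) w)"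
  using w by (simp add: opp_all tensor_map_sw[OF w] E_fold K_simps cong: sw_cong2)

text \<open>The axiom on \<theta> has \<mu> applied to the first factor, whereas
  \<open>H_r(T)\<close> asks for \<mu> on the last one. Associativity of \<mu>, with \<theta>
  applied to the middle factor of its five, connects the two forms.\<close>

lemma coaction_exists:
  assumes x: "x \<in> carrier T"
  obtains w where "w \<in> carrier (T \<boxtimes> H)" "E T w = \<mu> x"
proof -
  let ?A = "duo T4 (\<lambda>a b. tri T4 (\<lambda>d e f. t4 a (\<theta> d) e f) (\<mu> b))"
  let ?B = "duo T4 (\<lambda>a b. tri T4 (\<lambda>d e f. t4 f e d b) (\<mu> a))"
  have A: "linear_map R T2 T4 ?A" and B: "linear_map R T2 T4 ?B" by (simp_all add: T_simps)
  have m: "\<mu> x \<in> carrier (T \<boxtimes> T2)" using x by (simp add: T_simps)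
  have a: "tri T5 (\<lambda>a b c. tri T5 (\<lambda>d e f. t5 a b (\<theta> d) e f) (\<mu> c)) (\<mu> x) = tri T5 (\<lambda>a b c. tri T5 (\<lambda>d e f. t5 d e (\<theta> f) b c) (\<mu> a)) (\<mu> x)"
    using arg_cong[OF mu_assoc[OF x], of "ev5 T5 (\<lambda>a b d e f. t5 a b (\<theta> d) e f)"] x
    by (simp add: T_simps cong: sw_cong2)
  have 1: "sw R T T2 T5 (\<lambda>t v. pt T T4 t (?A v)) (\<mu> x) = tri T5 (\<lambda>a b c. tri T5 (\<lambda>d e f. t5 a b (\<theta> d) e f) (\<mu> c)) (\<mu> x)"
    using x by (simp add: T_simps cong: sw_cong2)
  have 2: "sw R T T2 T5 (\<lambda>t v. pt T T4 t (?B v)) (\<mu> x) = tri T5 (\<lambda>a b c. tri T5 (\<lambda>d e f. t5 a f e d c) (\<mu> b)) (\<mu> x)"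
    using x by (simp add: T_simps cong: sw_cong2)
  have e: "sw R T T2 T5 (\<lambda>t v. pt T T4 t (?A v)) (\<mu> x) = sw R T T2 T5 (\<lambda>t v. pt T T4 t (?B v)) (\<mu> x)"
    unfolding 1 2 a by (rule mu_theta[OF x])
  have o: "z \<in> r ` carrier H" if "z \<in> carrier T2" "?A z = ?B z" for z
    using that by (intro r_onto) (simp add: Hr_eq_def)
  obtain w where w: "w \<in> carrier (T \<boxtimes> H)" "\<mu> x = sw R T H (T \<boxtimes> T2) (\<lambda>t h. pt T T2 t (r h)) w"
    by (rule flat_equalizer_right[OF torsor_flat _ _ A B H_module r_lin m e o]) (simp_all only: tensor_module T_module)
  then show ?thesis using that[OF w(1)] E_fold[OF T_module] by simp
qed

definition "rhoT x = tensor_map R T H id i (right_torsor_coaction R T x)"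

lemma rhoT: assumes x: "x \<in> carrier T" shows "rhoT x \<in> carrier (T \<boxtimes> H)" "E T (rhoT x) = \<mu> x"
proof -
  obtain w where w: "w \<in> carrier (T \<boxtimes> H)" "E T w = \<mu> x" using coaction_exists[OF x] .
  let ?l = "sw R T H (T \<boxtimes> K) (\<lambda>t h. pt T K t (r h))"
  let ?i = "sw R T K (T \<boxtimes> H) (\<lambda>t l. pt T H t (i l))"
  have li: "?l (?i v) = v" if "v \<in> carrier (T \<boxtimes> K)" for v using that by (simp add: K_simps cong: sw_cong2)
  have il: "?i (?l v) = v" if "v \<in> carrier (T \<boxtimes> H)" for v using that by (simp add: K_simps cong: sw_cong2)
  have lw: "?l w \<in> carrier (T \<boxtimes> K)" by (simp add: K_simps)
  have "right_torsor_coaction R T x = ?l w"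
    unfolding right_torsor_coaction_def
  proof (rule the_equality)
    show "?l w \<in> carrier (T \<boxtimes> K) \<and> tensor_map R T (opp T \<boxtimes> T) id id (?l w) = \<mu> x"
      using lw by (simp only: E_i[OF lw] il[OF w(1)] w(2))
    fix v assume v: "v \<in> carrier (T \<boxtimes> K) \<and> tensor_map R T (opp T \<boxtimes> T) id id v = \<mu> x"
    have "?i v = w"
    proof (rule inj_onD[OF E_inj[OF torsor_flat] _ _ w(1)])
      show "E T (?i v) = E T w" using v E_i[of v] w(2) by simp
      show "?i v \<in> carrier (T \<boxtimes> H)" by (simp add: K_simps)
    qed
    then show "v = ?l w" using li[of v] v by simp
  qed
  then have "rhoT x = ?i (?l w)" unfolding rhoT_def by (simp only: tensor_map_sw[OF lw] id_apply)
  then show "rhoT x \<in> carrier (T \<boxtimes> H)" "E T (rhoT x) = \<mu> x" using il[OF w(1)] w by simp_all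
qed

lemma right_torsor_data: "right_torsor_data R T H r rhoT"
  by unfold_locales (use rhoT in \<open>simp_all add: E_def\<close>)

definition "E2 v = sw R H H T4 (\<lambda>g k. duo T4 (\<lambda>a b. duo T4 (\<lambda>c d. t4 a b c d) (r k)) (r g)) v"

lemma E2_eq: "v \<in> carrier (H \<boxtimes> H) \<Longrightarrow>
    E2 v = assoc R T T T2 (E T2 (sw R H H (T2 \<boxtimes> H) (\<lambda>g k. pt T2 H (r g) k) v))"
  by (simp add: E2_def E_fold E_simps0 assoc_sw cong: sw_cong2; simp add: T_fold r_typ lin_r H_module cong: sw_cong2)

text \<open>The comultiplication of \<open>H_r(T)\<close> is prescribed in \<open>T4\<close>, while
  the embedding \<open>E T2\<close> lands in \<open>T2 \<boxtimes> T2\<close>; the associator has to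
  be cancelled in between.\<close>

lemma assoc_inj: "inj_on (assoc R T T T2) (carrier (T2 \<boxtimes> T2))"
proof -
  have "assoc_inv R T T T2 (assoc R T T T2 w) = w" if "w \<in> carrier (T2 \<boxtimes> T2)" for w
    using that by (simp add: assoc_sw assoc_inv_sw T_simps cong: sw_cong2)
  then show ?thesis by (rule inj_on_inverseI)
qed

lemma E2_inj: "inj_on E2 (carrier (H \<boxtimes> H))"
proof (rule inj_onI)
  fix v w assume v: "v \<in> carrier (H \<boxtimes> H)" and w: "w \<in> carrier (H \<boxtimes> H)" and e: "E2 v = E2 w"
  let ?j = "sw R H H (T2 \<boxtimes> H) (\<lambda>g k. pt T2 H (r g) k)"
  have f: "flat R T2" using torsor_flat by (intro flat_tensor)
  have t: "?j u \<in> carrier (T2 \<boxtimes> H)" for u by (simp add: E_simps0)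
  have Et: "E T2 (?j u) \<in> carrier (T2 \<boxtimes> T2)" for u by (rule lin_closed[OF E_lin t]) (simp add: T_simps)
  have "E T2 (?j v) = E T2 (?j w)"
    using e unfolding E2_eq[OF v] E2_eq[OF w] by (rule inj_onD[OF assoc_inj _ Et Et])
  then have "?j v = ?j w" by (rule inj_onD[OF E_inj[OF f] _ t t])
  moreover have "inj_on ?j (carrier (H \<boxtimes> H))"
    by (rule flat_inj_left[OF H_flat H_module _ r_lin r_inj]) (simp add: T_simps)
  ultimately show "v = w" using v w by (blast dest: inj_onD)
qed

lemma comult_eq:
  assumes h: "h \<in> carrier H" and v: "v \<in> carrier (H \<boxtimes> H)"
    and e: "E2 v = duo T4 (\<lambda>a b. tri T4 (\<lambda>d e f. t4 a d e f) (\<mu> b)) (r h)"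
  shows "comult K (r h) = tensor_map R K K r r v"
proof -
  let ?l = "sw R H H (K \<boxtimes> K) (\<lambda>g k. pt K K (r g) (r k))"
  let ?i = "sw R K K (H \<boxtimes> H) (\<lambda>g k. pt H H (i g) (i k))"
  have li: "?l (?i v) = v" if "v \<in> carrier (K \<boxtimes> K)" for v using that by (simp add: K_simps cong: sw_cong2)
  have il: "?i (?l v) = v" if "v \<in> carrier (H \<boxtimes> H)" for v using that by (simp add: K_simps cong: sw_cong2)
  have Ei: "assoc R (opp T) T (opp T \<boxtimes> T) (tensor_map R (opp T \<boxtimes> T) (opp T \<boxtimes> T) id id w) = E2 (?i w)"
    if w: "w \<in> carrier (K \<boxtimes> K)" for w
    using w by (simp add: opp_all tensor_map_sw[OF w] E2_def assoc_sw K_simps cong: sw_cong2; simp add: T_fold K_simps cong: sw_cong2)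
  have lv: "?l v \<in> carrier (K \<boxtimes> K)" by (simp add: K_simps)
  have "comult K (r h) = (THE w. w \<in> carrier (K \<boxtimes> K) \<and>
      assoc R (opp T) T (opp T \<boxtimes> T) (tensor_map R (opp T \<boxtimes> T) (opp T \<boxtimes> T) id id w) = E2 v)"
  proof -
    have "same K (right_algebra R T)" by (simp add: same_def right_hopf_def Let_def with_coalgebra_def)
    from same_carrier[OF same_tensor[OF this this, of R]]
    have "carrier (right_algebra R T \<boxtimes> right_algebra R T) = carrier (K \<boxtimes> K)" ..
    then show ?thesis using conv_right_comult[OF r_typ[OF h]]
      by (simp add: e right_hopf_def Let_def with_coalgebra_def)
  qed
  also have "\<dots> = ?l v"
  proof (rule the_equality)
    show "?l v \<in> carrier (K \<boxtimes> K) \<and>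
      assoc R (opp T) T (opp T \<boxtimes> T) (tensor_map R (opp T \<boxtimes> T) (opp T \<boxtimes> T) id id (?l v)) = E2 v"
      using lv by (simp only: Ei[OF lv] il[OF v])
    fix w assume w: "w \<in> carrier (K \<boxtimes> K) \<and>
      assoc R (opp T) T (opp T \<boxtimes> T) (tensor_map R (opp T \<boxtimes> T) (opp T \<boxtimes> T) id id w) = E2 v"
    have t: "?i w \<in> carrier (H \<boxtimes> H)" by (simp add: K_simps)
    have "E2 (?i w) = E2 v" using w Ei[of w] by simp
    then have "?i w = v" by (rule inj_onD[OF E2_inj _ t v])
    then show "w = ?l v" using li[of w] w by simp
  qed
  also have "\<dots> = tensor_map R K K r r v" by (rule tensor_map_sw[OF v, symmetric])
  finally show ?thesis .
qed

end

context quantum_torsor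
begin

lemma right_onto_of_iso:
  assumes H: "flat R H" and iso: "algebra_iso R H (right_hopf R T) r"
  shows "right_onto R T H r"
proof -
  have bij: "bij_betw r (carrier H) {z. Hr_eq z}" and lin: "linear_map R H (right_hopf R T) r"
    using iso by (simp_all add: algebra_iso_def algebra_hom_def right_hopf_fields)
  show ?thesis
  proof unfold_locales
    show "linear_map R H T2 r" using lin by (auto simp: linear_map_def right_hopf_fields Hr_eq_def)
    show "inj_on r (carrier H)" using bij by (rule bij_betw_imp_inj_on)
    show "Hr_eq (r h)" if "h \<in> carrier H" for h using bij that by (auto simp: bij_betw_def)
    show "z \<in> r ` carrier H" if "Hr_eq z" for z using bij that by (auto simp: bij_betw_def)
  qed (fact H)
qed

lemma right_torsor_of_hopf_iso:
  assumes H: "flat R H" and bi: "bialgebra R H" and iso: "hopf_iso R H (right_hopf R T) r"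
  shows "right_torsor R T H r (right_onto.rhoT R T H r)"
proof -
  have alg: "algebra_iso R H (right_hopf R T) r" using iso by (simp add: hopf_iso_def)
  interpret right_onto R T H r by (rule right_onto_of_iso[OF H alg])
  interpret D: right_torsor_data R T H r rhoT by (rule right_torsor_data)
  interpret H: bialgebra R H by (rule bi)
  show ?thesis
  proof unfold_locales
    show "z \<in> r ` carrier H" if "Hr_eq z" for z by (rule r_onto[OF that])
    show "r (g \<otimes>\<^bsub>H\<^esub> h) = r g \<otimes>\<^bsub>opp T \<boxtimes> T\<^esub> r h" if "g \<in> carrier H" "h \<in> carrier H" for g h
      using alg that by (simp add: algebra_iso_def algebra_hom_def ring_hom_def right_hopf_fields)
    show "r \<one>\<^bsub>H\<^esub> = t2 \<^bold>1 \<^bold>1"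
      using alg by (simp add: algebra_iso_def algebra_hom_def ring_hom_def right_hopf_fields)
    fix h assume h: "h \<in> carrier H"
    show "nabla T (r h) = counit H h \<odot>\<^bsub>T\<^esub> \<^bold>1"
      using iso h right_hopf_counit[OF r_Hr[OF h] H.counit_closed[OF h]] by (simp add: hopf_iso_def)
    obtain v where v: "v \<in> carrier (H \<boxtimes> H)"
      "D.W (r h) = sw R H H (T2 \<boxtimes> H) (\<lambda>b h. pt T2 H (r b) h) v"
      using D.W_Hr[OF r_Hr[OF h] H_module r_lin r_onto] by metis
    have "assoc R T T T2 (E T2 (D.W (r h))) = duo T4 (\<lambda>a b. tri T4 (\<lambda>d e f. t4 a d e f) (\<mu> b)) (r h)"
      unfolding D.E_W[OF r_typ[OF h]] using h
      by (simp add: assoc_sw E_simps0 cong: sw_cong2; simp add: T_fold cong: sw_cong2)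
    then have e: "E2 v = duo T4 (\<lambda>a b. tri T4 (\<lambda>d e f. t4 a d e f) (\<mu> b)) (r h)"
      using E2_eq[OF v(1)] v(2) by simp
    have dh: "comult H h \<in> carrier (H \<boxtimes> H)" using h by (rule lin_closed[OF H.comult_lin])
    have "tensor_map R K K r r v = tensor_map R K K r r (comult H h)"
      using comult_eq[OF h v(1) e] iso h by (simp add: hopf_iso_def)
    from arg_cong[OF this, of "sw R K K (H \<boxtimes> H) (\<lambda>g k. pt H H (i g) (i k))"]
    have "v = comult H h"
      using v(1) dh by (simp add: tensor_map_sw[OF v(1)] tensor_map_sw[OF dh] K_simps cong: sw_cong2)
    then show "sw R H H T4 (\<lambda>g k. duo T4 (\<lambda>a b. duo T4 (\<lambda>c d. t4 a b c d) (r k)) (r g)) (comult H h) =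
      duo T4 (\<lambda>a b. tri T4 (\<lambda>d e f. t4 a d e f) (\<mu> b)) (r h)" using e by (simp add: E2_def)
  qed
qed

end

context right_torsor
begin

lemma right_onto: "right_onto R T H r"
  by unfold_locales (rule r_onto)

lemma right_hopf_iso: "hopf_iso R H (right_hopf R T) r"
proof -
  interpret O: right_onto R T H r by (rule right_onto)
  have "bij_betw r (carrier H) {z. Hr_eq z}"
    using r_inj r_Hr r_onto by (auto simp: bij_betw_def)
  then have "algebra_iso R H (right_hopf R T) r"
    using O.r_K r_mult r_one lin_add[OF O.r_K] lin_closed[OF O.r_K]
    by (auto simp: algebra_iso_def algebra_hom_def ring_hom_def right_hopf_fields)
  moreover have "comult (right_hopf R T) (r h) = tensor_map R (right_hopf R T) (right_hopf R T) r r (comult H h)"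
    if "h \<in> carrier H" for h
    using r_comult[OF that] that by (intro O.comult_eq) (simp_all add: O.E2_def comult_typ)
  ultimately show ?thesis
    using right_hopf_counit[OF r_Hr H.counit_closed] r_counit by (auto simp: hopf_iso_def)
qed

lemma rhoT_eq: "x \<in> carrier T \<Longrightarrow> right_onto.rhoT R T H r x = rho x"
proof -
  assume x: "x \<in> carrier T"
  interpret O: right_onto R T H r by (rule right_onto)
  show ?thesis using O.rhoT[OF x] E_rho[OF x] rho_typ[OF x] by (intro inj_onD[OF E_inj[OF torsor_flat]]) simp_all
qed

end

section \<open>Torsors are bi-Galois objects\<close>

text \<open>Torsors and bicomodule algebras are different records over one algebra.
  \<open>same_alg\<close> compares the algebra fields only, and the lemmas after it carry comodule
  and Galois properties from one record to the other.\<close>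

definition same_alg :: "('k, 'a, 'm) module_scheme \<Rightarrow> ('k, 'a, 'n) module_scheme \<Rightarrow> bool" where
  "same_alg A B \<longleftrightarrow> same A B \<and> monoid.mult A = monoid.mult B \<and> \<one>\<^bsub>A\<^esub> = \<one>\<^bsub>B\<^esub>"

lemma same_alg_tensor_right:
  fixes R (structure)
  assumes "same_alg A B"
  shows "M \<boxtimes> A = M \<boxtimes> B"
  using assms same_tensor_class[OF same_refl, of A B R M]
  by (simp add: same_alg_def tensor_def same_def)

lemma same_alg_tensor_left:
  fixes R (structure)
  assumes "same_alg A B"
  shows "A \<boxtimes> M = B \<boxtimes> M"
  using assms same_tensor_class[OF _ same_refl, of A B R M]
  by (simp add: same_alg_def tensor_def same_def)

lemma same_alg_algebra:
  assumes s: "same_alg A B" and A: "assoc_algebra R A"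
  shows "assoc_algebra R B"
proof -
  interpret A: assoc_algebra R A by fact
  have [simp]: "carrier B = carrier A" "add B = add A" "\<zero>\<^bsub>B\<^esub> = \<zero>\<^bsub>A\<^esub>" "smult B = smult A"
    "monoid.mult B = monoid.mult A" "\<one>\<^bsub>B\<^esub> = \<one>\<^bsub>A\<^esub>"
    using s by (simp_all add: same_alg_def same_def)
  have m: "module R B" using s A.module_axioms by (auto simp: same_alg_def intro: same_module)
  interpret B: module R B by (rule m)
  have "ring B"
    by (rule ringI) (auto simp: A.A.m_assoc A.A.l_distr A.A.r_distr B.M.abelian_group_axioms
        intro!: monoidI)
  then show ?thesis
    by (intro assoc_algebra.intro m assoc_algebra_axioms.intro) (auto simp: A.smult_mult_left A.smult_mult_right)
qed

lemma same_alg_hom: "same_alg A B \<Longrightarrow> algebra_hom R A C f = algebra_hom R B C f"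
  by (simp add: same_alg_def same_def algebra_hom_def ring_hom_def linear_map_def)

lemma same_alg_iso: "same_alg A B \<Longrightarrow> algebra_iso R A C f = algebra_iso R B C f"
  using same_alg_hom[of A B R C f] by (simp add: algebra_iso_def same_alg_def same_def)

lemma same_alg_iso_target: "same_alg A B \<Longrightarrow> algebra_iso R C A f = algebra_iso R C B f"
  by (simp add: same_alg_def same_def algebra_iso_def algebra_hom_def ring_hom_def linear_map_def)

lemma same_alg_ff: "same_alg A B \<Longrightarrow> faithfully_flat R A \<Longrightarrow> faithfully_flat R B"
proof -
  assume s: "same_alg A B" and f: "faithfully_flat R A"
  have ab: "same A B" using s by (simp add: same_alg_def)
  have "module R A = module R B"
    using same_module[of A B R] same_module[of B A R] same_sym[of A B] ab by auto
  then show ?thesis using f unfolding faithfully_flat_def same_alg_tensor_left[OF s] same_map[OF ab same_refl] by simp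
qed

lemma same_alg_rules:
  assumes "same_alg A B"
  shows "pure_tensor R M A = pure_tensor R M B" "pure_tensor R A M = pure_tensor R B M"
    "tensor_map R M A = tensor_map R M B" "tensor_map R A M = tensor_map R B M" "tensor_lift A = tensor_lift B"
    "assoc R M N A = assoc R M N B" "assoc R A M N = assoc R B M N" "assoc R M A N = assoc R M B N"
  using assms unfolding same_alg_def
  by (auto intro!: same_pure same_map same_lift same_assoc same_refl)

lemma same_alg_left_comodule:
  assumes s: "same_alg A B" and A: "left_comodule_algebra R L A lam"
  shows "left_comodule_algebra R L B lam"
proof -
  interpret A: left_comodule_algebra R L A lam by fact
  have c: "carrier B = carrier A" "smult B = smult A" using s by (auto simp: same_alg_def same_def)
  show ?thesis
    using A.left_coaction_hom A.left_coassoc A.left_counit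
    by (intro left_comodule_algebra.intro left_comodule_algebra_axioms.intro A.L.bialgebra_axioms
        same_alg_algebra[OF s A.T.assoc_algebra_axioms])
      (simp_all add: c same_alg_tensor_right[OF s] same_alg_hom[OF s] same_alg_rules[OF s])
qed

lemma same_alg_right_comodule:
  assumes s: "same_alg A B" and A: "right_comodule_algebra R H A rho"
  shows "right_comodule_algebra R H B rho"
proof -
  interpret A: right_comodule_algebra R H A rho by fact
  have c: "carrier B = carrier A" "smult B = smult A" using s by (auto simp: same_alg_def same_def)
  show ?thesis
    using A.right_coaction_hom A.right_coassoc A.right_counit
    by (intro right_comodule_algebra.intro right_comodule_algebra_axioms.intro A.H.bialgebra_axioms
        same_alg_algebra[OF s A.T.assoc_algebra_axioms])
      (simp_all add: c same_alg_tensor_left[OF s] same_alg_hom[OF s] same_alg_rules[OF s])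
qed

lemma same_alg_left_galois:
  assumes s: "same_alg A B" and A: "left_galois R L A lam"
  shows "left_galois R L B lam"
proof -
  interpret A: left_galois R L A lam by fact
  have c: "carrier B = carrier A" "smult B = smult A" "monoid.mult B = monoid.mult A" "\<one>\<^bsub>B\<^esub> = \<one>\<^bsub>A\<^esub>"
    using s by (auto simp: same_alg_def same_def)
  show ?thesis
    using A.left_coinvariants A.left_galois_bij
    by (intro left_galois.intro left_galois_axioms.intro same_alg_left_comodule[OF s A.left_comodule_algebra_axioms])
      (simp_all add: c same_alg_tensor_right[OF s] same_alg_tensor_left[OF s] same_alg_rules[OF s])
qed

lemma same_alg_right_galois:
  assumes s: "same_alg A B" and A: "right_galois R H A rho"
  shows "right_galois R H B rho"
proof -
  interpret A: right_galois R H A rho by fact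
  have c: "carrier B = carrier A" "smult B = smult A" "monoid.mult B = monoid.mult A" "\<one>\<^bsub>B\<^esub> = \<one>\<^bsub>A\<^esub>"
    using s by (auto simp: same_alg_def same_def)
  show ?thesis
    using A.right_coinvariants A.right_galois_bij
    by (intro right_galois.intro right_galois_axioms.intro same_alg_right_comodule[OF s A.right_comodule_algebra_axioms])
      (simp_all add: c same_alg_tensor_right[OF s] same_alg_tensor_left[OF s] same_alg_rules[OF s])
qed

lemma with_coactions_same_alg: "same_alg A (with_coactions A l r)"
  by (simp add: same_alg_def same_def with_coactions_def)

lemma with_coactions_coacts: "lcoact (with_coactions A l r) = l" "rcoact (with_coactions A l r) = r"
  by (simp_all add: with_coactions_def)

text \<open>Embed the factor \<open>T \<otimes> H\<close> into \<open>T3\<close> and keep the left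
  \<open>H\<close>. One side becomes \<open>lam\<close> on the first factor of
  \<open>\<mu> x\<close>, the other becomes \<mu> on the \<open>T\<close>-component of
  \<open>lam x\<close>; these agree by colinearity of \<mu>.\<close>

lemma torsor_coactions_commute:
  fixes R (structure)
  assumes L: "left_torsor R T H ell lam" and R: "right_torsor R T H r rho" and x: "x \<in> carrier T"
  shows "assoc R H T H (tensor_map R (H \<boxtimes> T) H lam id (rho x)) = tensor_map R H (T \<boxtimes> H) id rho (lam x)"
proof -
  interpret L: left_torsor R T H ell lam by fact
  interpret R: right_torsor R T H r rho by fact
  let ?P = "H \<boxtimes> (T \<boxtimes> H)"
  let ?Q = "H \<boxtimes> L.T3"
  let ?l = "sw R T H ?P (\<lambda>t h. sw R H T ?P (\<lambda>k s. pure_tensor R H (T \<boxtimes> H) k (pure_tensor R T H s h)) (lam t)) (rho x)"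
  let ?r = "sw R H T ?P (\<lambda>k t. pure_tensor R H (T \<boxtimes> H) k (rho t)) (lam x)"
  let ?J = "sw R H (T \<boxtimes> H) ?Q (\<lambda>k w. pure_tensor R H L.T3 k (R.E T w))"
  note simps = L.F_simps R.rho_typ R.lin_rho R.r_typ R.lin_r
  have l: "assoc R H T H (tensor_map R (H \<boxtimes> T) H lam id (rho x)) = ?l"
    unfolding tensor_map_sw[OF R.rho_typ[OF x]] using x by (simp add: assoc_sw simps cong: sw_cong2)
  have r: "tensor_map R H (T \<boxtimes> H) id rho (lam x) = ?r"
    using tensor_map_sw[OF L.lam_typ[OF x], of "H" "T \<boxtimes> H" id rho] by simp
  let ?G = "\<lambda>t v. sw R H T ?Q (\<lambda>k s. pure_tensor R H L.T3 k (pure_tensor R T L.T2 s v)) (lam t)"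
  have "?J ?l = sw R T H ?Q (\<lambda>t h. ?G t (r h)) (rho x)"
    using x by (simp add: R.E_def simps cong: sw_cong2; simp add: L.T_fold simps cong: sw_cong2)
  also have "\<dots> = sw R T L.T2 ?Q ?G (L.\<mu> x)"
    using x by (intro R.mu_to_rho_sw[of x ?Q ?G]) (simp_all add: simps)
  also have "\<dots> = L.tri ?Q (\<lambda>a b c. ?G a (L.t2 b c)) (L.\<mu> x)"
    by (intro L.tri_expand) (simp_all add: simps)
  also have "\<dots> = sw R H T ?Q (\<lambda>k t. pure_tensor R H L.T3 k (L.\<mu> t)) (lam x)"
    by (rule L.lam_mu_colinear[OF x, symmetric])
  also have "\<dots> = sw R H T ?Q (\<lambda>k t. pure_tensor R H L.T3 k (R.E T (rho t))) (lam x)"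
    by (intro sw_cong) (simp_all add: simps R.E_rho)
  also have "\<dots> = ?J ?r"
    using x by (simp add: lin_comp[OF _ R.E_lin[OF L.T_module]] lin_closed[OF R.E_lin[OF L.T_module]] simps cong: sw_cong2)
  finally have e: "?J ?l = ?J ?r" .
  have "?l \<in> carrier ?P" "?r \<in> carrier ?P"
    by (intro sw_closed pure_closed R.rho_typ L.lam_typ; simp add: simps)+
  moreover have "inj_on ?J (carrier ?P)"
    by (rule flat_inj_right[OF L.H_flat _ _ R.E_lin R.E_inj]) (simp_all add: simps L.torsor_flat)
  ultimately show ?thesis unfolding l r using e by (blast dest: inj_onD)
qed

text \<open>The coactions of \<open>torsor_bicomodule_algebra\<close> are identified with those of
  \<open>left_torsor\<close> and \<open>right_torsor\<close>, so the bi-Galois properties can be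
  read off from the two one-sided theories.\<close>

lemma torsor_bigal:
  assumes H: "flat R H" and bi: "bialgebra R H" and T: "T \<in> tor_objects R H"
  shows "torsor_bicomodule_algebra R H T \<in> bigal_objects R H"
    and "left_torsor R T H (left_ident T) (lcoact (torsor_bicomodule_algebra R H T))"
    and "right_torsor R T H (right_ident T) (rcoact (torsor_bicomodule_algebra R H T))"
proof -
  have q: "quantum_torsor R T" and hl: "hopf_iso R H (left_hopf R T) (left_ident T)"
    and hr: "hopf_iso R H (right_hopf R T) (right_ident T)"
    using T by (auto simp: tor_objects_def)
  interpret T: quantum_torsor R T by (rule q)
  let ?A = "torsor_bicomodule_algebra R H T"
  have l: "lcoact ?A = left_onto.lamT R T H (left_ident T)" and r: "rcoact ?A = right_onto.rhoT R T H (right_ident T)"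
    using left_onto.lamT_def[OF T.left_onto_of_iso[OF H]] right_onto.rhoT_def[OF T.right_onto_of_iso[OF H]] hl hr
    by (auto simp: torsor_bicomodule_algebra_def with_coactions_coacts hopf_iso_def fun_eq_iff)
  show L: "left_torsor R T H (left_ident T) (lcoact ?A)"
    unfolding l by (rule T.left_torsor_of_hopf_iso[OF H bi hl])
  show R: "right_torsor R T H (right_ident T) (rcoact ?A)"
    unfolding r by (rule T.right_torsor_of_hopf_iso[OF H bi hr])
  interpret L: left_torsor R T H "left_ident T" "lcoact ?A" by (rule L)
  interpret R: right_torsor R T H "right_ident T" "rcoact ?A" by (rule R)
  have s: "same_alg T ?A" unfolding torsor_bicomodule_algebra_def by (rule with_coactions_same_alg)
  have c: "carrier ?A = carrier T" using s by (simp add: same_alg_def same_def)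
  note gl = same_alg_left_galois[OF s L.left_galois] and gr = same_alg_right_galois[OF s R.right_galois]
  have "bicomodule_algebra R H H ?A"
    using torsor_coactions_commute[OF L R]
    by (intro bicomodule_algebra.intro bicomodule_algebra_axioms.intro left_galois.axioms[OF gl] right_galois.axioms[OF gr])
      (simp add: c same_alg_rules[OF s, symmetric] same_alg_tensor_left[OF s, symmetric] same_alg_tensor_right[OF s, symmetric])
  then have "bi_galois R H H ?A" using gl gr by (rule bi_galois.intro)
  then show "?A \<in> bigal_objects R H"
    using same_alg_ff[OF s T.torsor_faithfully_flat] by (simp add: bigal_objects_def)
qed

section \<open>Antipodes\<close>

definition trilinear ::
  "'k ring \<Rightarrow> ('k, 'a, 'm) module_scheme \<Rightarrow> ('k, 'b, 'n) module_scheme \<Rightarrow> ('k, 'c, 'o) module_scheme \<Rightarrow>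
   ('k, 'd, 'p) module_scheme \<Rightarrow> ('a \<Rightarrow> 'b \<Rightarrow> 'c \<Rightarrow> 'd) \<Rightarrow> bool" where
  "trilinear R A B C P F \<longleftrightarrow>
     (\<forall>b\<in>carrier B. \<forall>c\<in>carrier C. linear_map R A P (\<lambda>a. F a b c)) \<and>
     (\<forall>a\<in>carrier A. \<forall>c\<in>carrier C. linear_map R B P (\<lambda>b. F a b c)) \<and>
     (\<forall>a\<in>carrier A. \<forall>b\<in>carrier B. linear_map R C P (\<lambda>c. F a b c))"

lemma trilinearI:
  assumes "\<And>b c. b \<in> carrier B \<Longrightarrow> c \<in> carrier C \<Longrightarrow> linear_map R A P (\<lambda>a. F a b c)"
    and "\<And>a c. a \<in> carrier A \<Longrightarrow> c \<in> carrier C \<Longrightarrow> linear_map R B P (\<lambda>b. F a b c)"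
    and "\<And>a b. a \<in> carrier A \<Longrightarrow> b \<in> carrier B \<Longrightarrow> linear_map R C P (\<lambda>c. F a b c)"
  shows "trilinear R A B C P F"
  using assms by (simp add: trilinear_def)

lemma trilinearD:
  assumes "trilinear R A B C P F"
  shows "b \<in> carrier B \<Longrightarrow> c \<in> carrier C \<Longrightarrow> linear_map R A P (\<lambda>a. F a b c)"
    and "a \<in> carrier A \<Longrightarrow> c \<in> carrier C \<Longrightarrow> linear_map R B P (\<lambda>b. F a b c)"
    and "a \<in> carrier A \<Longrightarrow> b \<in> carrier B \<Longrightarrow> linear_map R C P (\<lambda>c. F a b c)"
    and "a \<in> carrier A \<Longrightarrow> b \<in> carrier B \<Longrightarrow> c \<in> carrier C \<Longrightarrow> F a b c \<in> carrier P"
  using assms lin_closed[of R C P "F a b" c] by (auto simp: trilinear_def)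

lemma bilinearD:
  assumes "bilinear R M N P f"
  shows "y \<in> carrier N \<Longrightarrow> linear_map R M P (\<lambda>x. f x y)"
    and "x \<in> carrier M \<Longrightarrow> linear_map R N P (\<lambda>y. f x y)"
    and "x \<in> carrier M \<Longrightarrow> y \<in> carrier N \<Longrightarrow> f x y \<in> carrier P"
  using assms lin_closed[of R N P "f x" y] by (auto simp: bilinear_def)

context bialgebra
begin

abbreviation hmul (infixl \<open>\<star>\<close> 70) where "x \<star> y \<equiv> x \<otimes>\<^bsub>H\<^esub> y"

lemma H_module: "module R H" by unfold_locales

lemma lin_comult: "linear_map R A H f \<Longrightarrow> linear_map R A (H \<boxtimes> H) (\<lambda>x. comult H (f x))"
  by (rule lin_comp[OF _ comult_lin])

lemma comult_typ: "h \<in> carrier H \<Longrightarrow> comult H h \<in> carrier (H \<boxtimes> H)"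
  by (rule lin_closed[OF comult_lin])

lemma H_one: "\<one>\<^bsub>H\<^esub> \<in> carrier H" by simp

abbreviation "Del P F h \<equiv> sw R H H P F (comult H h)"

lemmas H_simps = sw_all H_module H_bimult lin_comult comult_typ lin_counit counit_closed H_one
  bimult_closed[of R] bimult_one[of R]

text \<open>Coassociativity tested on a trilinear \<open>F\<close>. In this form it regroups nested
  Sweedler sums without mentioning the associator.\<close>

lemma coassoc_sw:
  assumes h: "h \<in> carrier H" and P: "module R P" and F: "trilinear R H H H P F"
  shows "Del P (\<lambda>g k. Del P (\<lambda>a b. F a b k) g) h = Del P (\<lambda>a g. Del P (\<lambda>b c. F a b c) g) h"
proof -
  note F = trilinearD[OF F]
  let ?e = "sw R H (H \<boxtimes> H) P (\<lambda>a v. sw R H H P (\<lambda>b c. F a b c) v)"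
  have "?e (assoc R H H H (tensor_map R (H \<boxtimes> H) H (comult H) id (comult H h))) =
      Del P (\<lambda>g k. Del P (\<lambda>a b. F a b k) g) h"
    unfolding tensor_map_sw[OF comult_typ[OF h]] using h P F by (simp add: assoc_sw H_simps cong: sw_cong2)
  moreover have "?e (tensor_map R H (H \<boxtimes> H) id (comult H) (comult H h)) =
      Del P (\<lambda>a g. Del P (\<lambda>b c. F a b c) g) h"
    unfolding tensor_map_sw[OF comult_typ[OF h]] using h P F by (simp add: H_simps cong: sw_cong2)
  ultimately show ?thesis by (simp add: coassoc[OF h])
qed

lemma comult_one: "comult H \<one>\<^bsub>H\<^esub> = pure_tensor R H H \<one>\<^bsub>H\<^esub> \<one>\<^bsub>H\<^esub>"
  using comult_hom by (simp add: algebra_hom_def ring_hom_def tensor_one)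

lemma comult_mult_sw:
  assumes "g \<in> carrier H" "h \<in> carrier H" "module R P" "bilinear R H H P F"
  shows "Del P F (g \<star> h) = Del P (\<lambda>a b. Del P (\<lambda>c d. F (a \<star> c) (b \<star> d)) h) g"
proof -
  have "comult H (g \<star> h) = comult H g \<otimes>\<^bsub>H \<boxtimes> H\<^esub> comult H h"
    using comult_hom assms(1,2) by (simp add: algebra_hom_def ring_hom_def)
  then show ?thesis using assms bilinearD[OF assms(4)] by (simp add: tensor_mult H_simps cong: sw_cong2)
qed

lemma counit_mult: "g \<in> carrier H \<Longrightarrow> h \<in> carrier H \<Longrightarrow> counit H (g \<star> h) = counit H g \<otimes>\<^bsub>R\<^esub> counit H h"
  using counit_hom by (simp add: ring_hom_def)

lemma counit_one: "counit H \<one>\<^bsub>H\<^esub> = \<one>\<^bsub>R\<^esub>"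
  using counit_hom by (simp add: ring_hom_def)

lemma counit_left_lin:
  assumes "h \<in> carrier H" "module R P" "linear_map R H P F"
  shows "Del P (\<lambda>a b. counit H a \<odot>\<^bsub>P\<^esub> F b) h = F h"
proof -
  have "F (Del H (\<lambda>a b. counit H a \<odot>\<^bsub>H\<^esub> b) h) = Del P (\<lambda>a b. F (counit H a \<odot>\<^bsub>H\<^esub> b)) h"
    by (rule lin_sw_apply[OF _ _ _ _ assms(3)]) (simp_all add: H_simps assms)
  also have "\<dots> = Del P (\<lambda>a b. counit H a \<odot>\<^bsub>P\<^esub> F b) h"
    by (intro sw_cong) (simp_all add: H_simps lin_smult[OF assms(3)])
  finally show ?thesis by (simp add: counit_left_sw assms)
qed

lemma counit_right_lin:
  assumes "h \<in> carrier H" "module R P" "linear_map R H P F"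
  shows "Del P (\<lambda>a b. counit H b \<odot>\<^bsub>P\<^esub> F a) h = F h"
proof -
  have "F (Del H (\<lambda>a b. counit H b \<odot>\<^bsub>H\<^esub> a) h) = Del P (\<lambda>a b. F (counit H b \<odot>\<^bsub>H\<^esub> a)) h"
    by (rule lin_sw_apply[OF _ _ _ _ assms(3)]) (simp_all add: H_simps assms)
  also have "\<dots> = Del P (\<lambda>a b. counit H b \<odot>\<^bsub>P\<^esub> F a) h"
    by (intro sw_cong) (simp_all add: H_simps lin_smult[OF assms(3)])
  finally show ?thesis by (simp add: counit_right_sw assms)
qed

end

section \<open>The antipode reverses products and coproducts\<close>

context hopf_algebra
begin

lemma lin_S: "linear_map R A H f \<Longrightarrow> linear_map R A H (\<lambda>x. S (f x))"
  by (rule lin_comp[OF _ antipode_linear])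

lemma S_typ: "h \<in> carrier H \<Longrightarrow> S h \<in> carrier H" by (rule lin_closed[OF antipode_linear])

lemmas S_simps = H_simps lin_S S_typ

lemma S_left_lin:
  assumes "h \<in> carrier H" "module R P" "linear_map R H P F"
  shows "Del P (\<lambda>a b. F (S a \<star> b)) h = counit H h \<odot>\<^bsub>P\<^esub> F \<one>\<^bsub>H\<^esub>"
proof -
  have "F (Del H (\<lambda>a b. S a \<star> b) h) = Del P (\<lambda>a b. F (S a \<star> b)) h"
    by (rule lin_sw_apply[OF _ _ _ _ assms(3)]) (simp_all add: S_simps assms)
  moreover have "Del H (\<lambda>a b. S a \<star> b) h = counit H h \<odot>\<^bsub>H\<^esub> \<one>\<^bsub>H\<^esub>"
    using antipode_left[OF assms(1)] comult_typ[OF assms(1)] by (simp add: sw_def)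
  ultimately show ?thesis using assms by (simp add: lin_smult[OF assms(3)] S_simps)
qed

lemma S_right_lin:
  assumes "h \<in> carrier H" "module R P" "linear_map R H P F"
  shows "Del P (\<lambda>a b. F (a \<star> S b)) h = counit H h \<odot>\<^bsub>P\<^esub> F \<one>\<^bsub>H\<^esub>"
proof -
  have "F (Del H (\<lambda>a b. a \<star> S b) h) = Del P (\<lambda>a b. F (a \<star> S b)) h"
    by (rule lin_sw_apply[OF _ _ _ _ assms(3)]) (simp_all add: S_simps assms)
  moreover have "Del H (\<lambda>a b. a \<star> S b) h = counit H h \<odot>\<^bsub>H\<^esub> \<one>\<^bsub>H\<^esub>"
    using antipode_right[OF assms(1)] comult_typ[OF assms(1)] by (simp add: sw_def)
  ultimately show ?thesis using assms by (simp add: lin_smult[OF assms(3)] S_simps)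
qed

lemma S_one: "S \<one>\<^bsub>H\<^esub> = \<one>\<^bsub>H\<^esub>"
  using S_left_lin[OF H_one H_module lin_id] by (simp add: comult_one S_simps counit_one)

lemma counit_S: "h \<in> carrier H \<Longrightarrow> counit H (S h) = counit H h"
proof -
  assume h: "h \<in> carrier H"
  \<comment> \<open>The rules for sums take values in modules, so the counit is regarded as a map
    into the base ring seen as a module over itself.\<close>
  let ?R = "\<lparr>carrier = carrier R, monoid.mult = monoid.mult R, one = \<one>\<^bsub>R\<^esub>, zero = \<zero>\<^bsub>R\<^esub>, add = add R, smult = monoid.mult R\<rparr>"
  have "abelian_group ?R"
    by (rule abelian_groupI) (auto simp: R.a_ac intro: bexI[of _ "\<ominus>\<^bsub>R\<^esub> x" for x] R.l_neg)
  then have M: "module R ?R"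
    by (intro moduleI R.is_cring) (auto simp: R.l_distr R.r_distr R.m_assoc)
  have l: "linear_map R H ?R (counit H)"
    using counit_hom by (auto simp: linear_map_def ring_hom_def counit_smult)
  have "counit H (S h) = Del ?R (\<lambda>a b. counit H b \<odot>\<^bsub>?R\<^esub> counit H (S a)) h"
    using counit_right_lin[OF h M lin_comp[OF antipode_linear l]] by simp
  also have "\<dots> = Del ?R (\<lambda>a b. counit H (S a \<star> b)) h"
    by (intro sw_cong H_module) (simp add: counit_mult S_typ counit_closed R.m_comm)
  also have "\<dots> = counit H h" using S_left_lin[OF h M l] h by (simp add: counit_one counit_closed)
  finally show ?thesis .
qed

text \<open>The identity is \<open>m_1 S(m_2) \<otimes> m_3 = 1 \<otimes> m\<close>: coassociativity
  brings the first two components together, and the antipode and counit axioms do the rest.\<close>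

lemma S_left_right:
  assumes "m \<in> carrier H" "module R P" "bilinear R H H P F"
  shows "Del P (\<lambda>l k. Del P (\<lambda>k1 k2. F (l \<star> S k1) k2) k) m = F \<one>\<^bsub>H\<^esub> m"
proof -
  note F = bilinearD[OF assms(3)]
  have lF: "linear_map R A P (\<lambda>x. F (g x) k)" if "linear_map R A H g" "k \<in> carrier H" for A :: "('k, 'z, 'y) module_scheme" and g k
    using lin_comp[OF that(1) F(1)[OF that(2)]] .
  have lF2: "linear_map R A P (\<lambda>x. F k (g x))" if "linear_map R A H g" "k \<in> carrier H" for A :: "('k, 'z, 'y) module_scheme" and g k
    using lin_comp[OF that(1) F(2)[OF that(2)]] .
  have "Del P (\<lambda>l k. Del P (\<lambda>k1 k2. F (l \<star> S k1) k2) k) m = Del P (\<lambda>n k. Del P (\<lambda>l k1. F (l \<star> S k1) k) n) m"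
    using assms(1,2) by (intro coassoc_sw[symmetric] trilinearI lF lF2) (simp_all add: S_simps)
  also have "\<dots> = Del P (\<lambda>n k. counit H n \<odot>\<^bsub>P\<^esub> F \<one>\<^bsub>H\<^esub> k) m"
    using assms(2) F by (intro sw_cong S_right_lin) (simp_all add: S_simps)
  also have "\<dots> = F \<one>\<^bsub>H\<^esub> m" using assms F by (intro counit_left_lin) (simp_all add: H_one)
  finally show ?thesis .
qed

text \<open>A convolution argument: both sides are convolution inverse to the product of
  \<open>H\<close>. The sum of \<open>S(g_1 h_1) g_2 h_2 S(h_3) S(g_3)\<close> is evaluated twice,
  cancelling either everything after the first factor or everything before
  \<open>S(h_3)\<close>.\<close>

lemma S_mult:
  assumes g: "g \<in> carrier H" and h: "h \<in> carrier H"
  shows "S (g \<star> h) = S h \<star> S g"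
proof -
  let ?X = "\<lambda>g1 h1 g2 h2 g3 h3. S (g1 \<star> h1) \<star> ((g2 \<star> h2) \<star> (S h3 \<star> S g3))"
  note as = A.m_assoc
  interpret H: ring H by (rule A.ring_axioms)
  have 1: "Del H (\<lambda>g2 g3. Del H (\<lambda>h2 h3. p \<star> ((g2 \<star> h2) \<star> (S h3 \<star> S g3))) l) k =
      counit H k \<odot>\<^bsub>H\<^esub> (counit H l \<odot>\<^bsub>H\<^esub> p)" if "p \<in> carrier H" "k \<in> carrier H" "l \<in> carrier H" for p k l
  proof -
    have "Del H (\<lambda>h2 h3. p \<star> ((g2 \<star> h2) \<star> (S h3 \<star> S g3))) l =
        counit H l \<odot>\<^bsub>H\<^esub> (p \<star> (g2 \<star> S g3))" if "g2 \<in> carrier H" "g3 \<in> carrier H" for g2 g3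
      using S_right_lin[OF \<open>l \<in> carrier H\<close> H_module, of "\<lambda>x. p \<star> (g2 \<star> (x \<star> S g3))"] that \<open>p \<in> carrier H\<close>
      by (simp add: S_simps as cong: sw_cong2)
    then have "Del H (\<lambda>g2 g3. Del H (\<lambda>h2 h3. p \<star> ((g2 \<star> h2) \<star> (S h3 \<star> S g3))) l) k =
        Del H (\<lambda>g2 g3. counit H l \<odot>\<^bsub>H\<^esub> (p \<star> (g2 \<star> S g3))) k"
      by (intro sw_cong H_module)
    also have "\<dots> = counit H k \<odot>\<^bsub>H\<^esub> (counit H l \<odot>\<^bsub>H\<^esub> p)"
      using S_right_lin[OF that(2) H_module, of "\<lambda>x. counit H l \<odot>\<^bsub>H\<^esub> (p \<star> x)"] that
      by (simp add: S_simps lin_smult_right)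
    finally show ?thesis .
  qed
  have "S (g \<star> h) = Del H (\<lambda>g1 k. counit H k \<odot>\<^bsub>H\<^esub> S (g1 \<star> h)) g"
    using g h by (intro counit_right_lin[symmetric]) (simp_all add: S_simps)
  also have "\<dots> = Del H (\<lambda>g1 k. counit H k \<odot>\<^bsub>H\<^esub> Del H (\<lambda>h1 l. counit H l \<odot>\<^bsub>H\<^esub> S (g1 \<star> h1)) h) g"
    using g h by (intro sw_cong arg_cong2[where f = "smult H"] refl counit_right_lin[symmetric]) (simp_all add: S_simps)
  also have "\<dots> = Del H (\<lambda>g1 k. Del H (\<lambda>h1 l. Del H (\<lambda>g2 g3. Del H (\<lambda>h2 h3. ?X g1 h1 g2 h2 g3 h3) l) k) h) g"
    using g h by (simp add: 1 smult_sw S_simps cong: sw_cong2)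
  also have "\<dots> = Del H (\<lambda>g1 k. Del H (\<lambda>g2 g3. Del H (\<lambda>h1 l. Del H (\<lambda>h2 h3. ?X g1 h1 g2 h2 g3 h3) l) h) k) g"
    by (intro sw_cong sw_swap) (simp_all add: S_simps)
  also have "\<dots> = Del H (\<lambda>g1 k. Del H (\<lambda>g2 g3. Del H (\<lambda>l h3. Del H (\<lambda>h1 h2. ?X g1 h1 g2 h2 g3 h3) l) h) k) g"
    using h by (intro sw_cong coassoc_sw[symmetric] trilinearI) (simp_all add: S_simps)
  also have "\<dots> = Del H (\<lambda>k g3. Del H (\<lambda>g1 g2. Del H (\<lambda>l h3. Del H (\<lambda>h1 h2. ?X g1 h1 g2 h2 g3 h3) l) h) k) g"
    using g by (intro coassoc_sw[symmetric] trilinearI) (simp_all add: S_simps)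
  also have "\<dots> = Del H (\<lambda>k g3. Del H (\<lambda>l h3. Del H (\<lambda>g1 g2. Del H (\<lambda>h1 h2. ?X g1 h1 g2 h2 g3 h3) l) k) h) g"
    by (intro sw_cong sw_swap) (simp_all add: S_simps)
  also have "\<dots> = Del H (\<lambda>k g3. Del H (\<lambda>l h3. counit H k \<odot>\<^bsub>H\<^esub> (counit H l \<odot>\<^bsub>H\<^esub> (S h3 \<star> S g3))) h) g"
  proof (intro sw_cong H_module)
    fix k g3 l h3 assume c: "k \<in> carrier H" "g3 \<in> carrier H" "l \<in> carrier H" "h3 \<in> carrier H"
    have "Del H (\<lambda>g1 g2. Del H (\<lambda>h1 h2. ?X g1 h1 g2 h2 g3 h3) l) k = Del H (\<lambda>a b. S a \<star> b \<star> (S h3 \<star> S g3)) (k \<star> l)"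
      using c by (subst comult_mult_sw) (simp_all add: S_simps as bilinearI cong: sw_cong2)
    also have "\<dots> = counit H k \<odot>\<^bsub>H\<^esub> (counit H l \<odot>\<^bsub>H\<^esub> (S h3 \<star> S g3))"
      using c S_left_lin[of "k \<star> l" H "\<lambda>x. x \<star> (S h3 \<star> S g3)"]
      by (simp add: S_simps counit_mult smult_assoc1)
    finally show "Del H (\<lambda>g1 g2. Del H (\<lambda>h1 h2. ?X g1 h1 g2 h2 g3 h3) l) k =
      counit H k \<odot>\<^bsub>H\<^esub> (counit H l \<odot>\<^bsub>H\<^esub> (S h3 \<star> S g3))" .
  qed
  also have "\<dots> = Del H (\<lambda>k g3. counit H k \<odot>\<^bsub>H\<^esub> (S h \<star> S g3)) g"
  proof (intro sw_cong H_module)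
    fix k g3 assume c: "k \<in> carrier H" "g3 \<in> carrier H"
    show "Del H (\<lambda>l h3. counit H k \<odot>\<^bsub>H\<^esub> (counit H l \<odot>\<^bsub>H\<^esub> (S h3 \<star> S g3))) h = counit H k \<odot>\<^bsub>H\<^esub> (S h \<star> S g3)"
      using c h counit_left_lin[OF h H_module, of "\<lambda>x. S x \<star> S g3"]
      by (simp add: S_simps smult_sw[symmetric])
  qed
  also have "\<dots> = S h \<star> S g"
    using g h by (intro counit_left_lin) (simp_all add: S_simps)
  finally show ?thesis .
qed

text \<open>A convolution argument in \<open>H \<boxtimes> H\<close>: the product of
  \<open>\<Delta>(S h_1)\<close>, \<open>\<Delta>(h_2)\<close> and
  \<open>S(h_4) \<otimes> S(h_3)\<close> is evaluated from both ends.\<close>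

lemma comult_S:
  assumes h: "h \<in> carrier H"
  shows "comult H (S h) = Del (H \<boxtimes> H) (\<lambda>a b. pure_tensor R H H (S b) (S a)) h"
proof -
  let ?P = "H \<boxtimes> H"
  let ?p = "pure_tensor R H H"
  let ?X = "\<lambda>p q a b c d. ?p ((p \<star> a) \<star> S d) ((q \<star> b) \<star> S c)"
  have P: "module R ?P" by (simp add: H_simps)
  note as = A.m_assoc
  have 1: "Del ?P (\<lambda>u v. Del ?P (\<lambda>a b. Del ?P (\<lambda>c d. ?X p q a b c d) v) u) k = counit H k \<odot>\<^bsub>?P\<^esub> ?p p q"
    if c: "p \<in> carrier H" "q \<in> carrier H" "k \<in> carrier H" for p q k
  proof -
    have "Del ?P (\<lambda>u v. Del ?P (\<lambda>a b. Del ?P (\<lambda>c d. ?X p q a b c d) v) u) k =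
        Del ?P (\<lambda>a g. Del ?P (\<lambda>b v. Del ?P (\<lambda>c d. ?X p q a b c d) v) g) k"
      using c by (intro coassoc_sw trilinearI) (simp_all add: S_simps)
    also have "\<dots> = Del ?P (\<lambda>a g. Del ?P (\<lambda>g' d. Del ?P (\<lambda>b c. ?X p q a b c d) g') g) k"
      using c by (intro sw_cong coassoc_sw[symmetric] trilinearI) (simp_all add: S_simps)
    also have "\<dots> = Del ?P (\<lambda>a g. Del ?P (\<lambda>g' d. counit H g' \<odot>\<^bsub>?P\<^esub> ?p ((p \<star> a) \<star> S d) q) g) k"
    proof (intro sw_cong H_module)
      fix a g g' d assume d: "a \<in> carrier H" "g' \<in> carrier H" "d \<in> carrier H"
      show "Del ?P (\<lambda>b c. ?X p q a b c d) g' = counit H g' \<odot>\<^bsub>?P\<^esub> ?p ((p \<star> a) \<star> S d) q"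
        using S_right_lin[OF d(2) P, of "\<lambda>x. ?p ((p \<star> a) \<star> S d) (q \<star> x)"] c d
        by (simp add: S_simps as cong: sw_cong2)
    qed
    also have "\<dots> = Del ?P (\<lambda>a g. ?p ((p \<star> a) \<star> S g) q) k"
      using c by (intro sw_cong counit_left_lin) (simp_all add: S_simps)
    also have "\<dots> = counit H k \<odot>\<^bsub>?P\<^esub> ?p p q"
      using S_right_lin[OF c(3) P, of "\<lambda>x. ?p (p \<star> x) q"] c by (simp add: S_simps as cong: sw_cong2)
    finally show ?thesis .
  qed
  have "comult H (S h) = Del ?P (\<lambda>h1 k. counit H k \<odot>\<^bsub>?P\<^esub> comult H (S h1)) h"
    using h by (intro counit_right_lin[symmetric]) (simp_all add: S_simps)
  also have "\<dots> = Del ?P (\<lambda>h1 k. Del ?P (\<lambda>p q. counit H k \<odot>\<^bsub>?P\<^esub> ?p p q) (S h1)) h"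
    by (intro sw_cong) (simp_all add: S_simps smult_sw[symmetric])
  also have "\<dots> = Del ?P (\<lambda>h1 k. Del ?P (\<lambda>p q. Del ?P (\<lambda>u v. Del ?P (\<lambda>a b. Del ?P (\<lambda>c d. ?X p q a b c d) v) u) k) (S h1)) h"
    by (intro sw_cong 1[symmetric]) (simp_all add: S_simps)
  also have "\<dots> = Del ?P (\<lambda>h1 k. Del ?P (\<lambda>u v. Del ?P (\<lambda>p q. Del ?P (\<lambda>a b. Del ?P (\<lambda>c d. ?X p q a b c d) v) u) (S h1)) k) h"
    by (intro sw_cong sw_swap) (simp_all add: S_simps)
  also have "\<dots> = Del ?P (\<lambda>w v. Del ?P (\<lambda>h1 u. Del ?P (\<lambda>p q. Del ?P (\<lambda>a b. Del ?P (\<lambda>c d. ?X p q a b c d) v) u) (S h1)) w) h"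
    using h by (intro coassoc_sw[symmetric] trilinearI) (simp_all add: S_simps)
  also have "\<dots> = Del ?P (\<lambda>w v. Del ?P (\<lambda>h1 u. Del ?P (\<lambda>p q. Del ?P (\<lambda>c d. ?p (p \<star> S d) (q \<star> S c)) v) (S h1 \<star> u)) w) h"
    by (intro sw_cong comult_mult_sw[symmetric] bilinearI) (simp_all add: S_simps)
  also have "\<dots> = Del ?P (\<lambda>w v. counit H w \<odot>\<^bsub>?P\<^esub> Del ?P (\<lambda>c d. ?p (S d) (S c)) v) h"
  proof (intro sw_cong H_module)
    fix w v assume c: "w \<in> carrier H" "v \<in> carrier H"
    show "Del ?P (\<lambda>h1 u. Del ?P (\<lambda>p q. Del ?P (\<lambda>c d. ?p (p \<star> S d) (q \<star> S c)) v) (S h1 \<star> u)) w =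
        counit H w \<odot>\<^bsub>?P\<^esub> Del ?P (\<lambda>c d. ?p (S d) (S c)) v"
      using S_left_lin[OF c(1) P, of "\<lambda>x. Del ?P (\<lambda>p q. Del ?P (\<lambda>c d. ?p (p \<star> S d) (q \<star> S c)) v) x"] c
      by (simp add: S_simps comult_one cong: sw_cong2)
  qed
  also have "\<dots> = Del ?P (\<lambda>a b. ?p (S b) (S a)) h"
    using h by (intro counit_left_lin) (simp_all add: S_simps)
  finally show ?thesis .
qed

end

section \<open>The inverse antipode\<close>

locale hopf_bij = hopf_algebra R H S
  for R :: "'k ring" (structure) and H :: "('k, 'h) bialgebra" and S :: "'h \<Rightarrow> 'h" +
  assumes S_bij: "bij_betw S (carrier H) (carrier H)"
begin

abbreviation "Si \<equiv> inv_into (carrier H) S"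

lemma Si_typ: "h \<in> carrier H \<Longrightarrow> Si h \<in> carrier H"
  using S_bij by (metis bij_betw_def inv_into_into)

lemma S_Si: "h \<in> carrier H \<Longrightarrow> S (Si h) = h"
  using S_bij by (rule bij_betw_inv_into_right)

lemma Si_S: "h \<in> carrier H \<Longrightarrow> Si (S h) = h"
  using S_bij by (rule bij_betw_inv_into_left)

lemma Si_linear: "linear_map R H H Si"
  by (rule lin_of_inj[OF H_module antipode_linear bij_betw_imp_inj_on[OF S_bij] H_module Si_typ])
    (use lin_id lin_cong[of H "\<lambda>x. S (Si x)" "\<lambda>x. x" R H] S_Si H_module in blast)+

lemma lin_Si: "linear_map R A H f \<Longrightarrow> linear_map R A H (\<lambda>x. Si (f x))"
  by (rule lin_comp[OF _ Si_linear])

lemmas Si_simps = S_simps lin_Si Si_typ S_Si Si_S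

lemma Si_one: "Si \<one>\<^bsub>H\<^esub> = \<one>\<^bsub>H\<^esub>"
  using Si_S[OF H_one] by (simp add: S_one)

lemma counit_Si: "h \<in> carrier H \<Longrightarrow> counit H (Si h) = counit H h"
  using counit_S[OF Si_typ] by (simp add: S_Si)

lemma Si_mult: "g \<in> carrier H \<Longrightarrow> h \<in> carrier H \<Longrightarrow> Si (g \<star> h) = Si h \<star> Si g"
  using Si_S[of "Si h \<star> Si g"] by (simp add: S_mult Si_simps)

lemma comult_S_sw:
  assumes "h \<in> carrier H" "module R P" "bilinear R H H P F"
  shows "Del P F (S h) = Del P (\<lambda>a b. F (S b) (S a)) h"
  using assms bilinearD[OF assms(3)] by (simp add: comult_S S_simps cong: sw_cong2)

lemma comult_Si_sw:
  assumes "h \<in> carrier H" "module R P" "bilinear R H H P F"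
  shows "Del P F (Si h) = Del P (\<lambda>a b. F (Si b) (Si a)) h"
proof -
  note F = bilinearD[OF assms(3)]
  have "Del P (\<lambda>a b. F (Si b) (Si a)) (S (Si h)) = Del P (\<lambda>a b. F (Si (S a)) (Si (S b))) (Si h)"
    by (intro comult_S_sw bilinearI) (simp_all add: assms Si_simps lin_comp[OF _ F(1)] lin_comp[OF _ F(2)])
  also have "\<dots> = Del P F (Si h)" by (intro sw_cong) (simp_all add: Si_simps)
  finally show ?thesis using assms by (simp add: S_Si)
qed

text \<open>The identity is \<open>S^-1(m_2) m_1 \<otimes> m_3 = 1 \<otimes> m\<close>. The inverse
  antipode is an antipode for the opposite multiplication, as one sees by applying \<open>Si\<close>
  to \<open>S l \<star> k1\<close>.\<close>

lemma Si_left_right: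
  assumes "m \<in> carrier H" "module R P" "bilinear R H H P F"
  shows "Del P (\<lambda>l k. Del P (\<lambda>k1 k2. F (Si k1 \<star> l) k2) k) m = F \<one>\<^bsub>H\<^esub> m"
proof -
  note F = bilinearD[OF assms(3)]
  have lF: "linear_map R A P (\<lambda>x. F (g x) k)" if "linear_map R A H g" "k \<in> carrier H" for A :: "('k, 'z, 'y) module_scheme" and g k
    using lin_comp[OF that(1) F(1)[OF that(2)]] .
  have lF2: "linear_map R A P (\<lambda>x. F k (g x))" if "linear_map R A H g" "k \<in> carrier H" for A :: "('k, 'z, 'y) module_scheme" and g k
    using lin_comp[OF that(1) F(2)[OF that(2)]] .
  have "Del P (\<lambda>l k. Del P (\<lambda>k1 k2. F (Si k1 \<star> l) k2) k) m = Del P (\<lambda>n k. Del P (\<lambda>l k1. F (Si k1 \<star> l) k) n) m"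
    using assms(1,2) by (intro coassoc_sw[symmetric] trilinearI lF lF2) (simp_all add: Si_simps)
  also have "\<dots> = Del P (\<lambda>n k. Del P (\<lambda>l k1. F (Si (S l \<star> k1)) k) n) m"
    by (intro sw_cong) (simp_all add: Si_simps Si_mult)
  also have "\<dots> = Del P (\<lambda>n k. counit H n \<odot>\<^bsub>P\<^esub> F \<one>\<^bsub>H\<^esub> k) m"
  proof (intro sw_cong H_module)
    fix n k assume c: "n \<in> carrier H" "k \<in> carrier H"
    show "Del P (\<lambda>l k1. F (Si (S l \<star> k1)) k) n = counit H n \<odot>\<^bsub>P\<^esub> F \<one>\<^bsub>H\<^esub> k"
      using S_left_lin[OF c(1) assms(2), of "\<lambda>x. F (Si x) k"] c by (simp add: lF lin_Si lin_id Si_one)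
  qed
  also have "\<dots> = F \<one>\<^bsub>H\<^esub> m" using assms F by (intro counit_left_lin) (simp_all add: H_one)
  finally show ?thesis .
qed

end

section \<open>Right Galois objects\<close>

text \<open>\<open>T\<close> and its coaction are separate parameters, so the theory can be applied
  to the bicomodule algebra and again to the torsor record built on the same algebra.\<close>

locale right_gal = hopf_bij R H S
  for R :: "'k ring" (structure) and H :: "('k, 'h) bialgebra" and S :: "'h \<Rightarrow> 'h" +
  fixes T :: "('k, 'a, 'm) module_scheme" and rho :: "'a \<Rightarrow> ('a, 'h) tens"
  assumes right_galois: "right_galois R H T rho"
    and T_ff: "faithfully_flat R T"
    and H_flat: "flat R H"
begin

abbreviation mul (infixl \<open>\<cdot>\<close> 70) where "x \<cdot> y \<equiv> x \<otimes>\<^bsub>T\<^esub> y"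

abbreviation unit (\<open>\<^bold>e\<close>) where "\<^bold>e \<equiv> \<one>\<^bsub>T\<^esub>"

abbreviation "pt \<equiv> pure_tensor R"

interpretation G: right_galois R H T rho by (rule right_galois)

lemma T_algebra: "assoc_algebra R T" by (rule G.T.assoc_algebra_axioms)

lemma T_bim: "bimult R T" by (rule assoc_algebra_bimult[OF T_algebra])

lemma T_mod: "module R T" by (rule bimult_module[OF T_bim])

lemma T_flat: "flat R T" by (rule ff_flat[OF T_ff])

lemma T_unit: "\<^bold>e \<in> carrier T" by simp

lemma T_as: "x \<in> carrier T \<Longrightarrow> y \<in> carrier T \<Longrightarrow> z \<in> carrier T \<Longrightarrow> (x \<cdot> y) \<cdot> z = x \<cdot> (y \<cdot> z)"
  by (rule G.T.A.m_assoc)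

lemma T_units: "x \<in> carrier T \<Longrightarrow> \<^bold>e \<cdot> x = x" "x \<in> carrier T \<Longrightarrow> x \<cdot> \<^bold>e = x"
  by simp_all

lemma H_as: "x \<in> carrier H \<Longrightarrow> y \<in> carrier H \<Longrightarrow> z \<in> carrier H \<Longrightarrow> (x \<star> y) \<star> z = x \<star> (y \<star> z)"
  by (rule A.m_assoc)

lemma H_units: "x \<in> carrier H \<Longrightarrow> \<one>\<^bsub>H\<^esub> \<star> x = x" "x \<in> carrier H \<Longrightarrow> x \<star> \<one>\<^bsub>H\<^esub> = x"
  by simp_all

lemma rho_lin: "linear_map R T (T \<boxtimes> H) rho" using G.right_coaction_hom by (simp add: algebra_hom_def)

lemma lin_rho: "linear_map R A T f \<Longrightarrow> linear_map R A (T \<boxtimes> H) (\<lambda>x. rho (f x))" by (rule lin_comp[OF _ rho_lin])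

lemma rho_typ: "x \<in> carrier T \<Longrightarrow> rho x \<in> carrier (T \<boxtimes> H)" by (rule lin_closed[OF rho_lin])

abbreviation "TT \<equiv> T \<boxtimes> T"
abbreviation "TH \<equiv> T \<boxtimes> H"
abbreviation "tt \<equiv> pt T T"
abbreviation "th \<equiv> pt T H"
abbreviation "Rho P F x \<equiv> sw R T H P F (rho x)"

lemmas G_simps0 = Si_simps T_bim T_mod T_unit lin_rho rho_typ T_units H_units

section \<open>The Galois map and the translation map\<close>

definition "beta z = sw R T T TH (\<lambda>a b. Rho TH (\<lambda>t g. th (a \<cdot> t) g) b) z"

lemma beta_lin: "linear_map R TT TH beta"
  by (simp add: beta_def[abs_def] G_simps0)

lemma beta_bij: "bij_betw beta (carrier TT) (carrier TH)"
proof -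
  have "tensor_lift TH (\<lambda>x y. tensor_map R T H (\<lambda>y0. x \<cdot> y0) id (rho y)) z = beta z" if "z \<in> carrier TT" for z
    unfolding beta_def using that by (intro lift_cong) (simp_all add: T_mod tensor_map_sw[OF rho_typ])
  then show ?thesis using bij_betw_cong[THEN iffD1, OF _ G.right_galois_bij] by blast
qed

lemma beta_inj: "inj_on beta (carrier TT)" by (rule bij_betw_imp_inj_on[OF beta_bij])

definition "r h = inv_into (carrier TT) beta (th \<^bold>e h)"

lemma r_typ: "h \<in> carrier H \<Longrightarrow> r h \<in> carrier TT"
  unfolding r_def using beta_bij by (metis bij_betw_def inv_into_into pure_closed T_unit)

lemma beta_r: "h \<in> carrier H \<Longrightarrow> beta (r h) = th \<^bold>e h"
  unfolding r_def by (rule bij_betw_inv_into_right[OF beta_bij]) (simp add: G_simps0)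

lemma r_lin: "linear_map R H TT r"
proof (rule lin_of_inj[OF _ beta_lin beta_inj H_module r_typ])
  show "linear_map R H TH (\<lambda>x. beta (r x))"
    using lin_cong[of H "\<lambda>x. beta (r x)" "\<lambda>x. th \<^bold>e x" R TH] beta_r by (simp add: G_simps0)
qed (simp_all add: G_simps0)

lemma lin_r: "linear_map R A H f \<Longrightarrow> linear_map R A TT (\<lambda>x. r (f x))" by (rule lin_comp[OF _ r_lin])

abbreviation "Rr P F h \<equiv> sw R T T P F (r h)"

lemmas G_simps = G_simps0 lin_r r_typ

text \<open>The defining property of the translation map,
  \<open>h' h''_0 \<otimes> h''_1 = 1 \<otimes> h\<close>, tested on a bilinear \<open>G\<close>.
  Later sums are rearranged until this pattern appears and contracts.\<close>

lemma beta_rr: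
  assumes "h \<in> carrier H" "module R P" "bilinear R T H P G"
  shows "Rr P (\<lambda>a b. Rho P (\<lambda>c g. G (a \<cdot> c) g) b) h = G \<^bold>e h"
  using arg_cong[OF beta_r[OF assms(1)], of "sw R T H P G"] assms bilinearD[OF assms(3)]
  by (simp add: beta_def G_simps cong: sw_cong2)

lemma rcoassoc:
  assumes x: "x \<in> carrier T" and P: "module R P" and F: "trilinear R T H H P F"
  shows "Rho P (\<lambda>t h. Rho P (\<lambda>s k. F s k h) t) x = Rho P (\<lambda>t h. Del P (\<lambda>k l. F t k l) h) x"
proof -
  note F = trilinearD[OF F]
  let ?e = "sw R T (H \<boxtimes> H) P (\<lambda>a v. sw R H H P (\<lambda>b c. F a b c) v)"
  have "?e (assoc R T H H (tensor_map R (T \<boxtimes> H) H rho id (rho x))) = Rho P (\<lambda>t h. Rho P (\<lambda>s k. F s k h) t) x"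
    unfolding tensor_map_sw[OF rho_typ[OF x]] using x P F by (simp add: assoc_sw G_simps cong: sw_cong2)
  moreover have "?e (tensor_map R T (H \<boxtimes> H) id (comult H) (rho x)) = Rho P (\<lambda>t h. Del P (\<lambda>k l. F t k l) h) x"
    unfolding tensor_map_sw[OF rho_typ[OF x]] using x P F by (simp add: G_simps cong: sw_cong2)
  ultimately show ?thesis by (simp add: G.right_coassoc[OF x])
qed

lemma rcounit: "x \<in> carrier T \<Longrightarrow> Rho T (\<lambda>t h. counit H h \<odot>\<^bsub>T\<^esub> t) x = x"
  using G.right_counit[of x] rho_typ[of x] by (simp add: sw_def)

lemma rho_one: "rho \<^bold>e = th \<^bold>e \<one>\<^bsub>H\<^esub>"
  using G.right_coaction_hom by (simp add: algebra_hom_def ring_hom_def tensor_one)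

lemma rho_mult_sw:
  assumes "x \<in> carrier T" "y \<in> carrier T" "module R P" "bilinear R T H P F"
  shows "Rho P F (x \<cdot> y) = Rho P (\<lambda>s h. Rho P (\<lambda>t k. F (s \<cdot> t) (h \<star> k)) y) x"
proof -
  have "rho (x \<cdot> y) = rho x \<otimes>\<^bsub>TH\<^esub> rho y"
    using G.right_coaction_hom assms(1,2) by (simp add: algebra_hom_def ring_hom_def)
  then show ?thesis using assms bilinearD[OF assms(4)] by (simp add: tensor_mult G_simps cong: sw_cong2)
qed

text \<open>The identity is \<open>x_0 (x_1)' \<otimes> (x_1)'' = 1 \<otimes> x\<close>. Since
  \<open>beta\<close> is left linear over \<open>T\<close>, both sides have the image
  \<open>x_0 \<otimes> x_1\<close>.\<close>

lemma r_rho_elt: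
  assumes x: "x \<in> carrier T"
  shows "Rho TT (\<lambda>c g. Rr TT (\<lambda>a b. tt (c \<cdot> a) b) g) x = tt \<^bold>e x"
proof (rule inj_onD[OF beta_inj])
  have "beta (Rho TT (\<lambda>c g. Rr TT (\<lambda>a b. tt (c \<cdot> a) b) g) x) =
      Rho TH (\<lambda>c g. Rr TH (\<lambda>a b. Rho TH (\<lambda>d k. th (c \<cdot> (a \<cdot> d)) k) b) g) x"
    using x by (simp add: beta_def G_simps T_as cong: sw_cong2)
  also have "\<dots> = Rho TH (\<lambda>c g. th (c \<cdot> \<^bold>e) g) x"
  proof (intro sw_cong H_module T_mod)
    fix c g assume "c \<in> carrier T" "g \<in> carrier H"
    then show "Rr TH (\<lambda>a b. Rho TH (\<lambda>d k. th (c \<cdot> (a \<cdot> d)) k) b) g = th (c \<cdot> \<^bold>e) g"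
      by (intro beta_rr[of g TH "\<lambda>t k. th (c \<cdot> t) k"] bilinearI) (simp_all add: G_simps)
  qed
  also have "\<dots> = beta (tt \<^bold>e x)"
    using x by (simp add: beta_def G_simps cong: sw_cong2)
  finally show "beta (Rho TT (\<lambda>c g. Rr TT (\<lambda>a b. tt (c \<cdot> a) b) g) x) = beta (tt \<^bold>e x)" .
qed (use x in \<open>simp_all add: G_simps\<close>)

lemma r_rho:
  assumes "x \<in> carrier T" "module R P" "bilinear R T T P F"
  shows "Rho P (\<lambda>c g. Rr P (\<lambda>a b. F (c \<cdot> a) b) g) x = F \<^bold>e x"
  using arg_cong[OF r_rho_elt[OF assms(1)], of "sw R T T P F"] assms bilinearD[OF assms(3)]
  by (simp add: G_simps cong: sw_cong2)

lemma r_nabla: "h \<in> carrier H \<Longrightarrow> Rr T (\<lambda>a b. a \<cdot> b) h = counit H h \<odot>\<^bsub>T\<^esub> \<^bold>e"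
proof -
  assume h: "h \<in> carrier H"
  have "Rr T (\<lambda>a b. a \<cdot> b) h = Rr T (\<lambda>a b. a \<cdot> Rho T (\<lambda>c g. counit H g \<odot>\<^bsub>T\<^esub> c) b) h"
    by (intro sw_cong) (simp_all add: T_mod rcounit)
  also have "\<dots> = Rr T (\<lambda>a b. Rho T (\<lambda>c g. counit H g \<odot>\<^bsub>T\<^esub> (a \<cdot> c)) b) h"
    using h by (simp add: G_simps mult_smult[of R] lin_smult_right cong: sw_cong2)
  also have "\<dots> = counit H h \<odot>\<^bsub>T\<^esub> \<^bold>e"
    using h by (intro beta_rr[of h T "\<lambda>t g. counit H g \<odot>\<^bsub>T\<^esub> t"] bilinearI) (simp_all add: G_simps lin_smult_right)
  finally show ?thesis .
qed

lemma r_nabla_lin: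
  assumes "h \<in> carrier H" "module R P" "linear_map R T P F"
  shows "Rr P (\<lambda>a b. F (a \<cdot> b)) h = counit H h \<odot>\<^bsub>P\<^esub> F \<^bold>e"
proof -
  have "F (Rr T (\<lambda>a b. a \<cdot> b) h) = Rr P (\<lambda>a b. F (a \<cdot> b)) h"
    by (rule lin_sw_apply[OF _ _ _ _ assms(3)]) (simp_all add: G_simps assms)
  then show ?thesis using assms by (simp add: r_nabla lin_smult[OF assms(3)] G_simps)
qed

text \<open>The coaction on the second factor of \<open>r h\<close> is comultiplication of
  \<open>h\<close> on the right. The component \<open>h''_0\<close> is expanded by
  \<open>r_rho\<close>, coassociativity regroups, and \<open>beta_rr\<close> contracts.\<close>

lemma r_right:
  assumes h: "h \<in> carrier H" and P: "module R P" and F: "trilinear R T T H P F"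
  shows "Rr P (\<lambda>a b. Rho P (\<lambda>c g. F a c g) b) h = Del P (\<lambda>h1 h2. Rr P (\<lambda>a b. F a b h2) h1) h"
proof -
  note F = trilinearD[OF F]
  note l = lin_comp[OF _ F(1)] lin_comp[OF _ F(2)] lin_comp[OF _ F(3)]
  have "Rr P (\<lambda>a b. Rho P (\<lambda>c g. F a c g) b) h =
      Rr P (\<lambda>a b. Rho P (\<lambda>c g. Rho P (\<lambda>c' g'. Rr P (\<lambda>p q. F (a \<cdot> (c' \<cdot> p)) q g) g') c) b) h"
  proof (intro sw_cong H_module T_mod)
    fix a c g assume "a \<in> carrier T" "c \<in> carrier T" "g \<in> carrier H"
    then show "F a c g = Rho P (\<lambda>c' g'. Rr P (\<lambda>p q. F (a \<cdot> (c' \<cdot> p)) q g) g') c"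
      using r_rho[of c P "\<lambda>x y. F (a \<cdot> x) y g"] P by (simp add: bilinearI G_simps l F)
  qed
  also have "\<dots> = Rr P (\<lambda>a b. Rho P (\<lambda>c k. Del P (\<lambda>g' g. Rr P (\<lambda>p q. F (a \<cdot> (c \<cdot> p)) q g) g') k) b) h"
    by (intro sw_cong rcoassoc trilinearI) (simp_all add: G_simps l F P)
  also have "\<dots> = Rr P (\<lambda>a b. Rho P (\<lambda>c k. Del P (\<lambda>g' g. Rr P (\<lambda>p q. F ((a \<cdot> c) \<cdot> p) q g) g') k) b) h"
    by (intro sw_cong) (simp_all add: G_simps T_as)
  also have "\<dots> = Del P (\<lambda>h1 h2. Rr P (\<lambda>p q. F (\<^bold>e \<cdot> p) q h2) h1) h"
    using h by (intro beta_rr[of h P "\<lambda>t k. Del P (\<lambda>g' g. Rr P (\<lambda>p q. F (t \<cdot> p) q g) g') k"] bilinearI)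
      (simp_all add: G_simps l F P)
  also have "\<dots> = Del P (\<lambda>h1 h2. Rr P (\<lambda>a b. F a b h2) h1) h"
    by (intro sw_cong) (simp_all add: G_simps)
  finally show ?thesis .
qed

text \<open>The coaction on the first factor of \<open>r h\<close> produces \<open>S h_1\<close> and
  leaves \<open>r h_2\<close>. The second factor is expanded by \<open>r_rho\<close> and a
  cancelling product with \<open>S\<close> is inserted. Then two coactions combine into the coaction
  of one product, which \<open>beta_rr\<close> contracts to the coaction of 1.\<close>

lemma r_left:
  assumes h: "h \<in> carrier H" and P: "module R P" and F: "trilinear R T T H P F"
  shows "Rr P (\<lambda>a b. Rho P (\<lambda>c g. F c b g) a) h = Del P (\<lambda>h1 h2. Rr P (\<lambda>a b. F a b (S h1)) h2) h"
proof -
  note F = trilinearD[OF F]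
  note l = lin_comp[OF _ F(1)] lin_comp[OF _ F(2)] lin_comp[OF _ F(3)]
  note s = G_simps l F P
  let ?K = "\<lambda>x y k. Del P (\<lambda>k1 k2. Rr P (\<lambda>p q. F (x \<cdot> p) q (y \<star> S k1)) k2) k"
  have "Rr P (\<lambda>a b. Rho P (\<lambda>c g. F c b g) a) h = Rr P (\<lambda>a b. Rho P (\<lambda>c g. Rho P (\<lambda>d m. Rr P (\<lambda>p q. F ((c \<cdot> d) \<cdot> p) q g) m) b) a) h"
  proof (intro sw_cong H_module T_mod)
    fix b c g assume "b \<in> carrier T" "c \<in> carrier T" "g \<in> carrier H"
    then show "F c b g = Rho P (\<lambda>d m. Rr P (\<lambda>p q. F ((c \<cdot> d) \<cdot> p) q g) m) b"
      using r_rho[of b P "\<lambda>x y. F (c \<cdot> x) y g"] P by (simp add: bilinearI s T_as cong: sw_cong2)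
  qed
  also have "\<dots> = Rr P (\<lambda>a b. Rho P (\<lambda>c g. Rho P (\<lambda>d m. Del P (\<lambda>u k. ?K (c \<cdot> d) (g \<star> u) k) m) b) a) h"
  proof (intro sw_cong H_module T_mod)
    fix a b c g d m assume c: "c \<in> carrier T" "g \<in> carrier H" "d \<in> carrier T" "m \<in> carrier H"
    have "Del P (\<lambda>u k. Del P (\<lambda>k1 k2. Rr P (\<lambda>p q. F ((c \<cdot> d) \<cdot> p) q (g \<star> (u \<star> S k1))) k2) k) m =
        Rr P (\<lambda>p q. F ((c \<cdot> d) \<cdot> p) q (g \<star> \<one>\<^bsub>H\<^esub>)) m"
      using c by (intro S_left_right[of m P "\<lambda>x k2. Rr P (\<lambda>p q. F ((c \<cdot> d) \<cdot> p) q (g \<star> x)) k2"] bilinearI) (simp_all add: s)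
    then show "Rr P (\<lambda>p q. F ((c \<cdot> d) \<cdot> p) q g) m = Del P (\<lambda>u k. ?K (c \<cdot> d) (g \<star> u) k) m"
      using c by (simp add: s H_as cong: sw_cong2)
  qed
  also have "\<dots> = Rr P (\<lambda>a b. Rho P (\<lambda>c g. Rho P (\<lambda>e k. Rho P (\<lambda>d u. ?K (c \<cdot> d) (g \<star> u) k) e) b) a) h"
    by (intro sw_cong rcoassoc[symmetric] trilinearI) (simp_all add: s)
  also have "\<dots> = Rr P (\<lambda>a b. Rho P (\<lambda>e k. Rho P (\<lambda>c g. Rho P (\<lambda>d u. ?K (c \<cdot> d) (g \<star> u) k) e) a) b) h"
    by (intro sw_cong sw_swap) (simp_all add: s)
  also have "\<dots> = Rr P (\<lambda>a b. Rho P (\<lambda>e k. Rho P (\<lambda>x y. ?K x y k) (a \<cdot> e)) b) h"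
    by (intro sw_cong rho_mult_sw[symmetric] bilinearI) (simp_all add: s)
  also have "\<dots> = Rho P (\<lambda>x y. ?K x y h) \<^bold>e"
    using h by (intro beta_rr[of h P "\<lambda>t k. Rho P (\<lambda>x y. ?K x y k) t"] bilinearI) (simp_all add: s)
  also have "\<dots> = ?K \<^bold>e \<one>\<^bsub>H\<^esub> h"
    unfolding rho_one using h by (intro sw_pure) (simp_all add: s)
  also have "\<dots> = Del P (\<lambda>h1 h2. Rr P (\<lambda>a b. F a b (S h1)) h2) h"
    by (intro sw_cong) (simp_all add: s)
  finally show ?thesis .
qed

text \<open>Both sides have the image \<open>1 \<otimes> g h\<close> under \<open>beta\<close>. The
  first factors appear in reverse order because \<open>g'\<close> must stand next to the coaction of
  \<open>g''\<close> to be contracted.\<close>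

lemma r_mult:
  assumes g: "g \<in> carrier H" and h: "h \<in> carrier H"
  shows "r (g \<star> h) = Rr TT (\<lambda>a b. Rr TT (\<lambda>c d. tt (c \<cdot> a) (b \<cdot> d)) h) g"
proof (rule inj_onD[OF beta_inj])
  have "beta (Rr TT (\<lambda>a b. Rr TT (\<lambda>c d. tt (c \<cdot> a) (b \<cdot> d)) h) g) =
      Rr TH (\<lambda>a b. Rr TH (\<lambda>c d. Rho TH (\<lambda>x y. th ((c \<cdot> a) \<cdot> x) y) (b \<cdot> d)) h) g"
    using g h by (simp add: beta_def G_simps cong: sw_cong2)
  also have "\<dots> = Rr TH (\<lambda>a b. Rr TH (\<lambda>c d. Rho TH (\<lambda>u k. Rho TH (\<lambda>v l. th ((c \<cdot> a) \<cdot> (u \<cdot> v)) (k \<star> l)) d) b) h) g"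
    by (intro sw_cong rho_mult_sw bilinearI) (simp_all add: G_simps)
  also have "\<dots> = Rr TH (\<lambda>c d. Rr TH (\<lambda>a b. Rho TH (\<lambda>u k. Rho TH (\<lambda>v l. th ((c \<cdot> a) \<cdot> (u \<cdot> v)) (k \<star> l)) d) b) g) h"
    by (intro sw_swap) (simp_all add: G_simps)
  also have "\<dots> = Rr TH (\<lambda>c d. Rho TH (\<lambda>v l. th (c \<cdot> v) (g \<star> l)) d) h"
  proof (intro sw_cong T_mod)
    fix c d assume c: "c \<in> carrier T" "d \<in> carrier T"
    show "Rr TH (\<lambda>a b. Rho TH (\<lambda>u k. Rho TH (\<lambda>v l. th ((c \<cdot> a) \<cdot> (u \<cdot> v)) (k \<star> l)) d) b) g =
        Rho TH (\<lambda>v l. th (c \<cdot> v) (g \<star> l)) d"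
      using beta_rr[OF g, of TH "\<lambda>t k. Rho TH (\<lambda>v l. th (c \<cdot> (t \<cdot> v)) (k \<star> l)) d"] c g
      by (simp add: bilinearI G_simps T_as cong: sw_cong2)
  qed
  also have "\<dots> = th \<^bold>e (g \<star> h)"
    using g h by (intro beta_rr[of h TH "\<lambda>t l. th t (g \<star> l)"] bilinearI) (simp_all add: G_simps)
  finally show "beta (r (g \<star> h)) = beta (Rr TT (\<lambda>a b. Rr TT (\<lambda>c d. tt (c \<cdot> a) (b \<cdot> d)) h) g)"
    using g h by (simp add: beta_r G_simps)
qed (use g h in \<open>simp_all add: G_simps\<close>)

lemma r_one: "r \<one>\<^bsub>H\<^esub> = tt \<^bold>e \<^bold>e"
proof (rule inj_onD[OF beta_inj])
  have "beta (tt \<^bold>e \<^bold>e) = th \<^bold>e \<one>\<^bsub>H\<^esub>" by (simp add: beta_def rho_one G_simps)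
  then show "beta (r \<one>\<^bsub>H\<^esub>) = beta (tt \<^bold>e \<^bold>e)" by (simp add: beta_r G_simps)
qed (simp_all add: G_simps)

text \<open>
  The hypothesis says that the first factor of \<open>z\<close> is coinvariant: \<open>c \<otimes> g \<mapsto> c g' \<otimes> g''\<close> is the
  inverse of the Galois map.
\<close>

lemma scalar_left:
  assumes z: "z \<in> carrier TT"
    and e: "sw R T T (TT \<boxtimes> T) (\<lambda>u v. Rho (TT \<boxtimes> T) (\<lambda>c g. Rr (TT \<boxtimes> T) (\<lambda>p q. pt TT T (tt (c \<cdot> p) q) v) g) u) z =
      sw R T T (TT \<boxtimes> T) (\<lambda>u v. pt TT T (tt u \<^bold>e) v) z"
  shows "z = tt \<^bold>e (sw R T T T (\<lambda>u v. u \<cdot> v) z)"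
proof -
  let ?P = "TT \<boxtimes> T"
  have "sw R T T ?P (\<lambda>u v. pt TT T (tt \<^bold>e u) v) z =
      sw R T T ?P (\<lambda>u v. Rho ?P (\<lambda>c g. Rr ?P (\<lambda>p q. pt TT T (tt (c \<cdot> p) q) v) g) u) z"
  proof (intro sw_cong T_mod)
    fix u v assume "u \<in> carrier T" "v \<in> carrier T"
    then show "pt TT T (tt \<^bold>e u) v = Rho ?P (\<lambda>c g. Rr ?P (\<lambda>p q. pt TT T (tt (c \<cdot> p) q) v) g) u"
      by (intro r_rho[symmetric, of u ?P "\<lambda>x y. pt TT T (tt x y) v"] bilinearI) (simp_all add: G_simps)
  qed
  then have "sw R T T ?P (\<lambda>u v. pt TT T (tt u \<^bold>e) v) z = sw R T T ?P (\<lambda>u v. pt TT T (tt \<^bold>e u) v) z"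
    using e by simp
  then obtain t where t: "t \<in> carrier T" "z = tt \<^bold>e t"
    using flat_scalar_left[OF T_algebra T_ff T_flat z] by blast
  have "sw R T T T (\<lambda>u v. u \<cdot> v) z = t" unfolding t(2) using t(1) by (simp add: G_simps)
  then show ?thesis using t(2) by simp
qed

section \<open>The automorphism \<theta> and its inverse\<close>

definition "vartheta x = Rho T (\<lambda>y h. Rr T (\<lambda>a b. (y \<cdot> b) \<cdot> a) (S h)) x"

lemma theta_lin: "linear_map R T T vartheta" by (simp add: vartheta_def[abs_def] G_simps)

lemma lin_theta: "linear_map R A T f \<Longrightarrow> linear_map R A T (\<lambda>x. vartheta (f x))" by (rule lin_comp[OF _ theta_lin])

lemma theta_typ: "x \<in> carrier T \<Longrightarrow> vartheta x \<in> carrier T" by (rule lin_closed[OF theta_lin])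

text \<open>By \<open>scalar_left\<close> only coinvariance of the first factor has to be shown. Its
  coaction contributes \<open>x_1 S(x_2)\<close>, by \<open>r_right\<close> and because
  \<open>S\<close> reverses the coproduct, and this cancels by \<open>S_left_right\<close>.\<close>

lemma theta_elt:
  assumes x: "x \<in> carrier T"
  shows "Rho TT (\<lambda>y h. Rr TT (\<lambda>a b. tt (y \<cdot> b) a) (S h)) x = tt \<^bold>e (vartheta x)"
proof -
  let ?z = "Rho TT (\<lambda>y h. Rr TT (\<lambda>a b. tt (y \<cdot> b) a) (S h)) x"
  let ?P = "TT \<boxtimes> T"
  let ?M = "\<lambda>c g v. Rr ?P (\<lambda>p q. pt TT T (tt (c \<cdot> p) q) v) g"
  have "sw R T T ?P (\<lambda>u v. Rho ?P (\<lambda>c g. ?M c g v) u) ?z =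
      Rho ?P (\<lambda>y h. Rr ?P (\<lambda>a b. Rho ?P (\<lambda>c g. ?M c g a) (y \<cdot> b)) (S h)) x"
    using x by (simp add: G_simps cong: sw_cong2)
  also have "\<dots> = Rho ?P (\<lambda>y h. Rr ?P (\<lambda>a b. Rho ?P (\<lambda>c g. Rho ?P (\<lambda>d l. ?M (c \<cdot> d) (g \<star> l) a) b) y) (S h)) x"
    by (intro sw_cong rho_mult_sw bilinearI) (simp_all add: G_simps)
  also have "\<dots> = Rho ?P (\<lambda>y h. Rho ?P (\<lambda>c g. Rr ?P (\<lambda>a b. Rho ?P (\<lambda>d l. ?M (c \<cdot> d) (g \<star> l) a) b) (S h)) y) x"
    by (intro sw_cong sw_swap) (simp_all add: G_simps)
  also have "\<dots> = Rho ?P (\<lambda>y h. Rho ?P (\<lambda>c g. Del ?P (\<lambda>s1 s2. Rr ?P (\<lambda>a b. ?M (c \<cdot> b) (g \<star> s2) a) s1) (S h)) y) x"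
    by (intro sw_cong r_right trilinearI) (simp_all add: G_simps)
  also have "\<dots> = Rho ?P (\<lambda>y h. Rho ?P (\<lambda>c g. Del ?P (\<lambda>h1 h2. Rr ?P (\<lambda>a b. ?M (c \<cdot> b) (g \<star> S h1) a) (S h2)) h) y) x"
    by (intro sw_cong comult_S_sw bilinearI) (simp_all add: G_simps)
  also have "\<dots> = Rho ?P (\<lambda>c m. Del ?P (\<lambda>g h. Del ?P (\<lambda>h1 h2. Rr ?P (\<lambda>a b. ?M (c \<cdot> b) (g \<star> S h1) a) (S h2)) h) m) x"
    using x by (intro rcoassoc trilinearI) (simp_all add: G_simps)
  also have "\<dots> = Rho ?P (\<lambda>c m. Rr ?P (\<lambda>a b. ?M (c \<cdot> b) \<one>\<^bsub>H\<^esub> a) (S m)) x"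
  proof (intro sw_cong H_module T_mod)
    fix c m assume "c \<in> carrier T" "m \<in> carrier H"
    then show "Del ?P (\<lambda>g h. Del ?P (\<lambda>h1 h2. Rr ?P (\<lambda>a b. ?M (c \<cdot> b) (g \<star> S h1) a) (S h2)) h) m =
        Rr ?P (\<lambda>a b. ?M (c \<cdot> b) \<one>\<^bsub>H\<^esub> a) (S m)"
      by (intro S_left_right[of m ?P "\<lambda>g h2. Rr ?P (\<lambda>a b. ?M (c \<cdot> b) g a) (S h2)"] bilinearI) (simp_all add: G_simps)
  qed
  also have "\<dots> = sw R T T ?P (\<lambda>u v. pt TT T (tt u \<^bold>e) v) ?z"
    using x by (simp add: r_one G_simps cong: sw_cong2)
  finally have e: "sw R T T ?P (\<lambda>u v. Rho ?P (\<lambda>c g. ?M c g v) u) ?z = sw R T T ?P (\<lambda>u v. pt TT T (tt u \<^bold>e) v) ?z" .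
  have "?z \<in> carrier TT" by (simp add: G_simps)
  then have "?z = tt \<^bold>e (sw R T T T (\<lambda>u v. u \<cdot> v) ?z)" using e by (rule scalar_left)
  also have "sw R T T T (\<lambda>u v. u \<cdot> v) ?z = vartheta x"
    unfolding vartheta_def using x by (simp add: G_simps cong: sw_cong2)
  finally show ?thesis .
qed

lemma theta_sw:
  assumes "x \<in> carrier T" "module R P" "bilinear R T T P F"
  shows "Rho P (\<lambda>y h. Rr P (\<lambda>a b. F (y \<cdot> b) a) (S h)) x = F \<^bold>e (vartheta x)"
  using arg_cong[OF theta_elt[OF assms(1)], of "sw R T T P F"] assms bilinearD[OF assms(3)]
  by (simp add: G_simps theta_typ cong: sw_cong2)

definition "theta_inv x = Rho T (\<lambda>y h. Rr T (\<lambda>a b. (a \<cdot> y) \<cdot> b) (Si (Si h))) x"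

lemma theta_inv_lin: "linear_map R T T theta_inv" by (simp add: theta_inv_def[abs_def] G_simps)

lemma lin_theta_inv: "linear_map R A T f \<Longrightarrow> linear_map R A T (\<lambda>x. theta_inv (f x))" by (rule lin_comp[OF _ theta_inv_lin])

lemma theta_inv_typ: "x \<in> carrier T \<Longrightarrow> theta_inv x \<in> carrier T" by (rule lin_closed[OF theta_inv_lin])

text \<open>Now the first factor is \<open>k' x_0\<close> with \<open>k = S^-2 x_1\<close>. Two
  applications of \<open>Si\<close> keep the order of the coproduct, \<open>r_left\<close>
  contributes \<open>S (S^-2 h_1) = S^-1 h_1\<close>, and its product with the coaction of
  \<open>x_0\<close> has the shape cancelled by \<open>Si_left_right\<close>.\<close>

lemma theta_inv_elt:
  assumes x: "x \<in> carrier T"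
  shows "Rho TT (\<lambda>y h. Rr TT (\<lambda>a b. tt (a \<cdot> y) b) (Si (Si h))) x = tt \<^bold>e (theta_inv x)"
proof -
  let ?z = "Rho TT (\<lambda>y h. Rr TT (\<lambda>a b. tt (a \<cdot> y) b) (Si (Si h))) x"
  let ?P = "TT \<boxtimes> T"
  let ?M = "\<lambda>c g v. Rr ?P (\<lambda>p q. pt TT T (tt (c \<cdot> p) q) v) g"
  have "sw R T T ?P (\<lambda>u v. Rho ?P (\<lambda>c g. ?M c g v) u) ?z =
      Rho ?P (\<lambda>y h. Rr ?P (\<lambda>a b. Rho ?P (\<lambda>c g. ?M c g b) (a \<cdot> y)) (Si (Si h))) x"
    using x by (simp add: G_simps cong: sw_cong2)
  also have "\<dots> = Rho ?P (\<lambda>y h. Rr ?P (\<lambda>a b. Rho ?P (\<lambda>c g. Rho ?P (\<lambda>d l. ?M (c \<cdot> d) (g \<star> l) b) y) a) (Si (Si h))) x"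
    by (intro sw_cong rho_mult_sw bilinearI) (simp_all add: G_simps)
  also have "\<dots> = Rho ?P (\<lambda>y h. Del ?P (\<lambda>k1 k2. Rr ?P (\<lambda>a b. Rho ?P (\<lambda>d l. ?M (a \<cdot> d) (S k1 \<star> l) b) y) k2) (Si (Si h))) x"
    by (intro sw_cong r_left trilinearI) (simp_all add: G_simps)
  also have "\<dots> = Rho ?P (\<lambda>y h. Del ?P (\<lambda>h1 h2. Rr ?P (\<lambda>a b. Rho ?P (\<lambda>d l. ?M (a \<cdot> d) (S (Si (Si h1)) \<star> l) b) y) (Si (Si h2))) h) x"
  proof (intro sw_cong H_module T_mod)
    fix y h assume c: "y \<in> carrier T" "h \<in> carrier H"
    let ?F = "\<lambda>k1 k2. Rr ?P (\<lambda>a b. Rho ?P (\<lambda>d l. ?M (a \<cdot> d) (S k1 \<star> l) b) y) k2"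
    have "Del ?P ?F (Si (Si h)) = Del ?P (\<lambda>a b. ?F (Si b) (Si a)) (Si h)"
      using c by (intro comult_Si_sw bilinearI) (simp_all add: G_simps)
    also have "\<dots> = Del ?P (\<lambda>a b. ?F (Si (Si a)) (Si (Si b))) h"
      using c by (intro comult_Si_sw bilinearI) (simp_all add: G_simps)
    finally show "Del ?P ?F (Si (Si h)) = Del ?P (\<lambda>a b. ?F (Si (Si a)) (Si (Si b))) h" .
  qed
  also have "\<dots> = Rho ?P (\<lambda>y h. Del ?P (\<lambda>h1 h2. Rho ?P (\<lambda>d l. Rr ?P (\<lambda>a b. ?M (a \<cdot> d) (Si h1 \<star> l) b) (Si (Si h2))) y) h) x"
  proof (intro sw_cong H_module T_mod)
    fix y h h1 h2 assume c: "y \<in> carrier T" "h1 \<in> carrier H" "h2 \<in> carrier H"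
    show "Rr ?P (\<lambda>a b. Rho ?P (\<lambda>d l. ?M (a \<cdot> d) (S (Si (Si h1)) \<star> l) b) y) (Si (Si h2)) =
        Rho ?P (\<lambda>d l. Rr ?P (\<lambda>a b. ?M (a \<cdot> d) (Si h1 \<star> l) b) (Si (Si h2))) y"
      unfolding S_Si[OF Si_typ[OF c(2)]] using c by (intro sw_swap) (simp_all add: G_simps)
  qed
  also have "\<dots> = Rho ?P (\<lambda>y h. Rho ?P (\<lambda>d l. Del ?P (\<lambda>h1 h2. Rr ?P (\<lambda>a b. ?M (a \<cdot> d) (Si h1 \<star> l) b) (Si (Si h2))) h) y) x"
    by (intro sw_cong sw_swap) (simp_all add: G_simps)
  also have "\<dots> = Rho ?P (\<lambda>d m. Del ?P (\<lambda>l h. Del ?P (\<lambda>h1 h2. Rr ?P (\<lambda>a b. ?M (a \<cdot> d) (Si h1 \<star> l) b) (Si (Si h2))) h) m) x"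
    using x by (intro rcoassoc trilinearI) (simp_all add: G_simps)
  also have "\<dots> = Rho ?P (\<lambda>d m. Rr ?P (\<lambda>a b. ?M (a \<cdot> d) \<one>\<^bsub>H\<^esub> b) (Si (Si m))) x"
  proof (intro sw_cong H_module T_mod)
    fix d m assume "d \<in> carrier T" "m \<in> carrier H"
    then show "Del ?P (\<lambda>l h. Del ?P (\<lambda>h1 h2. Rr ?P (\<lambda>a b. ?M (a \<cdot> d) (Si h1 \<star> l) b) (Si (Si h2))) h) m =
        Rr ?P (\<lambda>a b. ?M (a \<cdot> d) \<one>\<^bsub>H\<^esub> b) (Si (Si m))"
      by (intro Si_left_right[of m ?P "\<lambda>g h2. Rr ?P (\<lambda>a b. ?M (a \<cdot> d) g b) (Si (Si h2))"] bilinearI) (simp_all add: G_simps)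
  qed
  also have "\<dots> = sw R T T ?P (\<lambda>u v. pt TT T (tt u \<^bold>e) v) ?z"
    using x by (simp add: r_one G_simps cong: sw_cong2)
  finally have e: "sw R T T ?P (\<lambda>u v. Rho ?P (\<lambda>c g. ?M c g v) u) ?z = sw R T T ?P (\<lambda>u v. pt TT T (tt u \<^bold>e) v) ?z" .
  have "?z \<in> carrier TT" by (simp add: G_simps)
  then have "?z = tt \<^bold>e (sw R T T T (\<lambda>u v. u \<cdot> v) ?z)" using e by (rule scalar_left)
  also have "sw R T T T (\<lambda>u v. u \<cdot> v) ?z = theta_inv x"
    unfolding theta_inv_def using x by (simp add: G_simps cong: sw_cong2)
  finally show ?thesis .
qed

lemma theta_inv_sw:
  assumes "x \<in> carrier T" "module R P" "bilinear R T T P F"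
  shows "Rho P (\<lambda>y h. Rr P (\<lambda>a b. F (a \<cdot> y) b) (Si (Si h))) x = F \<^bold>e (theta_inv x)"
  using arg_cong[OF theta_inv_elt[OF assms(1)], of "sw R T T P F"] assms bilinearD[OF assms(3)]
  by (simp add: G_simps theta_inv_typ cong: sw_cong2)

lemmas U_simps = G_simps theta_typ theta_inv_typ lin_theta lin_theta_inv

text \<open>The identity is \<open>h' \<otimes> \<theta>(h'') = (S h)'' \<otimes> (S h)'\<close>.
  After \<open>h'' \<mapsto> \<theta>(h'')\<close> is expanded by \<open>theta_sw\<close>, the first
  factor \<open>h'\<close> meets the coaction of \<open>h''\<close> and \<open>beta_rr\<close>
  contracts.\<close>

lemma r_theta:
  assumes "h \<in> carrier H" "module R P" "bilinear R T T P F"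
  shows "Rr P (\<lambda>a b. F a (vartheta b)) h = Rr P (\<lambda>a b. F b a) (S h)"
proof -
  note F = bilinearD[OF assms(3)]
  note l = lin_comp[OF _ F(1)] lin_comp[OF _ F(2)] F assms(2)
  have "Rr P (\<lambda>a b. F a (vartheta b)) h = Rr P (\<lambda>a b. Rho P (\<lambda>y k. Rr P (\<lambda>p q. F ((a \<cdot> y) \<cdot> q) p) (S k)) b) h"
  proof (intro sw_cong T_mod)
    fix a b assume "a \<in> carrier T" "b \<in> carrier T"
    then show "F a (vartheta b) = Rho P (\<lambda>y k. Rr P (\<lambda>p q. F ((a \<cdot> y) \<cdot> q) p) (S k)) b"
      using theta_sw[of b P "\<lambda>x y. F (a \<cdot> x) y"] by (simp add: bilinearI U_simps l T_as cong: sw_cong2)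
  qed
  also have "\<dots> = Rr P (\<lambda>p q. F (\<^bold>e \<cdot> q) p) (S h)"
    using assms(1) by (intro beta_rr[of h P "\<lambda>t k. Rr P (\<lambda>p q. F (t \<cdot> q) p) (S k)"] bilinearI) (simp_all add: U_simps l)
  also have "\<dots> = Rr P (\<lambda>a b. F b a) (S h)" by (intro sw_cong) (simp_all add: U_simps)
  finally show ?thesis .
qed

text \<open>The identity is
  \<open>h'' \<otimes> theta_inv(h') = (S^-1 h)' \<otimes> (S^-1 h)''\<close>. After
  \<open>r_left\<close> the argument of the inner translation map is
  \<open>S^-2 (S h_1) = S^-1 h_1\<close>, and the remaining product \<open>h_2' h_2''\<close> is a
  counit.\<close>

lemma r_theta_inv:
  assumes "h \<in> carrier H" "module R P" "bilinear R T T P F"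
  shows "Rr P (\<lambda>a b. F b (theta_inv a)) h = Rr P F (Si h)"
proof -
  note F = bilinearD[OF assms(3)]
  note l = lin_comp[OF _ F(1)] lin_comp[OF _ F(2)] F assms(2)
  have "Rr P (\<lambda>a b. F b (theta_inv a)) h = Rr P (\<lambda>a b. Rho P (\<lambda>y k. Rr P (\<lambda>p q. F (p \<cdot> (y \<cdot> b)) q) (Si (Si k))) a) h"
  proof (intro sw_cong T_mod)
    fix a b assume "a \<in> carrier T" "b \<in> carrier T"
    then show "F b (theta_inv a) = Rho P (\<lambda>y k. Rr P (\<lambda>p q. F (p \<cdot> (y \<cdot> b)) q) (Si (Si k))) a"
      using theta_inv_sw[of a P "\<lambda>x y. F (x \<cdot> b) y"] by (simp add: bilinearI U_simps l T_as cong: sw_cong2)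
  qed
  also have "\<dots> = Del P (\<lambda>h1 h2. Rr P (\<lambda>a b. Rr P (\<lambda>p q. F (p \<cdot> (a \<cdot> b)) q) (Si (Si (S h1)))) h2) h"
    using assms(1) by (intro r_left trilinearI) (simp_all add: U_simps l)
  also have "\<dots> = Del P (\<lambda>h1 h2. counit H h2 \<odot>\<^bsub>P\<^esub> Rr P (\<lambda>p q. F (p \<cdot> \<^bold>e) q) (Si h1)) h"
  proof (intro sw_cong H_module)
    fix h1 h2 assume c: "h1 \<in> carrier H" "h2 \<in> carrier H"
    show "Rr P (\<lambda>a b. Rr P (\<lambda>p q. F (p \<cdot> (a \<cdot> b)) q) (Si (Si (S h1)))) h2 = counit H h2 \<odot>\<^bsub>P\<^esub> Rr P (\<lambda>p q. F (p \<cdot> \<^bold>e) q) (Si h1)"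
      unfolding Si_S[OF c(1)]
      using c by (intro r_nabla_lin[of h2 P "\<lambda>x. Rr P (\<lambda>p q. F (p \<cdot> x) q) (Si h1)"]) (simp_all add: U_simps l)
  qed
  also have "\<dots> = Rr P (\<lambda>p q. F (p \<cdot> \<^bold>e) q) (Si h)"
    using assms(1) by (intro counit_right_lin) (simp_all add: U_simps l)
  also have "\<dots> = Rr P F (Si h)" by (intro sw_cong) (simp_all add: U_simps)
  finally show ?thesis .
qed

text \<open>Apply \<open>theta_inv\<close> to the second factor in \<open>theta_elt\<close>: by
  \<open>r_theta_inv\<close> the antipode disappears, and the sum is that of
  \<open>r_rho_elt\<close>. The factor 1 is then removed by faithful flatness.\<close>

lemma theta_inv_theta: assumes x: "x \<in> carrier T" shows "theta_inv (vartheta x) = x"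
proof -
  have "tt \<^bold>e (theta_inv (vartheta x)) = Rho TT (\<lambda>y h. Rr TT (\<lambda>a b. tt (y \<cdot> b) (theta_inv a)) (S h)) x"
    using x by (intro theta_sw[symmetric, of x TT "\<lambda>u v. tt u (theta_inv v)"] bilinearI) (simp_all add: U_simps)
  also have "\<dots> = Rho TT (\<lambda>y h. Rr TT (\<lambda>a b. tt (y \<cdot> a) b) (Si (S h))) x"
    by (intro sw_cong r_theta_inv bilinearI) (simp_all add: U_simps)
  also have "\<dots> = Rho TT (\<lambda>y h. Rr TT (\<lambda>a b. tt (y \<cdot> a) b) h) x"
    by (intro sw_cong arg_cong[where f = "\<lambda>h. Rr TT F h" for F]) (simp_all add: U_simps)
  also have "\<dots> = tt \<^bold>e x" by (rule r_rho_elt[OF x])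
  finally show ?thesis using ff_one_right[OF T_algebra T_ff T_mod] x by (simp add: U_simps)
qed

lemma theta_theta_inv: assumes x: "x \<in> carrier T" shows "vartheta (theta_inv x) = x"
proof -
  have "vartheta (theta_inv x) = Rho T (\<lambda>y h. Rr T (\<lambda>a b. vartheta b \<cdot> (a \<cdot> y)) (Si (Si h))) x"
    using theta_inv_sw[OF x, of T "\<lambda>u v. vartheta v \<cdot> u"] x by (simp add: bilinearI U_simps)
  also have "\<dots> = Rho T (\<lambda>y h. Rr T (\<lambda>a b. a \<cdot> (b \<cdot> y)) (S (Si (Si h)))) x"
  proof (intro sw_cong T_mod H_module)
    fix y h assume "y \<in> carrier T" "h \<in> carrier H"
    then show "Rr T (\<lambda>a b. vartheta b \<cdot> (a \<cdot> y)) (Si (Si h)) = Rr T (\<lambda>a b. a \<cdot> (b \<cdot> y)) (S (Si (Si h)))"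
      by (intro r_theta[of _ T "\<lambda>u v. v \<cdot> (u \<cdot> y)"] bilinearI) (simp_all add: U_simps)
  qed
  also have "\<dots> = Rho T (\<lambda>y h. counit H h \<odot>\<^bsub>T\<^esub> y) x"
  proof (intro sw_cong T_mod H_module)
    fix y h assume c: "y \<in> carrier T" "h \<in> carrier H"
    have "Rr T (\<lambda>a b. a \<cdot> (b \<cdot> y)) (Si h) = counit H (Si h) \<odot>\<^bsub>T\<^esub> (\<^bold>e \<cdot> y)"
      using r_nabla_lin[of "Si h" T "\<lambda>u. u \<cdot> y"] c by (simp add: U_simps T_as cong: sw_cong2)
    then show "Rr T (\<lambda>a b. a \<cdot> (b \<cdot> y)) (S (Si (Si h))) = counit H h \<odot>\<^bsub>T\<^esub> y"
      using c by (simp add: U_simps counit_Si)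
  qed
  also have "\<dots> = x" by (rule rcounit[OF x])
  finally show ?thesis .
qed

lemma theta_one: "vartheta \<^bold>e = \<^bold>e"
  by (simp add: vartheta_def rho_one S_one r_one U_simps)

text \<open>\<open>S\<close> and \<open>r\<close> both reverse products, so the two defining sums
  are nested: the one for \<open>y\<close> sits between \<open>x_0\<close> and the factor belonging
  to \<open>x\<close> and contracts to \<theta> of \<open>y\<close> by itself.\<close>

lemma theta_mult:
  assumes x: "x \<in> carrier T" and y: "y \<in> carrier T"
  shows "vartheta (x \<cdot> y) = vartheta x \<cdot> vartheta y"
proof -
  have "tt \<^bold>e (vartheta (x \<cdot> y)) = Rho TT (\<lambda>c g. Rho TT (\<lambda>d l. Rr TT (\<lambda>a b. tt ((c \<cdot> d) \<cdot> b) a) (S (g \<star> l))) y) x"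
    using x y by (subst theta_elt[symmetric], simp add: U_simps, intro rho_mult_sw bilinearI) (simp_all add: U_simps)
  also have "\<dots> = Rho TT (\<lambda>c g. Rho TT (\<lambda>d l. Rr TT (\<lambda>a b. Rr TT (\<lambda>a' b'. tt ((c \<cdot> d) \<cdot> (b \<cdot> b')) (a' \<cdot> a)) (S g)) (S l)) y) x"
    by (intro sw_cong) (simp_all add: U_simps S_mult r_mult cong: sw_cong2)
  also have "\<dots> = Rho TT (\<lambda>c g. Rho TT (\<lambda>d l. Rr TT (\<lambda>a' b'. Rr TT (\<lambda>a b. tt ((c \<cdot> d) \<cdot> (b \<cdot> b')) (a' \<cdot> a)) (S l)) (S g)) y) x"
    by (intro sw_cong sw_swap) (simp_all add: U_simps)
  also have "\<dots> = Rho TT (\<lambda>c g. Rr TT (\<lambda>a' b'. Rho TT (\<lambda>d l. Rr TT (\<lambda>a b. tt ((c \<cdot> d) \<cdot> (b \<cdot> b')) (a' \<cdot> a)) (S l)) y) (S g)) x"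
    by (intro sw_cong sw_swap) (simp_all add: U_simps)
  also have "\<dots> = Rho TT (\<lambda>c g. Rr TT (\<lambda>a' b'. tt (c \<cdot> b') (a' \<cdot> vartheta y)) (S g)) x"
  proof (intro sw_cong T_mod H_module)
    fix c g a' b' assume c: "c \<in> carrier T" "a' \<in> carrier T" "b' \<in> carrier T"
    show "Rho TT (\<lambda>d l. Rr TT (\<lambda>a b. tt ((c \<cdot> d) \<cdot> (b \<cdot> b')) (a' \<cdot> a)) (S l)) y = tt (c \<cdot> b') (a' \<cdot> vartheta y)"
      using theta_sw[OF y, of TT "\<lambda>u v. tt (c \<cdot> (u \<cdot> b')) (a' \<cdot> v)"] c y
      by (simp add: bilinearI U_simps T_as cong: sw_cong2)
  qed
  also have "\<dots> = tt \<^bold>e (vartheta x \<cdot> vartheta y)"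
    using x y by (intro theta_sw[of x TT "\<lambda>u v. tt u (v \<cdot> vartheta y)"] bilinearI) (simp_all add: U_simps)
  finally show ?thesis using ff_one_right[OF T_algebra T_ff T_mod] x y by (simp add: U_simps)
qed

lemma theta_iso: "algebra_iso R T T vartheta"
proof -
  have "bij_betw vartheta (carrier T) (carrier T)"
    by (rule bij_betw_byWitness[where f' = theta_inv]) (auto simp: theta_inv_theta theta_theta_inv theta_typ theta_inv_typ)
  then show ?thesis using theta_mult theta_one theta_lin theta_typ lin_add[OF theta_lin]
    by (auto simp: algebra_iso_def algebra_hom_def ring_hom_def)
qed

text \<open>Apply the coaction to the second factor in \<open>theta_elt\<close>. By
  \<open>r_left\<close> it produces \<open>S\<close> of a component of \<open>S x_1\<close>, which
  explains the square of the antipode.\<close>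

lemma rho_theta:
  assumes x: "x \<in> carrier T"
  shows "rho (vartheta x) = Rho TH (\<lambda>y h. th (vartheta y) (S (S h))) x"
proof -
  let ?P = "T \<boxtimes> TH"
  let ?p = "\<lambda>u v g. pt T TH u (th v g)"
  have "pt T TH \<^bold>e (rho (vartheta x)) = Rho ?P (\<lambda>y h. Rr ?P (\<lambda>a b. pt T TH (y \<cdot> b) (rho a)) (S h)) x"
    using x by (intro theta_sw[symmetric, of x ?P "\<lambda>u v. pt T TH u (rho v)"] bilinearI) (simp_all add: U_simps)
  also have "\<dots> = Rho ?P (\<lambda>y h. Rr ?P (\<lambda>a b. Rho ?P (\<lambda>c g. ?p (y \<cdot> b) c g) a) (S h)) x"
    by (intro sw_cong) (simp_all add: U_simps sw_eta2 cong: sw_cong2)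
  also have "\<dots> = Rho ?P (\<lambda>y h. Del ?P (\<lambda>s1 s2. Rr ?P (\<lambda>a b. ?p (y \<cdot> b) a (S s1)) s2) (S h)) x"
    by (intro sw_cong r_left trilinearI) (simp_all add: U_simps)
  also have "\<dots> = Rho ?P (\<lambda>y h. Del ?P (\<lambda>h1 h2. Rr ?P (\<lambda>a b. ?p (y \<cdot> b) a (S (S h2))) (S h1)) h) x"
    by (intro sw_cong comult_S_sw bilinearI) (simp_all add: U_simps)
  also have "\<dots> = Rho ?P (\<lambda>t h2. Rho ?P (\<lambda>y h1. Rr ?P (\<lambda>a b. ?p (y \<cdot> b) a (S (S h2))) (S h1)) t) x"
    using x by (intro rcoassoc[symmetric] trilinearI) (simp_all add: U_simps)
  also have "\<dots> = Rho ?P (\<lambda>t h2. ?p \<^bold>e (vartheta t) (S (S h2))) x"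
  proof (intro sw_cong T_mod H_module)
    fix t h2 assume "t \<in> carrier T" "h2 \<in> carrier H"
    then show "Rho ?P (\<lambda>y h1. Rr ?P (\<lambda>a b. ?p (y \<cdot> b) a (S (S h2))) (S h1)) t = ?p \<^bold>e (vartheta t) (S (S h2))"
      by (intro theta_sw[of t ?P "\<lambda>u v. ?p u v (S (S h2))"] bilinearI) (simp_all add: U_simps)
  qed
  also have "\<dots> = pt T TH \<^bold>e (Rho TH (\<lambda>y h. th (vartheta y) (S (S h))) x)"
    by (intro pure_sw_right[symmetric]) (simp_all add: U_simps)
  finally show ?thesis
    using ff_one_right[OF T_algebra T_ff, of TH] x by (simp add: U_simps)
qed

text \<open>Two applications of \<open>r_theta\<close>: each trades \<theta> on one factor for an
  antipode in the argument of \<open>r\<close> and exchanges the factors.\<close>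

lemma r_S_S:
  assumes h: "h \<in> carrier H" and P: "module R P" and F: "bilinear R T T P F"
  shows "Rr P F (S (S h)) = Rr P (\<lambda>a b. F (vartheta a) (vartheta b)) h"
proof -
  note F' = bilinearD[OF F]
  note l = lin_comp[OF _ F'(1)] lin_comp[OF _ F'(2)] F' P
  have "Rr P (\<lambda>a b. F (vartheta a) (vartheta b)) h = Rr P (\<lambda>a b. F (vartheta b) a) (S h)"
    using h by (intro r_theta[of h P "\<lambda>u v. F (vartheta u) v"] bilinearI) (simp_all add: U_simps l)
  also have "\<dots> = Rr P F (S (S h))"
    using h by (intro r_theta[of "S h" P "\<lambda>u v. F v u"] bilinearI) (simp_all add: U_simps l)
  finally show ?thesis ..
qed

end

section \<open>Bi-Galois objects\<close>

locale bi_gal = right_gal R H S T rho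
  for R :: "'k ring" (structure) and H :: "('k, 'h) bialgebra" and S :: "'h \<Rightarrow> 'h"
    and T :: "('k, 'a, 'm) module_scheme" and rho :: "'a \<Rightarrow> ('a, 'h) tens" +
  fixes lam :: "'a \<Rightarrow> ('h, 'a) tens"
  assumes left_galois: "left_galois R H T lam"
    and commute: "x \<in> carrier T \<Longrightarrow>
      assoc R H T H (tensor_map R (H \<boxtimes> T) H lam id (rho x)) = tensor_map R H (T \<boxtimes> H) id rho (lam x)"
begin

interpretation L: left_galois R H T lam by (rule left_galois)

abbreviation "HT \<equiv> H \<boxtimes> T"
abbreviation "ht \<equiv> pt H T"
abbreviation "Lam P F x \<equiv> sw R H T P F (lam x)"

lemma lam_lin: "linear_map R T HT lam" using L.left_coaction_hom by (simp add: algebra_hom_def)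

lemma lin_lam: "linear_map R A T f \<Longrightarrow> linear_map R A HT (\<lambda>x. lam (f x))" by (rule lin_comp[OF _ lam_lin])

lemma lam_typ: "x \<in> carrier T \<Longrightarrow> lam x \<in> carrier HT" by (rule lin_closed[OF lam_lin])

lemmas B_simps0 = U_simps lin_lam lam_typ

section \<open>The left translation map\<close>

definition "beta_l z = sw R T T HT (\<lambda>a b. Lam HT (\<lambda>g t. ht g (t \<cdot> b)) a) z"

lemma beta_l_lin: "linear_map R TT HT beta_l"
  by (simp add: beta_l_def[abs_def] B_simps0)

lemma beta_l_bij: "bij_betw beta_l (carrier TT) (carrier HT)"
proof -
  have "tensor_lift HT (\<lambda>x y. tensor_map R H T id (\<lambda>x0. x0 \<cdot> y) (lam x)) z = beta_l z" if "z \<in> carrier TT" for z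
    unfolding beta_l_def using that by (intro lift_cong) (simp_all add: T_mod tensor_map_sw[OF lam_typ])
  then show ?thesis using bij_betw_cong[THEN iffD1, OF _ L.left_galois_bij] by blast
qed

lemma beta_l_inj: "inj_on beta_l (carrier TT)" by (rule bij_betw_imp_inj_on[OF beta_l_bij])

definition "l h = inv_into (carrier TT) beta_l (ht h \<^bold>e)"

lemma l_typ: "h \<in> carrier H \<Longrightarrow> l h \<in> carrier TT"
  unfolding l_def using beta_l_bij by (metis bij_betw_def inv_into_into pure_closed T_unit)

lemma beta_l_l: "h \<in> carrier H \<Longrightarrow> beta_l (l h) = ht h \<^bold>e"
  unfolding l_def by (rule bij_betw_inv_into_right[OF beta_l_bij]) (simp add: B_simps0)

lemma l_lin: "linear_map R H TT l"
proof (rule lin_of_inj[OF _ beta_l_lin beta_l_inj H_module l_typ])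
  show "linear_map R H HT (\<lambda>x. beta_l (l x))"
    using lin_cong[of H "\<lambda>x. beta_l (l x)" "\<lambda>x. ht x \<^bold>e" R HT] beta_l_l by (simp add: B_simps0)
qed (simp_all add: B_simps0)

lemma lin_l: "linear_map R A H f \<Longrightarrow> linear_map R A TT (\<lambda>x. l (f x))" by (rule lin_comp[OF _ l_lin])

abbreviation "Ll P F h \<equiv> sw R T T P F (l h)"

lemmas B_simps = B_simps0 lin_l l_typ

lemma beta_ll:
  assumes "h \<in> carrier H" "module R P" "bilinear R H T P G"
  shows "Ll P (\<lambda>a b. Lam P (\<lambda>g c. G g (c \<cdot> b)) a) h = G h \<^bold>e"
  using arg_cong[OF beta_l_l[OF assms(1)], of "sw R H T P G"] assms bilinearD[OF assms(3)]
  by (simp add: beta_l_def B_simps cong: sw_cong2)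

lemma lcoassoc:
  assumes x: "x \<in> carrier T" and P: "module R P" and F: "trilinear R H H T P F"
  shows "Lam P (\<lambda>h t. Lam P (\<lambda>k s. F h k s) t) x = Lam P (\<lambda>h t. Del P (\<lambda>k l. F k l t) h) x"
proof -
  note F = trilinearD[OF F]
  let ?e = "sw R H (H \<boxtimes> T) P (\<lambda>a v. sw R H T P (\<lambda>b c. F a b c) v)"
  have "?e (assoc R H H T (tensor_map R (H \<boxtimes> H) T (comult H) id (lam x))) = Lam P (\<lambda>h t. Del P (\<lambda>k l. F k l t) h) x"
    unfolding tensor_map_sw[OF lam_typ[OF x]] using x P F by (simp add: assoc_sw B_simps cong: sw_cong2)
  moreover have "?e (tensor_map R H (H \<boxtimes> T) id lam (lam x)) = Lam P (\<lambda>h t. Lam P (\<lambda>k s. F h k s) t) x"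
    unfolding tensor_map_sw[OF lam_typ[OF x]] using x P F by (simp add: B_simps cong: sw_cong2)
  ultimately show ?thesis by (simp add: L.left_coassoc[OF x])
qed

lemma commute_sw:
  assumes x: "x \<in> carrier T" and P: "module R P" and F: "trilinear R H T H P F"
  shows "Rho P (\<lambda>t h. Lam P (\<lambda>g s. F g s h) t) x = Lam P (\<lambda>g t. Rho P (\<lambda>s h. F g s h) t) x"
proof -
  note F = trilinearD[OF F]
  let ?e = "sw R H (T \<boxtimes> H) P (\<lambda>a v. sw R T H P (\<lambda>b c. F a b c) v)"
  have "?e (assoc R H T H (tensor_map R (H \<boxtimes> T) H lam id (rho x))) = Rho P (\<lambda>t h. Lam P (\<lambda>g s. F g s h) t) x"
    unfolding tensor_map_sw[OF rho_typ[OF x]] using x P F by (simp add: assoc_sw B_simps cong: sw_cong2)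
  moreover have "?e (tensor_map R H (T \<boxtimes> H) id rho (lam x)) = Lam P (\<lambda>g t. Rho P (\<lambda>s h. F g s h) t) x"
    unfolding tensor_map_sw[OF lam_typ[OF x]] using x P F by (simp add: B_simps cong: sw_cong2)
  ultimately show ?thesis by (simp add: commute[OF x])
qed

lemma lcounit: "x \<in> carrier T \<Longrightarrow> Lam T (\<lambda>h t. counit H h \<odot>\<^bsub>T\<^esub> t) x = x"
  using L.left_counit[of x] lam_typ[of x] by (simp add: sw_def)

lemma lam_one: "lam \<^bold>e = ht \<one>\<^bsub>H\<^esub> \<^bold>e"
  using L.left_coaction_hom by (simp add: algebra_hom_def ring_hom_def tensor_one)

lemma lam_mult_sw:
  assumes "x \<in> carrier T" "y \<in> carrier T" "module R P" "bilinear R H T P F"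
  shows "Lam P F (x \<cdot> y) = Lam P (\<lambda>h s. Lam P (\<lambda>k t. F (h \<star> k) (s \<cdot> t)) y) x"
proof -
  have "lam (x \<cdot> y) = monoid.mult HT (lam x) (lam y)"
    using L.left_coaction_hom assms(1,2) by (simp add: algebra_hom_def ring_hom_def)
  then show ?thesis using assms bilinearD[OF assms(4)] by (simp add: tensor_mult B_simps cong: sw_cong2)
qed

lemma l_lam_elt:
  assumes x: "x \<in> carrier T"
  shows "Lam TT (\<lambda>g c. Ll TT (\<lambda>a b. tt a (b \<cdot> c)) g) x = tt x \<^bold>e"
proof (rule inj_onD[OF beta_l_inj])
  have "beta_l (Lam TT (\<lambda>g c. Ll TT (\<lambda>a b. tt a (b \<cdot> c)) g) x) =
      Lam HT (\<lambda>g c. Ll HT (\<lambda>a b. Lam HT (\<lambda>k d. ht k ((d \<cdot> b) \<cdot> c)) a) g) x"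
    using x by (simp add: beta_l_def B_simps T_as cong: sw_cong2)
  also have "\<dots> = Lam HT (\<lambda>g c. ht g (\<^bold>e \<cdot> c)) x"
  proof (intro sw_cong H_module T_mod)
    fix c g assume "c \<in> carrier T" "g \<in> carrier H"
    then show "Ll HT (\<lambda>a b. Lam HT (\<lambda>k d. ht k ((d \<cdot> b) \<cdot> c)) a) g = ht g (\<^bold>e \<cdot> c)"
      by (intro beta_ll[of g HT "\<lambda>k t. ht k (t \<cdot> c)"] bilinearI) (simp_all add: B_simps)
  qed
  also have "\<dots> = beta_l (tt x \<^bold>e)"
    using x by (simp add: beta_l_def B_simps cong: sw_cong2)
  finally show "beta_l (Lam TT (\<lambda>g c. Ll TT (\<lambda>a b. tt a (b \<cdot> c)) g) x) = beta_l (tt x \<^bold>e)" .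
qed (use x in \<open>simp_all add: B_simps\<close>)

lemma l_lam:
  assumes "x \<in> carrier T" "module R P" "bilinear R T T P F"
  shows "Lam P (\<lambda>g c. Ll P (\<lambda>a b. F a (b \<cdot> c)) g) x = F x \<^bold>e"
  using arg_cong[OF l_lam_elt[OF assms(1)], of "sw R T T P F"] assms bilinearD[OF assms(3)]
  by (simp add: B_simps cong: sw_cong2)

lemma l_nabla: "h \<in> carrier H \<Longrightarrow> Ll T (\<lambda>a b. a \<cdot> b) h = counit H h \<odot>\<^bsub>T\<^esub> \<^bold>e"
proof -
  assume h: "h \<in> carrier H"
  have "Ll T (\<lambda>a b. a \<cdot> b) h = Ll T (\<lambda>a b. Lam T (\<lambda>g c. counit H g \<odot>\<^bsub>T\<^esub> c) a \<cdot> b) h"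
    by (intro sw_cong) (simp_all add: T_mod lcounit)
  also have "\<dots> = Ll T (\<lambda>a b. Lam T (\<lambda>g c. counit H g \<odot>\<^bsub>T\<^esub> (c \<cdot> b)) a) h"
    using h by (simp add: B_simps mult_smult[of R] lin_smult_right cong: sw_cong2)
  also have "\<dots> = counit H h \<odot>\<^bsub>T\<^esub> \<^bold>e"
    using h by (intro beta_ll[of h T "\<lambda>g t. counit H g \<odot>\<^bsub>T\<^esub> t"] bilinearI) (simp_all add: B_simps lin_smult_right)
  finally show ?thesis .
qed

text \<open>The counterpart of \<open>r_right\<close>; it later yields compatibility of
  \<open>l\<close> with the comultiplication.\<close>

lemma l_left:
  assumes h: "h \<in> carrier H" and P: "module R P" and F: "trilinear R H T T P F"
  shows "Ll P (\<lambda>a b. Lam P (\<lambda>g c. F g c b) a) h = Del P (\<lambda>h1 h2. Ll P (\<lambda>a b. F h1 a b) h2) h"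
proof -
  note F = trilinearD[OF F]
  note l = lin_comp[OF _ F(1)] lin_comp[OF _ F(2)] lin_comp[OF _ F(3)]
  have "Ll P (\<lambda>a b. Lam P (\<lambda>g c. F g c b) a) h =
      Ll P (\<lambda>a b. Lam P (\<lambda>g c. Lam P (\<lambda>g' c'. Ll P (\<lambda>p q. F g p (q \<cdot> (c' \<cdot> b))) g') c) a) h"
  proof (intro sw_cong H_module T_mod)
    fix b c g assume "b \<in> carrier T" "c \<in> carrier T" "g \<in> carrier H"
    then show "F g c b = Lam P (\<lambda>g' c'. Ll P (\<lambda>p q. F g p (q \<cdot> (c' \<cdot> b))) g') c"
      using l_lam[of c P "\<lambda>x y. F g x (y \<cdot> b)"] P by (simp add: bilinearI B_simps l F T_as cong: sw_cong2)
  qed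
  also have "\<dots> = Ll P (\<lambda>a b. Lam P (\<lambda>k c. Del P (\<lambda>g g'. Ll P (\<lambda>p q. F g p (q \<cdot> (c \<cdot> b))) g') k) a) h"
    by (intro sw_cong lcoassoc trilinearI) (simp_all add: B_simps l F P)
  also have "\<dots> = Del P (\<lambda>h1 h2. Ll P (\<lambda>p q. F h1 p (q \<cdot> \<^bold>e)) h2) h"
    using h by (intro beta_ll[of h P "\<lambda>k t. Del P (\<lambda>g g'. Ll P (\<lambda>p q. F g p (q \<cdot> t)) g') k"] bilinearI)
      (simp_all add: B_simps l F P)
  also have "\<dots> = Del P (\<lambda>h1 h2. Ll P (\<lambda>a b. F h1 a b) h2) h"
    by (intro sw_cong) (simp_all add: B_simps)
  finally show ?thesis .
qed

lemma l_mult: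
  assumes g: "g \<in> carrier H" and h: "h \<in> carrier H"
  shows "l (g \<star> h) = Ll TT (\<lambda>a b. Ll TT (\<lambda>c d. tt (a \<cdot> c) (d \<cdot> b)) h) g"
proof (rule inj_onD[OF beta_l_inj])
  have "beta_l (Ll TT (\<lambda>a b. Ll TT (\<lambda>c d. tt (a \<cdot> c) (d \<cdot> b)) h) g) =
      Ll HT (\<lambda>a b. Ll HT (\<lambda>c d. Lam HT (\<lambda>x y. ht x (y \<cdot> (d \<cdot> b))) (a \<cdot> c)) h) g"
    using g h by (simp add: beta_l_def B_simps cong: sw_cong2)
  also have "\<dots> = Ll HT (\<lambda>a b. Ll HT (\<lambda>c d. Lam HT (\<lambda>u k. Lam HT (\<lambda>v m. ht (u \<star> v) ((k \<cdot> m) \<cdot> (d \<cdot> b))) c) a) h) g"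
    by (intro sw_cong lam_mult_sw bilinearI) (simp_all add: B_simps)
  also have "\<dots> = Ll HT (\<lambda>a b. Lam HT (\<lambda>u k. Ll HT (\<lambda>c d. Lam HT (\<lambda>v m. ht (u \<star> v) ((k \<cdot> m) \<cdot> (d \<cdot> b))) c) h) a) g"
    by (intro sw_cong sw_swap) (simp_all add: B_simps)
  also have "\<dots> = Ll HT (\<lambda>a b. Lam HT (\<lambda>u k. ht (u \<star> h) (k \<cdot> b)) a) g"
  proof (intro sw_cong T_mod H_module)
    fix b u k assume c: "b \<in> carrier T" "u \<in> carrier H" "k \<in> carrier T"
    show "Ll HT (\<lambda>c d. Lam HT (\<lambda>v m. ht (u \<star> v) ((k \<cdot> m) \<cdot> (d \<cdot> b))) c) h = ht (u \<star> h) (k \<cdot> b)"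
      using beta_ll[OF h, of HT "\<lambda>v t. ht (u \<star> v) (k \<cdot> (t \<cdot> b))"] c h
      by (simp add: bilinearI B_simps T_as cong: sw_cong2)
  qed
  also have "\<dots> = ht (g \<star> h) \<^bold>e"
    using g h by (intro beta_ll[of g HT "\<lambda>u t. ht (u \<star> h) t"] bilinearI) (simp_all add: B_simps)
  finally show "beta_l (l (g \<star> h)) = beta_l (Ll TT (\<lambda>a b. Ll TT (\<lambda>c d. tt (a \<cdot> c) (d \<cdot> b)) h) g)"
    using g h by (simp add: beta_l_l B_simps)
qed (use g h in \<open>simp_all add: B_simps\<close>)

lemma l_one: "l \<one>\<^bsub>H\<^esub> = tt \<^bold>e \<^bold>e"
proof (rule inj_onD[OF beta_l_inj])
  have "beta_l (tt \<^bold>e \<^bold>e) = ht \<one>\<^bsub>H\<^esub> \<^bold>e" by (simp add: beta_l_def lam_one B_simps)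
  then show "beta_l (l \<one>\<^bsub>H\<^esub>) = beta_l (tt \<^bold>e \<^bold>e)" by (simp add: beta_l_l B_simps)
qed (simp_all add: B_simps)

lemma l_inj: "inj_on l (carrier H)"
proof (rule inj_onI)
  fix g h assume "g \<in> carrier H" "h \<in> carrier H" "l g = l h"
  then show "g = h" using beta_l_l[of g] beta_l_l[of h] ff_one_left[OF T_algebra T_ff H_module] by simp
qed

lemma r_inj: "inj_on r (carrier H)"
proof (rule inj_onI)
  fix g h assume "g \<in> carrier H" "h \<in> carrier H" "r g = r h"
  then show "g = h" using beta_r[of g] beta_r[of h] ff_one_right[OF T_algebra T_ff H_module] by simp
qed

text \<open>Compare after applying \<open>beta\<close> to the last two factors, which is injective
  by flatness of \<open>T\<close>. The left side contracts to
  \<open>x_0 \<otimes> 1 \<otimes> x_1\<close>. Expanding \<open>x_0 \<otimes> 1\<close> by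
  \<open>l_lam\<close> and exchanging the two coactions gives the image of the right side.\<close>

lemma r_rho_l_lam:
  assumes x: "x \<in> carrier T"
  shows "Rho (T \<boxtimes> TT) (\<lambda>y h. Rr (T \<boxtimes> TT) (\<lambda>a b. pt T TT y (tt a b)) h) x =
    Lam (T \<boxtimes> TT) (\<lambda>g t. Ll (T \<boxtimes> TT) (\<lambda>a b. pt T TT a (tt b t)) g) x" (is "?l = ?r")
proof -
  let ?P = "T \<boxtimes> TH"
  let ?p = "\<lambda>a t h. pt T TH a (th t h)"
  let ?J = "sw R T TT ?P (\<lambda>t z. pt T TH t (beta z))"
  have J: "inj_on ?J (carrier (T \<boxtimes> TT))"
    by (rule flat_inj_right[OF T_flat _ _ beta_lin beta_inj]) (simp_all add: B_simps)
  have "?J ?l = Rho ?P (\<lambda>y h. Rr ?P (\<lambda>a b. Rho ?P (\<lambda>t g. ?p y (a \<cdot> t) g) b) h) x"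
    using x by (simp add: beta_def B_simps cong: sw_cong2)
  also have "\<dots> = Rho ?P (\<lambda>y h. ?p y \<^bold>e h) x"
  proof (intro sw_cong T_mod H_module)
    fix y h assume "y \<in> carrier T" "h \<in> carrier H"
    then show "Rr ?P (\<lambda>a b. Rho ?P (\<lambda>t g. ?p y (a \<cdot> t) g) b) h = ?p y \<^bold>e h"
      by (intro beta_rr bilinearI) (simp_all add: B_simps)
  qed
  also have "\<dots> = Rho ?P (\<lambda>t h. Lam ?P (\<lambda>g s. Ll ?P (\<lambda>a b. ?p a (b \<cdot> s) h) g) t) x"
    by (intro sw_cong l_lam[symmetric, of _ ?P "\<lambda>a b. ?p a b h" for h] bilinearI) (simp_all add: B_simps)
  also have "\<dots> = Lam ?P (\<lambda>g t. Rho ?P (\<lambda>s h. Ll ?P (\<lambda>a b. ?p a (b \<cdot> s) h) g) t) x"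
    using x by (intro commute_sw trilinearI) (simp_all add: B_simps)
  also have "\<dots> = Lam ?P (\<lambda>g t. Ll ?P (\<lambda>a b. Rho ?P (\<lambda>s h. ?p a (b \<cdot> s) h) t) g) x"
    by (intro sw_cong sw_swap) (simp_all add: B_simps)
  also have "\<dots> = ?J ?r"
    using x by (simp add: beta_def B_simps cong: sw_cong2)
  finally show ?thesis using inj_onD[OF J] x by (simp add: B_simps)
qed

end

section \<open>The torsor of a bi-Galois object\<close>

text \<open>The torsor fields are arbitrary and tied to the formulas by equations, so the sum
  identities of \<open>pretorsor\<close> apply to them directly. The record satisfying these
  equations is built in \<open>bigal_torsor\<close>.\<close>

locale gal_torsor = bi_gal R H S T rho lam
  for R :: "'k ring" (structure) and H :: "('k, 'h) bialgebra" and S :: "'h \<Rightarrow> 'h"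
    and T :: "('k, 'a, 'm) torsor_scheme" and rho :: "'a \<Rightarrow> ('a, 'h) tens" and lam :: "'a \<Rightarrow> ('h, 'a) tens" +
  assumes tmu_eq: "x \<in> carrier T \<Longrightarrow>
      tmu T x = Rho (T \<boxtimes> TT) (\<lambda>y h. Rr (T \<boxtimes> TT) (\<lambda>a b. pt T TT y (tt a b)) h) x"
    and theta_eq: "x \<in> carrier T \<Longrightarrow> theta T x = vartheta x"
begin

abbreviation "T3 \<equiv> T \<boxtimes> TT"
abbreviation "T4 \<equiv> T \<boxtimes> T3"
abbreviation "T5 \<equiv> T \<boxtimes> T4"
abbreviation "t3 a b c \<equiv> pt T TT a (tt b c)"
abbreviation "t4 a b c d \<equiv> pt T T3 a (t3 b c d)"
abbreviation "t5 a b c d e \<equiv> pt T T4 a (t4 b c d e)"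
abbreviation "duo P F z \<equiv> sw R T T P F z"
abbreviation "tri P F z \<equiv> sw R T TT P (\<lambda>a v. sw R T T P (\<lambda>b c. F a b c) v) z"
abbreviation "Mu P F x \<equiv> tri P F (tmu T x)"

lemma tmu_lin: "linear_map R T T3 (tmu T)"
proof -
  have "linear_map R T T3 (\<lambda>x. Rho T3 (\<lambda>y h. Rr T3 (\<lambda>a b. t3 y a b) h) x)" by (simp add: B_simps)
  then show ?thesis by (subst lin_cong[OF tmu_eq T_mod])
qed

lemma lin_tmu: "linear_map R A T f \<Longrightarrow> linear_map R A T3 (\<lambda>x. tmu T (f x))" by (rule lin_comp[OF _ tmu_lin])

lemma tmu_typ: "x \<in> carrier T \<Longrightarrow> tmu T x \<in> carrier T3" by (rule lin_closed[OF tmu_lin])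

lemma tmu_eq_left: "x \<in> carrier T \<Longrightarrow> tmu T x = Lam T3 (\<lambda>g t. Ll T3 (\<lambda>a b. t3 a b t) g) x"
  by (simp add: tmu_eq r_rho_l_lam)

lemmas M_simps = B_simps lin_tmu tmu_typ

lemma mu_r:
  assumes "x \<in> carrier T" "module R P" "trilinear R T T T P F"
  shows "Mu P F x = Rho P (\<lambda>y h. Rr P (\<lambda>a b. F y a b) h) x"
  using assms(1,2) trilinearD[OF assms(3)] by (simp add: tmu_eq M_simps cong: sw_cong2)

lemma mu_l:
  assumes "x \<in> carrier T" "module R P" "trilinear R T T T P F"
  shows "Mu P F x = Lam P (\<lambda>g t. Ll P (\<lambda>a b. F a b t) g) x"
  using assms(1,2) trilinearD[OF assms(3)] by (simp add: tmu_eq_left M_simps cong: sw_cong2)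

lemma theta_T_iso: "algebra_iso R T T (theta T)"
proof -
  have "theta T x = vartheta x" if "x \<in> carrier T" for x using that by (rule theta_eq)
  note c = this
  have "linear_map R T T (theta T)" using theta_lin by (subst lin_cong[OF theta_eq T_mod])
  moreover have "bij_betw (theta T) (carrier T) (carrier T)"
    using theta_iso by (subst bij_betw_cong[OF theta_eq]) (simp_all add: algebra_iso_def)
  moreover have "theta T \<in> ring_hom T T"
  proof (rule ring_hom_memI)
    fix x y assume "x \<in> carrier T" "y \<in> carrier T"
    then show "theta T x \<in> carrier T" "theta T (x \<cdot> y) = theta T x \<cdot> theta T y"
        "theta T (add T x y) = add T (theta T x) (theta T y)"
      using theta_typ theta_mult theta_lin bimult_closed[OF T_bim] lin_add[OF theta_lin]
        abelian_monoid.a_closed[OF abelian_group.axioms(1)[OF module.axioms(2)[OF T_mod]]]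
      by (simp_all add: c)
  qed (simp add: c theta_one T_unit)
  ultimately show ?thesis by (simp add: algebra_iso_def algebra_hom_def)
qed

lemma pretorsor: "pretorsor R T"
  using T_algebra tmu_lin theta_T_iso
  by (intro pretorsor.intro pretorsor_axioms.intro) (simp_all add: algebra_iso_def algebra_hom_def)

interpretation Q: pretorsor R T by (rule pretorsor)

lemma tmu_hom: "algebra_hom R T (T \<boxtimes> opp T \<boxtimes> T) (tmu T)"
proof -
  have "tmu T \<^bold>e = t3 \<^bold>e \<^bold>e \<^bold>e" by (simp add: tmu_eq rho_one r_one M_simps)
  moreover have "tmu T (x \<cdot> y) = monoid.mult (T \<boxtimes> opp T \<boxtimes> T) (tmu T x) (tmu T y)"
    if x: "x \<in> carrier T" and y: "y \<in> carrier T" for x y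
  proof -
    have "tmu T (x \<cdot> y) = Rho T3 (\<lambda>s h. Rho T3 (\<lambda>t k. Rr T3 (\<lambda>a b. t3 (s \<cdot> t) a b) (h \<star> k)) y) x"
      using x y unfolding tmu_eq[OF bimult_closed[OF T_bim x y]] by (intro rho_mult_sw bilinearI) (simp_all add: M_simps)
    also have "\<dots> = Rho T3 (\<lambda>s h. Rho T3 (\<lambda>t k. Rr T3 (\<lambda>a b. Rr T3 (\<lambda>c d. t3 (s \<cdot> t) (c \<cdot> a) (b \<cdot> d)) k) h) y) x"
      by (intro sw_cong) (simp_all add: M_simps r_mult cong: sw_cong2)
    also have "\<dots> = Rho T3 (\<lambda>s h. Rr T3 (\<lambda>a b. Rho T3 (\<lambda>t k. Rr T3 (\<lambda>c d. t3 (s \<cdot> t) (c \<cdot> a) (b \<cdot> d)) k) y) h) x"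
      by (intro sw_cong sw_swap) (simp_all add: M_simps)
    also have "\<dots> = Rho T3 (\<lambda>s h. Rr T3 (\<lambda>a b. Mu T3 (\<lambda>d e f. t3 (s \<cdot> d) (e \<cdot> a) (b \<cdot> f)) y) h) x"
      using y by (intro sw_cong mu_r[symmetric] trilinearI) (simp_all add: M_simps)
    also have "\<dots> = Mu T3 (\<lambda>a b c. Mu T3 (\<lambda>d e f. t3 (a \<cdot> d) (e \<cdot> b) (c \<cdot> f)) y) x"
      using x y by (intro mu_r[symmetric] trilinearI) (simp_all add: M_simps)
    also have "\<dots> = monoid.mult (T \<boxtimes> opp T \<boxtimes> T) (tmu T x) (tmu T y)"
      using x y by (intro Q.mult_T3[symmetric] tmu_typ)
    finally show ?thesis .
  qed
  moreover have s: "same TT (opp T \<boxtimes> T)" "same T3 (T \<boxtimes> opp T \<boxtimes> T)" by (intro same_tensor same_sym[OF same_opp] same_refl)+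
  moreover have "pt T (opp T \<boxtimes> T) = pt T TT" "pt (opp T) T = tt"
    by (intro same_pure same_sym[OF s(1)] same_opp same_refl)+
  moreover have l: "linear_map R T (T \<boxtimes> opp T \<boxtimes> T) (tmu T)"
    using tmu_lin by (simp add: same_linear[OF same_refl s(2), symmetric])
  ultimately show ?thesis
    unfolding algebra_hom_def using lin_closed[OF l] lin_add[OF l]
    by (intro conjI ring_hom_memI) (simp_all add: tensor_one opp_simps)
qed

lemma nabla_right: "x \<in> carrier T \<Longrightarrow> Mu TT (\<lambda>a b c. tt a (b \<cdot> c)) x = tt x \<^bold>e"
proof -
  assume x: "x \<in> carrier T"
  have "Mu TT (\<lambda>a b c. tt a (b \<cdot> c)) x = Rho TT (\<lambda>y h. Rr TT (\<lambda>a b. tt y (a \<cdot> b)) h) x"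
    using x by (intro mu_r trilinearI) (simp_all add: M_simps)
  also have "\<dots> = Rho TT (\<lambda>y h. tt (counit H h \<odot>\<^bsub>T\<^esub> y) \<^bold>e) x"
    by (intro sw_cong) (simp_all add: r_nabla_lin[where F = "\<lambda>z. tt y z" for y] M_simps pure_smult_left pure_smult_right)
  also have "\<dots> = tt (Rho T (\<lambda>y h. counit H h \<odot>\<^bsub>T\<^esub> y) x) \<^bold>e"
    by (intro pure_sw_left[symmetric]) (simp_all add: M_simps module.smult_closed[OF T_mod])
  finally show ?thesis using x by (simp add: rcounit)
qed

lemma nabla_left: "x \<in> carrier T \<Longrightarrow> Mu TT (\<lambda>a b c. tt (a \<cdot> b) c) x = tt \<^bold>e x"
  using mu_r[of x TT "\<lambda>a b c. tt (a \<cdot> b) c"] r_rho_elt[of x] by (simp add: trilinearI M_simps)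

text \<open>A normal form for the double sum with \<mu> on the first factor, from the formula with
  \<open>r\<close> used twice and coassociativity of the coaction. Both the associativity and the
  \<theta> axiom are compared with it.\<close>

lemma mu_mu_left:
  assumes x: "x \<in> carrier T" and P: "module R P"
    and F: "\<And>b c d e. \<lbrakk>b \<in> carrier T; c \<in> carrier T; d \<in> carrier T; e \<in> carrier T\<rbrakk> \<Longrightarrow> linear_map R T P (\<lambda>a. F a b c d e)"
      "\<And>a c d e. \<lbrakk>a \<in> carrier T; c \<in> carrier T; d \<in> carrier T; e \<in> carrier T\<rbrakk> \<Longrightarrow> linear_map R T P (\<lambda>b. F a b c d e)"
      "\<And>a b d e. \<lbrakk>a \<in> carrier T; b \<in> carrier T; d \<in> carrier T; e \<in> carrier T\<rbrakk> \<Longrightarrow> linear_map R T P (\<lambda>c. F a b c d e)"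
      "\<And>a b c e. \<lbrakk>a \<in> carrier T; b \<in> carrier T; c \<in> carrier T; e \<in> carrier T\<rbrakk> \<Longrightarrow> linear_map R T P (\<lambda>d. F a b c d e)"
      "\<And>a b c d. \<lbrakk>a \<in> carrier T; b \<in> carrier T; c \<in> carrier T; d \<in> carrier T\<rbrakk> \<Longrightarrow> linear_map R T P (\<lambda>e. F a b c d e)"
  shows "Mu P (\<lambda>a b c. Mu P (\<lambda>d e f. F d e f b c) a) x =
    Rho P (\<lambda>z m. Del P (\<lambda>k h. Rr P (\<lambda>a b. Rr P (\<lambda>p q. F z a b p q) h) k) m) x"
proof -
  note l = P F lin_closed[OF F(1)] lin_comp[OF _ F(1)] lin_comp[OF _ F(2)] lin_comp[OF _ F(3)] lin_comp[OF _ F(4)] lin_comp[OF _ F(5)]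
  have "Mu P (\<lambda>a b c. Mu P (\<lambda>d e f. F d e f b c) a) x = Rho P (\<lambda>y h. Rr P (\<lambda>p q. Mu P (\<lambda>d e f. F d e f p q) y) h) x"
    using x by (intro mu_r trilinearI) (simp_all add: M_simps l)
  also have "\<dots> = Rho P (\<lambda>y h. Rr P (\<lambda>p q. Rho P (\<lambda>z k. Rr P (\<lambda>a b. F z a b p q) k) y) h) x"
    by (intro sw_cong mu_r trilinearI) (simp_all add: M_simps l)
  also have "\<dots> = Rho P (\<lambda>y h. Rho P (\<lambda>z k. Rr P (\<lambda>p q. Rr P (\<lambda>a b. F z a b p q) k) h) y) x"
    by (intro sw_cong sw_swap) (simp_all add: M_simps l)
  also have "\<dots> = Rho P (\<lambda>z m. Del P (\<lambda>k h. Rr P (\<lambda>p q. Rr P (\<lambda>a b. F z a b p q) k) h) m) x"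
    using x by (intro rcoassoc trilinearI) (simp_all add: M_simps l)
  also have "\<dots> = Rho P (\<lambda>z m. Del P (\<lambda>k h. Rr P (\<lambda>a b. Rr P (\<lambda>p q. F z a b p q) h) k) m) x"
    by (intro sw_cong sw_swap) (simp_all add: M_simps l)
  finally show ?thesis .
qed

text \<open>By \<open>r_right\<close> the coaction on the second factor of \<open>r h\<close> splits
  \<open>h\<close> by the comultiplication, and this is the normal form of the other side.\<close>

lemma mu_assoc:
  assumes x: "x \<in> carrier T"
  shows "Mu T5 (\<lambda>a b c. Mu T5 (\<lambda>d e f. t5 a b d e f) c) x = Mu T5 (\<lambda>a b c. Mu T5 (\<lambda>d e f. t5 d e f b c) a) x"
proof -
  have "Mu T5 (\<lambda>a b c. Mu T5 (\<lambda>d e f. t5 a b d e f) c) x = Rho T5 (\<lambda>y h. Rr T5 (\<lambda>a b. Mu T5 (\<lambda>d e f. t5 y a d e f) b) h) x"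
    using x by (intro mu_r trilinearI) (simp_all add: M_simps)
  also have "\<dots> = Rho T5 (\<lambda>y h. Rr T5 (\<lambda>a b. Rho T5 (\<lambda>z k. Rr T5 (\<lambda>p q. t5 y a z p q) k) b) h) x"
    by (intro sw_cong mu_r trilinearI) (simp_all add: M_simps)
  also have "\<dots> = Rho T5 (\<lambda>y h. Del T5 (\<lambda>h1 h2. Rr T5 (\<lambda>a b. Rr T5 (\<lambda>p q. t5 y a b p q) h2) h1) h) x"
    by (intro sw_cong r_right trilinearI) (simp_all add: M_simps)
  also have "\<dots> = Mu T5 (\<lambda>a b c. Mu T5 (\<lambda>d e f. t5 d e f b c) a) x"
    using x by (intro mu_mu_left[symmetric]) (simp_all add: M_simps)
  finally show ?thesis .
qed

text \<open>On one side \<open>r_theta\<close> replaces \<theta> by an antipode in the argument of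
  \<open>r\<close> together with a flip. On the other side the coaction on the first factor of
  \<open>r h\<close> produces the same antipode by \<open>r_left\<close>.\<close>

lemma mu_theta:
  assumes x: "x \<in> carrier T"
  shows "Mu T5 (\<lambda>a b c. Mu T5 (\<lambda>d e f. t5 d e (theta T f) b c) a) x = Mu T5 (\<lambda>a b c. Mu T5 (\<lambda>d e f. t5 a f e d c) b) x"
proof -
  have "Mu T5 (\<lambda>a b c. Mu T5 (\<lambda>d e f. t5 d e (theta T f) b c) a) x = Mu T5 (\<lambda>a b c. Mu T5 (\<lambda>d e f. t5 d e (vartheta f) b c) a) x"
    by (intro sw_cong) (simp_all add: theta_eq M_simps)
  also have "\<dots> = Rho T5 (\<lambda>z m. Del T5 (\<lambda>k h. Rr T5 (\<lambda>a b. Rr T5 (\<lambda>p q. t5 z a (vartheta b) p q) h) k) m) x"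
    using x by (intro mu_mu_left) (simp_all add: M_simps)
  also have "\<dots> = Rho T5 (\<lambda>z m. Del T5 (\<lambda>k h. Rr T5 (\<lambda>a b. Rr T5 (\<lambda>p q. t5 z b a p q) h) (S k)) m) x"
  proof (intro sw_cong T_mod H_module)
    fix z k h assume "z \<in> carrier T" "k \<in> carrier H" "h \<in> carrier H"
    then show "Rr T5 (\<lambda>a b. Rr T5 (\<lambda>p q. t5 z a (vartheta b) p q) h) k = Rr T5 (\<lambda>a b. Rr T5 (\<lambda>p q. t5 z b a p q) h) (S k)"
      by (intro r_theta[of k T5 "\<lambda>a b. Rr T5 (\<lambda>p q. t5 z a b p q) h"] bilinearI) (simp_all add: M_simps)
  qed
  also have "\<dots> = Rho T5 (\<lambda>z m. Del T5 (\<lambda>k h. Rr T5 (\<lambda>p q. Rr T5 (\<lambda>a b. t5 z b a p q) (S k)) h) m) x"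
    by (intro sw_cong sw_swap) (simp_all add: M_simps)
  also have "\<dots> = Rho T5 (\<lambda>y h. Rr T5 (\<lambda>b c. Rho T5 (\<lambda>z k. Rr T5 (\<lambda>p q. t5 y q p z c) k) b) h) x"
    by (intro sw_cong r_left[symmetric] trilinearI) (simp_all add: M_simps)
  also have "\<dots> = Rho T5 (\<lambda>y h. Rr T5 (\<lambda>b c. Mu T5 (\<lambda>d e f. t5 y f e d c) b) h) x"
    by (intro sw_cong mu_r[symmetric] trilinearI) (simp_all add: M_simps)
  also have "\<dots> = Mu T5 (\<lambda>a b c. Mu T5 (\<lambda>d e f. t5 a f e d c) b) x"
    using x by (intro mu_r[symmetric] trilinearI) (simp_all add: M_simps)
  finally show ?thesis .
qed

text \<open>Both sides carry the square of the antipode on the component in \<open>H\<close>: on one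
  it comes from \<open>r_S_S\<close>, on the other from \<open>rho_theta\<close>.\<close>

lemma theta_tmu:
  assumes x: "x \<in> carrier T"
  shows "Mu T3 (\<lambda>a b c. t3 (theta T a) (theta T b) (theta T c)) x = tmu T (theta T x)"
proof -
  have "Mu T3 (\<lambda>a b c. t3 (theta T a) (theta T b) (theta T c)) x = Mu T3 (\<lambda>a b c. t3 (vartheta a) (vartheta b) (vartheta c)) x"
    by (intro sw_cong) (simp_all add: theta_eq M_simps)
  also have "\<dots> = Rho T3 (\<lambda>y h. Rr T3 (\<lambda>a b. t3 (vartheta y) (vartheta a) (vartheta b)) h) x"
    using x by (intro mu_r trilinearI) (simp_all add: M_simps)
  also have "\<dots> = Rho T3 (\<lambda>y h. Rr T3 (\<lambda>a b. t3 (vartheta y) a b) (S (S h))) x"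
  proof (intro sw_cong T_mod H_module)
    fix y h assume "y \<in> carrier T" "h \<in> carrier H"
    then show "Rr T3 (\<lambda>a b. t3 (vartheta y) (vartheta a) (vartheta b)) h = Rr T3 (\<lambda>a b. t3 (vartheta y) a b) (S (S h))"
      by (intro r_S_S[symmetric] bilinearI) (simp_all add: M_simps)
  qed
  also have "\<dots> = Rho T3 (\<lambda>y h. Rr T3 (\<lambda>a b. t3 y a b) h) (vartheta x)"
    unfolding rho_theta[OF x] using x by (simp add: M_simps cong: sw_cong2)
  finally show ?thesis using x by (simp add: theta_eq tmu_eq theta_typ)
qed

lemma quantum_torsor: "quantum_torsor R T"
  unfolding Q.quantum_torsor_iff
  by (intro conjI ballI T_ff tmu_hom theta_T_iso nabla_right nabla_left mu_assoc mu_theta theta_tmu)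

end

section \<open>The translation maps identify \<open>H\<close> with \<open>H_l(T)\<close> and
  \<open>H_r(T)\<close>\<close>

context gal_torsor
begin

interpretation Q: quantum_torsor R T by (rule quantum_torsor)

text \<open>\<open>h \<otimes> 1 = beta_l (l h)\<close> is a combination of values of
  \<open>lam\<close> multiplied by elements of \<open>T\<close>. Hence
  \<open>f h \<otimes> 1\<close> is determined by what \<open>f\<close> does on the coaction, and
  faithful flatness removes the factor 1.\<close>

lemma l_descent:
  assumes X: "module R X" and f: "linear_map R H X f" and g: "linear_map R H X g"
    and e: "\<And>x. x \<in> carrier T \<Longrightarrow> Lam (X \<boxtimes> T) (\<lambda>k t. pt X T (f k) t) x = Lam (X \<boxtimes> T) (\<lambda>k t. pt X T (g k) t) x"
    and h: "h \<in> carrier H"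
  shows "f h = g h"
proof (rule ff_one_left[OF T_algebra T_ff X])
  let ?P = "X \<boxtimes> T"
  have b: "Ll ?P (\<lambda>a b. Lam ?P (\<lambda>k t. pt X T (f k) (t \<cdot> b)) a) h = pt X T (f h) \<^bold>e"
    if "linear_map R H X f" for f
    using h by (intro beta_ll bilinearI) (simp_all add: B_simps X lin_comp[OF _ that] lin_closed[OF that])
  have "Lam ?P (\<lambda>k t. pt X T (f k) (t \<cdot> b)) a = Lam ?P (\<lambda>k t. pt X T (g k) (t \<cdot> b)) a"
    if "a \<in> carrier T" "b \<in> carrier T" for a b
    using arg_cong[OF e[OF that(1)], of "sw R X T ?P (\<lambda>u t. pt X T u (t \<cdot> b))"] that
    by (simp add: B_simps X lin_comp[OF _ f] lin_closed[OF f] lin_comp[OF _ g] lin_closed[OF g] cong: sw_cong2)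
  then have "Ll ?P (\<lambda>a b. Lam ?P (\<lambda>k t. pt X T (f k) (t \<cdot> b)) a) h =
      Ll ?P (\<lambda>a b. Lam ?P (\<lambda>k t. pt X T (g k) (t \<cdot> b)) a) h"
    by (rule sw_cong[OF T_mod T_mod])
  then show "pt X T (f h) \<^bold>e = pt X T (g h) \<^bold>e" by (simp add: b[OF f] b[OF g])
qed (use h lin_closed[OF f] lin_closed[OF g] in auto)

lemma r_descent:
  assumes X: "module R X" and f: "linear_map R H X f" and g: "linear_map R H X g"
    and e: "\<And>x. x \<in> carrier T \<Longrightarrow> Rho (T \<boxtimes> X) (\<lambda>t k. pt T X t (f k)) x = Rho (T \<boxtimes> X) (\<lambda>t k. pt T X t (g k)) x"
    and h: "h \<in> carrier H"
  shows "f h = g h"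
proof (rule ff_one_right[OF T_algebra T_ff X])
  let ?P = "T \<boxtimes> X"
  have b: "Rr ?P (\<lambda>a b. Rho ?P (\<lambda>t k. pt T X (a \<cdot> t) (f k)) b) h = pt T X \<^bold>e (f h)"
    if "linear_map R H X f" for f
    using h by (intro beta_rr bilinearI) (simp_all add: B_simps X lin_comp[OF _ that] lin_closed[OF that])
  have "Rho ?P (\<lambda>t k. pt T X (a \<cdot> t) (f k)) b = Rho ?P (\<lambda>t k. pt T X (a \<cdot> t) (g k)) b"
    if "a \<in> carrier T" "b \<in> carrier T" for a b
    using arg_cong[OF e[OF that(2)], of "sw R T X ?P (\<lambda>t u. pt T X (a \<cdot> t) u)"] that
    by (simp add: B_simps X lin_comp[OF _ f] lin_closed[OF f] lin_comp[OF _ g] lin_closed[OF g] cong: sw_cong2)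
  then have "Rr ?P (\<lambda>a b. Rho ?P (\<lambda>t k. pt T X (a \<cdot> t) (f k)) b) h =
      Rr ?P (\<lambda>a b. Rho ?P (\<lambda>t k. pt T X (a \<cdot> t) (g k)) b) h"
    by (rule sw_cong[OF T_mod T_mod])
  then show "pt T X \<^bold>e (f h) = pt T X \<^bold>e (g h)" by (simp add: b[OF f] b[OF g])
qed (use h lin_closed[OF f] lin_closed[OF g] in auto)

lemmas Q_simps = M_simps Q.lin_theta Q.theta_typ

text \<open>The defining equation of \<open>H_l(T)\<close> at \<open>l h\<close> is linear in
  \<open>h\<close>, so \<open>l_descent\<close> allows testing it on the coaction. There, since
  \<mu> is assembled from \<open>lam\<close> and \<open>l\<close>, it is the axiom relating \<mu>
  and \<theta>.\<close>

lemma l_Hl: "h \<in> carrier H \<Longrightarrow> Q.Hl_eq (l h)"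
proof -
  assume h: "h \<in> carrier H"
  let ?f = "\<lambda>h. Ll T4 (\<lambda>a b. Mu T4 (\<lambda>d e f. t4 d e (theta T f) b) a) h"
  let ?g = "\<lambda>h. Ll T4 (\<lambda>a b. Mu T4 (\<lambda>d e f. t4 a f e d) b) h"
  have "?f h = ?g h"
  proof (rule l_descent[OF _ _ _ _ h])
    fix x assume x: "x \<in> carrier T"
    let ?P = "T4 \<boxtimes> T"
    let ?p = "pt T4 T"
    let ?k = "sw R T T4 ?P (\<lambda>a v. sw R T T3 ?P (\<lambda>b w. tri ?P (\<lambda>c d e. ?p (t4 a b c d) e) w) v)"
    have "Lam ?P (\<lambda>g t. ?p (?f g) t) x = Lam ?P (\<lambda>g t. Ll ?P (\<lambda>a b. Mu ?P (\<lambda>d e f. ?p (t4 d e (theta T f) b) t) a) g) x"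
      using x by (simp add: Q_simps cong: sw_cong2)
    also have "\<dots> = Mu ?P (\<lambda>a b c. Mu ?P (\<lambda>d e f. ?p (t4 d e (theta T f) b) c) a) x"
      using x by (intro mu_l[symmetric] trilinearI) (simp_all add: Q_simps)
    also have "\<dots> = ?k (Mu T5 (\<lambda>a b c. Mu T5 (\<lambda>d e f. t5 d e (theta T f) b c) a) x)"
      using x by (simp add: Q_simps cong: sw_cong2)
    also have "\<dots> = ?k (Mu T5 (\<lambda>a b c. Mu T5 (\<lambda>d e f. t5 a f e d c) b) x)"
      by (simp only: mu_theta[OF x])
    also have "\<dots> = Mu ?P (\<lambda>a b c. Mu ?P (\<lambda>d e f. ?p (t4 a f e d) c) b) x"
      using x by (simp add: Q_simps cong: sw_cong2)
    also have "\<dots> = Lam ?P (\<lambda>g t. Ll ?P (\<lambda>a b. Mu ?P (\<lambda>d e f. ?p (t4 a f e d) t) b) g) x"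
      using x by (intro mu_l trilinearI) (simp_all add: Q_simps)
    also have "\<dots> = Lam ?P (\<lambda>g t. ?p (?g g) t) x"
      using x by (simp add: Q_simps cong: sw_cong2)
    finally show "Lam ?P (\<lambda>g t. ?p (?f g) t) x = Lam ?P (\<lambda>g t. ?p (?g g) t) x" .
  qed (simp_all add: Q_simps)
  then show ?thesis using h by (simp add: Q.Hl_eq_def l_typ)
qed

text \<open>The same descent on the right; associativity of \<mu> first moves the inner \<mu> to the
  factor where the axiom on \<theta> has it.\<close>

lemma r_Hr: "h \<in> carrier H \<Longrightarrow> Q.Hr_eq (r h)"
proof -
  assume h: "h \<in> carrier H"
  let ?f = "\<lambda>h. Rr T4 (\<lambda>a b. Mu T4 (\<lambda>d e f. t4 a (theta T d) e f) b) h"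
  let ?g = "\<lambda>h. Rr T4 (\<lambda>a b. Mu T4 (\<lambda>d e f. t4 f e d b) a) h"
  have "?f h = ?g h"
  proof (rule r_descent[OF _ _ _ _ h])
    fix x assume x: "x \<in> carrier T"
    let ?k = "sw R T T4 T5 (\<lambda>a v. sw R T T3 T5 (\<lambda>b w. tri T5 (\<lambda>c d e. t5 a b (theta T c) d e) w) v)"
    have "Rho T5 (\<lambda>y h. pt T T4 y (?f h)) x = Rho T5 (\<lambda>y h. Rr T5 (\<lambda>a b. Mu T5 (\<lambda>d e f. t5 y a (theta T d) e f) b) h) x"
      using x by (simp add: Q_simps cong: sw_cong2)
    also have "\<dots> = Mu T5 (\<lambda>a b c. Mu T5 (\<lambda>d e f. t5 a b (theta T d) e f) c) x"
      using x by (intro mu_r[symmetric] trilinearI) (simp_all add: Q_simps)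
    also have "\<dots> = ?k (Mu T5 (\<lambda>a b c. Mu T5 (\<lambda>d e f. t5 a b d e f) c) x)"
      using x by (simp add: Q_simps cong: sw_cong2)
    also have "\<dots> = ?k (Mu T5 (\<lambda>a b c. Mu T5 (\<lambda>d e f. t5 d e f b c) a) x)"
      by (simp only: mu_assoc[OF x])
    also have "\<dots> = Mu T5 (\<lambda>a b c. Mu T5 (\<lambda>d e f. t5 d e (theta T f) b c) a) x"
      using x by (simp add: Q_simps cong: sw_cong2)
    also have "\<dots> = Mu T5 (\<lambda>a b c. Mu T5 (\<lambda>d e f. t5 a f e d c) b) x" by (rule mu_theta[OF x])
    also have "\<dots> = Rho T5 (\<lambda>y h. Rr T5 (\<lambda>b c. Mu T5 (\<lambda>d e f. t5 y f e d c) b) h) x"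
      using x by (intro mu_r trilinearI) (simp_all add: Q_simps)
    also have "\<dots> = Rho T5 (\<lambda>y h. pt T T4 y (?g h)) x"
      using x by (simp add: Q_simps cong: sw_cong2)
    finally show "Rho T5 (\<lambda>y h. pt T T4 y (?f h)) x = Rho T5 (\<lambda>y h. pt T T4 y (?g h)) x" .
  qed (simp_all add: Q_simps)
  then show ?thesis using h by (simp add: Q.Hr_eq_def r_typ)
qed

lemma left_torsor_data: "left_torsor_data R T H l lam"
  by (intro left_torsor_data.intro left_torsor_data_axioms.intro left_ell.intro left_ell_axioms.intro)
    (simp_all add: quantum_torsor H_flat l_lin l_inj l_Hl lam_typ tmu_eq_left)

lemma right_torsor_data: "right_torsor_data R T H r rho"
  by (intro right_torsor_data.intro right_torsor_data_axioms.intro right_ell.intro right_ell_axioms.intro)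
    (simp_all add: quantum_torsor H_flat r_lin r_inj r_Hr rho_typ tmu_eq)

text \<open>
  By flatness of \<open>H\<close> the element \<open>(\<lambda> \<otimes> T) z\<close> comes from \<open>H \<otimes> H\<^sub>l(T)\<close>. Since \<open>\<nabla>\<close> is scalar on
  \<open>H\<^sub>l(T)\<close>, the Galois map sends \<open>z\<close> into \<open>H \<otimes> 1\<close>, which is where it sends the image of \<open>l\<close>.
\<close>

lemma l_onto:
  assumes z: "Q.Hl_eq z"
  shows "z \<in> l ` carrier H"
proof -
  interpret D: left_torsor_data R T H l lam by (rule left_torsor_data)
  let ?B = "left_hopf R T"
  have zt: "z \<in> carrier TT" using z by (simp add: Q.Hl_eq_def)
  have B: "module R ?B" by (rule Q.left_hopf_module)
  have j: "linear_map R ?B TT (\<lambda>x. x)" by (auto simp: linear_map_def Q.left_hopf_fields Q.Hl_eq_def)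
  obtain v where v: "v \<in> carrier (H \<boxtimes> ?B)" "D.W z = sw R H ?B (H \<boxtimes> TT) (\<lambda>h b. pt H TT h b) v"
    using D.W_Hl[OF z B j] by (auto simp: Q.left_hopf_fields)
  let ?n = "\<lambda>u. sw R T T T (\<lambda>a b. a \<cdot> b) u"
  have n: "tt (?n b) \<^bold>e = tt \<^bold>e (?n b)" if "b \<in> carrier ?B" for b
    using Q.Hl_nabla[of b] Q.nabla_sw[of b] that by (simp add: Q.left_hopf_fields Q.Hl_eq_def)
  have bT: "b \<in> carrier TT" if "b \<in> carrier ?B" for b using that by (simp add: Q.left_hopf_fields Q.Hl_eq_def)
  have "beta_l z = sw R H TT HT (\<lambda>h u. ht h (?n u)) (D.W z)"
    using zt by (simp add: beta_l_def D.W_def Q_simps cong: sw_cong2)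
  also have "\<dots> = sw R H ?B HT (\<lambda>h b. ht h (?n b)) v"
    unfolding v(2) using v(1) by (simp add: Q_simps B bT lin_comp[OF _ j] cong: sw_cong2)
  finally have b: "beta_l z = sw R H ?B HT (\<lambda>h b. ht h (?n b)) v" .
  let ?P = "H \<boxtimes> TT"
  obtain h where h: "h \<in> carrier H" "beta_l z = ht h \<^bold>e"
  proof (rule flat_scalar_right[OF T_algebra T_ff H_flat lin_closed[OF beta_l_lin zt]])
    have "sw R H T ?P (\<lambda>h t. pt H TT h (tt t \<^bold>e)) (beta_l z) = sw R H ?B ?P (\<lambda>h b. pt H TT h (tt (?n b) \<^bold>e)) v"
      unfolding b using v(1) by (simp add: Q_simps B bT lin_comp[OF _ j] cong: sw_cong2)
    also have "\<dots> = sw R H ?B ?P (\<lambda>h b. pt H TT h (tt \<^bold>e (?n b))) v"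
      by (intro sw_cong H_module B arg_cong[OF n, where f = "pt H TT h" for h])
    also have "\<dots> = sw R H T ?P (\<lambda>h t. pt H TT h (tt \<^bold>e t)) (beta_l z)"
      unfolding b using v(1) by (simp add: Q_simps B bT lin_comp[OF _ j] cong: sw_cong2)
    finally show "sw R H T ?P (\<lambda>h t. pt H TT h (tt t \<^bold>e)) (beta_l z) =
        sw R H T ?P (\<lambda>h t. pt H TT h (tt \<^bold>e t)) (beta_l z)" .
  qed
  have "z = l h" by (rule inj_onD[OF beta_l_inj]) (simp_all add: h beta_l_l zt l_typ)
  then show ?thesis using h(1) by (rule image_eqI)
qed

lemma r_onto:
  assumes z: "Q.Hr_eq z"
  shows "z \<in> r ` carrier H"
proof -
  interpret D: right_torsor_data R T H r rho by (rule right_torsor_data)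
  let ?B = "right_hopf R T"
  have zt: "z \<in> carrier TT" using z by (simp add: Q.Hr_eq_def)
  have B: "module R ?B" by (rule Q.right_hopf_module)
  have j: "linear_map R ?B TT (\<lambda>x. x)" by (auto simp: linear_map_def Q.right_hopf_fields Q.Hr_eq_def)
  obtain v where v: "v \<in> carrier (?B \<boxtimes> H)" "D.W z = sw R ?B H (TT \<boxtimes> H) (\<lambda>b h. pt TT H b h) v"
    using D.W_Hr[OF z B j] by (auto simp: Q.right_hopf_fields)
  let ?n = "\<lambda>u. sw R T T T (\<lambda>a b. a \<cdot> b) u"
  have n: "tt (?n b) \<^bold>e = tt \<^bold>e (?n b)" if "b \<in> carrier ?B" for b
    using Q.Hr_nabla[of b] Q.nabla_sw[of b] that by (simp add: Q.right_hopf_fields Q.Hr_eq_def)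
  have bT: "b \<in> carrier TT" if "b \<in> carrier ?B" for b using that by (simp add: Q.right_hopf_fields Q.Hr_eq_def)
  have "beta z = sw R TT H TH (\<lambda>u h. th (?n u) h) (D.W z)"
    using zt by (simp add: beta_def D.W_def Q_simps cong: sw_cong2)
  also have "\<dots> = sw R ?B H TH (\<lambda>b h. th (?n b) h) v"
    unfolding v(2) using v(1) by (simp add: Q_simps B bT lin_comp[OF _ j] cong: sw_cong2)
  finally have b: "beta z = sw R ?B H TH (\<lambda>b h. th (?n b) h) v" .
  let ?P = "TT \<boxtimes> H"
  obtain h where h: "h \<in> carrier H" "beta z = th \<^bold>e h"
  proof (rule flat_scalar_left[OF T_algebra T_ff H_flat lin_closed[OF beta_lin zt]])
    have "sw R T H ?P (\<lambda>t h. pt TT H (tt t \<^bold>e) h) (beta z) = sw R ?B H ?P (\<lambda>b h. pt TT H (tt (?n b) \<^bold>e) h) v"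
      unfolding b using v(1) by (simp add: Q_simps B bT lin_comp[OF _ j] cong: sw_cong2)
    also have "\<dots> = sw R ?B H ?P (\<lambda>b h. pt TT H (tt \<^bold>e (?n b)) h) v"
      by (intro sw_cong H_module B arg_cong[OF n, where f = "\<lambda>u. pt TT H u h" for h])
    also have "\<dots> = sw R T H ?P (\<lambda>t h. pt TT H (tt \<^bold>e t) h) (beta z)"
      unfolding b using v(1) by (simp add: Q_simps B bT lin_comp[OF _ j] cong: sw_cong2)
    finally show "sw R T H ?P (\<lambda>t h. pt TT H (tt t \<^bold>e) h) (beta z) =
        sw R T H ?P (\<lambda>t h. pt TT H (tt \<^bold>e t) h) (beta z)" .
  qed
  have "z = r h" by (rule inj_onD[OF beta_inj]) (simp_all add: h beta_r zt r_typ)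
  then show ?thesis using h(1) by (rule image_eqI)
qed

text \<open>Writing \<mu> by the formula with \<open>l\<close> produces the coaction on the first
  factor of \<open>l h\<close>, which \<open>l_left\<close> turns into the comultiplication.\<close>

lemma l_comult:
  assumes h: "h \<in> carrier H"
  shows "Del T4 (\<lambda>g k. Ll T4 (\<lambda>a b. Ll T4 (\<lambda>c d. t4 a b c d) k) g) h = Ll T4 (\<lambda>a b. Mu T4 (\<lambda>d e f. t4 d e f b) a) h"
proof -
  have "Ll T4 (\<lambda>a b. Mu T4 (\<lambda>d e f. t4 d e f b) a) h = Ll T4 (\<lambda>a b. Lam T4 (\<lambda>g t. Ll T4 (\<lambda>d e. t4 d e t b) g) a) h"
    by (intro sw_cong mu_l trilinearI) (simp_all add: Q_simps)
  also have "\<dots> = Del T4 (\<lambda>h1 h2. Ll T4 (\<lambda>a b. Ll T4 (\<lambda>d e. t4 d e a b) h1) h2) h"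
    using h by (intro l_left trilinearI) (simp_all add: Q_simps)
  also have "\<dots> = Del T4 (\<lambda>g k. Ll T4 (\<lambda>a b. Ll T4 (\<lambda>c d. t4 a b c d) k) g) h"
    by (intro sw_cong sw_swap) (simp_all add: Q_simps)
  finally show ?thesis ..
qed

lemma r_comult:
  assumes h: "h \<in> carrier H"
  shows "Del T4 (\<lambda>g k. Rr T4 (\<lambda>a b. Rr T4 (\<lambda>c d. t4 a b c d) k) g) h = Rr T4 (\<lambda>a b. Mu T4 (\<lambda>d e f. t4 a d e f) b) h"
proof -
  have "Rr T4 (\<lambda>a b. Mu T4 (\<lambda>d e f. t4 a d e f) b) h = Rr T4 (\<lambda>a b. Rho T4 (\<lambda>y k. Rr T4 (\<lambda>e f. t4 a y e f) k) b) h"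
    by (intro sw_cong mu_r trilinearI) (simp_all add: Q_simps)
  also have "\<dots> = Del T4 (\<lambda>g k. Rr T4 (\<lambda>a b. Rr T4 (\<lambda>c d. t4 a b c d) k) g) h"
    using h by (intro r_right trilinearI) (simp_all add: Q_simps)
  finally show ?thesis ..
qed

lemma left_torsor: "left_torsor R T H l lam"
proof (intro left_torsor.intro left_torsor_axioms.intro left_torsor_data bialgebra_axioms)
  fix g h assume g: "g \<in> carrier H" and h: "h \<in> carrier H"
  show "l (g \<star> h) = monoid.mult (T \<boxtimes> opp T) (l g) (l h)"
    using g h by (simp add: l_mult Q.mult_T_opT l_typ)
qed (simp_all add: l_onto l_comult l_nabla l_one Q.nabla_sw l_typ)

lemma right_torsor: "right_torsor R T H r rho"
proof (intro right_torsor.intro right_torsor_axioms.intro right_torsor_data bialgebra_axioms)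
  fix g h assume g: "g \<in> carrier H" and h: "h \<in> carrier H"
  show "r (g \<star> h) = monoid.mult (opp T \<boxtimes> T) (r g) (r h)"
    using g h by (simp add: r_mult Q.mult_opT_T r_typ)
qed (simp_all add: r_onto r_comult r_nabla r_one Q.nabla_sw r_typ)

end

section \<open>Isomorphisms of torsors and of bi-Galois objects\<close>

text \<open>Multiply the five factors of the axiom on \<theta>: on the side containing \<theta> the
  unit axioms collapse the product to \<open>theta T x\<close>. Thus \<theta> is determined by
  \<mu>, and algebra maps compatible with \<mu> commute with it.\<close>

lemma (in quantum_torsor) theta_mu_formula:
  assumes x: "x \<in> carrier T"
  shows "theta T x = tri T (\<lambda>a b c. tri T (\<lambda>d e f. a \<bullet> (f \<bullet> (e \<bullet> (d \<bullet> c)))) (tmu T b)) (tmu T x)"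
proof -
  let ?m = "sw R T T4 T (\<lambda>a v. sw R T T3 T (\<lambda>b w. tri T (\<lambda>c d e. a \<bullet> (b \<bullet> (c \<bullet> (d \<bullet> e)))) w) v)"
  let ?g = "\<lambda>a. theta T (tri T (\<lambda>d e f. (d \<bullet> e) \<bullet> f) (tmu T a))"
  have 1: "tri T (\<lambda>d e f. d \<bullet> (e \<bullet> theta T f)) (tmu T a) = theta T a" if a: "a \<in> carrier T" for a
    using arg_cong[OF mu_nabla_left[OF a], of "sw R T T T (\<lambda>u v. u \<bullet> theta T v)"] a
    by (simp add: T_simps T_one bimult_closed[of R] T_assoc cong: sw_cong2)
  have "?m (tri T5 (\<lambda>a b c. tri T5 (\<lambda>d e f. t5 d e (theta T f) b c) (tmu T a)) (tmu T x)) =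
      tri T (\<lambda>a b c. tri T (\<lambda>d e f. d \<bullet> (e \<bullet> theta T f)) (tmu T a) \<bullet> (b \<bullet> c)) (tmu T x)"
    using x by (simp add: T_simps T_one bimult_closed[of R] T_assoc cong: sw_cong2)
  also have "\<dots> = tri T (\<lambda>a b c. theta T a \<bullet> (b \<bullet> c)) (tmu T x)"
    by (intro sw_cong) (simp_all add: 1 T_simps)
  also have "\<dots> = theta T x"
    using arg_cong[OF mu_nabla_right[OF x], of "sw R T T T (\<lambda>u v. theta T u \<bullet> v)"] x
    by (simp add: T_simps T_one bimult_closed[of R] cong: sw_cong2)
  finally show ?thesis
    unfolding mu_theta[OF x] using x by (simp add: T_simps T_one bimult_closed[of R] cong: sw_cong2)
qed

text \<open>By \<open>galois_ell\<close> the map \<open>?G\<close> is a left inverse of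
  \<open>beta\<close>, so \<open>ell h\<close> is the only preimage of
  \<open>h \<otimes> 1\<close>.\<close>

lemma (in left_torsor) ell_unique:
  assumes z: "z \<in> carrier T2" and h: "h \<in> carrier H" and e: "beta z = pt H T h \<^bold>1"
  shows "z = ell h"
proof -
  let ?G = "sw R H T T2 (\<lambda>g u. duo T2 (\<lambda>a b. t2 a (b \<bullet> u)) (ell g))"
  have "?G (beta z) = duo T2 (\<lambda>x y. sw R H T T2 (\<lambda>g s. duo T2 (\<lambda>a b. t2 a (b \<bullet> (s \<bullet> y))) (ell g)) (lam x)) z"
    using z by (simp add: beta_def F_simps cong: sw_cong2)
  also have "\<dots> = duo T2 t2 z" by (intro sw_cong) (simp_all add: galois_ell T_module)
  also have "\<dots> = z" using z by (simp add: sw_eta T_module)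
  finally have "z = ?G (pt H T h \<^bold>1)" by (simp add: e)
  also have "\<dots> = ell h" using h by (simp add: F_simps sw_eta cong: sw_cong2)
  finally show ?thesis .
qed

lemma (in right_torsor) r_unique:
  assumes z: "z \<in> carrier T2" and h: "h \<in> carrier H" and e: "beta z = pt T H \<^bold>1 h"
  shows "z = r h"
proof -
  let ?G = "sw R T H T2 (\<lambda>u g. duo T2 (\<lambda>a b. t2 (u \<bullet> a) b) (r g))"
  have "?G (beta z) = duo T2 (\<lambda>y x. sw R T H T2 (\<lambda>s g. duo T2 (\<lambda>a b. t2 ((y \<bullet> s) \<bullet> a) b) (r g)) (rho x)) z"
    using z by (simp add: beta_def F_simps cong: sw_cong2)
  also have "\<dots> = duo T2 t2 z" by (intro sw_cong) (simp_all add: galois_r T_module)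
  also have "\<dots> = z" using z by (simp add: sw_eta T_module)
  finally have "z = ?G (pt T H \<^bold>1 h)" by (simp add: e)
  also have "\<dots> = r h" using h by (simp add: F_simps sw_eta cong: sw_cong2)
  finally show ?thesis .
qed

text \<open>Both sides are determined by their images under the embedding \<open>E\<close> of the
  target. Since \<open>f\<close> respects \<open>ell\<close> and \<mu>, both images are \<mu> at
  \<open>f x\<close>.\<close>

lemma left_torsor_colinear:
  fixes R (structure)
  assumes L: "left_torsor R T H ell lam" and L': "left_torsor R U H ell' lam'" and f: "linear_map R T U f"
    and mu: "tmu U (f x) = sw R T (T \<boxtimes> T) (U \<boxtimes> U \<boxtimes> U) (\<lambda>a v. sw R T T (U \<boxtimes> U \<boxtimes> U)
      (\<lambda>b c. pure_tensor R U (U \<boxtimes> U) (f a) (pure_tensor R U U (f b) (f c))) v) (tmu T x)"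
    and ell: "\<And>h. h \<in> carrier H \<Longrightarrow> ell' h = sw R T T (U \<boxtimes> U) (\<lambda>a b. pure_tensor R U U (f a) (f b)) (ell h)"
    and x: "x \<in> carrier T"
  shows "lam' (f x) = sw R H T (H \<boxtimes> U) (\<lambda>h t. pure_tensor R H U h (f t)) (lam x)"
proof -
  interpret L: left_torsor R T H ell lam by (rule L)
  interpret L': left_torsor R U H ell' lam' by (rule L')
  note s = L.F_simps L'.F_simps f lin_comp[OF _ f] lin_closed[OF f]
  let ?r = "sw R H T (H \<boxtimes> U) (\<lambda>h t. pure_tensor R H U h (f t)) (lam x)"
  let ?P = "U \<boxtimes> U \<boxtimes> U"
  let ?t = "\<lambda>a b c. pure_tensor R U (U \<boxtimes> U) (f a) (pure_tensor R U U (f b) (f c))"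
  have "L'.E U ?r = sw R H T ?P (\<lambda>h t. sw R U U ?P (\<lambda>a b. pure_tensor R U (U \<boxtimes> U) a (pure_tensor R U U b (f t))) (ell' h)) (lam x)"
    using x by (simp add: L'.E_def s cong: sw_cong2)
  also have "\<dots> = sw R H T ?P (\<lambda>h t. sw R T T ?P (\<lambda>a b. ?t a b t) (ell h)) (lam x)"
    by (intro sw_cong L.H_module L.T_module) (simp add: ell s cong: sw_cong2)
  also have "\<dots> = tmu U (f x)" unfolding mu using x by (intro L.mu_to_lam) (simp_all add: s)
  also have "\<dots> = L'.E U (lam' (f x))" using x by (intro L'.E_lam[symmetric] lin_closed[OF f])
  finally have "L'.E U (lam' (f x)) = L'.E U ?r" ..
  moreover have "lam' (f x) \<in> carrier (H \<boxtimes> U)" "?r \<in> carrier (H \<boxtimes> U)" using x by (simp_all add: s)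
  ultimately show ?thesis using inj_onD[OF L'.E_inj[OF L'.torsor_flat]] by blast
qed

lemma right_torsor_colinear:
  fixes R (structure)
  assumes L: "right_torsor R T H r rho" and L': "right_torsor R U H r' rho'" and f: "linear_map R T U f"
    and mu: "tmu U (f x) = sw R T (T \<boxtimes> T) (U \<boxtimes> U \<boxtimes> U) (\<lambda>a v. sw R T T (U \<boxtimes> U \<boxtimes> U)
      (\<lambda>b c. pure_tensor R U (U \<boxtimes> U) (f a) (pure_tensor R U U (f b) (f c))) v) (tmu T x)"
    and r: "\<And>h. h \<in> carrier H \<Longrightarrow> r' h = sw R T T (U \<boxtimes> U) (\<lambda>a b. pure_tensor R U U (f a) (f b)) (r h)"
    and x: "x \<in> carrier T"
  shows "rho' (f x) = sw R T H (U \<boxtimes> H) (\<lambda>t h. pure_tensor R U H (f t) h) (rho x)"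
proof -
  interpret L: right_torsor R T H r rho by (rule L)
  interpret L': right_torsor R U H r' rho' by (rule L')
  note s = L.F_simps L'.F_simps f lin_comp[OF _ f] lin_closed[OF f]
  let ?r = "sw R T H (U \<boxtimes> H) (\<lambda>t h. pure_tensor R U H (f t) h) (rho x)"
  let ?P = "U \<boxtimes> U \<boxtimes> U"
  let ?t = "\<lambda>a b c. pure_tensor R U (U \<boxtimes> U) (f a) (pure_tensor R U U (f b) (f c))"
  have "L'.E U ?r = sw R T H ?P (\<lambda>t h. sw R U U ?P (\<lambda>a b. pure_tensor R U (U \<boxtimes> U) (f t) (pure_tensor R U U a b)) (r' h)) (rho x)"
    using x by (simp add: L'.E_def s cong: sw_cong2)
  also have "\<dots> = sw R T H ?P (\<lambda>t h. sw R T T ?P (\<lambda>a b. ?t t a b) (r h)) (rho x)"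
    by (intro sw_cong L.H_module L.T_module) (simp add: r s cong: sw_cong2)
  also have "\<dots> = tmu U (f x)" unfolding mu using x by (intro L.mu_to_rho) (simp_all add: s)
  also have "\<dots> = L'.E U (rho' (f x))" using x by (intro L'.E_rho[symmetric] lin_closed[OF f])
  finally have "L'.E U (rho' (f x)) = L'.E U ?r" ..
  moreover have "rho' (f x) \<in> carrier (U \<boxtimes> H)" "?r \<in> carrier (U \<boxtimes> H)" using x by (simp_all add: s)
  ultimately show ?thesis using inj_onD[OF L'.E_inj[OF L'.torsor_flat]] by blast
qed

text \<open>The converse direction: a colinear algebra map commutes with the Galois maps, hence
  carries the preimage of \<open>h \<otimes> 1\<close> to the corresponding preimage. Compatibility
  with \<mu> follows because \<mu> is assembled from \<open>ell\<close> and the coaction.\<close>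

lemma colinear_left_torsor:
  fixes R (structure)
  assumes L: "left_torsor R T H ell lam" and L': "left_torsor R U H ell' lam'" and f: "algebra_hom R T U f"
    and lam: "\<And>x. x \<in> carrier T \<Longrightarrow> lam' (f x) = sw R H T (H \<boxtimes> U) (\<lambda>h t. pure_tensor R H U h (f t)) (lam x)"
  shows "h \<in> carrier H \<Longrightarrow> ell' h = sw R T T (U \<boxtimes> U) (\<lambda>a b. pure_tensor R U U (f a) (f b)) (ell h)"
    and "x \<in> carrier T \<Longrightarrow> tmu U (f x) = sw R T (T \<boxtimes> T) (U \<boxtimes> U \<boxtimes> U) (\<lambda>a v. sw R T T (U \<boxtimes> U \<boxtimes> U)
      (\<lambda>b c. pure_tensor R U (U \<boxtimes> U) (f a) (pure_tensor R U U (f b) (f c))) v) (tmu T x)"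
proof -
  interpret L: left_torsor R T H ell lam by (rule L)
  interpret L': left_torsor R U H ell' lam' by (rule L')
  have l: "linear_map R T U f" and f1: "f \<one>\<^bsub>T\<^esub> = \<one>\<^bsub>U\<^esub>"
    using f by (simp_all add: algebra_hom_def ring_hom_def)
  have fm: "f (a \<otimes>\<^bsub>T\<^esub> b) = f a \<otimes>\<^bsub>U\<^esub> f b" if "a \<in> carrier T" "b \<in> carrier T" for a b
    using f that by (simp add: algebra_hom_def ring_hom_def)
  note s = L.F_simps L'.F_simps l lin_comp[OF _ l] lin_closed[OF l]
  have e: "ell' h = sw R T T (U \<boxtimes> U) (\<lambda>a b. pure_tensor R U U (f a) (f b)) (ell h)" (is "_ = ?z")
    if h: "h \<in> carrier H" for h
  proof (rule L'.ell_unique[OF _ h, symmetric])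
    show "?z \<in> carrier (U \<boxtimes> U)" by (simp add: s)
    have "L'.beta ?z = sw R T T (H \<boxtimes> U) (\<lambda>a b. sw R H U (H \<boxtimes> U) (\<lambda>g t. pure_tensor R H U g (t \<otimes>\<^bsub>U\<^esub> f b)) (lam' (f a))) (ell h)"
      using h by (simp add: L'.beta_def s cong: sw_cong2)
    also have "\<dots> = sw R T T (H \<boxtimes> U) (\<lambda>a b. sw R H T (H \<boxtimes> U) (\<lambda>g t. pure_tensor R H U g (f t \<otimes>\<^bsub>U\<^esub> f b)) (lam a)) (ell h)"
      by (intro sw_cong L.T_module) (simp add: lam s cong: sw_cong2)
    also have "\<dots> = sw R H T (H \<boxtimes> U) (\<lambda>g t. pure_tensor R H U g (f t)) (L.beta (ell h))"
      using h by (simp add: L.beta_def s fm cong: sw_cong2)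
    also have "\<dots> = pure_tensor R H U h \<one>\<^bsub>U\<^esub>"
      using h by (simp add: L.beta_ell s f1)
    finally show "L'.beta ?z = pure_tensor R H U h \<one>\<^bsub>U\<^esub>" .
  qed
  then show "h \<in> carrier H \<Longrightarrow> ell' h = sw R T T (U \<boxtimes> U) (\<lambda>a b. pure_tensor R U U (f a) (f b)) (ell h)" .
  let ?P = "U \<boxtimes> U \<boxtimes> U"
  let ?t = "\<lambda>a b c. pure_tensor R U (U \<boxtimes> U) (f a) (pure_tensor R U U (f b) (f c))"
  assume x: "x \<in> carrier T"
  have "tmu U (f x) = sw R H U ?P (\<lambda>h t. sw R U U ?P (\<lambda>a b. pure_tensor R U (U \<boxtimes> U) a (pure_tensor R U U b t)) (ell' h)) (lam' (f x))"
    using x by (intro L'.lam_mu[symmetric] lin_closed[OF l])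
  also have "\<dots> = sw R H T ?P (\<lambda>h t. sw R U U ?P (\<lambda>a b. pure_tensor R U (U \<boxtimes> U) a (pure_tensor R U U b (f t))) (ell' h)) (lam x)"
    unfolding lam[OF x] using x by (simp add: s cong: sw_cong2)
  also have "\<dots> = sw R H T ?P (\<lambda>h t. sw R T T ?P (\<lambda>a b. ?t a b t) (ell h)) (lam x)"
    by (intro sw_cong L.H_module L.T_module) (simp add: e s cong: sw_cong2)
  also have "\<dots> = sw R T (T \<boxtimes> T) ?P (\<lambda>a v. sw R T T ?P (\<lambda>b c. ?t a b c) v) (tmu T x)"
    using x by (intro L.mu_to_lam) (simp_all add: s)
  finally show "tmu U (f x) = sw R T (T \<boxtimes> T) ?P (\<lambda>a v. sw R T T ?P (\<lambda>b c. ?t a b c) v) (tmu T x)" .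
qed

lemma colinear_right_torsor:
  fixes R (structure)
  assumes L: "right_torsor R T H r rho" and L': "right_torsor R U H r' rho'" and f: "algebra_hom R T U f"
    and rho: "\<And>x. x \<in> carrier T \<Longrightarrow> rho' (f x) = sw R T H (U \<boxtimes> H) (\<lambda>t h. pure_tensor R U H (f t) h) (rho x)"
    and h: "h \<in> carrier H"
  shows "r' h = sw R T T (U \<boxtimes> U) (\<lambda>a b. pure_tensor R U U (f a) (f b)) (r h)" (is "_ = ?z")
proof -
  interpret L: right_torsor R T H r rho by (rule L)
  interpret L': right_torsor R U H r' rho' by (rule L')
  have l: "linear_map R T U f" and f1: "f \<one>\<^bsub>T\<^esub> = \<one>\<^bsub>U\<^esub>"
    using f by (simp_all add: algebra_hom_def ring_hom_def)
  have fm: "f (a \<otimes>\<^bsub>T\<^esub> b) = f a \<otimes>\<^bsub>U\<^esub> f b" if "a \<in> carrier T" "b \<in> carrier T" for a b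
    using f that by (simp add: algebra_hom_def ring_hom_def)
  note s = L.F_simps L'.F_simps l lin_comp[OF _ l] lin_closed[OF l]
  show ?thesis
  proof (rule L'.r_unique[OF _ h, symmetric])
    show "?z \<in> carrier (U \<boxtimes> U)" by (simp add: s)
    have "L'.beta ?z = sw R T T (U \<boxtimes> H) (\<lambda>a b. sw R U H (U \<boxtimes> H) (\<lambda>t g. pure_tensor R U H (f a \<otimes>\<^bsub>U\<^esub> t) g) (rho' (f b))) (r h)"
      using h by (simp add: L'.beta_def s cong: sw_cong2)
    also have "\<dots> = sw R T T (U \<boxtimes> H) (\<lambda>a b. sw R T H (U \<boxtimes> H) (\<lambda>t g. pure_tensor R U H (f a \<otimes>\<^bsub>U\<^esub> f t) g) (rho b)) (r h)"
      by (intro sw_cong L.T_module) (simp add: rho s cong: sw_cong2)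
    also have "\<dots> = sw R T H (U \<boxtimes> H) (\<lambda>t g. pure_tensor R U H (f t) g) (L.beta (r h))"
      using h by (simp add: L.beta_def s fm cong: sw_cong2)
    also have "\<dots> = pure_tensor R U H \<one>\<^bsub>U\<^esub> h"
      using h by (simp add: L.beta_r s f1)
    finally show "L'.beta ?z = pure_tensor R U H \<one>\<^bsub>U\<^esub> h" .
  qed
qed

lemma torsor_map_theta:
  fixes R (structure)
  assumes T: "quantum_torsor R T" and U: "quantum_torsor R U" and f: "algebra_hom R T U f"
    and mu: "\<And>x. x \<in> carrier T \<Longrightarrow> tmu U (f x) = sw R T (T \<boxtimes> T) (U \<boxtimes> U \<boxtimes> U) (\<lambda>a v. sw R T T (U \<boxtimes> U \<boxtimes> U)
      (\<lambda>b c. pure_tensor R U (U \<boxtimes> U) (f a) (pure_tensor R U U (f b) (f c))) v) (tmu T x)"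
    and x: "x \<in> carrier T"
  shows "theta U (f x) = f (theta T x)"
proof -
  interpret T: quantum_torsor R T by (rule T)
  interpret U: quantum_torsor R U by (rule U)
  have l: "linear_map R T U f" using f by (simp add: algebra_hom_def)
  have fm: "f (a \<otimes>\<^bsub>T\<^esub> b) = f a \<otimes>\<^bsub>U\<^esub> f b" if "a \<in> carrier T" "b \<in> carrier T" for a b
    using f that by (simp add: algebra_hom_def ring_hom_def)
  note s = T.T_simps U.T_simps bimult_closed[of R] l lin_comp[OF _ l] lin_closed[OF l]
    lin_sw_apply[OF _ _ T.T_module U.T_module l] fm
  have "theta U (f x) = U.tri U (\<lambda>a b c. U.tri U (\<lambda>d e g. a \<otimes>\<^bsub>U\<^esub> (g \<otimes>\<^bsub>U\<^esub> (e \<otimes>\<^bsub>U\<^esub> (d \<otimes>\<^bsub>U\<^esub> c)))) (tmu U b)) (tmu U (f x))"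
    by (intro U.theta_mu_formula lin_closed[OF l] x)
  also have "\<dots> = T.tri U (\<lambda>a b c. U.tri U (\<lambda>d e g. f a \<otimes>\<^bsub>U\<^esub> (g \<otimes>\<^bsub>U\<^esub> (e \<otimes>\<^bsub>U\<^esub> (d \<otimes>\<^bsub>U\<^esub> f c)))) (tmu U (f b))) (tmu T x)"
    unfolding mu[OF x] using x by (simp add: s cong: sw_cong2)
  also have "\<dots> = T.tri U (\<lambda>a b c. T.tri U (\<lambda>d e g. f a \<otimes>\<^bsub>U\<^esub> (f g \<otimes>\<^bsub>U\<^esub> (f e \<otimes>\<^bsub>U\<^esub> (f d \<otimes>\<^bsub>U\<^esub> f c)))) (tmu T b)) (tmu T x)"
    by (intro sw_cong T.T_module tensor_module) (simp add: mu s cong: sw_cong2)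
  also have "\<dots> = f (T.tri T (\<lambda>a b c. T.tri T (\<lambda>d e g. a \<otimes>\<^bsub>T\<^esub> (g \<otimes>\<^bsub>T\<^esub> (e \<otimes>\<^bsub>T\<^esub> (d \<otimes>\<^bsub>T\<^esub> c)))) (tmu T b)) (tmu T x))"
    using x by (simp add: s cong: sw_cong2)
  finally show ?thesis by (simp add: T.theta_mu_formula[OF x])
qed

section \<open>Isomorphism of bi-Galois objects as an equivalence relation\<close>

lemma algebra_iso_comp:
  assumes f: "algebra_iso R A B f" and g: "algebra_iso R B C g"
  shows "algebra_iso R A C (\<lambda>x. g (f x))"
proof -
  have "linear_map R A C (\<lambda>x. g (f x))"
    using lin_comp[of R A B f C g] f g by (simp add: algebra_iso_def algebra_hom_def)
  moreover have "(\<lambda>x. g (f x)) \<in> ring_hom A C"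
    using ring_hom_trans[of f A B g C] f g by (simp add: algebra_iso_def algebra_hom_def comp_def)
  moreover have "bij_betw (\<lambda>x. g (f x)) (carrier A) (carrier C)"
    using bij_betw_trans[of f "carrier A" "carrier B" g "carrier C"] f g by (simp add: algebra_iso_def comp_def)
  ultimately show ?thesis by (simp add: algebra_iso_def algebra_hom_def)
qed

lemma algebra_iso_inv:
  assumes A: "assoc_algebra R A" and f: "algebra_iso R A B f"
  shows "algebra_iso R B A (inv_into (carrier A) f)"
proof -
  interpret A: assoc_algebra R A by (rule A)
  let ?g = "inv_into (carrier A) f"
  have bij: "bij_betw f (carrier A) (carrier B)" and l: "linear_map R A B f" and h: "f \<in> ring_hom A B"
    using f by (simp_all add: algebra_iso_def algebra_hom_def)
  have gf: "?g (f x) = x" if "x \<in> carrier A" for x using bij_betw_inv_into_left[OF bij that] .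
  have surj: "\<exists>x\<in>carrier A. y = f x" if "y \<in> carrier B" for y using bij that by (auto simp: bij_betw_def)
  have "linear_map R B A ?g"
    unfolding linear_map_def
  proof (intro conjI ballI funcsetI)
    fix y assume "y \<in> carrier B"
    then show "?g y \<in> carrier A" using surj gf by fastforce
  next
    fix u v assume "u \<in> carrier B" "v \<in> carrier B"
    then obtain x y where xy: "x \<in> carrier A" "u = f x" "y \<in> carrier A" "v = f y" using surj by blast
    then have "add B u v = f (add A x y)" by (simp add: lin_add[OF l])
    then show "?g (add B u v) = add A (?g u) (?g v)" using xy by (simp add: gf)
  next
    fix c v assume c: "c \<in> carrier R" and "v \<in> carrier B"
    then obtain y where y: "y \<in> carrier A" "v = f y" using surj by blast
    then have "smult B c v = f (smult A c y)" using c by (simp add: lin_smult[OF l])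
    then show "?g (smult B c v) = smult A c (?g v)" using y c by (simp add: gf)
  qed
  moreover have "?g \<in> ring_hom B A"
  proof (rule ring_hom_memI)
    fix u v assume "u \<in> carrier B" "v \<in> carrier B"
    then obtain x y where xy: "x \<in> carrier A" "u = f x" "y \<in> carrier A" "v = f y" using surj by blast
    then have "monoid.mult B u v = f (monoid.mult A x y)" using h by (simp add: ring_hom_mult)
    then show "?g (monoid.mult B u v) = monoid.mult A (?g u) (?g v)" using xy by (simp add: gf)
    have "add B u v = f (add A x y)" using xy by (simp add: lin_add[OF l])
    then show "?g (add B u v) = add A (?g u) (?g v)" using xy by (simp add: gf)
  next
    fix u assume "u \<in> carrier B"
    then show "?g u \<in> carrier A" using surj gf by fastforce
  next
    show "?g \<one>\<^bsub>B\<^esub> = \<one>\<^bsub>A\<^esub>" using gf[of "\<one>\<^bsub>A\<^esub>"] h by (simp add: ring_hom_one)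
  qed
  ultimately show ?thesis using bij_betw_inv_into[OF bij] by (simp add: algebra_iso_def algebra_hom_def)
qed

lemma bigal_facts:
  fixes R (structure)
  assumes "A \<in> bigal_objects R H"
  shows "assoc_algebra R A" "module R A" "module R H"
    "linear_map R A (H \<boxtimes> A) (lcoact A)" "linear_map R A (A \<boxtimes> H) (rcoact A)"
    "x \<in> carrier A \<Longrightarrow> lcoact A x \<in> carrier (H \<boxtimes> A)" "x \<in> carrier A \<Longrightarrow> rcoact A x \<in> carrier (A \<boxtimes> H)"
proof -
  interpret A: bi_galois R H H A using assms by (simp add: bigal_objects_def)
  show "assoc_algebra R A" "module R A" "module R H" by unfold_locales
  show l: "linear_map R A (H \<boxtimes> A) (lcoact A)" and r: "linear_map R A (A \<boxtimes> H) (rcoact A)"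
    using A.left_coaction_hom A.right_coaction_hom by (simp_all add: algebra_hom_def)
  show "x \<in> carrier A \<Longrightarrow> lcoact A x \<in> carrier (H \<boxtimes> A)" "x \<in> carrier A \<Longrightarrow> rcoact A x \<in> carrier (A \<boxtimes> H)"
    by (rule lin_closed[OF l], assumption, rule lin_closed[OF r])
qed

lemma bicomodule_algebra_iso_sw:
  fixes R (structure)
  assumes "A \<in> bigal_objects R H" "x \<in> carrier A"
  shows "tensor_map R H B id f (lcoact A x) = sw R H A (H \<boxtimes> B) (\<lambda>h y. pure_tensor R H B h (f y)) (lcoact A x)"
    and "tensor_map R B H f id (rcoact A x) = sw R A H (B \<boxtimes> H) (\<lambda>y h. pure_tensor R B H (f y) h) (rcoact A x)"
  by (simp_all add: tensor_map_sw[OF bigal_facts(6)[OF assms]] tensor_map_sw[OF bigal_facts(7)[OF assms]])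

lemma bicomodule_algebra_isoI:
  fixes R (structure)
  assumes A: "A \<in> bigal_objects R H" and f: "algebra_iso R A B f"
    and l: "\<And>x. x \<in> carrier A \<Longrightarrow> lcoact B (f x) = sw R H A (H \<boxtimes> B) (\<lambda>h y. pure_tensor R H B h (f y)) (lcoact A x)"
    and r: "\<And>x. x \<in> carrier A \<Longrightarrow> rcoact B (f x) = sw R A H (B \<boxtimes> H) (\<lambda>y h. pure_tensor R B H (f y) h) (rcoact A x)"
  shows "bicomodule_algebra_iso R H H A B"
  unfolding bicomodule_algebra_iso_def
proof (intro exI conjI ballI)
  fix x assume x: "x \<in> carrier A"
  show "lcoact B (f x) = tensor_map R H B id f (lcoact A x)" "rcoact B (f x) = tensor_map R B H f id (rcoact A x)"
    unfolding bicomodule_algebra_iso_sw[OF A x] by (rule l[OF x], rule r[OF x])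
qed (rule f)

lemma bicomodule_algebra_isoE:
  fixes R (structure)
  assumes i: "bicomodule_algebra_iso R H H A B" and A: "A \<in> bigal_objects R H"
  obtains f where "algebra_iso R A B f"
    and "\<forall>x\<in>carrier A. lcoact B (f x) = sw R H A (H \<boxtimes> B) (\<lambda>h y. pure_tensor R H B h (f y)) (lcoact A x)"
    and "\<forall>x\<in>carrier A. rcoact B (f x) = sw R A H (B \<boxtimes> H) (\<lambda>y h. pure_tensor R B H (f y) h) (rcoact A x)"
proof -
  obtain f where f: "algebra_iso R A B f" and e: "\<forall>x\<in>carrier A. lcoact B (f x) = tensor_map R H B id f (lcoact A x) \<and>
      rcoact B (f x) = tensor_map R B H f id (rcoact A x)"
    using i unfolding bicomodule_algebra_iso_def by blast
  show thesis
    by (rule that[OF f]) (simp_all add: e bicomodule_algebra_iso_sw[OF A])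
qed

lemma bicomodule_algebra_iso_refl:
  assumes A: "A \<in> bigal_objects R H"
  shows "bicomodule_algebra_iso R H H A A"
proof (rule bicomodule_algebra_isoI[OF A, where f = "\<lambda>x. x"])
  note a = bigal_facts[OF A]
  have "ring_hom A A \<subseteq> ring_hom A A" "id \<in> ring_hom A A" by (simp_all add: id_ring_hom)
  then show "algebra_iso R A A (\<lambda>x. x)"
    by (simp add: algebra_iso_def algebra_hom_def lin_id bij_betw_def ring_hom_def)
qed (simp_all add: sw_eta bigal_facts[OF A])

lemma bicomodule_algebra_iso_trans:
  fixes R (structure)
  assumes "bicomodule_algebra_iso R H H A B" "bicomodule_algebra_iso R H H B C"
    and A: "A \<in> bigal_objects R H" and B: "B \<in> bigal_objects R H" and C: "module R C"
  shows "bicomodule_algebra_iso R H H A C"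
proof -
  obtain f where f: "algebra_iso R A B f"
    and fl: "\<forall>x\<in>carrier A. lcoact B (f x) = sw R H A (H \<boxtimes> B) (\<lambda>h y. pure_tensor R H B h (f y)) (lcoact A x)"
    and fr: "\<forall>x\<in>carrier A. rcoact B (f x) = sw R A H (B \<boxtimes> H) (\<lambda>y h. pure_tensor R B H (f y) h) (rcoact A x)"
    by (rule bicomodule_algebra_isoE[OF assms(1) A])
  obtain g where g: "algebra_iso R B C g"
    and gl: "\<forall>x\<in>carrier B. lcoact C (g x) = sw R H B (H \<boxtimes> C) (\<lambda>h y. pure_tensor R H C h (g y)) (lcoact B x)"
    and gr: "\<forall>x\<in>carrier B. rcoact C (g x) = sw R B H (C \<boxtimes> H) (\<lambda>y h. pure_tensor R C H (g y) h) (rcoact B x)"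
    by (rule bicomodule_algebra_isoE[OF assms(2) B])
  have l: "linear_map R A B f" "linear_map R B C g" using f g by (simp_all add: algebra_iso_def algebra_hom_def)
  note s = sws C bigal_facts[OF A] bigal_facts(2)[OF B] l lin_comp[OF _ l(1)] lin_comp[OF _ l(2)] lin_closed[OF l(1)] lin_closed[OF l(2)]
  show ?thesis
    by (rule bicomodule_algebra_isoI[OF A algebra_iso_comp[OF f g]])
      (simp_all add: gl gr fl fr s cong: sw_cong2)
qed

lemma bicomodule_algebra_iso_sym:
  fixes R (structure)
  assumes "bicomodule_algebra_iso R H H A B" and A: "A \<in> bigal_objects R H" and B: "B \<in> bigal_objects R H"
  shows "bicomodule_algebra_iso R H H B A"
proof -
  obtain f where f: "algebra_iso R A B f"
    and fl: "\<forall>x\<in>carrier A. lcoact B (f x) = sw R H A (H \<boxtimes> B) (\<lambda>h y. pure_tensor R H B h (f y)) (lcoact A x)"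
    and fr: "\<forall>x\<in>carrier A. rcoact B (f x) = sw R A H (B \<boxtimes> H) (\<lambda>y h. pure_tensor R B H (f y) h) (rcoact A x)"
    by (rule bicomodule_algebra_isoE[OF assms(1) A])
  let ?g = "inv_into (carrier A) f"
  have g: "algebra_iso R B A ?g" by (rule algebra_iso_inv[OF bigal_facts(1)[OF A] f])
  have bij: "bij_betw f (carrier A) (carrier B)" using f by (simp add: algebra_iso_def)
  have gf: "?g (f x) = x" if "x \<in> carrier A" for x using bij_betw_inv_into_left[OF bij that] .
  have l: "linear_map R A B f" "linear_map R B A ?g" using f g by (simp_all add: algebra_iso_def algebra_hom_def)
  note s = sws bigal_facts[OF A] bigal_facts(2)[OF B] l lin_comp[OF _ l(1)] lin_comp[OF _ l(2)] lin_closed[OF l(1)] lin_closed[OF l(2)] gf sw_eta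
  show ?thesis
  proof (rule bicomodule_algebra_isoI[OF B g])
    fix y assume "y \<in> carrier B"
    then obtain x where x: "x \<in> carrier A" "y = f x" using bij by (auto simp: bij_betw_def)
    show "lcoact A (?g y) = sw R H B (H \<boxtimes> A) (\<lambda>h y. pure_tensor R H A h (?g y)) (lcoact B y)"
      unfolding x(2) using x(1) by (simp add: fl s cong: sw_cong2)
    show "rcoact A (?g y) = sw R B H (A \<boxtimes> H) (\<lambda>y h. pure_tensor R A H (?g y) h) (rcoact B y)"
      unfolding x(2) using x(1) by (simp add: fr s cong: sw_cong2)
  qed
qed

text \<open>This is what \<open>bicomodule_algebra_iso_trans\<close> asks of a cotensor product that
  stands as the target of a composite isomorphism. The module is the equalizer of two linear
  maps.\<close>

lemma cotensor_module:
  fixes R (structure)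
  assumes A: "A \<in> bigal_objects R H" and B: "B \<in> bigal_objects R H"
  shows "module R (cotensor R H A B)"
proof -
  note a = bigal_facts[OF A] and b = bigal_facts[OF B]
  note s = sws a b lin_comp[OF _ a(4)] lin_comp[OF _ a(5)] lin_comp[OF _ b(4)] lin_comp[OF _ b(5)]
  let ?f = "\<lambda>z. assoc R A H B (tensor_map R (A \<boxtimes> H) B (rcoact A) id z)"
  let ?g = "\<lambda>z. tensor_map R A (H \<boxtimes> B) id (lcoact B) z"
  have f0: "linear_map R (A \<boxtimes> B) (A \<boxtimes> H \<boxtimes> B) (\<lambda>z. sw R A B (A \<boxtimes> H \<boxtimes> B) (\<lambda>a b. sw R A H (A \<boxtimes> H \<boxtimes> B)
      (\<lambda>x y. pure_tensor R A (H \<boxtimes> B) x (pure_tensor R H B y b)) (rcoact A a)) z)"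
    by (simp add: s)
  have e: "?f z = sw R A B (A \<boxtimes> H \<boxtimes> B) (\<lambda>a b. sw R A H (A \<boxtimes> H \<boxtimes> B)
      (\<lambda>x y. pure_tensor R A (H \<boxtimes> B) x (pure_tensor R H B y b)) (rcoact A a)) z" if "z \<in> carrier (A \<boxtimes> B)" for z
    unfolding tensor_map_sw[OF that] using that by (simp add: assoc_sw s cong: sw_cong2)
  have AB: "module R (A \<boxtimes> B)" by (simp add: s)
  have f: "linear_map R (A \<boxtimes> B) (A \<boxtimes> H \<boxtimes> B) ?f"
    by (subst lin_cong[OF e AB]) (assumption, rule f0)
  have g: "linear_map R (A \<boxtimes> B) (A \<boxtimes> H \<boxtimes> B) ?g" by (rule lin_tensor_map) (simp_all add: s id_def)
  have "submodule {z \<in> carrier (A \<boxtimes> B). ?f z = ?g z} R (A \<boxtimes> B)"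
    by (rule equalizer_submodule[OF _ _ f g]) (simp_all add: s)
  then have m: "module R (cotensor_algebra R H A B)"
    unfolding cotensor_algebra_def by (rule submodule_module) (simp add: s)
  have "same (cotensor_algebra R H A B) (cotensor R H A B)"
    by (simp add: cotensor_def Let_def with_coactions_same_alg[unfolded same_alg_def])
  then show ?thesis using m by (rule same_module)
qed

text \<open>Gives both that the inclusion is well defined on classes and that it is injective. From
  left to right the embeddings \<open>E\<close> are used, from right to left the Galois maps;
  compatibility with \<theta> comes from \<open>torsor_map_theta\<close>.\<close>

lemma torsor_over_iso_iff:
  fixes R (structure)
  assumes H: "flat R H" and bi: "bialgebra R H" and T: "T \<in> tor_objects R H" and U: "U \<in> tor_objects R H"
  shows "torsor_over_iso R H T U \<longleftrightarrow>
    bicomodule_algebra_iso R H H (torsor_bicomodule_algebra R H T) (torsor_bicomodule_algebra R H U)"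
proof -
  let ?A = "torsor_bicomodule_algebra R H T" and ?B = "torsor_bicomodule_algebra R H U"
  note t = torsor_bigal[OF H bi T] and u = torsor_bigal[OF H bi U]
  interpret T: left_torsor R T H "left_ident T" "lcoact ?A" by (rule t(2))
  interpret U: left_torsor R U H "left_ident U" "lcoact ?B" by (rule u(2))
  interpret Tr: right_torsor R T H "right_ident T" "rcoact ?A" by (rule t(3))
  have sT: "same_alg T ?A" and sU: "same_alg U ?B"
    unfolding torsor_bicomodule_algebra_def by (rule with_coactions_same_alg)+
  have c: "carrier ?A = carrier T" using sT by (simp add: same_alg_def same_def)
  have iso: "algebra_iso R ?A ?B f \<longleftrightarrow> algebra_iso R T U f" for f
    by (simp add: same_alg_iso[OF sT, symmetric] same_alg_iso_target[OF sU, symmetric])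
  note rw = c same_alg_tensor_left[OF sU, symmetric] same_alg_tensor_right[OF sU, symmetric]
    same_alg_rules(1,2)[OF sU, symmetric] same_sw[OF same_refl same_sym[OF sT[unfolded same_alg_def, THEN conjunct1]] same_refl]
    same_sw[OF same_sym[OF sT[unfolded same_alg_def, THEN conjunct1]] same_refl same_refl]
  have tmu: "tensor_map R U (opp U \<boxtimes> U) f (tensor_map R (opp U) U f f) (tmu T x) =
      T.tri (U \<boxtimes> U \<boxtimes> U) (\<lambda>a b c. pure_tensor R U (U \<boxtimes> U) (f a) (pure_tensor R U U (f b) (f c))) (tmu T x)"
    if "linear_map R T U f" "x \<in> carrier T" for f x
  proof -
    note s = T.F_simps U.F_simps that(1) lin_comp[OF _ that(1)] lin_closed[OF that(1)]
    have "tensor_map R U (opp U \<boxtimes> U) f (tensor_map R (opp U) U f f) (tmu T x) =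
      sw R T (T \<boxtimes> T) (U \<boxtimes> U \<boxtimes> U) (\<lambda>a v. pure_tensor R U (U \<boxtimes> U) (f a) (sw R T T (U \<boxtimes> U) (\<lambda>b c. pure_tensor R U U (f b) (f c)) v)) (tmu T x)"
      unfolding U.opp_eqs tensor_map_sw[OF T.mu_typ[OF that(2)]]
      by (intro sw_cong) (simp_all add: tensor_map_sw s)
    also have "\<dots> = T.tri (U \<boxtimes> U \<boxtimes> U) (\<lambda>a b c. pure_tensor R U (U \<boxtimes> U) (f a) (pure_tensor R U U (f b) (f c))) (tmu T x)"
      by (intro sw_cong) (simp_all add: s)
    finally show ?thesis .
  qed
  show ?thesis
  proof
    assume "torsor_over_iso R H T U"
    then obtain f where f: "algebra_iso R T U f"
      and m: "\<And>x. x \<in> carrier T \<Longrightarrow> tmu U (f x) = tensor_map R U (opp U \<boxtimes> U) f (tensor_map R (opp U) U f f) (tmu T x)"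
      and l: "\<And>h. h \<in> carrier H \<Longrightarrow> left_ident U h = tensor_map R U (opp U) f f (left_ident T h)"
      and r: "\<And>h. h \<in> carrier H \<Longrightarrow> right_ident U h = tensor_map R (opp U) U f f (right_ident T h)"
      unfolding torsor_over_iso_def by blast
    have lin: "linear_map R T U f" using f by (simp add: algebra_iso_def algebra_hom_def)
    have l': "left_ident U h = sw R T T (U \<boxtimes> U) (\<lambda>a b. pure_tensor R U U (f a) (f b)) (left_ident T h)" if "h \<in> carrier H" for h
      using l[OF that] unfolding U.opp_eqs tensor_map_sw[OF T.ell_typ[OF that]] .
    have r': "right_ident U h = sw R T T (U \<boxtimes> U) (\<lambda>a b. pure_tensor R U U (f a) (f b)) (right_ident T h)" if "h \<in> carrier H" for h
      using r[OF that] unfolding U.opp_eqs tensor_map_sw[OF Tr.r_typ[OF that]] .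
    show "bicomodule_algebra_iso R H H ?A ?B"
    proof (rule bicomodule_algebra_isoI[OF t(1), where f = f])
      show "algebra_iso R ?A ?B f" using f by (simp add: iso)
      fix x assume "x \<in> carrier ?A"
      then have x: "x \<in> carrier T" by (simp add: c)
      note mx = m[OF x, unfolded tmu[OF lin x]]
      show "lcoact ?B (f x) = sw R H ?A (H \<boxtimes> ?B) (\<lambda>h y. pure_tensor R H ?B h (f y)) (lcoact ?A x)"
        unfolding rw by (rule left_torsor_colinear[OF t(2) u(2) lin mx l' x])
      show "rcoact ?B (f x) = sw R ?A H (?B \<boxtimes> H) (\<lambda>y h. pure_tensor R ?B H (f y) h) (rcoact ?A x)"
        unfolding rw by (rule right_torsor_colinear[OF t(3) u(3) lin mx r' x])
    qed
  next
    assume "bicomodule_algebra_iso R H H ?A ?B"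
    then obtain f where f': "algebra_iso R ?A ?B f"
      and fl: "\<forall>x\<in>carrier ?A. lcoact ?B (f x) = sw R H ?A (H \<boxtimes> ?B) (\<lambda>h y. pure_tensor R H ?B h (f y)) (lcoact ?A x)"
      and fr: "\<forall>x\<in>carrier ?A. rcoact ?B (f x) = sw R ?A H (?B \<boxtimes> H) (\<lambda>y h. pure_tensor R ?B H (f y) h) (rcoact ?A x)"
      by (rule bicomodule_algebra_isoE[OF _ t(1)])
    have f: "algebra_iso R T U f" using f' by (simp only: iso)
    then have hom: "algebra_hom R T U f" by (simp add: algebra_iso_def)
    then have lin: "linear_map R T U f" by (simp add: algebra_hom_def)
    note L = colinear_left_torsor[OF t(2) u(2) hom bspec[OF fl[unfolded rw]]]
    note Rr = colinear_right_torsor[OF t(3) u(3) hom bspec[OF fr[unfolded rw]]]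
    have th: "theta U (f x) = f (theta T x)" if "x \<in> carrier T" for x
      by (rule torsor_map_theta[OF T.quantum_torsor_axioms U.quantum_torsor_axioms hom L(2) that])
    show "torsor_over_iso R H T U"
      unfolding torsor_over_iso_def
    proof (intro exI[of _ f] conjI ballI f)
      fix x assume x: "x \<in> carrier T"
      show "tmu U (f x) = tensor_map R U (opp U \<boxtimes> U) f (tensor_map R (opp U) U f f) (tmu T x)"
        unfolding tmu[OF lin x] by (rule L(2)[OF _ x])
      show "theta U (f x) = f (theta T x)" by (rule th[OF x])
    next
      fix h assume h: "h \<in> carrier H"
      show "left_ident U h = tensor_map R U (opp U) f f (left_ident T h)"
        unfolding U.opp_eqs tensor_map_sw[OF T.ell_typ[OF h]] by (rule L(1)[OF _ h])
      show "right_ident U h = tensor_map R (opp U) U f f (right_ident T h)"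
        unfolding U.opp_eqs tensor_map_sw[OF Tr.r_typ[OF h]] by (rule Rr[OF _ h])
    qed
  qed
qed

text \<open>The translation map and \<theta> depend only on the fields compared by
  \<open>same_alg\<close>. This matters because the torsor record stores maps computed on the
  bicomodule algebra, while the theory is afterwards instantiated at the torsor itself.\<close>

lemma same_alg_r:
  assumes A: "right_gal R H S A rho" and B: "right_gal R H S B rho" and s: "same_alg A B"
  shows "right_gal.r R H A rho = right_gal.r R H B rho"
    and "right_gal.vartheta R H S A rho = right_gal.vartheta R H S B rho"
proof -
  interpret A: right_gal R H S A rho by (rule A)
  interpret B: right_gal R H S B rho by (rule B)
  have m: "same A B" "monoid.mult A = monoid.mult B" "\<one>\<^bsub>A\<^esub> = \<one>\<^bsub>B\<^esub>" using s by (simp_all add: same_alg_def)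
  note rw = m(2,3) same_alg_tensor_left[OF s] same_alg_tensor_right[OF s] same_alg_rules(1,2)[OF s]
    same_sw[OF same_refl m(1) same_refl] same_sw[OF m(1) same_refl same_refl] same_sw[OF same_refl same_refl m(1)]
  show r: "A.r = B.r"
    unfolding A.r_def[abs_def] B.r_def[abs_def] A.beta_def[abs_def] B.beta_def[abs_def] rw by (rule HOL.refl)
  show "A.vartheta = B.vartheta"
    unfolding A.vartheta_def[abs_def] B.vartheta_def[abs_def] r rw by (rule HOL.refl)
qed

lemma same_alg_l:
  assumes A: "bi_gal R H S A rho lam" and B: "bi_gal R H S B rho lam" and s: "same_alg A B"
  shows "bi_gal.l R H A lam = bi_gal.l R H B lam"
proof -
  interpret A: bi_gal R H S A rho lam by (rule A)
  interpret B: bi_gal R H S B rho lam by (rule B)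
  have m: "same A B" "monoid.mult A = monoid.mult B" "\<one>\<^bsub>A\<^esub> = \<one>\<^bsub>B\<^esub>" using s by (simp_all add: same_alg_def)
  note rw = m(2,3) same_alg_tensor_left[OF s] same_alg_tensor_right[OF s] same_alg_rules(1,2)[OF s]
    same_sw[OF same_refl m(1) same_refl] same_sw[OF m(1) same_refl same_refl] same_sw[OF same_refl same_refl m(1)]
  show "A.l = B.l"
    unfolding A.l_def[abs_def] B.l_def[abs_def] A.beta_l_def[abs_def] B.beta_l_def[abs_def] rw by (rule HOL.refl)
qed

lemma bigal_bi_gal:
  assumes hopf: "hopf_algebra R H S" and H: "flat R H" and bij: "bij_betw S (carrier H) (carrier H)"
    and A: "A \<in> bigal_objects R H" and s: "same_alg A B"
  shows "bi_gal R H S B (rcoact A) (lcoact A)"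
proof -
  interpret A: bi_galois R H H A using A by (simp add: bigal_objects_def)
  have c: "carrier B = carrier A" using s by (simp add: same_alg_def same_def)
  have "right_gal R H S B (rcoact A)"
    using hopf bij H same_alg_right_galois[OF s A.right_galois_axioms] same_alg_ff[OF s] A
    by (intro right_gal.intro right_gal_axioms.intro hopf_bij.intro hopf_bij_axioms.intro) (simp_all add: bigal_objects_def)
  then show ?thesis
    using same_alg_left_galois[OF s A.left_galois_axioms] A.coactions_commute
    by (intro bi_gal.intro bi_gal_axioms.intro)
      (simp_all add: c same_alg_rules[OF s, symmetric] same_alg_tensor_left[OF s, symmetric] same_alg_tensor_right[OF s, symmetric])
qed

text \<open>The fields of \<open>T\<close> must be computed before \<open>T\<close> exists, hence
  from \<open>A\<close>, and are converted to terms over \<open>T\<close> afterwards. The identity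
  map is the isomorphism, since the coactions recovered from the torsor are those of
  \<open>A\<close>.\<close>

lemma bigal_torsor:
  fixes R (structure) and A :: "('k, 'h, 'h, 'u) bicomodule_algebra"
  assumes hopf: "hopf_algebra R H S" and H: "flat R H" and bij: "bij_betw S (carrier H) (carrier H)"
    and A: "A \<in> bigal_objects R H"
  obtains T :: "('k, 'h, 'u) torsor_over"
  where "T \<in> tor_objects R H" "bicomodule_algebra_iso R H H A (torsor_bicomodule_algebra R H T)"
proof -
  let ?P = "A \<boxtimes> A \<boxtimes> A"
  define T :: "('k, 'h, 'u) torsor_over" where
    "T = \<lparr>carrier = carrier A, monoid.mult = monoid.mult A, one = \<one>\<^bsub>A\<^esub>, zero = \<zero>\<^bsub>A\<^esub>, add = add A, smult = smult A,
      tmu = \<lambda>x. sw R A H ?P (\<lambda>y h. sw R A A ?P (\<lambda>a b. pure_tensor R A (A \<boxtimes> A) y (pure_tensor R A A a b))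
        (right_gal.r R H A (rcoact A) h)) (rcoact A x),
      theta = right_gal.vartheta R H S A (rcoact A),
      left_ident = bi_gal.l R H A (lcoact A), right_ident = right_gal.r R H A (rcoact A)\<rparr>"
  have s: "same_alg A T" by (simp add: same_alg_def same_def T_def)
  have gA: "bi_gal R H S A (rcoact A) (lcoact A)"
    by (rule bigal_bi_gal[OF hopf H bij A]) (simp add: same_alg_def same_refl)
  have gT: "bi_gal R H S T (rcoact A) (lcoact A)" by (rule bigal_bi_gal[OF hopf H bij A s])
  note rA = bi_gal.axioms(1)[OF gA] and rT = bi_gal.axioms(1)[OF gT]
  have m: "same A T" "carrier T = carrier A" using s by (simp_all add: same_alg_def same_def)
  interpret T: gal_torsor R H S T "rcoact A" "lcoact A"
  proof (intro gal_torsor.intro gal_torsor_axioms.intro gT)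
    fix x
    show "theta T x = right_gal.vartheta R H S T (rcoact A) x"
      unfolding same_alg_r(2)[OF rA rT s, symmetric] by (simp add: T_def)
    have "tmu T x = sw R A H ?P (\<lambda>y h. sw R A A ?P (\<lambda>a b. pure_tensor R A (A \<boxtimes> A) y (pure_tensor R A A a b))
        (right_gal.r R H A (rcoact A) h)) (rcoact A x)" by (simp add: T_def)
    then show "tmu T x = sw R T H (T \<boxtimes> T \<boxtimes> T) (\<lambda>y h. sw R T T (T \<boxtimes> T \<boxtimes> T) (\<lambda>a b. pure_tensor R T (T \<boxtimes> T) y (pure_tensor R T T a b))
        (right_gal.r R H T (rcoact A) h)) (rcoact A x)"
      unfolding same_alg_r(1)[OF rA rT s] same_alg_tensor_left[OF s] same_alg_tensor_right[OF s] same_alg_rules(1,2)[OF s]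
        same_sw[OF same_refl m(1) same_refl] same_sw[OF m(1) same_refl same_refl] .
  qed
  have l: "left_ident T = T.l" using same_alg_l[OF gA gT s] by (simp add: T_def)
  have r: "right_ident T = T.r" using same_alg_r(1)[OF rA rT s] by (simp add: T_def)
  have L: "left_torsor R T H (left_ident T) (lcoact A)" unfolding l by (rule T.left_torsor)
  have Rt: "right_torsor R T H (right_ident T) (rcoact A)" unfolding r by (rule T.right_torsor)
  have tor: "T \<in> tor_objects R H"
    using T.quantum_torsor left_torsor.left_hopf_iso[OF L] right_torsor.right_hopf_iso[OF Rt] by (simp add: tor_objects_def)
  have bi: "bialgebra R H" using hopf by (rule hopf_algebra.axioms(1))
  let ?B = "torsor_bicomodule_algebra R H T"
  note t = torsor_bigal[OF H bi tor]
  have sB: "same_alg T ?B" unfolding torsor_bicomodule_algebra_def by (rule with_coactions_same_alg)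
  have sAB: "same_alg A ?B" using s sB by (simp add: same_alg_def same_def)
  \<comment> \<open>The coaction of \<open>?B\<close> arises from a definite description.
    \<open>lamT_eq\<close>, used for the two presentations of the same left torsor, equates it with
    that of \<open>A\<close>.\<close>
  have lc: "lcoact ?B x = lcoact A x" if "x \<in> carrier A" for x
    using left_torsor.lamT_eq[OF t(2), of x] left_torsor.lamT_eq[OF L, of x] that m(2) by simp
  have rc: "rcoact ?B x = rcoact A x" if "x \<in> carrier A" for x
    using right_torsor.rhoT_eq[OF t(3), of x] right_torsor.rhoT_eq[OF Rt, of x] that m(2) by simp
  note refl = bicomodule_algebra_iso_refl[OF A]
  have "bicomodule_algebra_iso R H H A ?B"
  proof (rule bicomodule_algebra_isoI[OF A, where f = "\<lambda>x. x"])
    have "algebra_iso R A A (\<lambda>x. x)"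
      by (auto simp: algebra_iso_def algebra_hom_def lin_id bij_betw_def ring_hom_def)
    then show "algebra_iso R A ?B (\<lambda>x. x)" by (simp add: same_alg_iso_target[OF sAB])
    fix x assume x: "x \<in> carrier A"
    show "lcoact ?B x = sw R H A (H \<boxtimes> ?B) (\<lambda>h y. pure_tensor R H ?B h y) (lcoact A x)"
      unfolding same_alg_tensor_right[OF sAB, symmetric] same_alg_rules(1)[OF sAB, symmetric]
      by (simp add: lc x sw_eta bigal_facts[OF A])
    show "rcoact ?B x = sw R A H (?B \<boxtimes> H) (\<lambda>y h. pure_tensor R ?B H y h) (rcoact A x)"
      unfolding same_alg_tensor_left[OF sAB, symmetric] same_alg_rules(2)[OF sAB, symmetric]
      by (simp add: rc x sw_eta bigal_facts[OF A])
  qed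
  with tor show thesis by (rule that)
qed

text \<open>Surjectivity on classes comes from \<open>bigal_torsor\<close>. Since the product in
  \<open>Tor\<close> is the preimage of the product in \<open>BiGal\<close>, the homomorphism
  property also rests on it: every object in a product of classes must be isomorphic to one that
  comes from a torsor.\<close>

theorem corollary3p5:
  fixes R :: "'k ring" and H :: "('k, 'h) bialgebra" and S :: "'h \<Rightarrow> 'h"
  assumes "hopf_algebra R H S"
    and "flat R H"
    and "bij_betw S (carrier H) (carrier H)"
  shows "(tor_inclusion R H :: ('k, 'h, 'u) torsor_over set \<Rightarrow> _) \<in> iso (Tor R H) (BiGal R H)"
proof -
  have bi: "bialgebra R H" using assms(1) by (rule hopf_algebra.axioms(1))
  let ?t = "torsor_bicomodule_algebra R H :: ('k, 'h, 'u) torsor_over \<Rightarrow> _"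
  let ?O = "bigal_objects R H :: ('k, 'h, 'h, 'u) bicomodule_algebra set"
  let ?I = "tor_inclusion R H :: ('k, 'h, 'u) torsor_over set \<Rightarrow> _"
  let ?i = "bicomodule_algebra_iso R H H"
  note rf = bicomodule_algebra_iso_refl and sm = bicomodule_algebra_iso_sym and tr = bicomodule_algebra_iso_trans
  have t: "?t T \<in> ?O" if "T \<in> tor_objects R H" for T by (rule torsor_bigal(1)[OF assms(2) bi that])
  have tr': "?i A C" if "?i A B" "?i B C" "A \<in> ?O" "B \<in> ?O" "C \<in> ?O" for A B C :: "('k, 'h, 'h, 'u) bicomodule_algebra"
    by (rule tr[OF that(1-4) bigal_facts(2)[OF that(5)]])
  have iff: "torsor_over_iso R H T U \<longleftrightarrow> ?i (?t T) (?t U)" if "T \<in> tor_objects R H" "U \<in> tor_objects R H" for T U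
    by (rule torsor_over_iso_iff[OF assms(2) bi that])
  have ex: "\<exists>T\<in>tor_objects R H. ?i A (?t T)" if "A \<in> ?O" for A
    using bigal_torsor[OF assms that] by blast
  \<comment> \<open>The inclusion takes the class of a torsor to the class of its bi-Galois object,
    which reduces bijectivity to statements about representatives.\<close>
  have incl_class: "?I (tor_rel R H `` {T}) = bigal_rel R H `` {?t T}" if T: "T \<in> tor_objects R H" for T
  proof (intro equalityI subsetI)
    fix A assume "A \<in> ?I (tor_rel R H `` {T})"
    then obtain U where U: "A \<in> ?O" "U \<in> tor_objects R H" "?i (?t T) (?t U)" "?i A (?t U)"
      using iff[OF T] by (auto simp: tor_inclusion_def tor_rel_def)
    have "?i (?t T) A" by (rule tr'[OF U(3) sm[OF U(4) U(1) t[OF U(2)]] t[OF T] t[OF U(2)] U(1)])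
    then show "A \<in> bigal_rel R H `` {?t T}" using U(1) t[OF T] by (simp add: bigal_rel_def)
  next
    fix A assume "A \<in> bigal_rel R H `` {?t T}"
    then have A: "A \<in> ?O" "?i (?t T) A" by (simp_all add: bigal_rel_def)
    have "?i A (?t T)" by (rule sm[OF A(2) t[OF T] A(1)])
    moreover have "T \<in> tor_rel R H `` {T}" using iff[OF T T] rf[OF t[OF T]] T by (simp add: tor_rel_def)
    ultimately show "A \<in> ?I (tor_rel R H `` {T})" using A(1) by (auto simp: tor_inclusion_def)
  qed
  have eqv: "bigal_rel R H `` {A} = bigal_rel R H `` {B} \<longleftrightarrow> ?i A B" if "A \<in> ?O" "B \<in> ?O" for A B
  proof
    assume "bigal_rel R H `` {A} = bigal_rel R H `` {B}"
    moreover have "B \<in> bigal_rel R H `` {B}" using that(2) rf[OF that(2)] by (simp add: bigal_rel_def)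
    ultimately have "B \<in> bigal_rel R H `` {A}" by blast
    then show "?i A B" by (simp add: bigal_rel_def)
  next
    assume ab: "?i A B"
    have ba: "?i B A" by (rule sm[OF ab that])
    have "?i A C \<longleftrightarrow> ?i B C" if C: "C \<in> ?O" for C
      using tr'[OF ab _ \<open>A \<in> ?O\<close> \<open>B \<in> ?O\<close> C] tr'[OF ba _ \<open>B \<in> ?O\<close> \<open>A \<in> ?O\<close> C] by blast
    then show "bigal_rel R H `` {A} = bigal_rel R H `` {B}" using that by (auto simp: bigal_rel_def)
  qed
  have teq: "tor_rel R H `` {T} = tor_rel R H `` {U}" if T: "T \<in> tor_objects R H" and U: "U \<in> tor_objects R H" and tu: "?i (?t T) (?t U)" for T U
  proof -
    have "bigal_rel R H `` {?t T} = bigal_rel R H `` {?t U}" using eqv[OF t[OF T] t[OF U]] tu by simp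
    then have "?i (?t T) (?t V) \<longleftrightarrow> ?i (?t U) (?t V)" if "V \<in> tor_objects R H" for V
      using t[OF that] t[OF T] t[OF U] by (auto simp: bigal_rel_def set_eq_iff)
    then show ?thesis using iff T U by (auto simp: tor_rel_def)
  qed
  have cT: "carrier (Tor R H :: ('k, 'h, 'u) torsor_over set monoid) = tor_objects R H // tor_rel R H" and cB: "carrier (BiGal R H) = ?O // bigal_rel R H"
    by (simp_all add: Tor_def BiGal_def)
  have bij: "bij_betw ?I (carrier (Tor R H)) (carrier (BiGal R H))"
    unfolding cT cB bij_betw_def
  proof (intro conjI inj_onI)
    fix X Y :: "('k, 'h, 'u) torsor_over set"
    assume "X \<in> tor_objects R H // tor_rel R H" "Y \<in> tor_objects R H // tor_rel R H" and e: "?I X = ?I Y"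
    then obtain T U where T: "T \<in> tor_objects R H" "X = tor_rel R H `` {T}" and U: "U \<in> tor_objects R H" "Y = tor_rel R H `` {U}"
      by (auto elim!: quotientE)
    have "?i (?t T) (?t U)" using e eqv[OF t[OF T(1)] t[OF U(1)]] by (simp add: T(2) U(2) incl_class[OF T(1)] incl_class[OF U(1)])
    then show "X = Y" unfolding T(2) U(2) by (rule teq[OF T(1) U(1)])
  next
    show "?I ` (tor_objects R H // tor_rel R H) = ?O // bigal_rel R H"
    proof (intro equalityI subsetI)
      fix Z assume "Z \<in> ?I ` (tor_objects R H // tor_rel R H)"
      then obtain T where T: "T \<in> tor_objects R H" "Z = ?I (tor_rel R H `` {T})" by (auto elim!: quotientE)
      then show "Z \<in> ?O // bigal_rel R H" using quotientI[OF t[OF T(1)]] by (simp add: incl_class[OF T(1)])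
    next
      fix Z assume "Z \<in> ?O // bigal_rel R H"
      then obtain A where A: "A \<in> ?O" "Z = bigal_rel R H `` {A}" by (auto elim!: quotientE)
      obtain T where T: "T \<in> tor_objects R H" "?i A (?t T)" using ex[OF A(1)] by blast
      have "Z = ?I (tor_rel R H `` {T})" unfolding A(2) incl_class[OF T(1)] using eqv[OF A(1) t[OF T(1)]] T(2) by simp
      then show "Z \<in> ?I ` (tor_objects R H // tor_rel R H)" using quotientI[OF T(1)] by (rule image_eqI)
    qed
  qed
  \<comment> \<open>Products of classes are closed under isomorphism. The cotensor product itself
    lives on another type, so membership is transferred by composing with an isomorphism onto
    it.\<close>
  have closed: "A \<in> I" if I: "I = {C \<in> ?O. \<exists>A\<in>X. \<exists>B\<in>Y. ?i C (cotensor R H A B)}" "X \<subseteq> ?O" "Y \<subseteq> ?O"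
    and A: "A \<in> ?O" and B: "B \<in> I" and i: "?i A B" for A B I X Y
  proof -
    obtain C D where c: "B \<in> ?O" "C \<in> X" "D \<in> Y" "?i B (cotensor R H C D)" using B I(1) by blast
    have "?i A (cotensor R H C D)"
      by (rule tr[OF i c(4) A c(1) cotensor_module[OF subsetD[OF I(2) c(2)] subsetD[OF I(3) c(3)]]])
    then show ?thesis using I(1) A c(2,3) by blast
  qed
  have sub: "?I X \<subseteq> ?O" for X by (auto simp: tor_inclusion_def)
  have mult: "?I (X \<otimes>\<^bsub>Tor R H\<^esub> Y) = ?I X \<otimes>\<^bsub>BiGal R H\<^esub> ?I Y" for X Y
  proof -
    let ?P = "{C \<in> ?O. \<exists>A\<in>?I X. \<exists>B\<in>?I Y. ?i C (cotensor R H A B)}"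
    have P: "?I X \<otimes>\<^bsub>BiGal R H\<^esub> ?I Y = ?P" by (simp add: BiGal_def)
    have TP: "X \<otimes>\<^bsub>Tor R H\<^esub> Y = {T \<in> tor_objects R H. ?t T \<in> ?P}" unfolding P[symmetric] by (simp add: Tor_def)
    show ?thesis unfolding P TP
    proof (intro equalityI subsetI)
      fix A assume "A \<in> ?I {T \<in> tor_objects R H. ?t T \<in> ?P}"
      then obtain T where T: "A \<in> ?O" "?t T \<in> ?P" "?i A (?t T)" unfolding tor_inclusion_def by blast
      show "A \<in> ?P" by (rule closed[OF HOL.refl sub sub T])
    next
      fix A assume A: "A \<in> ?P"
      then have AO: "A \<in> ?O" by blast
      obtain T where T: "T \<in> tor_objects R H" "?i A (?t T)" using ex[OF AO] by blast
      \<comment> \<open>\<open>?t T\<close> is isomorphic to \<open>A\<close> and therefore lies in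
        the product, which by definition places \<open>T\<close> in the product formed in
        \<open>Tor\<close>.\<close>
      have "?t T \<in> ?P" by (rule closed[OF HOL.refl sub sub t[OF T(1)] A sm[OF T(2) AO t[OF T(1)]]])
      then show "A \<in> ?I {T \<in> tor_objects R H. ?t T \<in> ?P}" using AO T unfolding tor_inclusion_def by blast
    qed
  qed
  have "?I \<in> hom (Tor R H) (BiGal R H)"
    using bij mult by (auto simp: hom_def bij_betw_def)
  then show ?thesis using bij by (simp add: iso_def)
qed

end
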